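(* Let $n\ge1$, let $U$ be a compact metric space, and assume (A1)–(A6) from the context. For every $(x,p,X)$ ($x,p\in\mathbb R^n$, $X$ a symmetric $n\times n$ matrix), the constant $$\lambda=\int_{\mathbb R^3}H(x,y,p,X,0)\,d\mu(y)$$ is the unique constant such that the cell problem $$-\mathrm{tr}(\sigma(y)\sigma^T(y)D^2w(y))-b(y)\cdot Dw(y)+H(x,y,p,X,0)=\lambda,\qquad y\in\mathbb R^3,$$ admits a (viscosity) solution $w$ which is globally Lipschitz continuous and satisfies, for some constant $C$, $$|w(y)-w(0)|\le C\big[1+\log((y_1^2+y_2^2)^2+y_3^2+1)\big]\qquad\forall y=(y_1,y_2,y_3)\in\mathbb R^3.$$ Moreover, the solution $w$ with these properties is unique up to an additive constant.
   Context: Notation: $\tilde\phi:\mathbb R^n\times\mathbb R^3\times U\to\mathbb R^n$, $\tilde\sigma$ is an $n\times 2$-matrix-valued function on $\mathbb R^n\times\mathbb R^3\times U$, $f:\mathbb R^n\times\mathbb R^3\times U\to\mathbb R$, $g:\mathbb R^n\times\mathbb R^3\to\mathbb R$. For $p\in\mathbb R^n$, $X$ symmetric $n\times n$, $Z$ a $3\times n$ matrix, $$H(x,y,p,X,Z):=\min_{u\in U}\{-\mathrm{tr}(\tilde\sigma\tilde\sigma^TX)-\tilde\phi\cdot p-2\,\mathrm{tr}(\tilde\sigma\sigma^TZ)-f(x,y,u)\},$$ with $\tilde\sigma=\tilde\sigma(x,y,u)$, $\tilde\phi=\tilde\phi(x,y,u)$, $\sigma=\sigma(y)$ (the minimum is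 assumed attained). Assumptions: (A1) $\sigma(y)=\begin{pmatrix}1&0\\0&1\\2y_2&-2y_1\end{pmatrix}$ for $y=(y_1,y_2,y_3)$. (A2) $b(y)=-(k_1y_1,k_2y_2,k_3y_3)$ with $k_1>4$, $k_2>4$, $k_3>0$. (A3) $f$ is Lipschitz continuous in $(x,y)$ uniformly in $u$, and $|f(x,y,u)|\le C_f(1+|x|)$ for all $(x,y,u)$, for some $C_f>0$. (A4) $g$ is continuous and $|g(x,y)|\le C_g(1+|x|)$ for all $(x,y)$, for some $C_g$. (A5) $\tilde\phi$ and $\tilde\sigma$ are Lipschitz continuous in $(x,y)$ uniformly in $u$, and bounded: $|\tilde\phi|\le C_{\tilde\phi}$, $|\tilde\sigma|\le C_{\tilde\sigma}$. (A6) For every $(x,p,X)$ the function $F(y)=-H(x,y,p,X,0)$ is such that $F$, $\partial F/\partial y_3$ and $\partial^2F/\partial y_3^2$ are bounded and globally Lipschitz on $\mathbb R^3$. $\mu$ is the unique invariant probability measure on $\mathbb R^3$ of the diffusion $dY_t=b(Y_t)dt+\sqrt2\,\sigma(Y_t)dW_t$, i.e. associated with the operator $\mathcal L\varphi=\mathrm{tr}(\sigma\sigma^TD^2\varphi)+b\cdot D\varphi$ (it is known to exist, be unique, and have a positive $C^\infty$ density). *)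

theory Defs
  imports "HOL-Probability.Probability"
begin

definition sig :: "real^3 \<Rightarrow> real^2^3" where
  "sig y = vector [vector [1, 0], vector [0, 1], vector [2 * y$2, - 2 * y$1]]"

definition drift :: "real \<Rightarrow> real \<Rightarrow> real \<Rightarrow> real^3 \<Rightarrow> real^3" where
  "drift k1 k2 k3 y = - vector [k1 * y$1, k2 * y$2, k3 * y$3]"

definition pre_hamiltonian ::
  "(real^'n \<Rightarrow> real^3 \<Rightarrow> 'u \<Rightarrow> real^'n) \<Rightarrow> (real^'n \<Rightarrow> real^3 \<Rightarrow> 'u \<Rightarrow> real^2^'n)
    \<Rightarrow> (real^'n \<Rightarrow> real^3 \<Rightarrow> 'u \<Rightarrow> real)
    \<Rightarrow> real^'n \<Rightarrow> real^3 \<Rightarrow> real^'n \<Rightarrow> real^'n^'n \<Rightarrow> real^'n^3 \<Rightarrow> 'u \<Rightarrow> real" where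
  "pre_hamiltonian \<phi> \<sigma> f x y p X Z u =
     - trace (\<sigma> x y u ** transpose (\<sigma> x y u) ** X) - \<phi> x y u \<bullet> p
     - 2 * trace (\<sigma> x y u ** transpose (sig y) ** Z) - f x y u"

text \<open>The minimum over \<open>U\<close>, provided that it is attained.\<close>

definition hamiltonian ::
  "'u set \<Rightarrow> (real^'n \<Rightarrow> real^3 \<Rightarrow> 'u \<Rightarrow> real^'n) \<Rightarrow> (real^'n \<Rightarrow> real^3 \<Rightarrow> 'u \<Rightarrow> real^2^'n)
    \<Rightarrow> (real^'n \<Rightarrow> real^3 \<Rightarrow> 'u \<Rightarrow> real)
    \<Rightarrow> real^'n \<Rightarrow> real^3 \<Rightarrow> real^'n \<Rightarrow> real^'n^'n \<Rightarrow> real^'n^3 \<Rightarrow> real" where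
  "hamiltonian U \<phi> \<sigma> f x y p X Z = (INF u\<in>U. pre_hamiltonian \<phi> \<sigma> f x y p X Z u)"

definition uniformly_lipschitz_in_xy ::
  "'u set \<Rightarrow> ('a::metric_space \<Rightarrow> 'b::metric_space \<Rightarrow> 'u \<Rightarrow> 'c::metric_space) \<Rightarrow> bool" where
  "uniformly_lipschitz_in_xy U h \<longleftrightarrow>
     (\<exists>L. \<forall>u\<in>U. L-lipschitz_on UNIV (\<lambda>(x, y). h x y u))"

definition bounded_lipschitz :: "('a::metric_space \<Rightarrow> real) \<Rightarrow> bool" where
  "bounded_lipschitz h \<longleftrightarrow> bounded (range h) \<and> (\<exists>L. L-lipschitz_on UNIV h)"

definition has_partial_y3 :: "(real^3 \<Rightarrow> real) \<Rightarrow> (real^3 \<Rightarrow> real) \<Rightarrow> bool" where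
  "has_partial_y3 F F' \<longleftrightarrow>
     (\<forall>y. ((\<lambda>t. F (y + t *\<^sub>R axis 3 1)) has_real_derivative F' y) (at 0))"

text \<open>\<open>D\<close> is the gradient of \<open>\<psi>\<close> and \<open>D2\<close> its Hessian.\<close>

definition C2_function ::
  "(real^'m \<Rightarrow> real) \<Rightarrow> (real^'m \<Rightarrow> real^'m) \<Rightarrow> (real^'m \<Rightarrow> real^'m^'m) \<Rightarrow> bool" where
  "C2_function \<psi> D D2 \<longleftrightarrow>
     (\<forall>y. GDERIV \<psi> y :> D y) \<and>
     (\<forall>y. (D has_derivative (\<lambda>h. D2 y *v h)) (at y)) \<and>
     continuous_on UNIV D2"

text \<open>Continuous viscosity solutions on the whole space of \<open>E(y, w, Dw, D\<^sup>2w) = 0\<close>,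
  with the sign convention for which \<open>E\<close> is nonincreasing in its last argument.\<close>

definition viscosity_subsolution ::
  "(real^'m \<Rightarrow> real \<Rightarrow> real^'m \<Rightarrow> real^'m^'m \<Rightarrow> real) \<Rightarrow> (real^'m \<Rightarrow> real) \<Rightarrow> bool" where
  "viscosity_subsolution E w \<longleftrightarrow>
     (\<forall>\<psi> D D2 y. C2_function \<psi> D D2 \<and> (\<forall>\<^sub>F z in nhds y. w z - \<psi> z \<le> w y - \<psi> y)
        \<longrightarrow> E y (w y) (D y) (D2 y) \<le> 0)"

definition viscosity_supersolution ::
  "(real^'m \<Rightarrow> real \<Rightarrow> real^'m \<Rightarrow> real^'m^'m \<Rightarrow> real) \<Rightarrow> (real^'m \<Rightarrow> real) \<Rightarrow> bool" where
  "viscosity_supersolution E w \<longleftrightarrow>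
     (\<forall>\<psi> D D2 y. C2_function \<psi> D D2 \<and> (\<forall>\<^sub>F z in nhds y. w z - \<psi> z \<ge> w y - \<psi> y)
        \<longrightarrow> E y (w y) (D y) (D2 y) \<ge> 0)"

definition viscosity_solution ::
  "(real^'m \<Rightarrow> real \<Rightarrow> real^'m \<Rightarrow> real^'m^'m \<Rightarrow> real) \<Rightarrow> (real^'m \<Rightarrow> real) \<Rightarrow> bool" where
  "viscosity_solution E w \<longleftrightarrow>
     continuous_on UNIV w \<and> viscosity_subsolution E w \<and> viscosity_supersolution E w"

definition cell_operator ::
  "real \<Rightarrow> real \<Rightarrow> real \<Rightarrow> (real^3 \<Rightarrow> real) \<Rightarrow> real
    \<Rightarrow> real^3 \<Rightarrow> real \<Rightarrow> real^3 \<Rightarrow> real^3^3 \<Rightarrow> real" where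
  "cell_operator k1 k2 k3 h l y r q Q =
     - trace (sig y ** transpose (sig y) ** Q) - drift k1 k2 k3 y \<bullet> q + h y - l"

definition log_growth :: "(real^3 \<Rightarrow> real) \<Rightarrow> bool" where
  "log_growth w \<longleftrightarrow>
     (\<exists>C. \<forall>y. \<bar>w y - w 0\<bar> \<le> C * (1 + ln (((y$1)\<^sup>2 + (y$2)\<^sup>2)\<^sup>2 + (y$3)\<^sup>2 + 1)))"

definition cell_solution ::
  "real \<Rightarrow> real \<Rightarrow> real \<Rightarrow> (real^3 \<Rightarrow> real) \<Rightarrow> real \<Rightarrow> (real^3 \<Rightarrow> real) \<Rightarrow> bool" where
  "cell_solution k1 k2 k3 h l w \<longleftrightarrow>
     viscosity_solution (cell_operator k1 k2 k3 h l) w \<and>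
     (\<exists>L. L-lipschitz_on UNIV w) \<and> log_growth w"

text \<open>Time is restricted to \<open>t \<ge> 0\<close>; values of \<open>F\<close>, \<open>W\<close> and \<open>Y\<close> at negative times are irrelevant.\<close>

definition brownian_motion ::
  "'w measure \<Rightarrow> (real \<Rightarrow> 'w measure) \<Rightarrow> (real \<Rightarrow> 'w \<Rightarrow> real^'d) \<Rightarrow> bool" where
  "brownian_motion M F W \<longleftrightarrow>
     prob_space M \<and> filtration (space M) F \<and> (\<forall>t\<ge>0. sets (F t) \<subseteq> sets M) \<and>
     (\<forall>t\<ge>0. W t \<in> borel_measurable (F t)) \<and>
     (\<forall>\<omega>\<in>space M. W 0 \<omega> = 0 \<and> continuous_on {0..} (\<lambda>t. W t \<omega>)) \<and>
     (\<forall>s t. 0 \<le> s \<and> s < t \<longrightarrow>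
        distributed M lborel (\<lambda>\<omega>. W t \<omega> - W s \<omega>)
          (\<lambda>z. ennreal (\<Prod>i\<in>UNIV. normal_density 0 (sqrt (t - s)) (z$i))) \<and>
        prob_space.indep_set M (sets (F s))
          {(\<lambda>\<omega>. W t \<omega> - W s \<omega>) -` B \<inter> space M |B. B \<in> sets borel})"

definition converges_in_probability ::
  "'w measure \<Rightarrow> (nat \<Rightarrow> 'w \<Rightarrow> 'b::real_normed_vector) \<Rightarrow> ('w \<Rightarrow> 'b) \<Rightarrow> bool" where
  "converges_in_probability M X Z \<longleftrightarrow>
     (\<forall>\<epsilon>>0. (\<lambda>n. measure M {\<omega>\<in>space M. norm (X n \<omega> - Z \<omega>) > \<epsilon>}) \<longlonglongrightarrow> 0)"

text \<open>The Ito integral \<open>\<integral>\<^sub>0\<^sup>t S(Y\<^sub>s) dW\<^sub>s\<close>. For a continuous adapted integrand it is the limit in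
  probability of the left-endpoint Riemann sums, so this determines it up to null sets.\<close>

definition is_ito_integral ::
  "'w measure \<Rightarrow> (real \<Rightarrow> 'w \<Rightarrow> real^'d) \<Rightarrow> (real \<Rightarrow> 'w \<Rightarrow> real^'d^'m) \<Rightarrow> real
    \<Rightarrow> ('w \<Rightarrow> real^'m) \<Rightarrow> bool" where
  "is_ito_integral M W G t J \<longleftrightarrow>
     converges_in_probability M
       (\<lambda>n \<omega>. \<Sum>i<n. G (t * real i / real n) \<omega> *v
                  (W (t * real (Suc i) / real n) \<omega> - W (t * real i / real n) \<omega>)) J"

text \<open>\<open>dY = B(Y) dt + S(Y) dW\<close> with \<open>Y\<^sub>0 = y0\<close>, for continuous \<open>B\<close> and \<open>S\<close>: the process
  \<open>Y\<^sub>t - Y\<^sub>0 - \<integral>\<^sub>0\<^sup>t B(Y\<^sub>s) ds\<close> is the Ito integral of \<open>S(Y)\<close>.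
  Paths are continuous everywhere, which makes all random variables involved measurable.\<close>

definition sde_solution ::
  "'w measure \<Rightarrow> (real \<Rightarrow> 'w measure) \<Rightarrow> (real \<Rightarrow> 'w \<Rightarrow> real^'d)
    \<Rightarrow> (real^'m \<Rightarrow> real^'m) \<Rightarrow> (real^'m \<Rightarrow> real^'d^'m) \<Rightarrow> real^'m
    \<Rightarrow> (real \<Rightarrow> 'w \<Rightarrow> real^'m) \<Rightarrow> bool" where
  "sde_solution M F W B S y0 Y \<longleftrightarrow>
     (\<forall>t\<ge>0. Y t \<in> borel_measurable (F t)) \<and>
     (\<forall>\<omega>\<in>space M. Y 0 \<omega> = y0 \<and> continuous_on {0..} (\<lambda>t. Y t \<omega>)) \<and>
     (\<forall>t\<ge>0. is_ito_integral M W (\<lambda>s \<omega>. S (Y s \<omega>)) t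
        (\<lambda>\<omega>. Y t \<omega> - Y 0 \<omega> - integral {0..t} (\<lambda>s. B (Y s \<omega>))))"

definition is_diffusion ::
  "real \<Rightarrow> real \<Rightarrow> real \<Rightarrow> 'w measure \<Rightarrow> (real \<Rightarrow> 'w measure) \<Rightarrow> (real \<Rightarrow> 'w \<Rightarrow> real^2)
    \<Rightarrow> (real^3 \<Rightarrow> real \<Rightarrow> 'w \<Rightarrow> real^3) \<Rightarrow> bool" where
  "is_diffusion k1 k2 k3 M F W Y \<longleftrightarrow>
     brownian_motion M F W \<and>
     (\<forall>y. sde_solution M F W (drift k1 k2 k3) (\<lambda>z. sqrt 2 *\<^sub>R sig z) y (Y y))"

text \<open>Invariance under the transition semigroup \<open>P\<^sub>t \<psi>(y) = E[\<psi>(Y\<^sub>t\<^sup>y)]\<close>.\<close>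

definition invariant_probability ::
  "'w measure \<Rightarrow> ('y::topological_space \<Rightarrow> real \<Rightarrow> 'w \<Rightarrow> 'y) \<Rightarrow> 'y measure \<Rightarrow> bool" where
  "invariant_probability M Y \<mu> \<longleftrightarrow>
     prob_space \<mu> \<and> sets \<mu> = sets borel \<and>
     (\<forall>t\<ge>0. \<forall>\<psi> :: 'y \<Rightarrow> real. \<psi> \<in> borel_measurable borel \<and> bounded (range \<psi>) \<longrightarrow>
        (\<integral>y. (\<integral>\<omega>. \<psi> (Y y t \<omega>) \<partial>M) \<partial>\<mu>) = (\<integral>y. \<psi> y \<partial>\<mu>))"

end

theory Submission
  imports Defs "HOL-Complex_Analysis.Great_Picard"
begin

text \<open>Write \<open>L\<close> for the generator of the diffusion and \<open>h = H(x, \<cdot>, p, X, 0)\<close>. Replace the diffusion by its Euler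
  scheme with coin tosses. The step is affine in the state and, since \<open>k1, k2 > 4\<close>, its synchronous coupling
  contracts in mean square, so the transition operator \<open>K\<close> with time step \<open>\<tau>\<close> multiplies Lipschitz constants by
  \<open>1 - \<delta> \<tau>\<close>.

  Existence: \<open>-\<tau> \<Sum>\<^sub>n (K\<^sup>n h - K\<^sup>n h(0))\<close> is Lipschitz uniformly in \<open>\<tau>\<close> and grows logarithmically; by stability of
  monotone consistent schemes, its limits along \<open>\<tau> \<rightarrow> 0\<close> are viscosity solutions.

  Uniqueness: a Lipschitz solution \<open>w\<close> solves \<open>\<beta> w - L w = g\<close> with \<open>g = \<beta> w - h + l\<close>. For a mollified \<open>g\<close>
  and large \<open>\<beta>\<close>, the discrete resolvent of \<open>g\<close> is smooth uniformly in \<open>\<tau>\<close> (its steps being affine), hence a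
  classical approximate solution that can serve as a test function; so \<open>w\<close> is its limit, with no need of a comparison
  principle between two viscosity solutions. As the resolvent contracts Lipschitz constants by \<open>1 / (\<beta> + \<delta>)\<close>, the
  difference of two solutions has a Lipschitz constant \<open>\<Lambda> \<le> \<beta> \<Lambda> / (\<beta> + \<delta>)\<close>, that is, \<open>0\<close>; this does not even
  use that both have the same \<open>l\<close>.

  The constant: an Ito-Taylor expansion for small times and the invariance of \<open>\<mu>\<close> give \<open>\<integral> L u d\<mu> = 0\<close> for the smooth
  resolvents \<open>u\<close>, where \<open>L u\<close> tends to \<open>h - l\<close>; hence \<open>l = \<integral> h d\<mu>\<close>.\<close>

section \<open>The Euler scheme with coin tosses\<close>

text \<open>The matrix \<open>sig y ** transpose (sig y)\<close> has rank 2 and grows quadratically,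
  so regularity theory for nondegenerate or bounded coefficients does not apply; smoothness has to
  be inherited from smooth data. The coin-toss scheme does this: a step is one of four affine maps,
  so expectations are finite sums and the derivatives of \<open>K^n g\<close> are explicit. The
  threshold 4: the difference \<open>d\<close> of two coupled diffusions has the third noise
  component \<open>2 sqrt 2 (d2 dW1 - d1 dW2)\<close>, which adds \<open>8 (d1^2 + d2^2)\<close> per
  unit of time to the decay \<open>- 2 k1 d1^2 - 2 k2 d2^2\<close>. Only second moments contract;
  the Lipschitz constant of a Hessian involves products of three differences, which may grow, and
  this is what a large \<beta> repairs. Uniqueness tolerates a large \<beta> because
  \<open>1 / (\<beta> + \<delta>)\<close> stays strictly below \<open>1 / \<beta>\<close>. On the
  side of \<mu>, invariance is given for bounded functions only and the Ito integral only as a limit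
  in probability; second moments are therefore obtained by truncation, and domination under \<mu>
  has to make do with quadratic growth.\<close>

definition signs :: "(real \<times> real) set" where
  "signs = {-1, 1} \<times> {-1, 1}"

definition avg :: "(real \<times> real \<Rightarrow> real) \<Rightarrow> real" where
  "avg g = (\<Sum>e\<in>signs. g e) / 4"

lemma avg_expand: "avg g = (g (1, 1) + g (1, -1) + g (-1, 1) + g (-1, -1)) / 4"
proof -
  have *: "signs = {(1, 1), (1, -1), (-1, 1), (-1, -1)}"
    by (auto simp: signs_def)
  show ?thesis unfolding avg_def * by simp
qed

lemma avg_const [simp]: "avg (\<lambda>e. c) = c"
  by (simp add: avg_expand)

lemma avg_add: "avg (\<lambda>e. f e + g e) = avg f + avg g"
  by (simp add: avg_def sum.distrib add_divide_distrib)

lemma avg_diff: "avg (\<lambda>e. f e - g e) = avg f - avg g"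
  by (simp add: avg_def sum_subtractf diff_divide_distrib)

lemma avg_cmult: "avg (\<lambda>e. c * f e) = c * avg f"
  by (simp add: avg_def sum_distrib_left)

lemma avg_mono: "(\<And>e. e \<in> signs \<Longrightarrow> f e \<le> g e) \<Longrightarrow> avg f \<le> avg g"
  unfolding avg_def by (intro divide_right_mono sum_mono) auto

lemma abs_avg_le: "\<bar>avg f\<bar> \<le> avg (\<lambda>e. \<bar>f e\<bar>)"
  unfolding avg_def by (simp add: divide_right_mono)

text \<open>The variance under the uniform law on the four tosses is nonnegative.\<close>

lemma avg_le_sqrt: "(avg f)\<^sup>2 \<le> avg (\<lambda>e. (f e)\<^sup>2)"
proof -
  define m where "m = avg f"
  have "0 \<le> avg (\<lambda>e. (f e - m)\<^sup>2)"
    using avg_mono[of "\<lambda>e. 0" "\<lambda>e. (f e - m)\<^sup>2"] by simp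
  also have "avg (\<lambda>e. (f e - m)\<^sup>2) = avg (\<lambda>e. (f e)\<^sup>2) - 2 * m * avg f + m\<^sup>2"
    by (simp add: avg_expand power2_eq_square field_simps)
  finally show ?thesis by (simp add: m_def power2_eq_square)
qed

lemma norm3: "(norm (y::real^3))\<^sup>2 = (y$1)\<^sup>2 + (y$2)\<^sup>2 + (y$3)\<^sup>2"
  unfolding power2_norm_eq_inner by (simp add: inner_vec_def sum_3 power2_eq_square)

lemma inner3: "(x::real^3) \<bullet> y = x$1 * y$1 + x$2 * y$2 + x$3 * y$3"
  by (simp add: inner_vec_def sum_3)

text \<open>The Euler scheme of the diffusion, with coin tosses \<open>\<plusminus>1\<close> in place of Gaussian increments.\<close>

definition Alin :: "real \<Rightarrow> real \<Rightarrow> real \<Rightarrow> real \<Rightarrow> real \<times> real \<Rightarrow> real^3^3" where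
  "Alin k1 k2 k3 \<tau> e = vector
     [vector [1 - \<tau> * k1, 0, 0], vector [0, 1 - \<tau> * k2, 0],
      vector [- 2 * sqrt (2 * \<tau>) * snd e, 2 * sqrt (2 * \<tau>) * fst e, 1 - \<tau> * k3]]"

definition noise :: "real \<Rightarrow> real \<times> real \<Rightarrow> real^3" where
  "noise \<tau> e = vector [sqrt (2 * \<tau>) * fst e, sqrt (2 * \<tau>) * snd e, 0]"

text \<open>This is \<open>y + \<tau> b(y) + sqrt (2 \<tau>) sig(y) e\<close>. Since
  \<open>sig\<close> is affine, the state-dependent part of the noise goes into the matrix
  \<open>Alin\<close>, and the step is affine in \<open>y\<close>.\<close>

definition estep :: "real \<Rightarrow> real \<Rightarrow> real \<Rightarrow> real \<Rightarrow> real \<times> real \<Rightarrow> real^3 \<Rightarrow> real^3" where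
  "estep k1 k2 k3 \<tau> e y = Alin k1 k2 k3 \<tau> e *v y + noise \<tau> e"

definition Kop :: "real \<Rightarrow> real \<Rightarrow> real \<Rightarrow> real \<Rightarrow> (real^3 \<Rightarrow> real) \<Rightarrow> real^3 \<Rightarrow> real" where
  "Kop k1 k2 k3 \<tau> \<psi> y = avg (\<lambda>e. \<psi> (estep k1 k2 k3 \<tau> e y))"

section \<open>Mean-square contraction of the Euler step\<close>

locale coeffs =
  fixes k1 k2 k3 :: real
  assumes k: "k1 > 4" "k2 > 4" "k3 > 0"
begin

abbreviation "A \<equiv> Alin k1 k2 k3"
abbreviation "T \<equiv> estep k1 k2 k3"
abbreviation "K \<equiv> Kop k1 k2 k3"

text \<open>Half of the margin by which the drift beats the noise; the other half pays for the
  quadratic term of the discrete step.\<close>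

definition \<delta> :: real where "\<delta> = min (min (k1 - 4) (k2 - 4)) k3 / 2"
definition km :: real where "km = k1 + k2 + k3"

text \<open>The conditions serve, in turn, \<open>\<tau> \<le> sqrt \<tau>\<close>, positivity of
  the contraction factor \<open>1 - \<delta> * \<tau>\<close>, and absorption of the terms
  \<open>\<tau>\<^sup>2 * c\<^sup>2\<close> with \<open>c \<le> km\<close> into
  \<open>2 * \<tau> * \<delta>\<close>.\<close>

definition small :: "real \<Rightarrow> bool" where
  "small \<tau> \<longleftrightarrow> 0 < \<tau> \<and> \<tau> \<le> 1 \<and> \<tau> * \<delta> < 1 \<and> \<tau> * km\<^sup>2 \<le> 2 * \<delta>"

lemma delta: "\<delta> > 0" "2 * \<delta> \<le> k1 - 4" "2 * \<delta> \<le> k2 - 4" "2 * \<delta> \<le> k3"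
  using k by (auto simp: \<delta>_def)

lemma km_pos: "km > 0" "k1 \<le> km" "k2 \<le> km" "k3 \<le> km"
  using k by (auto simp: km_def)

lemma small_eventually: "\<exists>t0>0. \<forall>\<tau>. 0 < \<tau> \<and> \<tau> \<le> t0 \<longrightarrow> small \<tau>"
proof -
  define t0 where "t0 = min 1 (min (1 / (2 * \<delta>)) (2 * \<delta> / km\<^sup>2))"
  have "t0 > 0" using delta km_pos by (simp add: t0_def)
  moreover have "small \<tau>" if "0 < \<tau>" "\<tau> \<le> t0" for \<tau>
  proof -
    have "\<tau> * \<delta> \<le> 1 / (2 * \<delta>) * \<delta>"
      using that delta by (intro mult_right_mono) (auto simp: t0_def)
    also have "\<dots> < 1" using delta by (simp add: field_simps)
    finally have 1: "\<tau> * \<delta> < 1" .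
    have "\<tau> * km\<^sup>2 \<le> 2 * \<delta> / km\<^sup>2 * km\<^sup>2"
      using that delta by (intro mult_right_mono) (auto simp: t0_def)
    also have "\<dots> = 2 * \<delta>" using km_pos by simp
    finally show ?thesis using 1 that by (simp add: small_def t0_def)
  qed
  ultimately show ?thesis by blast
qed

lemma A_components:
  "(A \<tau> e *v d) $ 1 = (1 - \<tau> * k1) * d$1"
  "(A \<tau> e *v d) $ 2 = (1 - \<tau> * k2) * d$2"
  "(A \<tau> e *v d) $ 3 = (1 - \<tau> * k3) * d$3 + 2 * sqrt (2 * \<tau>) * (d$2 * fst e - d$1 * snd e)"
  by (simp_all add: matrix_vector_mult_def Alin_def sum_3 algebra_simps)

lemma T_components:
  "T \<tau> e y $ 1 = (1 - \<tau> * k1) * y$1 + sqrt (2 * \<tau>) * fst e"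
  "T \<tau> e y $ 2 = (1 - \<tau> * k2) * y$2 + sqrt (2 * \<tau>) * snd e"
  "T \<tau> e y $ 3 = (1 - \<tau> * k3) * y$3 + 2 * sqrt (2 * \<tau>) * (y$2 * fst e - y$1 * snd e)"
  by (simp_all add: estep_def A_components noise_def)

lemma T_diff: "T \<tau> e y - T \<tau> e z = A \<tau> e *v (y - z)"
  by (simp add: estep_def matrix_vector_mult_diff_distrib)

lemma factor_le:
  assumes "small \<tau>" "0 < c" "c \<le> km"
  shows "(1 - \<tau> * c)\<^sup>2 \<le> 1 - 2 * \<tau> * c + 2 * \<tau> * \<delta>"
proof -
  have "\<tau> * c\<^sup>2 \<le> \<tau> * km\<^sup>2"
    using assms by (intro mult_left_mono power_mono) (auto simp: small_def)
  also have "\<dots> \<le> 2 * \<delta>" using assms by (simp add: small_def)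
  finally have "\<tau> * (\<tau> * c\<^sup>2) \<le> \<tau> * (2 * \<delta>)"
    using assms by (intro mult_left_mono) (auto simp: small_def)
  then show ?thesis by (simp add: power2_eq_square algebra_simps)
qed

text \<open>Terms odd in a toss cancel. The noise in the third coordinate depends on the first two
  and adds \<open>8 * \<tau>\<close> to their factors, against \<open>- 2 * \<tau> * k1\<close> and
  \<open>- 2 * \<tau> * k2\<close> from the drift.\<close>

lemma avg_A_sq_eq:
  assumes "0 \<le> \<tau>"
  shows "avg (\<lambda>e. (norm (A \<tau> e *v d))\<^sup>2) = ((1 - \<tau> * k1)\<^sup>2 + 8 * \<tau>) * (d$1)\<^sup>2
    + ((1 - \<tau> * k2)\<^sup>2 + 8 * \<tau>) * (d$2)\<^sup>2 + (1 - \<tau> * k3)\<^sup>2 * (d$3)\<^sup>2"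
proof -
  define s where "s = sqrt (2 * \<tau>)"
  have s: "s * s = 2 * \<tau>" using assms by (simp add: s_def)
  have "avg (\<lambda>e. (norm (A \<tau> e *v d))\<^sup>2) = (1 - \<tau> * k1)\<^sup>2 * (d$1)\<^sup>2
    + (1 - \<tau> * k2)\<^sup>2 * (d$2)\<^sup>2 + (1 - \<tau> * k3)\<^sup>2 * (d$3)\<^sup>2 + 4 * (s * s) * ((d$1)\<^sup>2 + (d$2)\<^sup>2)"
    unfolding norm3 A_components s_def[symmetric] by (simp add: avg_expand power2_eq_square) algebra
  then show ?thesis unfolding s by (simp add: algebra_simps)
qed

text \<open>This is where \<open>k1, k2 > 4\<close> enters: synchronously coupled Euler chains approach each
  other in mean square.\<close>

lemma avg_A_sq:
  assumes "small \<tau>"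
  shows "avg (\<lambda>e. (norm (A \<tau> e *v d))\<^sup>2) \<le> (1 - \<delta> * \<tau>)\<^sup>2 * (norm d)\<^sup>2"
proof -
  have t: "\<tau> > 0" using assms by (simp add: small_def)
  have q: "1 - 2 * \<tau> * \<delta> \<le> (1 - \<delta> * \<tau>)\<^sup>2"
    using zero_le_power2[of "\<delta> * \<tau>"] by (simp add: power2_diff algebra_simps)
  have m: "2 * \<delta> * \<tau> \<le> (k1 - 4) * \<tau>" "2 * \<delta> * \<tau> \<le> (k2 - 4) * \<tau>" "2 * \<delta> * \<tau> \<le> k3 * \<tau>"
    using delta t by (auto intro!: mult_right_mono)
  have c1: "(1 - \<tau> * k1)\<^sup>2 + 8 * \<tau> \<le> (1 - \<delta> * \<tau>)\<^sup>2"
    using factor_le[OF assms, of k1] q m k km_pos by (simp add: algebra_simps)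
  have c2: "(1 - \<tau> * k2)\<^sup>2 + 8 * \<tau> \<le> (1 - \<delta> * \<tau>)\<^sup>2"
    using factor_le[OF assms, of k2] q m k km_pos by (simp add: algebra_simps)
  have c3: "(1 - \<tau> * k3)\<^sup>2 \<le> (1 - \<delta> * \<tau>)\<^sup>2"
    using factor_le[OF assms, of k3] q m k km_pos by (simp add: algebra_simps)
  have "avg (\<lambda>e. (norm (A \<tau> e *v d))\<^sup>2) \<le> (1 - \<delta> * \<tau>)\<^sup>2 * (d$1)\<^sup>2 + (1 - \<delta> * \<tau>)\<^sup>2 * (d$2)\<^sup>2
      + (1 - \<delta> * \<tau>)\<^sup>2 * (d$3)\<^sup>2"
    unfolding avg_A_sq_eq[OF less_imp_le[OF t]]
    by (intro add_mono mult_right_mono c1 c2 c3) auto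
  then show ?thesis by (simp add: norm3 algebra_simps)
qed

lemma small_factor: "small \<tau> \<Longrightarrow> 0 < 1 - \<delta> * \<tau>" "small \<tau> \<Longrightarrow> 1 - \<delta> * \<tau> < 1"
  using delta by (auto simp: small_def mult.commute)

lemma avg_A:
  assumes "small \<tau>"
  shows "avg (\<lambda>e. norm (A \<tau> e *v d)) \<le> (1 - \<delta> * \<tau>) * norm d"
proof (rule power2_le_imp_le)
  show "(avg (\<lambda>e. norm (A \<tau> e *v d)))\<^sup>2 \<le> ((1 - \<delta> * \<tau>) * norm d)\<^sup>2"
    using avg_le_sqrt[of "\<lambda>e. norm (A \<tau> e *v d)"] avg_A_sq[OF assms, of d]
    by (simp add: power_mult_distrib)
qed (use small_factor[OF assms] in simp)

lemma avg_A_product: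
  assumes "small \<tau>"
  shows "avg (\<lambda>e. norm (A \<tau> e *v d) * norm (A \<tau> e *v c)) \<le> norm d * norm c"
proof (cases "d = 0 \<or> c = 0")
  case True
  then show ?thesis by auto
next
  case False
  \<comment> \<open>This weight makes both halves of the weighted AM-GM bound equal to
    \<open>norm d * norm c / 2\<close>.\<close>
  define q where "q = norm c / norm d"
  have q: "q > 0" using False by (simp add: q_def)
  have "avg (\<lambda>e. norm (A \<tau> e *v d) * norm (A \<tau> e *v c))
      \<le> avg (\<lambda>e. q / 2 * (norm (A \<tau> e *v d))\<^sup>2 + 1 / (2 * q) * (norm (A \<tau> e *v c))\<^sup>2)"
  proof (intro avg_mono)
    fix e :: "real \<times> real"
    define a b where "a = norm (A \<tau> e *v d)" and "b = norm (A \<tau> e *v c)"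
    have "0 \<le> (q * a - b)\<^sup>2 / (2 * q)" using q by simp
    also have "\<dots> = q / 2 * a\<^sup>2 + 1 / (2 * q) * b\<^sup>2 - a * b"
      using q by (simp add: power2_eq_square field_simps)
    finally show "a * b \<le> q / 2 * a\<^sup>2 + 1 / (2 * q) * b\<^sup>2" by simp
  qed
  also have "\<dots> = q / 2 * avg (\<lambda>e. (norm (A \<tau> e *v d))\<^sup>2) + 1 / (2 * q) * avg (\<lambda>e. (norm (A \<tau> e *v c))\<^sup>2)"
    by (simp only: avg_add avg_cmult)
  also have "\<dots> \<le> q / 2 * (1 * (norm d)\<^sup>2) + 1 / (2 * q) * (1 * (norm c)\<^sup>2)"
  proof (intro add_mono mult_left_mono)
    have "(1 - \<delta> * \<tau>)\<^sup>2 \<le> 1" using small_factor[OF assms] by (simp add: power_le_one)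
    then have *: "(1 - \<delta> * \<tau>)\<^sup>2 * (norm x)\<^sup>2 \<le> 1 * (norm x)\<^sup>2" for x :: "real^3"
      by (intro mult_right_mono) auto
    show "avg (\<lambda>e. (norm (A \<tau> e *v d))\<^sup>2) \<le> 1 * (norm d)\<^sup>2"
      "avg (\<lambda>e. (norm (A \<tau> e *v c))\<^sup>2) \<le> 1 * (norm c)\<^sup>2"
      using avg_A_sq[OF assms] * order_trans by blast+
  qed (use q in auto)
  also have "\<dots> = norm d * norm c"
    using False by (simp add: q_def power2_eq_square field_simps)
  finally show ?thesis .
qed

end

section \<open>Generator and consistency of the scheme\<close>

text \<open>Continuity of the Hessian is left out: Taylor's formula with Lagrange remainder does
  without it, and under \<open>C21\<close> it follows from the Lipschitz bound.\<close>

definition C2diff :: "(real^3 \<Rightarrow> real) \<Rightarrow> (real^3 \<Rightarrow> real^3) \<Rightarrow> (real^3 \<Rightarrow> real^3^3) \<Rightarrow> bool" where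
  "C2diff \<psi> D D2 \<longleftrightarrow> (\<forall>y. GDERIV \<psi> y :> D y) \<and>
     (\<forall>y. (D has_derivative (\<lambda>h. D2 y *v h)) (at y))"

text \<open>A bound on the bilinear form rather than on entries: under the pullback
  \<open>transpose B ** Q ** B\<close> the matrix \<open>B\<close> moves to the two vectors, where
  the averages of \<open>norm (A \<tau> e *v d)\<close> are known. It forces \<open>C\<close> to be
  nonnegative.\<close>

definition form_le :: "real^3^3 \<Rightarrow> real \<Rightarrow> bool" where
  "form_le Q C \<longleftrightarrow> (\<forall>d e. \<bar>d \<bullet> (Q *v e)\<bar> \<le> C * norm d * norm e)"

text \<open>Only the Hessian is bounded and Lipschitz: the function itself may grow, and its
  gradient is controlled separately through a Lipschitz constant of the function.\<close>

definition C21 :: "(real^3 \<Rightarrow> real) \<Rightarrow> (real^3 \<Rightarrow> real^3) \<Rightarrow> (real^3 \<Rightarrow> real^3^3)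
    \<Rightarrow> real \<Rightarrow> real \<Rightarrow> bool" where
  "C21 \<psi> D D2 C2 C3 \<longleftrightarrow> C2diff \<psi> D D2 \<and> (\<forall>y. form_le (D2 y) C2) \<and>
     (\<forall>y z. form_le (D2 y - D2 z) (C3 * norm (y - z)))"

lemma form_leD: "form_le Q C \<Longrightarrow> \<bar>d \<bullet> (Q *v e)\<bar> \<le> C * norm d * norm e"
  by (simp add: form_le_def)

lemma form_le_mono: "form_le Q C \<Longrightarrow> C \<le> C' \<Longrightarrow> form_le Q C'"
  unfolding form_le_def by (meson mult_right_mono norm_ge_zero order_trans)

lemma form_le_component: "form_le Q C \<Longrightarrow> \<bar>Q $ i $ j\<bar> \<le> C"
  using form_leD[of Q C "axis i 1" "axis j 1"]
  by (simp add: inner_axis' matrix_vector_mul_component inner_axis)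

lemma C21_continuous:
  assumes "C21 \<psi> D D2 C2 C3"
  shows "continuous_on UNIV D2"
proof -
  have "continuous_on UNIV (\<lambda>y. D2 y $ i $ j)" for i j
  proof (rule continuous_on_eq_continuous_at[THEN iffD2, OF open_UNIV, rule_format])
    fix y
    have "((\<lambda>z. D2 z $ i $ j - D2 y $ i $ j) \<longlongrightarrow> 0) (at y)"
    proof (rule Lim_null_comparison)
      show "\<forall>\<^sub>F z in at y. norm (D2 z $ i $ j - D2 y $ i $ j) \<le> C3 * norm (z - y)"
        using assms form_le_component[of "D2 z - D2 y" for z]
        unfolding C21_def by (intro always_eventually) force
      show "((\<lambda>z. C3 * norm (z - y)) \<longlongrightarrow> 0) (at y)"
        by (intro tendsto_eq_intros) auto
    qed
    then show "isCont (\<lambda>y. D2 y $ i $ j) y"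
      by (simp add: isCont_def LIM_zero_iff)
  qed
  then have "continuous_on UNIV (\<lambda>y. \<chi> i j. D2 y $ i $ j)"
    by (intro continuous_on_vec_lambda)
  then show ?thesis by simp
qed

lemma C2diff_add:
  "C2diff f D D2 \<Longrightarrow> C2diff g E E2 \<Longrightarrow> C2diff (\<lambda>y. f y + g y) (\<lambda>y. D y + E y) (\<lambda>y. D2 y + E2 y)"
  unfolding C2diff_def
  by (auto intro!: GDERIV_add derivative_eq_intros simp: matrix_vector_mult_add_rdistrib)

lemma C2diff_cmult:
  "C2diff f D D2 \<Longrightarrow> C2diff (\<lambda>y. c * f y) (\<lambda>y. c *\<^sub>R D y) (\<lambda>y. c *\<^sub>R D2 y)"
  unfolding C2diff_def gderiv_def
  by (auto intro!: derivative_eq_intros simp: scaleR_matrix_vector_assoc)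

lemma C2diff_sum:
  assumes "finite I" "\<And>i. i \<in> I \<Longrightarrow> C2diff (f i) (D i) (D2 i)"
  shows "C2diff (\<lambda>y. \<Sum>i\<in>I. f i y) (\<lambda>y. \<Sum>i\<in>I. D i y) (\<lambda>y. \<Sum>i\<in>I. D2 i y)"
  using assms
proof (induction I)
  case empty
  then show ?case by (simp add: C2diff_def gderiv_def)
next
  case (insert i I)
  then show ?case using C2diff_add[of "f i" "D i" "D2 i"] by simp
qed

lemma C2diff_affine:
  fixes B :: "real^3^3" and c :: "real^3"
  assumes "C2diff f D D2"
  shows "C2diff (\<lambda>y. f (B *v y + c)) (\<lambda>y. transpose B *v D (B *v y + c))
    (\<lambda>y. transpose B ** D2 (B *v y + c) ** B)"
proof -
  have aff: "((\<lambda>y. B *v y + c) has_derivative (\<lambda>h. B *v h)) (at y)" for y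
    using has_derivative_add[OF bounded_linear_imp_has_derivative[OF matrix_vector_mul_bounded_linear[of B]]
        has_derivative_const[of c]] by simp
  have 1: "((\<lambda>y. f (B *v y + c)) has_derivative (\<lambda>h. (B *v h) \<bullet> D (B *v y + c))) (at y)" for y
    using has_derivative_compose[OF aff, of f "\<lambda>h. h \<bullet> D (B *v y + c)" y] assms
    by (simp add: C2diff_def gderiv_def)
  have 2: "((\<lambda>y. D (B *v y + c)) has_derivative (\<lambda>h. D2 (B *v y + c) *v (B *v h))) (at y)" for y
    using has_derivative_compose[OF aff, of D "\<lambda>h. D2 (B *v y + c) *v h" y] assms
    by (simp add: C2diff_def)
  have 3: "((\<lambda>y. transpose B *v D (B *v y + c)) has_derivative
      (\<lambda>h. transpose B *v (D2 (B *v y + c) *v (B *v h)))) (at y)" for y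
    using bounded_linear.has_derivative[OF matrix_vector_mul_bounded_linear 2] .
  have 4: "h \<bullet> (transpose B *v x) = (B *v h) \<bullet> x" for h x
    by (metis dot_lmul_matrix inner_commute transpose_matrix_vector)
  have 5: "(transpose B ** Q ** B) *v h = transpose B *v (Q *v (B *v h))" for Q h
    by (simp only: matrix_vector_mul_assoc matrix_mul_assoc)
  show ?thesis
    unfolding C2diff_def gderiv_def 4 5 using 1 3 by blast
qed

lemma C2diff_taylor:
  assumes "C2diff \<psi> D D2"
  obtains s where "0 < s" "s < 1"
    "\<psi> (y + d) = \<psi> y + D y \<bullet> d + d \<bullet> (D2 (y + s *\<^sub>R d) *v d) / 2"
proof -
  \<comment> \<open>The derivatives of orders 0, 1, 2 of the restriction to the segment from
    \<open>y\<close> to \<open>y + d\<close>, indexed as Maclaurin's theorem expects them.\<close>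
  define diff where "diff m s = (if m = 0 then \<psi> (y + s *\<^sub>R d) else
    if m = 1 then D (y + s *\<^sub>R d) \<bullet> d else d \<bullet> (D2 (y + s *\<^sub>R d) *v d))" for m :: nat and s :: real
  have line: "((\<lambda>s. y + s *\<^sub>R d) has_derivative (\<lambda>h. h *\<^sub>R d)) (at s)" for s :: real
    by (auto intro!: derivative_eq_intros)
  have 0: "(diff 0 has_real_derivative diff 1 s) (at s)" for s
  proof -
    have "((\<lambda>s. \<psi> (y + s *\<^sub>R d)) has_derivative (\<lambda>h. (h *\<^sub>R d) \<bullet> D (y + s *\<^sub>R d))) (at s)"
      using has_derivative_compose[OF line, of \<psi> "\<lambda>h. h \<bullet> D (y + s *\<^sub>R d)" s] assms
      by (simp add: C2diff_def gderiv_def)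
    then show ?thesis
      unfolding has_field_derivative_def diff_def
      by (simp, elim has_derivative_eq_rhs) (simp add: fun_eq_iff inner_commute)
  qed
  have 1: "(diff 1 has_real_derivative diff 2 s) (at s)" for s
  proof -
    have "((\<lambda>s. D (y + s *\<^sub>R d)) has_derivative (\<lambda>h. D2 (y + s *\<^sub>R d) *v (h *\<^sub>R d))) (at s)"
      using has_derivative_compose[OF line, of D "\<lambda>h. D2 (y + s *\<^sub>R d) *v h" s] assms
      by (simp add: C2diff_def)
    then have "((\<lambda>s. D (y + s *\<^sub>R d) \<bullet> d) has_derivative (\<lambda>h. (D2 (y + s *\<^sub>R d) *v (h *\<^sub>R d)) \<bullet> d)) (at s)"
      by (intro has_derivative_inner_left)
    moreover have "(\<lambda>h. (D2 (y + s *\<^sub>R d) *v (h *\<^sub>R d)) \<bullet> d) = (*) (diff 2 s)"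
      by (auto simp: fun_eq_iff diff_def inner_commute matrix_vector_mult_scaleR)
    moreover have "(\<lambda>s. D (y + s *\<^sub>R d) \<bullet> d) = diff 1" by (auto simp: fun_eq_iff diff_def)
    ultimately show ?thesis unfolding has_field_derivative_def by simp
  qed
  have "\<exists>s>0. s < 1 \<and> diff 0 1 = (\<Sum>m<2. diff m 0 / fact m * 1 ^ m) + diff 2 s / fact 2 * 1 ^ 2"
    by (rule Maclaurin) (use 0 1 in \<open>auto simp: less_2_cases_iff numeral_2_eq_2 dest: less_SucE\<close>)
  then show thesis
    using that by (auto simp: diff_def numeral_2_eq_2)
qed

lemma C2diff_taylor_bound:
  assumes "C2diff \<psi> D D2" and "\<And>s. 0 < s \<Longrightarrow> s < 1 \<Longrightarrow> form_le (D2 (y + s *\<^sub>R d) - D2 y) \<omega>"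
  shows "\<bar>\<psi> (y + d) - \<psi> y - D y \<bullet> d - d \<bullet> (D2 y *v d) / 2\<bar> \<le> \<omega> * (norm d)\<^sup>2 / 2"
proof -
  obtain s where s: "0 < s" "s < 1" "\<psi> (y + d) = \<psi> y + D y \<bullet> d + d \<bullet> (D2 (y + s *\<^sub>R d) *v d) / 2"
    using C2diff_taylor[OF assms(1)] .
  have "\<psi> (y + d) - \<psi> y - D y \<bullet> d - d \<bullet> (D2 y *v d) / 2 = d \<bullet> ((D2 (y + s *\<^sub>R d) - D2 y) *v d) / 2"
    by (simp add: s(3) matrix_vector_mult_diff_rdistrib inner_diff_right diff_divide_distrib)
  moreover have "\<bar>d \<bullet> ((D2 (y + s *\<^sub>R d) - D2 y) *v d)\<bar> \<le> \<omega> * (norm d)\<^sup>2"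
    using form_leD[OF assms(2)[OF s(1,2)], of d d] by (simp add: power2_eq_square mult.assoc)
  ultimately show ?thesis by (simp only: abs_divide)
qed

text \<open>The generator as a function of point, gradient and Hessian, so that it can be evaluated
  on test functions and on explicitly given derivatives alike.\<close>

definition Lgen :: "real \<Rightarrow> real \<Rightarrow> real \<Rightarrow> real^3 \<Rightarrow> real^3 \<Rightarrow> real^3^3 \<Rightarrow> real" where
  "Lgen k1 k2 k3 y q Q = trace (sig y ** transpose (sig y) ** Q) + drift k1 k2 k3 y \<bullet> q"

lemma cell_operator_Lgen: "cell_operator k1 k2 k3 h l y r q Q = h y - l - Lgen k1 k2 k3 y q Q"
  by (simp add: cell_operator_def Lgen_def)

lemma Lgen_expand: "Lgen k1 k2 k3 y q Q = Q$1$1 + Q$2$2 + 2 * y$2 * (Q$1$3 + Q$3$1)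
   - 2 * y$1 * (Q$2$3 + Q$3$2) + 4 * ((y$1)\<^sup>2 + (y$2)\<^sup>2) * Q$3$3
   - k1 * y$1 * q$1 - k2 * y$2 * q$2 - k3 * y$3 * q$3"
  by (simp add: Lgen_def trace_def matrix_matrix_mult_def transpose_def sum_3 sum_2 sig_def drift_def
      inner3 power2_eq_square algebra_simps)

lemma Lgen_add: "Lgen k1 k2 k3 y (q + q') (Q + Q') = Lgen k1 k2 k3 y q Q + Lgen k1 k2 k3 y q' Q'"
  by (simp add: Lgen_expand algebra_simps)

lemma Lgen_cmult: "Lgen k1 k2 k3 y (c *\<^sub>R q) (c *\<^sub>R Q) = c * Lgen k1 k2 k3 y q Q"
  by (simp add: Lgen_expand algebra_simps)

context coeffs
begin

abbreviation "L \<equiv> Lgen k1 k2 k3"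

text \<open>Steps have size \<open>sqrt \<tau> * mm * (1 + norm y)\<close>: \<open>km\<close>
  accounts for the drift, 6 bounds the factor \<open>4 * sqrt 2\<close> of the state-dependent
  noise.\<close>

definition mm :: real where "mm = km + 6"

lemma mm_pos: "mm > 6" using km_pos by (simp add: mm_def)

lemma sqrt_small:
  assumes "small \<tau>" shows "\<tau> \<le> sqrt \<tau>" "sqrt \<tau> \<le> 1" "0 < sqrt \<tau>" "sqrt \<tau> * sqrt \<tau> = \<tau>"
proof -
  show "sqrt \<tau> \<le> 1" "0 < sqrt \<tau>" "sqrt \<tau> * sqrt \<tau> = \<tau>"
    using assms by (auto simp: small_def)
  then show "\<tau> \<le> sqrt \<tau>"
    by (metis less_imp_le mult.right_neutral mult_left_mono)
qed

lemma A_minus_id: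
  assumes "small \<tau>" "e \<in> signs"
  shows "norm (A \<tau> e *v d - d) \<le> sqrt \<tau> * mm * norm d"
proof -
  have t: "0 < \<tau>" using assms by (simp add: small_def)
  define u where "u = (vector [k1 * d$1, k2 * d$2, k3 * d$3] :: real^3)"
  define v where "v = (axis 3 (2 * sqrt 2 * (d$2 * fst e - d$1 * snd e)) :: real^3)"
  have eq: "A \<tau> e *v d - d = (- \<tau>) *\<^sub>R u + sqrt \<tau> *\<^sub>R v"
    by (simp add: vec_eq_iff forall_3 A_components u_def v_def axis_def real_sqrt_mult algebra_simps)
  have comp: "\<bar>d$i\<bar> \<le> norm d" for i by (rule component_le_norm_cart)
  have "norm u \<le> \<bar>u$1\<bar> + \<bar>u$2\<bar> + \<bar>u$3\<bar>"
    using norm_le_l1_cart[of u] by (simp add: sum_3)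
  also have "\<dots> \<le> k1 * norm d + k2 * norm d + k3 * norm d"
    using k comp by (auto simp: u_def abs_mult intro!: add_mono mult_left_mono)
  finally have u: "norm u \<le> km * norm d" by (simp add: km_def algebra_simps)
  have e: "\<bar>fst e\<bar> = 1" "\<bar>snd e\<bar> = 1" using assms by (auto simp: signs_def)
  have "\<bar>d$2 * fst e - d$1 * snd e\<bar> \<le> \<bar>d$2\<bar> * \<bar>fst e\<bar> + \<bar>d$1\<bar> * \<bar>snd e\<bar>"
    by (metis abs_mult abs_triangle_ineq4)
  also have "\<dots> \<le> 2 * norm d" using e comp[of 1] comp[of 2] by simp
  finally have "2 * sqrt 2 * \<bar>d$2 * fst e - d$1 * snd e\<bar> \<le> 2 * sqrt 2 * (2 * norm d)"
    by (intro mult_left_mono) auto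
  also have "\<dots> \<le> 2 * (3 / 2) * (2 * norm d)"
    by (intro mult_right_mono mult_left_mono real_le_lsqrt) (auto simp: power2_eq_square)
  finally have v: "norm v \<le> 6 * norm d" using norm_le_l1_cart[of v]
    by (simp add: v_def sum_3 axis_def abs_mult)
  have "norm (A \<tau> e *v d - d) \<le> \<tau> * norm u + sqrt \<tau> * norm v"
    unfolding eq using norm_triangle_ineq[of "(- \<tau>) *\<^sub>R u" "sqrt \<tau> *\<^sub>R v"] t by simp
  also have "\<dots> \<le> sqrt \<tau> * (km * norm d) + sqrt \<tau> * (6 * norm d)"
    using u v sqrt_small[OF assms(1)] by (intro add_mono mult_mono) auto
  finally show ?thesis by (simp add: mm_def algebra_simps)
qed

lemma step_bound:
  assumes "small \<tau>" "e \<in> signs"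
  shows "norm (T \<tau> e y - y) \<le> sqrt \<tau> * mm * (1 + norm y)"
proof -
  have e: "\<bar>fst e\<bar> = 1" "\<bar>snd e\<bar> = 1" using assms by (auto simp: signs_def)
  have "norm (noise \<tau> e) \<le> \<bar>noise \<tau> e $ 1\<bar> + \<bar>noise \<tau> e $ 2\<bar> + \<bar>noise \<tau> e $ 3\<bar>"
    using norm_le_l1_cart[of "noise \<tau> e"] by (simp add: sum_3)
  also have "\<dots> = sqrt \<tau> * (2 * sqrt 2)"
    using e assms by (simp add: noise_def abs_mult real_sqrt_mult small_def)
  also have "\<dots> \<le> sqrt \<tau> * (2 * (3/2))"
    using sqrt_small[OF assms(1)] by (intro mult_left_mono real_le_lsqrt) (auto simp: power2_eq_square)
  also have "\<dots> \<le> sqrt \<tau> * mm"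
    using mm_pos sqrt_small[OF assms(1)] by (intro mult_left_mono) auto
  finally have n: "norm (noise \<tau> e) \<le> sqrt \<tau> * mm" .
  have "T \<tau> e y - y = (A \<tau> e *v y - y) + noise \<tau> e" by (simp add: estep_def)
  then have "norm (T \<tau> e y - y) \<le> norm (A \<tau> e *v y - y) + norm (noise \<tau> e)"
    by (metis norm_triangle_ineq)
  then show ?thesis using A_minus_id[OF assms, of y] n by (simp add: algebra_simps)
qed

lemma avg_step_linear:
  assumes "0 \<le> \<tau>"
  shows "avg (\<lambda>e. q \<bullet> (T \<tau> e y - y)) = \<tau> * (drift k1 k2 k3 y \<bullet> q)"
  by (simp add: inner3 T_components avg_expand drift_def field_simps)

text \<open>Covariance plus square of the mean. The factor 2 of the covariance cancels the 1/2 in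
  Taylor's formula; the mean step is \<open>\<tau> * drift\<close> and contributes only at order
  \<open>\<tau>\<^sup>2\<close>.\<close>

lemma avg_step_quadratic:
  assumes "0 \<le> \<tau>"
  shows "avg (\<lambda>e. (T \<tau> e y - y) \<bullet> (Q *v (T \<tau> e y - y))) =
    2 * \<tau> * trace (sig y ** transpose (sig y) ** Q) + \<tau>\<^sup>2 * (drift k1 k2 k3 y \<bullet> (Q *v drift k1 k2 k3 y))"
proof -
  define s where "s = sqrt (2 * \<tau>)"
  have s: "s * s = 2 * \<tau>" using assms by (simp add: s_def)
  have tr: "trace (sig y ** transpose (sig y) ** Q) = Q$1$1 + Q$2$2 + 2 * y$2 * (Q$1$3 + Q$3$1)
   - 2 * y$1 * (Q$2$3 + Q$3$2) + 4 * ((y$1)\<^sup>2 + (y$2)\<^sup>2) * Q$3$3"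
    using Lgen_expand[of k1 k2 k3 y 0 Q] by (simp add: Lgen_def)
  have "avg (\<lambda>e. (T \<tau> e y - y) \<bullet> (Q *v (T \<tau> e y - y))) =
    (s * s) * (Q$1$1 + Q$2$2 + 2 * y$2 * (Q$1$3 + Q$3$1)
   - 2 * y$1 * (Q$2$3 + Q$3$2) + 4 * ((y$1)\<^sup>2 + (y$2)\<^sup>2) * Q$3$3) + \<tau>\<^sup>2 * (drift k1 k2 k3 y \<bullet> (Q *v drift k1 k2 k3 y))"
    unfolding inner3 matrix_vector_mult_def
    apply (simp add: inner3 sum_3 T_components drift_def avg_expand flip: s_def)
    apply (simp add: field_simps power2_eq_square)
    done
  then show ?thesis unfolding tr s by simp
qed

lemma drift_norm: "norm (drift k1 k2 k3 y) \<le> km * norm y"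
proof -
  have comp: "\<bar>y$i\<bar> \<le> norm y" for i by (rule component_le_norm_cart)
  have "norm (drift k1 k2 k3 y) \<le> \<bar>k1 * y$1\<bar> + \<bar>k2 * y$2\<bar> + \<bar>k3 * y$3\<bar>"
    using norm_le_l1_cart[of "drift k1 k2 k3 y"] by (simp add: sum_3 drift_def)
  also have "\<dots> \<le> k1 * norm y + k2 * norm y + k3 * norm y"
    using k comp by (auto simp: abs_mult intro!: add_mono mult_left_mono)
  finally show ?thesis by (simp add: km_def algebra_simps)
qed

text \<open>Taylor's formula for each toss, then averaging: first and second order together yield
  \<open>\<tau> * L\<close>. The bound \<omega> on the oscillation of the Hessian over one step is
  left abstract, so that the estimate serves test functions with merely continuous Hessian as well
  as resolvents with Lipschitz Hessian.\<close>

lemma K_consistent: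
  assumes \<psi>: "C2diff \<psi> D D2" and \<tau>: "small \<tau>" and C: "form_le (D2 y) C"
    and \<omega>: "\<And>z. norm (z - y) \<le> sqrt \<tau> * mm * (1 + norm y) \<Longrightarrow> form_le (D2 z - D2 y) \<omega>"
  shows "\<bar>(K \<tau> \<psi> y - \<psi> y) / \<tau> - L y (D y) (D2 y)\<bar>
    \<le> (\<omega> * (mm * (1 + norm y))\<^sup>2 + \<tau> * C * (km * norm y)\<^sup>2) / 2"
proof -
  define r where "r = sqrt \<tau> * mm * (1 + norm y)"
  define d where "d e = T \<tau> e y - y" for e
  have t: "0 < \<tau>" using \<tau> by (simp add: small_def)
  \<comment> \<open>Steps are of order \<open>sqrt \<tau>\<close>, so the squared step carries
    exactly the factor \<tau> that the final division removes.\<close>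
  have r2: "r\<^sup>2 = \<tau> * (mm * (1 + norm y))\<^sup>2"
    using sqrt_small[OF \<tau>] by (simp add: r_def power_mult_distrib power2_eq_square[of "sqrt \<tau>"])
  have d: "norm (d e) \<le> r" if "e \<in> signs" for e
    using step_bound[OF \<tau> that] by (simp add: d_def r_def)
  have r0: "0 \<le> r" using sqrt_small[OF \<tau>] mm_pos by (simp add: r_def)
  have w0: "0 \<le> \<omega>"
    using form_le_component[OF \<omega>[of y], of 1 1] r0 by (simp add: r_def)
  have rem: "\<bar>\<psi> (T \<tau> e y) - \<psi> y - D y \<bullet> d e - d e \<bullet> (D2 y *v d e) / 2\<bar> \<le> \<omega> * r\<^sup>2 / 2"
    if "e \<in> signs" for e
  proof -
    have "\<bar>\<psi> (y + d e) - \<psi> y - D y \<bullet> d e - d e \<bullet> (D2 y *v d e) / 2\<bar> \<le> \<omega> * (norm (d e))\<^sup>2 / 2"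
    proof (rule C2diff_taylor_bound[OF \<psi> \<omega>])
      fix s :: real assume "0 < s" "s < 1"
      then have "s * norm (d e) \<le> norm (d e)" by (simp add: mult_left_le_one_le)
      then show "norm (y + s *\<^sub>R d e - y) \<le> sqrt \<tau> * mm * (1 + norm y)"
        using d[OF that] \<open>0 < s\<close> by (simp add: r_def)
    qed
    also have "\<dots> \<le> \<omega> * r\<^sup>2 / 2"
      using d[OF that] w0 by (intro divide_right_mono mult_left_mono power_mono) auto
    finally show ?thesis by (simp add: d_def)
  qed
  define R where "R e = \<psi> (T \<tau> e y) - \<psi> y - D y \<bullet> d e - d e \<bullet> (D2 y *v d e) / 2" for e
  have "\<bar>avg R\<bar> \<le> avg (\<lambda>e. \<omega> * r\<^sup>2 / 2)"
    by (rule order_trans[OF abs_avg_le avg_mono]) (use rem in \<open>simp add: R_def\<close>)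
  then have avR: "\<bar>avg R\<bar> \<le> \<omega> * r\<^sup>2 / 2" by simp
  have "avg R = avg (\<lambda>e. \<psi> (T \<tau> e y)) - \<psi> y - avg (\<lambda>e. D y \<bullet> d e) - avg (\<lambda>e. d e \<bullet> (D2 y *v d e)) / 2"
    by (simp add: R_def avg_expand field_simps)
  also have "\<dots> = K \<tau> \<psi> y - \<psi> y - \<tau> * L y (D y) (D2 y)
      - \<tau>\<^sup>2 * (drift k1 k2 k3 y \<bullet> (D2 y *v drift k1 k2 k3 y)) / 2"
    using t unfolding d_def Kop_def Lgen_def
    by (simp only: avg_step_linear avg_step_quadratic less_imp_le) (simp add: algebra_simps)
  finally have eq: "K \<tau> \<psi> y - \<psi> y - \<tau> * L y (D y) (D2 y) =
      avg R + \<tau>\<^sup>2 * (drift k1 k2 k3 y \<bullet> (D2 y *v drift k1 k2 k3 y)) / 2" by simp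
  have "\<bar>drift k1 k2 k3 y \<bullet> (D2 y *v drift k1 k2 k3 y)\<bar> \<le> C * (norm (drift k1 k2 k3 y))\<^sup>2"
    using form_leD[OF C] by (simp add: power2_eq_square mult.assoc)
  also have "\<dots> \<le> C * (km * norm y)\<^sup>2"
    using drift_norm form_le_component[OF C, of 1 1] by (intro mult_left_mono power_mono) auto
  finally have q: "\<bar>\<tau>\<^sup>2 * (drift k1 k2 k3 y \<bullet> (D2 y *v drift k1 k2 k3 y)) / 2\<bar> \<le> \<tau>\<^sup>2 * (C * (km * norm y)\<^sup>2) / 2"
    using t by (simp add: abs_mult)
  have "\<bar>K \<tau> \<psi> y - \<psi> y - \<tau> * L y (D y) (D2 y)\<bar> \<le> \<omega> * r\<^sup>2 / 2 + \<tau>\<^sup>2 * (C * (km * norm y)\<^sup>2) / 2"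
    unfolding eq using avR q by linarith
  also have "\<dots> = \<tau> * ((\<omega> * (mm * (1 + norm y))\<^sup>2 + \<tau> * C * (km * norm y)\<^sup>2) / 2)"
    unfolding r2 by (simp add: power2_eq_square algebra_simps)
  finally have "\<bar>K \<tau> \<psi> y - \<psi> y - \<tau> * L y (D y) (D2 y)\<bar> / \<tau> \<le> (\<omega> * (mm * (1 + norm y))\<^sup>2 + \<tau> * C * (km * norm y)\<^sup>2) / 2"
    using t by (simp add: pos_divide_le_eq mult.commute)
  moreover have "(K \<tau> \<psi> y - \<psi> y) / \<tau> - L y (D y) (D2 y) = (K \<tau> \<psi> y - \<psi> y - \<tau> * L y (D y) (D2 y)) / \<tau>"
    using t by (simp add: field_simps)
  ultimately show ?thesis using t by simp
qed

end

section \<open>Stability for viscosity solutions\<close>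

lemma form_le_entries: "form_le Q (\<Sum>i\<in>UNIV. \<Sum>j\<in>UNIV. \<bar>Q $ i $ j\<bar>)"
  unfolding form_le_def
proof (intro allI)
  fix d e :: "real^3"
  have "\<bar>d \<bullet> (Q *v e)\<bar> = \<bar>\<Sum>i\<in>UNIV. \<Sum>j\<in>UNIV. d$i * (Q$i$j * e$j)\<bar>"
    by (simp add: inner_vec_def matrix_vector_mult_def sum_distrib_left)
  also have "\<dots> \<le> (\<Sum>i\<in>UNIV. \<Sum>j\<in>UNIV. \<bar>d$i * (Q$i$j * e$j)\<bar>)"
    by (intro order_trans[OF sum_abs] sum_mono sum_abs)
  also have "\<dots> \<le> (\<Sum>i\<in>UNIV. \<Sum>j\<in>UNIV. \<bar>Q$i$j\<bar> * (norm d * norm e))"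
  proof (intro sum_mono)
    fix i j :: 3
    have "\<bar>d$i * (Q$i$j * e$j)\<bar> = \<bar>Q$i$j\<bar> * (\<bar>d$i\<bar> * \<bar>e$j\<bar>)" by (simp add: abs_mult)
    also have "\<dots> \<le> \<bar>Q$i$j\<bar> * (norm d * norm e)"
      by (intro mult_left_mono mult_mono component_le_norm_cart) auto
    finally show "\<bar>d$i * (Q$i$j * e$j)\<bar> \<le> \<bar>Q$i$j\<bar> * (norm d * norm e)" .
  qed
  finally show "\<bar>d \<bullet> (Q *v e)\<bar> \<le> (\<Sum>i\<in>UNIV. \<Sum>j\<in>UNIV. \<bar>Q $ i $ j\<bar>) * norm d * norm e"
    by (simp add: sum_distrib_right mult.assoc)
qed

lemma form_le_near:
  fixes D2 :: "real^3 \<Rightarrow> real^3^3"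
  assumes "continuous_on UNIV D2" "\<epsilon> > 0"
  obtains \<rho> where "\<rho> > 0" "\<And>z. dist z y < \<rho> \<Longrightarrow> form_le (D2 z - D2 y) \<epsilon>"
proof -
  have c: "isCont D2 y" using assms(1) by (simp add: continuous_on_eq_continuous_at)
  have "((\<lambda>z. \<Sum>i\<in>UNIV. \<Sum>j\<in>UNIV. \<bar>(D2 z - D2 y) $ i $ j\<bar>) \<longlongrightarrow>
     (\<Sum>i\<in>UNIV. \<Sum>j\<in>UNIV. \<bar>(D2 y - D2 y) $ i $ j\<bar>)) (at y)"
    using c unfolding isCont_def
    by (intro tendsto_sum tendsto_rabs tendsto_vec_nth tendsto_diff tendsto_const)
  then have "\<forall>\<^sub>F z in at y. (\<Sum>i\<in>UNIV. \<Sum>j\<in>UNIV. \<bar>(D2 z - D2 y) $ i $ j\<bar>) < \<epsilon>"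
    by (rule order_tendstoD) (use assms in simp)
  then obtain \<rho> where "\<rho> > 0" and r: "\<And>z. z \<noteq> y \<Longrightarrow> dist z y < \<rho> \<Longrightarrow>
      (\<Sum>i\<in>UNIV. \<Sum>j\<in>UNIV. \<bar>(D2 z - D2 y) $ i $ j\<bar>) < \<epsilon>"
    unfolding eventually_at by auto
  have "form_le (D2 z - D2 y) \<epsilon>" if "dist z y < \<rho>" for z
  proof (cases "z = y")
    case True
    then show ?thesis using assms by (simp add: form_le_def)
  next
    case False
    show ?thesis by (rule form_le_mono[OF form_le_entries]) (use r[OF False that] in simp)
  qed
  then show thesis using that \<open>\<rho> > 0\<close> by blast
qed

lemma form_le_diff:
  "form_le (P - Q) a \<Longrightarrow> form_le (R - Q) b \<Longrightarrow> form_le (P - R) (a + b)"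
proof -
  assume a: "form_le (P - Q) a" and b: "form_le (R - Q) b"
  show ?thesis unfolding form_le_def
  proof (intro allI)
    fix d e :: "real^3"
    have "d \<bullet> ((P - R) *v e) = d \<bullet> ((P - Q) *v e) - d \<bullet> ((R - Q) *v e)"
      by (simp add: matrix_vector_mult_diff_rdistrib inner_diff_right)
    then show "\<bar>d \<bullet> ((P - R) *v e)\<bar> \<le> (a + b) * norm d * norm e"
      using form_leD[OF a, of d e] form_leD[OF b, of d e] by (simp add: algebra_simps)
  qed
qed

lemma Lgen_tendsto:
  assumes "(y \<longlongrightarrow> y0) G" "(q \<longlongrightarrow> q0) G" "(Q \<longlongrightarrow> Q0) G"
  shows "((\<lambda>n. Lgen k1 k2 k3 (y n) (q n) (Q n)) \<longlongrightarrow> Lgen k1 k2 k3 y0 q0 Q0) G"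
  unfolding Lgen_expand
  by (intro tendsto_intros tendsto_vec_nth assms)

text \<open>The equation is linear, so negating \<open>w\<close>, \<open>h\<close> and
  \<open>l\<close> exchanges sub- and supersolutions; every later argument is carried out for
  subsolutions only.\<close>

lemma supersolution_uminus:
  assumes "viscosity_subsolution (cell_operator k1 k2 k3 (\<lambda>y. - h y) (- l)) (\<lambda>y. - w y)"
  shows "viscosity_supersolution (cell_operator k1 k2 k3 h l) w"
  unfolding viscosity_supersolution_def
proof (intro allI impI, elim conjE)
  fix \<psi> D D2 y
  assume C2: "C2_function \<psi> D D2" and m: "\<forall>\<^sub>F z in nhds y. w z - \<psi> z \<ge> w y - \<psi> y"
  have "C2_function (\<lambda>y. - \<psi> y) (\<lambda>y. - D y) (\<lambda>y. - D2 y)"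
    using C2 C2diff_cmult[of \<psi> D D2 "-1"] continuous_on_minus[of UNIV D2]
    by (simp add: C2_function_def C2diff_def)
  moreover have "\<forall>\<^sub>F z in nhds y. - w z - (- \<psi> z) \<le> - w y - (- \<psi> y)"
    using m by eventually_elim simp
  ultimately have "cell_operator k1 k2 k3 (\<lambda>y. - h y) (- l) y (- w y) (- D y) (- D2 y) \<le> 0"
    using assms unfolding viscosity_subsolution_def by blast
  then show "0 \<le> cell_operator k1 k2 k3 h l y (w y) (D y) (D2 y)"
    using Lgen_cmult[of k1 k2 k3 y "-1" "D y" "D2 y"] by (simp add: cell_operator_Lgen)
qed

lemma subsolution_uminus:
  assumes "viscosity_supersolution (cell_operator k1 k2 k3 h l) w"
  shows "viscosity_subsolution (cell_operator k1 k2 k3 (\<lambda>y. - h y) (- l)) (\<lambda>y. - w y)"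
  unfolding viscosity_subsolution_def
proof (intro allI impI, elim conjE)
  fix \<psi> D D2 y
  assume C2: "C2_function \<psi> D D2" and m: "\<forall>\<^sub>F z in nhds y. - w z - \<psi> z \<le> - w y - \<psi> y"
  have "C2_function (\<lambda>y. - \<psi> y) (\<lambda>y. - D y) (\<lambda>y. - D2 y)"
    using C2 C2diff_cmult[of \<psi> D D2 "-1"] continuous_on_minus[of UNIV D2]
    by (simp add: C2_function_def C2diff_def)
  moreover have "\<forall>\<^sub>F z in nhds y. w z - (- \<psi> z) \<ge> w y - (- \<psi> y)"
    using m by eventually_elim simp
  ultimately have "cell_operator k1 k2 k3 h l y (w y) (- D y) (- D2 y) \<ge> 0"
    using assms unfolding viscosity_supersolution_def by blast
  then show "cell_operator k1 k2 k3 (\<lambda>y. - h y) (- l) y (- w y) (D y) (D2 y) \<le> 0"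
    using Lgen_cmult[of k1 k2 k3 y "-1" "D y" "D2 y"] by (simp add: cell_operator_Lgen)
qed

lemma C2diff_square: "C2diff (\<lambda>z. \<kappa> * (norm (z - c))\<^sup>2) (\<lambda>z. (2 * \<kappa>) *\<^sub>R (z - c)) (\<lambda>z. (2 * \<kappa>) *\<^sub>R mat 1)"
  unfolding C2diff_def gderiv_def power2_norm_eq_inner
  by (auto intro!: derivative_eq_intros simp: fun_eq_iff inner_commute algebra_simps inner_diff_right
      scaleR_matrix_vector_assoc[symmetric])

context coeffs
begin

text \<open>Consistency is needed along moving points, since the maximum points in the stability
  argument vary with \<open>j\<close>. As the Hessian is only continuous, its oscillation is
  controlled on a fixed ball around \<open>y0\<close> that eventually contains every step from
  \<open>y j\<close>.\<close>

lemma K_consistent_limit: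
  assumes \<psi>: "C2_function \<psi> D D2" and \<tau>: "\<And>j. small (\<tau> j)" "\<tau> \<longlonglongrightarrow> 0" and y: "y \<longlonglongrightarrow> y0"
  shows "(\<lambda>j. (K (\<tau> j) \<psi> (y j) - \<psi> (y j)) / \<tau> j) \<longlonglongrightarrow> L y0 (D y0) (D2 y0)"
proof -
  have C2: "C2diff \<psi> D D2" and cont: "continuous_on UNIV D2"
    using \<psi> by (auto simp: C2_function_def C2diff_def)
  have Dc: "isCont D y0" using C2 by (auto simp: C2diff_def intro: has_derivative_continuous)
  have D2c: "isCont D2 y0" using cont by (simp add: continuous_on_eq_continuous_at)
  have Lj: "(\<lambda>j. L (y j) (D (y j)) (D2 (y j))) \<longlonglongrightarrow> L y0 (D y0) (D2 y0)"
    by (intro Lgen_tendsto y isCont_tendsto_compose[OF Dc] isCont_tendsto_compose[OF D2c])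
  define C where "C = (\<Sum>i\<in>UNIV. \<Sum>j\<in>UNIV. \<bar>D2 y0 $ i $ j\<bar>) + 1"
  define M where "M = (mm * (1 + norm y0))\<^sup>2 + 1"
  have M0: "M > 0" unfolding M_def by (rule add_nonneg_pos) auto
  have "(\<lambda>j. (K (\<tau> j) \<psi> (y j) - \<psi> (y j)) / \<tau> j - L (y j) (D (y j)) (D2 (y j))) \<longlonglongrightarrow> 0"
  proof (rule LIMSEQ_I)
    fix r :: real assume "0 < r"
    define \<epsilon> where "\<epsilon> = min 1 (r / (4 * M))"
    have e: "\<epsilon> > 0" "\<epsilon> \<le> 1" "2 * \<epsilon> * M \<le> r / 2"
      using \<open>0 < r\<close> M0 by (auto simp: \<epsilon>_def min_def field_simps)
    obtain \<rho> where \<rho>: "\<rho> > 0" "\<And>z. dist z y0 < \<rho> \<Longrightarrow> form_le (D2 z - D2 y0) \<epsilon>"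
      using form_le_near[OF cont e(1)] by blast
    have "(\<lambda>j. dist (y j) y0 + sqrt (\<tau> j) * mm * (1 + norm (y j))) \<longlonglongrightarrow> dist y0 y0 + sqrt 0 * mm * (1 + norm y0)"
      by (intro tendsto_intros y \<tau>)
    then have 1: "\<forall>\<^sub>F j in sequentially. dist (y j) y0 + sqrt (\<tau> j) * mm * (1 + norm (y j)) < \<rho>"
      using \<rho>(1) by (auto intro: order_tendstoD)
    have "(\<lambda>j. (mm * (1 + norm (y j)))\<^sup>2) \<longlonglongrightarrow> (mm * (1 + norm y0))\<^sup>2"
      by (intro tendsto_intros y)
    then have 2: "\<forall>\<^sub>F j in sequentially. (mm * (1 + norm (y j)))\<^sup>2 < M"
      by (rule order_tendstoD) (simp add: M_def)
    have "(\<lambda>j. \<tau> j * (C + 1) * (km * norm (y j))\<^sup>2) \<longlonglongrightarrow> 0 * (C + 1) * (km * norm y0)\<^sup>2"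
      by (intro tendsto_intros y \<tau>)
    then have 3: "\<forall>\<^sub>F j in sequentially. \<tau> j * (C + 1) * (km * norm (y j))\<^sup>2 < r"
      using \<open>0 < r\<close> by (auto intro: order_tendstoD)
    have "\<forall>\<^sub>F j in sequentially. norm ((K (\<tau> j) \<psi> (y j) - \<psi> (y j)) / \<tau> j - L (y j) (D (y j)) (D2 (y j)) - 0) < r"
      using 1 2 3
    proof eventually_elim
      case (elim j)
      have t0: "0 < sqrt (\<tau> j)" using sqrt_small[OF \<tau>(1)] by simp
      have pos: "0 \<le> sqrt (\<tau> j) * mm * (1 + norm (y j))" using t0 mm_pos by simp
      then have dj: "dist (y j) y0 < \<rho>" using elim(1) by simp
      have f: "form_le (D2 z - D2 (y j)) (2 * \<epsilon>)"
        if "norm (z - y j) \<le> sqrt (\<tau> j) * mm * (1 + norm (y j))" for z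
      proof -
        have "dist z y0 < \<rho>" using that elim(1) dist_triangle[of z y0 "y j"] by (simp add: dist_norm)
        then show ?thesis using form_le_diff[OF \<rho>(2) \<rho>(2)[OF dj]] by fastforce
      qed
      have "form_le (D2 (y j)) (C + 1)"
        unfolding form_le_def
      proof (intro allI)
        fix d e
        have "d \<bullet> (D2 (y j) *v e) = d \<bullet> ((D2 (y j) - D2 y0) *v e) + d \<bullet> (D2 y0 *v e)"
          by (simp add: matrix_vector_mult_diff_rdistrib inner_diff_right)
        moreover have "\<bar>d \<bullet> ((D2 (y j) - D2 y0) *v e)\<bar> \<le> 1 * norm d * norm e"
          by (rule form_leD[OF form_le_mono[OF \<rho>(2)[OF dj] e(2)]])
        moreover have "\<bar>d \<bullet> (D2 y0 *v e)\<bar> \<le> (C - 1) * norm d * norm e"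
          unfolding C_def using form_leD[OF form_le_entries] by simp
        moreover have "0 \<le> norm d * norm e" by simp
        ultimately show "\<bar>d \<bullet> (D2 (y j) *v e)\<bar> \<le> (C + 1) * norm d * norm e"
          by (simp add: algebra_simps)
      qed
      from K_consistent[OF C2 \<tau>(1) this f]
      have "\<bar>(K (\<tau> j) \<psi> (y j) - \<psi> (y j)) / \<tau> j - L (y j) (D (y j)) (D2 (y j))\<bar>
        \<le> (2 * \<epsilon> * (mm * (1 + norm (y j)))\<^sup>2 + \<tau> j * (C + 1) * (km * norm (y j))\<^sup>2) / 2"
        by simp
      also have "2 * \<epsilon> * (mm * (1 + norm (y j)))\<^sup>2 \<le> 2 * \<epsilon> * M"
        using elim(2) e by (intro mult_left_mono) auto
      finally show ?case using e(3) elim(3) \<open>0 < r\<close> by simp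
    qed
    then show "\<exists>no. \<forall>n\<ge>no. norm ((K (\<tau> n) \<psi> (y n) - \<psi> (y n)) / \<tau> n - L (y n) (D (y n)) (D2 (y n)) - 0) < r"
      by (simp add: eventually_sequentially)
  qed
  from tendsto_add[OF this Lj] show ?thesis by simp
qed

lemma K_mono: "(\<And>e. e \<in> signs \<Longrightarrow> f (T \<tau> e y) \<le> g (T \<tau> e y)) \<Longrightarrow> K \<tau> f y \<le> K \<tau> g y"
  unfolding Kop_def by (rule avg_mono)

lemma K_add_const: "K \<tau> (\<lambda>z. f z + c) y = K \<tau> f y + c"
  by (simp add: Kop_def avg_add)

text \<open>Stability of the monotone scheme \<open>K\<close>: test functions are made to touch strictly by adding
  \<open>\<kappa> |z - y|\<^sup>2\<close>, and the maximum points of the approximations then converge.\<close>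

lemma scheme_limit_subsolution:
  assumes \<tau>: "\<And>j. small (\<tau> j)" "\<tau> \<longlonglongrightarrow> 0"
    and lip: "\<And>j x y. \<bar>w j x - w j y\<bar> \<le> \<Lambda> * norm (x - y)"
    and lim: "\<And>x. (\<lambda>j. w j x) \<longlonglongrightarrow> v x"
    and h: "continuous_on UNIV h" and e: "e \<longlonglongrightarrow> 0"
    and scheme: "\<And>j z. \<bar>(K (\<tau> j) (w j) z - w j z) / \<tau> j - (h z - l)\<bar> \<le> e j * (1 + norm z)"
  shows "viscosity_subsolution (cell_operator k1 k2 k3 h l) v"
  unfolding viscosity_subsolution_def
proof (intro allI impI, elim conjE)
  fix \<psi> D D2 y0
  assume C2: "C2_function \<psi> D D2" and max: "\<forall>\<^sub>F z in nhds y0. v z - \<psi> z \<le> v y0 - \<psi> y0"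
  obtain r where r: "r > 0" "\<And>z. dist z y0 < r \<Longrightarrow> v z - \<psi> z \<le> v y0 - \<psi> y0"
    using max by (auto simp: eventually_nhds_metric)
  define L0 where "L0 = L y0 0 (2 *\<^sub>R mat 1)"
  have key: "h y0 - l \<le> L y0 (D y0) (D2 y0) + \<kappa> * L0" if \<kappa>: "\<kappa> > 0" for \<kappa>
  proof -
    define \<psi>' where "\<psi>' z = \<psi> z + \<kappa> * (norm (z - y0))\<^sup>2" for z
    have C2': "C2_function \<psi>' (\<lambda>z. D z + (2 * \<kappa>) *\<^sub>R (z - y0)) (\<lambda>z. D2 z + (2 * \<kappa>) *\<^sub>R mat 1)"
      using C2diff_add[of \<psi> D D2, OF _ C2diff_square[of \<kappa> y0]] C2
      by (auto simp: C2_function_def C2diff_def \<psi>'_def[abs_def] intro!: continuous_intros)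
    have psi_cont: "continuous_on S \<psi>'" for S
      using C2' by (auto simp: C2_function_def gderiv_def intro!: continuous_at_imp_continuous_on
          intro: has_derivative_continuous)
    have w_cont: "continuous_on S (w j)" for S j
    proof -
      have "(max \<Lambda> 0)-lipschitz_on S (w j)"
      proof (rule lipschitz_onI)
        fix x y
        have "\<bar>w j x - w j y\<bar> \<le> max \<Lambda> 0 * norm (x - y)"
          by (rule order_trans[OF lip mult_right_mono]) auto
        then show "dist (w j x) (w j y) \<le> max \<Lambda> 0 * dist x y" by (simp add: dist_norm)
      qed simp
      then show ?thesis by (rule lipschitz_on_continuous_on)
    qed
    have "\<exists>y\<in>cball y0 (r/2). \<forall>z\<in>cball y0 (r/2). w j z - \<psi>' z \<le> w j y - \<psi>' y" for j
      by (rule continuous_attains_sup) (use r in \<open>auto intro!: continuous_intros psi_cont w_cont\<close>)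
    then obtain y where y: "\<And>j. y j \<in> cball y0 (r/2)"
        "\<And>j z. z \<in> cball y0 (r/2) \<Longrightarrow> w j z - \<psi>' z \<le> w j (y j) - \<psi>' (y j)"
      by metis
    obtain ys s where s: "strict_mono s" and ys: "ys \<in> cball y0 (r/2)" "(y \<circ> s) \<longlonglongrightarrow> ys"
      using compact_cball[of y0 "r/2"] y(1) unfolding compact_def by meson
    have w_lim: "(\<lambda>j. w (s j) (y (s j))) \<longlonglongrightarrow> v ys"
    proof -
      have "(\<lambda>j. w (s j) (y (s j)) - w (s j) ys) \<longlonglongrightarrow> 0"
      proof (rule Lim_null_comparison)
        show "\<forall>\<^sub>F j in sequentially. norm (w (s j) (y (s j)) - w (s j) ys) \<le> \<Lambda> * norm (y (s j) - ys)"
          using lip by simp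
        show "(\<lambda>j. \<Lambda> * norm (y (s j) - ys)) \<longlonglongrightarrow> 0"
          using tendsto_mult[OF tendsto_const[of \<Lambda>] tendsto_norm[OF LIM_zero[OF ys(2)]]] by (simp add: o_def)
      qed
      from tendsto_add[OF this LIMSEQ_subseq_LIMSEQ[OF lim s, of ys]] show ?thesis by (simp add: o_def)
    qed
    have psi_lim: "(\<lambda>j. \<psi>' (y (s j))) \<longlonglongrightarrow> \<psi>' ys"
      using continuous_on_tendsto_compose[OF psi_cont[of UNIV] ys(2)] by (simp add: o_def)
    \<comment> \<open>The limit of the maximum points does at least as well as \<open>y0\<close>;
      since \<open>v - \<psi>\<close> is largest at \<open>y0\<close>, the added square has to
      vanish at \<open>ys\<close>.\<close>
    have "v y0 - \<psi>' y0 \<le> v ys - \<psi>' ys"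
    proof (rule LIMSEQ_le[OF tendsto_diff[OF LIMSEQ_subseq_LIMSEQ[OF lim s] tendsto_const] tendsto_diff[OF w_lim psi_lim]])
      show "\<exists>N. \<forall>n\<ge>N. ((\<lambda>j. w j y0) \<circ> s) n - \<psi>' y0 \<le> w (s n) (y (s n)) - \<psi>' (y (s n))"
        using y(2)[of y0] r by simp
    qed
    moreover have "v ys - \<psi> ys \<le> v y0 - \<psi> y0"
      using ys(1) r by (intro r(2)) (simp add: dist_commute)
    ultimately have "\<kappa> * (norm (ys - y0))\<^sup>2 \<le> 0" by (simp add: \<psi>'_def)
    then have eq: "ys = y0" using \<kappa> by (simp add: mult_le_0_iff)
    have "(\<lambda>j. (K (\<tau> (s j)) \<psi>' (y (s j)) - \<psi>' (y (s j))) / \<tau> (s j)) \<longlonglongrightarrow>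
        L y0 (D y0 + (2 * \<kappa>) *\<^sub>R (y0 - y0)) (D2 y0 + (2 * \<kappa>) *\<^sub>R mat 1)"
      using K_consistent_limit[OF C2', of "\<tau> \<circ> s" "y \<circ> s" y0] \<tau> ys(2) eq LIMSEQ_subseq_LIMSEQ[OF \<tau>(2) s]
      by (simp add: o_def)
    also have "L y0 (D y0 + (2 * \<kappa>) *\<^sub>R (y0 - y0)) (D2 y0 + (2 * \<kappa>) *\<^sub>R mat 1) = L y0 (D y0) (D2 y0) + \<kappa> * L0"
      using Lgen_add[of k1 k2 k3 y0 "D y0" 0 "D2 y0" "(2 * \<kappa>) *\<^sub>R mat 1"]
        Lgen_cmult[of k1 k2 k3 y0 \<kappa> 0 "2 *\<^sub>R mat 1"] by (simp add: L0_def mult.commute)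
    finally have upper: "(\<lambda>j. (K (\<tau> (s j)) \<psi>' (y (s j)) - \<psi>' (y (s j))) / \<tau> (s j)) \<longlonglongrightarrow>
        L y0 (D y0) (D2 y0) + \<kappa> * L0" .
    have hy: "(\<lambda>j. h (y (s j))) \<longlonglongrightarrow> h y0"
      using continuous_on_tendsto_compose[OF h ys(2)] eq by (simp add: o_def)
    have ey: "(\<lambda>j. e (s j) * (1 + norm (y (s j)))) \<longlonglongrightarrow> 0 * (1 + norm y0)"
      using LIMSEQ_subseq_LIMSEQ[OF e s] ys(2) eq by (intro tendsto_intros) (auto simp: o_def)
    have "(\<lambda>j. h (y (s j)) - l - e (s j) * (1 + norm (y (s j)))) \<longlonglongrightarrow> h y0 - l - 0 * (1 + norm y0)"
      by (intro tendsto_diff hy ey tendsto_const)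
    then have lower: "(\<lambda>j. h (y (s j)) - l - e (s j) * (1 + norm (y (s j)))) \<longlonglongrightarrow> h y0 - l"
      by simp
    have "(\<lambda>j. dist (y (s j)) y0 + sqrt (\<tau> (s j)) * mm * (1 + norm (y (s j)))) \<longlonglongrightarrow> dist y0 y0 + sqrt 0 * mm * (1 + norm y0)"
      using LIMSEQ_subseq_LIMSEQ[OF \<tau>(2) s] ys(2) eq by (intro tendsto_intros) (auto simp: o_def)
    then have "\<forall>\<^sub>F j in sequentially. dist (y (s j)) y0 + sqrt (\<tau> (s j)) * mm * (1 + norm (y (s j))) < r/2"
      by (rule order_tendstoD) (use r(1) in simp)
    then have "\<forall>\<^sub>F j in sequentially. h (y (s j)) - l - e (s j) * (1 + norm (y (s j)))
        \<le> (K (\<tau> (s j)) \<psi>' (y (s j)) - \<psi>' (y (s j))) / \<tau> (s j)"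
    proof eventually_elim
      case (elim j)
      define i where "i = s j"
      define c where "c = w i (y i) - \<psi>' (y i)"
      have t: "0 < \<tau> i" using \<tau>(1)[of i] by (simp add: small_def)
      \<comment> \<open>At its maximum point \<open>w i\<close> lies below
        \<open>\<psi>' + c\<close> wherever one step can lead, with equality at \<open>y i\<close>;
        monotonicity of \<open>K\<close> turns this into a comparison of difference
        quotients.\<close>
      have "K (\<tau> i) (w i) (y i) \<le> K (\<tau> i) (\<lambda>z. \<psi>' z + c) (y i)"
      proof (rule K_mono)
        fix q assume "q \<in> signs"
        then have "dist (T (\<tau> i) q (y i)) y0 \<le> r/2"
          using step_bound[OF \<tau>(1)[of i], of q "y i"] elim dist_triangle[of "T (\<tau> i) q (y i)" y0 "y i"]
          by (simp add: i_def dist_norm)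
        then show "w i (T (\<tau> i) q (y i)) \<le> \<psi>' (T (\<tau> i) q (y i)) + c"
          using y(2)[of "T (\<tau> i) q (y i)" i] by (simp add: c_def dist_commute)
      qed
      then have "K (\<tau> i) (w i) (y i) - w i (y i) \<le> K (\<tau> i) \<psi>' (y i) - \<psi>' (y i)"
        by (simp add: K_add_const c_def)
      then have "(K (\<tau> i) (w i) (y i) - w i (y i)) / \<tau> i \<le> (K (\<tau> i) \<psi>' (y i) - \<psi>' (y i)) / \<tau> i"
        using t by (simp add: divide_right_mono)
      then show ?case using scheme[of i "y i"] unfolding i_def by linarith
    qed
    then show ?thesis using tendsto_le[OF sequentially_bot upper lower] by simp
  qed
  \<comment> \<open>Now \<kappa> tends to 0; the denominator \<open>\<bar>L0\<bar> + 1\<close>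
    covers both signs of \<open>L0\<close> and \<open>L0 = 0\<close>.\<close>
  have "h y0 - l \<le> L y0 (D y0) (D2 y0)"
  proof (rule field_le_epsilon)
    fix \<epsilon> :: real assume "0 < \<epsilon>"
    have "\<epsilon> / (\<bar>L0\<bar> + 1) * L0 \<le> \<epsilon> / (\<bar>L0\<bar> + 1) * (\<bar>L0\<bar> + 1)"
      using \<open>0 < \<epsilon>\<close> by (intro mult_left_mono) auto
    then show "h y0 - l \<le> L y0 (D y0) (D2 y0) + \<epsilon>"
      using key[of "\<epsilon> / (\<bar>L0\<bar> + 1)"] \<open>0 < \<epsilon>\<close> by (simp add: add_nonneg_pos)
  qed
  then show "cell_operator k1 k2 k3 h l y0 (v y0) (D y0) (D2 y0) \<le> 0"
    by (simp add: cell_operator_Lgen)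
qed

end

section \<open>Existence of a corrector\<close>

text \<open>If \<open>\<rho> = 1 / (1 + \<beta> \<tau>)\<close> then \<open>\<tau> \<Sum>\<^sub>n \<rho>\<^sup>n\<^sup>+\<^sup>1 (1 + c \<tau>)\<^sup>n = 1 / (\<beta> - c)\<close>.\<close>

lemma resolvent_geometric_le:
  fixes \<tau> \<beta> c :: real
  assumes "0 < \<tau>" "0 \<le> \<beta>" "c < \<beta>" "0 \<le> 1 + c * \<tau>"
  shows "(\<Sum>n<N. \<tau> * (1 / (1 + \<beta> * \<tau>)) ^ Suc n * (1 + c * \<tau>) ^ n) \<le> 1 / (\<beta> - c)"
proof -
  define \<rho> where "\<rho> = 1 / (1 + \<beta> * \<tau>)"
  have pos: "0 < 1 + \<beta> * \<tau>" using assms by (simp add: add_pos_nonneg)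
  have r: "0 < \<rho>" using pos by (simp add: \<rho>_def)
  \<comment> \<open>This identity makes each summand a multiple of the difference of consecutive
    powers of \<open>\<rho> * (1 + c * \<tau>)\<close>, so that the sum telescopes.\<close>
  have q: "1 - \<rho> * (1 + c * \<tau>) = \<rho> * \<tau> * (\<beta> - c)"
    using pos by (simp add: \<rho>_def field_simps)
  have "(\<Sum>n<N. \<tau> * \<rho> ^ Suc n * (1 + c * \<tau>) ^ n) = (1 - (\<rho> * (1 + c * \<tau>)) ^ N) / (\<beta> - c)"
  proof (induction N)
    case (Suc N)
    have "\<tau> * \<rho> ^ Suc N * (1 + c * \<tau>) ^ N * (\<beta> - c) = (\<rho> * \<tau> * (\<beta> - c)) * (\<rho> * (1 + c * \<tau>)) ^ N"
      by (simp add: power_mult_distrib)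
    also have "\<dots> = (\<rho> * (1 + c * \<tau>)) ^ N - (\<rho> * (1 + c * \<tau>)) ^ Suc N"
      unfolding q[symmetric] by (simp add: algebra_simps)
    finally have "\<tau> * \<rho> ^ Suc N * (1 + c * \<tau>) ^ N = ((\<rho> * (1 + c * \<tau>)) ^ N - (\<rho> * (1 + c * \<tau>)) ^ Suc N) / (\<beta> - c)"
      using assms by (simp add: eq_divide_eq)
    with Suc show ?case by (simp add: diff_divide_distrib)
  qed simp
  also have "\<dots> \<le> 1 / (\<beta> - c)"
    using assms r by (intro divide_right_mono) auto
  finally show ?thesis by (simp add: \<rho>_def)
qed

text \<open>The origin of the logarithm. The sum is cut at \<open>m\<close>, about
  \<open>ln (1 + R) / (\<delta> * \<tau>)\<close>, when the geometric decay has consumed the factor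
  \<open>R\<close>. Earlier terms cost at most \<open>\<tau> * B\<close> each, in total about
  \<open>B / \<delta> * ln (1 + R)\<close>; the later ones form a geometric series with sum at most
  \<open>\<Lambda> / \<delta>\<close>. Rounding \<open>m\<close> up costs one more
  \<open>B\<close>.\<close>

lemma log_geometric_le:
  fixes \<delta> \<tau> B \<Lambda> R :: real
  assumes "0 < \<delta>" "0 < \<tau>" "\<tau> \<le> 1" "\<delta> * \<tau> < 1" "0 \<le> B" "0 \<le> \<Lambda>" "0 \<le> R"
  shows "(\<Sum>n<N. \<tau> * min B (\<Lambda> * (1 - \<delta> * \<tau>) ^ n * R)) \<le> (B / \<delta> + B + \<Lambda> / \<delta>) * (1 + ln (1 + R))"
proof -
  define q where "q = 1 - \<delta> * \<tau>"
  have q: "0 < q" "q < 1" using assms by (auto simp: q_def)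
  define x where "x = ln (1 + R) / (\<delta> * \<tau>)"
  have lnR: "0 \<le> ln (1 + R)" using assms by simp
  have x: "0 \<le> x" using assms lnR by (simp add: x_def)
  define m where "m = nat \<lceil>x\<rceil>"
  have m: "x \<le> m" "m \<le> x + 1" using x by (auto simp: m_def)
  have "q ^ m \<le> exp (- (\<delta> * \<tau>)) ^ m"
    using q exp_ge_add_one_self[of "- (\<delta> * \<tau>)"] by (intro power_mono) (auto simp: q_def)
  also have "\<dots> = exp (- (\<delta> * \<tau> * m))" by (simp add: exp_of_nat_mult[symmetric] algebra_simps)
  also have "\<dots> \<le> exp (- ln (1 + R))"
    using m(1) assms by (simp add: x_def field_simps)
  also have "\<dots> = 1 / (1 + R)" using assms by (simp add: exp_minus inverse_eq_divide)
  finally have "q ^ m * R \<le> 1 / (1 + R) * R" using assms by (intro mult_right_mono)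
  also have "\<dots> \<le> 1" using assms by simp
  finally have qm: "q ^ m * R \<le> 1" .
  have tail: "\<tau> * min B (\<Lambda> * q ^ n * R) \<le> (if n < m then \<tau> * B else 0) + \<tau> * \<Lambda> * (if n < m then 0 else q ^ (n - m))" for n
  proof (cases "n < m")
    case True
    then show ?thesis using assms by simp
  next
    case False
    have "q ^ n * R = q ^ (n - m) * (q ^ m * R)" using False by (simp flip: power_add)
    also have "\<dots> \<le> q ^ (n - m) * 1" using q qm by (intro mult_left_mono) auto
    finally have "\<Lambda> * (q ^ n * R) \<le> \<Lambda> * q ^ (n - m)" using assms by (simp add: mult_left_mono)
    then show ?thesis using False assms by (simp add: min_def mult.assoc)
  qed
  have head_sum: "(\<Sum>n<N. (if n < m then \<tau> * B else 0)) \<le> B / \<delta> * ln (1 + R) + B"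
  proof -
    have "(\<Sum>n<N. (if n < m then \<tau> * B else 0)) = (\<Sum>n\<in>{..<N} \<inter> {..<m}. \<tau> * B)"
      by (rule sum.mono_neutral_cong_right) auto
    also have "\<dots> \<le> (\<Sum>n<m. \<tau> * B)" using assms by (intro sum_mono2) auto
    also have "\<dots> = (\<tau> * B) * m" by simp
    also have "\<dots> \<le> (\<tau> * B) * (x + 1)" using m assms by (intro mult_left_mono) auto
    also have "\<dots> = B / \<delta> * ln (1 + R) + \<tau> * B" using assms by (simp add: x_def field_simps)
    also have "\<dots> \<le> B / \<delta> * ln (1 + R) + 1 * B" using assms by (intro add_left_mono mult_right_mono) auto
    finally show ?thesis by simp
  qed
  have tail_sum: "(\<Sum>n<N. (if n < m then 0 else q ^ (n - m))) \<le> 1 / (1 - q)"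
  proof -
    have "(\<Sum>n<N. (if n < m then 0 else q ^ (n - m))) = (\<Sum>n\<in>{m..<N}. q ^ (n - m))"
      by (rule sum.mono_neutral_cong_right) auto
    also have "\<dots> = (\<Sum>n<N - m. q ^ n)"
      by (rule sum.reindex_bij_witness[where i="\<lambda>n. n + m" and j="\<lambda>n. n - m"]) auto
    also have "\<dots> = (1 - q ^ (N - m)) / (1 - q)" using q by (simp add: sum_gp_strict)
    also have "\<dots> \<le> 1 / (1 - q)" using q by (intro divide_right_mono) auto
    finally show ?thesis .
  qed
  have "(\<Sum>n<N. \<tau> * min B (\<Lambda> * q ^ n * R)) \<le>
      (\<Sum>n<N. (if n < m then \<tau> * B else 0)) + \<tau> * \<Lambda> * (\<Sum>n<N. (if n < m then 0 else q ^ (n - m)))"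
    unfolding sum_distrib_left sum.distrib[symmetric] by (rule sum_mono) (rule tail)
  also have "\<dots> \<le> (B / \<delta> * ln (1 + R) + B) + \<tau> * \<Lambda> * (1 / (1 - q))"
    using assms by (intro add_mono head_sum mult_left_mono tail_sum) auto
  also have "\<dots> = B / \<delta> * ln (1 + R) + B + \<Lambda> / \<delta>" using assms by (simp add: q_def)
  also have "\<dots> \<le> (B / \<delta> + B + \<Lambda> / \<delta>) * (1 + ln (1 + R))"
    using assms lnR by (simp add: algebra_simps)
  finally show ?thesis by (simp add: q_def)
qed

section \<open>Iterates of the transition operator and the discrete corrector\<close>

context coeffs
begin

lemma K_linear: "K \<tau> (\<lambda>z. a * f z + b * g z) y = a * K \<tau> f y + b * K \<tau> g y"
  by (simp add: Kop_def avg_add avg_cmult)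

lemma K_sum: "K \<tau> (\<lambda>z. \<Sum>n\<in>I. c n * f n z) y = (\<Sum>n\<in>I. c n * K \<tau> (f n) y)"
  by (simp add: Kop_def avg_def sum_distrib_left sum_distrib_right sum_divide_distrib sum.swap[of _ signs])

lemma Kpow_linear: "(K \<tau> ^^ n) (\<lambda>z. a * f z + b * g z) = (\<lambda>y. a * (K \<tau> ^^ n) f y + b * (K \<tau> ^^ n) g y)"
  by (induction n) (auto simp: K_linear)

text \<open>Both points are moved by the same toss (synchronous coupling), so their difference is
  moved by the linear part of the step alone.\<close>

lemma K_lip:
  assumes "small \<tau>" "\<And>x y. \<bar>f x - f y\<bar> \<le> \<Lambda> * norm (x - y)"
  shows "\<bar>K \<tau> f x - K \<tau> f y\<bar> \<le> (\<Lambda> * (1 - \<delta> * \<tau>)) * norm (x - y)"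
proof -
  \<comment> \<open>Testing the Lipschitz bound at two points of distance 1 shows that its constant
    is nonnegative; the same device recurs below.\<close>
  have L0: "0 \<le> \<Lambda>" using assms(2)[of "axis 1 1" 0] abs_ge_zero order_trans by fastforce
  have "\<bar>K \<tau> f x - K \<tau> f y\<bar> \<le> avg (\<lambda>e. \<bar>f (T \<tau> e x) - f (T \<tau> e y)\<bar>)"
    unfolding Kop_def avg_diff[symmetric] by (rule abs_avg_le)
  also have "\<dots> \<le> avg (\<lambda>e. \<Lambda> * norm (A \<tau> e *v (x - y)))"
    unfolding T_diff[symmetric] by (intro avg_mono assms)
  also have "\<dots> \<le> \<Lambda> * ((1 - \<delta> * \<tau>) * norm (x - y))"
    unfolding avg_cmult using avg_A[OF assms(1)] L0 by (intro mult_left_mono)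
  finally show ?thesis by (simp add: mult.assoc)
qed

lemma Kpow_lip:
  assumes "small \<tau>" "\<And>x y. \<bar>f x - f y\<bar> \<le> \<Lambda> * norm (x - y)"
  shows "\<bar>(K \<tau> ^^ n) f x - (K \<tau> ^^ n) f y\<bar> \<le> \<Lambda> * (1 - \<delta> * \<tau>) ^ n * norm (x - y)"
proof (induction n arbitrary: x y)
  case 0
  then show ?case using assms by simp
next
  case (Suc n)
  then show ?case using K_lip[OF assms(1) Suc] by (simp add: mult_ac)
qed

lemma K_bound:
  assumes "\<And>x. \<bar>f x\<bar> \<le> B"
  shows "\<bar>K \<tau> f x\<bar> \<le> B"
proof -
  have "\<bar>avg (\<lambda>e. f (T \<tau> e x))\<bar> \<le> avg (\<lambda>e. B)"
    by (rule order_trans[OF abs_avg_le avg_mono]) (rule assms)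
  then show ?thesis by (simp add: Kop_def)
qed

lemma Kpow_bound:
  assumes "\<And>x. \<bar>f x\<bar> \<le> B"
  shows "\<bar>(K \<tau> ^^ n) f x\<bar> \<le> B"
proof (induction n arbitrary: x)
  case 0
  then show ?case using assms by simp
next
  case (Suc n)
  then show ?case using K_bound[of "(K \<tau> ^^ n) f" B] by simp
qed

text \<open>\<open>-\<tau> \<Sum>\<^sub>n (K\<^sup>n h - K\<^sup>n h(0))\<close> is the discrete counterpart of \<open>-\<integral>\<^sub>0\<^sup>\<infinity> (P\<^sub>t h - P\<^sub>t h(0)) dt\<close>.\<close>

definition corrector :: "(real^3 \<Rightarrow> real) \<Rightarrow> real \<Rightarrow> nat \<Rightarrow> real^3 \<Rightarrow> real" where
  "corrector h \<tau> N y = (\<Sum>n<N. - \<tau> * ((K \<tau> ^^ n) h y - (K \<tau> ^^ n) h 0))"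

lemma sum_small_geometric:
  assumes "small \<tau>"
  shows "(\<Sum>n<N. \<tau> * (1 - \<delta> * \<tau>) ^ n) \<le> 1 / \<delta>"
  using resolvent_geometric_le[of \<tau> 0 "- \<delta>" N] assms delta small_factor[OF assms]
  by (simp add: small_def)

text \<open>The Lipschitz constants of the terms form a geometric series of ratio
  \<open>1 - \<delta> * \<tau>\<close>; weighted by \<tau> its sum is at most
  \<open>1 / \<delta>\<close>, uniformly in \<tau> and \<open>N\<close>.\<close>

lemma corrector_lip:
  assumes "small \<tau>" and h: "\<And>x y. \<bar>h x - h y\<bar> \<le> \<Lambda> * norm (x - y)"
  shows "\<bar>corrector h \<tau> N x - corrector h \<tau> N y\<bar> \<le> \<Lambda> / \<delta> * norm (x - y)"
proof -
  have t: "0 < \<tau>" using assms by (simp add: small_def)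
  have L0: "0 \<le> \<Lambda>" using h[of "axis 1 1" 0] abs_ge_zero order_trans by fastforce
  have "\<bar>corrector h \<tau> N x - corrector h \<tau> N y\<bar> = \<bar>\<Sum>n<N. \<tau> * ((K \<tau> ^^ n) h x - (K \<tau> ^^ n) h y)\<bar>"
    unfolding corrector_def sum_subtractf[symmetric]
    by (subst abs_minus_cancel[symmetric], subst sum_negf[symmetric])
      (simp add: algebra_simps sum.distrib sum_subtractf)
  also have "\<dots> \<le> (\<Sum>n<N. \<tau> * (\<Lambda> * (1 - \<delta> * \<tau>) ^ n * norm (x - y)))"
    using t by (intro order_trans[OF sum_abs] sum_mono)
      (simp add: abs_mult Kpow_lip[OF assms(1) h] mult_left_mono)
  also have "\<dots> = (\<Sum>n<N. \<tau> * (1 - \<delta> * \<tau>) ^ n) * (\<Lambda> * norm (x - y))"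
    unfolding sum_distrib_right by (simp add: mult_ac)
  also have "\<dots> \<le> 1 / \<delta> * (\<Lambda> * norm (x - y))"
    using sum_small_geometric[OF assms(1)] L0 by (intro mult_right_mono) auto
  finally show ?thesis by simp
qed

text \<open>Each term has two bounds: \<open>2 * B\<close>, as \<open>K\<close> does not increase
  the supremum norm, and the decaying Lipschitz bound. Their minimum is summed by
  \<open>log_geometric_le\<close>.\<close>

lemma corrector_log:
  assumes "small \<tau>" and h: "\<And>x y. \<bar>h x - h y\<bar> \<le> \<Lambda> * norm (x - y)" and B: "\<And>x. \<bar>h x\<bar> \<le> B"
  shows "\<bar>corrector h \<tau> N x\<bar> \<le> (2 * B / \<delta> + 2 * B + \<Lambda> / \<delta>) * (1 + ln (1 + norm x))"
proof -
  have t: "0 < \<tau>" "\<tau> \<le> 1" using assms by (auto simp: small_def)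
  have L0: "0 \<le> \<Lambda>" using h[of "axis 1 1" 0] abs_ge_zero order_trans by fastforce
  have B0: "0 \<le> B" using B[of 0] by simp
  have "\<bar>(K \<tau> ^^ n) h x - (K \<tau> ^^ n) h 0\<bar> \<le> min (2 * B) (\<Lambda> * (1 - \<delta> * \<tau>) ^ n * norm x)" for n
    using Kpow_lip[where f=h, OF assms(1) h, of n x 0] Kpow_bound[where f=h and n=n and x=x, OF B, of \<tau>]
      Kpow_bound[where f=h and n=n and x=0, OF B, of \<tau>]
    by simp
  then have "\<bar>corrector h \<tau> N x\<bar> \<le> (\<Sum>n<N. \<tau> * min (2 * B) (\<Lambda> * (1 - \<delta> * \<tau>) ^ n * norm x))"
    unfolding corrector_def using t
    by (intro order_trans[OF sum_abs] sum_mono) (simp add: abs_mult mult_left_mono del: min_less_iff_conj)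
  also have "\<dots> \<le> (2 * B / \<delta> + 2 * B + \<Lambda> / \<delta>) * (1 + ln (1 + norm x))"
    using log_geometric_le[of \<delta> \<tau> "2 * B" \<Lambda> "norm x" N] t delta L0 B0 small_factor[OF assms(1)] by simp
  finally show ?thesis .
qed

text \<open>Applying \<open>K\<close> shifts the sum by one, so all but the first and the last term
  cancel. For \<open>N\<close> as large as assumed, \<open>K^N h\<close> is nearly constant, and its
  value at 0 plays the role of \<open>l\<close>.\<close>

lemma corrector_scheme:
  assumes "small \<tau>" and h: "\<And>x y. \<bar>h x - h y\<bar> \<le> \<Lambda> * norm (x - y)" and N: "(1 - \<delta> * \<tau>) ^ N \<le> \<tau>"
  shows "\<bar>(K \<tau> (corrector h \<tau> N) z - corrector h \<tau> N z) / \<tau> - (h z - (K \<tau> ^^ N) h 0)\<bar> \<le> \<tau> * \<Lambda> * norm z"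
proof -
  have t: "0 < \<tau>" using assms by (simp add: small_def)
  have L0: "0 \<le> \<Lambda>" using h[of "axis 1 1" 0] abs_ge_zero order_trans by fastforce
  have "K \<tau> (corrector h \<tau> N) z = (\<Sum>n<N. - \<tau> * ((K \<tau> ^^ Suc n) h z - (K \<tau> ^^ n) h 0))"
    unfolding corrector_def using K_linear[of \<tau> 1 _ "- _" "\<lambda>_. 1" z]
    by (subst K_sum) (simp add: Kop_def avg_diff)
  then have "K \<tau> (corrector h \<tau> N) z - corrector h \<tau> N z =
      (\<Sum>n<N. - \<tau> * ((K \<tau> ^^ Suc n) h z - (K \<tau> ^^ n) h z))"
    unfolding corrector_def by (simp only: sum_subtractf[symmetric]) (simp add: algebra_simps)
  also have "\<dots> = - \<tau> * ((K \<tau> ^^ N) h z - h z)"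
    unfolding sum_distrib_left[symmetric] by (subst sum_lessThan_telescope) simp
  finally have "(K \<tau> (corrector h \<tau> N) z - corrector h \<tau> N z) / \<tau> - (h z - (K \<tau> ^^ N) h 0)
      = (K \<tau> ^^ N) h 0 - (K \<tau> ^^ N) h z" using t by (simp add: field_simps)
  moreover have "\<bar>(K \<tau> ^^ N) h 0 - (K \<tau> ^^ N) h z\<bar> \<le> \<Lambda> * (1 - \<delta> * \<tau>) ^ N * norm z"
    using Kpow_lip[where f=h, OF assms(1) h, of N 0 z] by simp
  moreover have "\<Lambda> * (1 - \<delta> * \<tau>) ^ N * norm z \<le> \<Lambda> * \<tau> * norm z"
    using N L0 by (intro mult_right_mono mult_left_mono) auto
  ultimately show ?thesis by (simp add: mult_ac)
qed

lemma cell_solution_exists: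
  assumes h: "\<And>x y. \<bar>h x - h y\<bar> \<le> \<Lambda> * norm (x - y)" and B: "\<And>x. \<bar>h x\<bar> \<le> B"
  shows "\<exists>l w. viscosity_solution (cell_operator k1 k2 k3 h l) w \<and>
    (\<forall>x y. \<bar>w x - w y\<bar> \<le> \<Lambda> / \<delta> * norm (x - y)) \<and> w 0 = 0 \<and>
    (\<forall>y. \<bar>w y\<bar> \<le> (2 * B / \<delta> + 2 * B + \<Lambda> / \<delta>) * (1 + ln (1 + norm y)))"
proof -
  have L0: "0 \<le> \<Lambda>" using h[of "axis 1 1" 0] abs_ge_zero order_trans by fastforce
  have B0: "0 \<le> B" using B[of 0] by simp
  obtain t0 where t0: "t0 > 0" "\<And>\<tau>. 0 < \<tau> \<Longrightarrow> \<tau> \<le> t0 \<Longrightarrow> small \<tau>"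
    using small_eventually by blast
  define \<tau> where "\<tau> j = t0 / real (Suc j)" for j
  have \<tau>: "small (\<tau> j)" for j
    using t0 by (intro t0(2)) (auto simp: \<tau>_def field_simps)
  have \<tau>0: "\<tau> \<longlonglongrightarrow> 0"
    using tendsto_mult[OF tendsto_const[of t0] LIMSEQ_inverse_real_of_nat]
    by (simp add: \<tau>_def[abs_def] divide_inverse)
  have tpos: "0 < \<tau> j" for j using \<tau>[of j] by (simp add: small_def)
  have "\<exists>N. (1 - \<delta> * \<tau> j) ^ N < \<tau> j" for j
    using real_arch_pow_inv[OF tpos small_factor(2)[OF \<tau>]] by blast
  then obtain N where N: "\<And>j. (1 - \<delta> * \<tau> j) ^ N j < \<tau> j" by metis
  define u where "u j = corrector h (\<tau> j) (N j)" for j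
  define c where "c j = (K (\<tau> j) ^^ N j) h 0" for j
  have u_lip: "\<bar>u j x - u j y\<bar> \<le> \<Lambda> / \<delta> * norm (x - y)" for j x y
    unfolding u_def by (rule corrector_lip[OF \<tau> h])
  have u0: "u j 0 = 0" for j by (simp add: u_def corrector_def)
  have u_scheme: "\<bar>(K (\<tau> j) (u j) z - u j z) / \<tau> j - (h z - c j)\<bar> \<le> \<tau> j * \<Lambda> * norm z" for j z
    unfolding u_def c_def by (rule corrector_scheme[OF \<tau> h less_imp_le[OF N]])
  obtain S :: "(real^3) set" where S: "countable S" "\<And>X. open X \<Longrightarrow> X \<noteq> {} \<Longrightarrow> \<exists>d\<in>S. d \<in> X"
    using countable_dense_exists by blast
  \<comment> \<open>One diagonal argument serves the constants (\<open>None\<close>) and the values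
    on a dense set (\<open>Some x\<close>). Division by \<open>1 + norm x\<close> provides the
    required uniform bound, since Lipschitz functions vanishing at 0 grow at most linearly.\<close>
  define f where "f j p = (case p of None \<Rightarrow> c j | Some x \<Rightarrow> u j x / (1 + norm x))" for j p
  have f_bound: "norm (f j p) \<le> B + \<Lambda> / \<delta>" for j p
  proof (cases p)
    case None
    have "\<bar>c j\<bar> \<le> B" unfolding c_def by (rule Kpow_bound[OF B])
    then show ?thesis using None L0 delta by (simp add: f_def add_increasing2)
  next
    case (Some x)
    have "\<bar>u j x\<bar> \<le> \<Lambda> / \<delta> * norm x" using u_lip[of j x 0] u0 by simp
    also have "\<dots> \<le> (B + \<Lambda> / \<delta>) * (1 + norm x)"
      using L0 B0 delta by (intro mult_mono) (auto intro: add_nonneg_nonneg)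
    finally have "\<bar>u j x\<bar> / (1 + norm x) \<le> B + \<Lambda> / \<delta>"
      by (simp add: divide_le_eq add_pos_nonneg)
    then show ?thesis using Some by (simp add: f_def abs_divide add_nonneg_nonneg)
  qed
  obtain s where s: "strict_mono s" "\<And>p. p \<in> insert None (Some ` S) \<Longrightarrow> \<exists>a. (\<lambda>j. f (s j) p) \<longlonglongrightarrow> a"
    using function_convergent_subsequence[of "insert None (Some ` S)" f "B + \<Lambda> / \<delta>"] S(1) f_bound
    by auto
  obtain l where l: "(\<lambda>j. c (s j)) \<longlonglongrightarrow> l" using s(2)[of None] by (auto simp: f_def)
  have convS: "convergent (\<lambda>j. u (s j) x)" if xS: "x \<in> S" for x
  proof -
    obtain a where "(\<lambda>j. u (s j) x / (1 + norm x)) \<longlonglongrightarrow> a" using s(2)[of "Some x"] xS by (auto simp: f_def)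
    from tendsto_mult[OF this tendsto_const[of "1 + norm x"]] show ?thesis
      using norm_ge_zero[of x] by (auto simp: convergent_def add_nonneg_eq_0_iff intro!: exI)
  qed
  \<comment> \<open>The extra 1 keeps the Lipschitz constant positive, as it is a denominator in the
    Cauchy estimate.\<close>
  define \<Lambda>' where "\<Lambda>' = \<Lambda> / \<delta> + 1"
  have L': "0 < \<Lambda>'" "\<Lambda> / \<delta> \<le> \<Lambda>'" using L0 delta by (auto simp: \<Lambda>'_def intro: add_nonneg_pos)
  have conv: "convergent (\<lambda>j. u (s j) x)" for x
  proof -
    have "Cauchy (\<lambda>j. u (s j) x)"
    proof (rule CauchyI)
      fix e :: real assume "0 < e"
      obtain d where d: "d \<in> S" "dist x d < e / (3 * \<Lambda>')"
        using S(2)[of "ball x (e / (3 * \<Lambda>'))"] divide_pos_pos[of e "3 * \<Lambda>'"] \<open>0 < e\<close> L'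
        by (auto simp: not_le)
      have close: "\<bar>u j x - u j d\<bar> < e / 3" for j
      proof -
        have "\<bar>u j x - u j d\<bar> \<le> \<Lambda>' * dist x d"
          using u_lip[of j x d] L'(2) mult_right_mono[OF L'(2), of "norm (x - d)"] by (simp add: dist_norm)
        also have "\<dots> < \<Lambda>' * (e / (3 * \<Lambda>'))" using d L' by (intro mult_strict_left_mono) auto
        finally show ?thesis using L' by simp
      qed
      have "Cauchy (\<lambda>j. u (s j) d)" using convS[OF d(1)] by (rule convergent_Cauchy)
      then obtain M where M: "\<And>m n. m \<ge> M \<Longrightarrow> n \<ge> M \<Longrightarrow> norm (u (s m) d - u (s n) d) < e / 3"
        using \<open>0 < e\<close> CauchyD[of "\<lambda>j. u (s j) d" "e / 3"] by auto
      have "norm (u (s m) x - u (s n) x) < e" if "m \<ge> M" "n \<ge> M" for m n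
        using M[OF that] close[of "s m"] close[of "s n"] unfolding real_norm_def by linarith
      then show "\<exists>M. \<forall>m\<ge>M. \<forall>n\<ge>M. norm (u (s m) x - u (s n) x) < e" by blast
    qed
    then show ?thesis by (simp add: Cauchy_convergent_iff)
  qed
  define w where "w x = lim (\<lambda>j. u (s j) x)" for x
  have w: "(\<lambda>j. u (s j) x) \<longlonglongrightarrow> w x" for x
    using conv[of x] by (simp add: w_def convergent_LIMSEQ_iff)
  have h_cont: "continuous_on UNIV h"
  proof -
    have "\<Lambda>-lipschitz_on UNIV h" using h L0 by (auto intro!: lipschitz_onI simp: dist_norm)
    then show ?thesis by (rule lipschitz_on_continuous_on)
  qed
  have w_lip: "\<bar>w x - w y\<bar> \<le> \<Lambda> / \<delta> * norm (x - y)" for x y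
    by (rule LIMSEQ_le_const2[OF tendsto_rabs[OF tendsto_diff[OF w w]]]) (use u_lip in auto)
  have w_cont: "continuous_on UNIV w"
  proof -
    have "(\<Lambda> / \<delta>)-lipschitz_on UNIV w" using w_lip L0 delta by (auto intro!: lipschitz_onI simp: dist_norm)
    then show ?thesis by (rule lipschitz_on_continuous_on)
  qed
  \<comment> \<open>Error of the scheme plus the distance of its constant from the limit
    \<open>l\<close>.\<close>
  define e where "e j = \<tau> (s j) * \<Lambda> + \<bar>c (s j) - l\<bar>" for j
  have e0: "e \<longlonglongrightarrow> 0"
    unfolding e_def[abs_def]
    using tendsto_add[OF tendsto_mult[OF LIMSEQ_subseq_LIMSEQ[OF \<tau>0 s(1)] tendsto_const[of \<Lambda>]] tendsto_rabs[OF LIM_zero[OF l]]]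
    by (simp add: o_def)
  have scheme: "\<bar>(K (\<tau> (s j)) (u (s j)) z - u (s j) z) / \<tau> (s j) - (h z - l)\<bar> \<le> e j * (1 + norm z)" for j z
  proof -
    have "\<bar>(K (\<tau> (s j)) (u (s j)) z - u (s j) z) / \<tau> (s j) - (h z - l)\<bar> \<le> \<tau> (s j) * \<Lambda> * norm z + \<bar>c (s j) - l\<bar>"
      using u_scheme[of "s j" z] by linarith
    also have "\<dots> \<le> e j * (1 + norm z)"
      using tpos[of "s j"] L0 by (simp add: e_def algebra_simps)
    finally show ?thesis .
  qed
  have "viscosity_subsolution (cell_operator k1 k2 k3 h l) w"
    by (rule scheme_limit_subsolution[where \<tau>="\<tau> \<circ> s" and w="\<lambda>j. u (s j)" and e=e and \<Lambda>="\<Lambda> / \<delta>"])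
      (use \<tau> LIMSEQ_subseq_LIMSEQ[OF \<tau>0 s(1)] u_lip w h_cont e0 scheme in \<open>auto\<close>)
  moreover have "viscosity_subsolution (cell_operator k1 k2 k3 (\<lambda>y. - h y) (- l)) (\<lambda>y. - w y)"
  proof (rule scheme_limit_subsolution[where \<tau>="\<tau> \<circ> s" and w="\<lambda>j z. - u (s j) z" and e=e and \<Lambda>="\<Lambda> / \<delta>"])
    show "\<bar>(K ((\<tau> \<circ> s) j) (\<lambda>z. - u (s j) z) z - - u (s j) z) / (\<tau> \<circ> s) j - (- h z - - l)\<bar> \<le> e j * (1 + norm z)" for j z
    proof -
      have "K (\<tau> (s j)) (\<lambda>z. - u (s j) z) z = - K (\<tau> (s j)) (u (s j)) z"
        using K_linear[of "\<tau> (s j)" "-1" "u (s j)" 0 "\<lambda>_. 0" z] by simp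
      moreover have "- ((K (\<tau> (s j)) (u (s j)) z - u (s j) z) / \<tau> (s j) - (h z - l)) =
          (- K (\<tau> (s j)) (u (s j)) z - - u (s j) z) / \<tau> (s j) - (- h z - - l)"
        by (simp add: diff_divide_distrib)
      ultimately show ?thesis using scheme[of j z] by (metis abs_minus_cancel comp_apply)
    qed
    show "\<bar>- u (s j) x - - u (s j) y\<bar> \<le> \<Lambda> / \<delta> * norm (x - y)" for j x y
      using u_lip[of "s j" y x] by (simp add: norm_minus_commute)
  qed (use \<tau> LIMSEQ_subseq_LIMSEQ[OF \<tau>0 s(1)] w h_cont e0 in \<open>auto intro!: tendsto_minus continuous_intros\<close>)
  ultimately have "viscosity_solution (cell_operator k1 k2 k3 h l) w"
    using w_cont supersolution_uminus by (simp add: viscosity_solution_def)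
  moreover have "\<bar>w y\<bar> \<le> (2 * B / \<delta> + 2 * B + \<Lambda> / \<delta>) * (1 + ln (1 + norm y))" for y
    by (rule LIMSEQ_le_const2[OF tendsto_rabs[OF w]]) (use corrector_log[OF \<tau> h B] in \<open>auto simp: u_def\<close>)
  moreover have "w 0 = 0" using LIMSEQ_unique[OF w[of 0]] u0 by simp
  ultimately show ?thesis using w_lip by blast
qed

end

section \<open>Linear equations with stochastic forcing\<close>

text \<open>\<open>lborel\<close> on \<open>real^'n\<close> is the image of a product measure
  indexed by the basis vectors. \<open>idx\<close> recovers the coordinate \<open>i\<close> from
  \<open>axis i 1\<close>, after which Fubini's theorem for finite products applies.\<close>

lemma integral_prod_vec:
  fixes g :: "'n::finite \<Rightarrow> real \<Rightarrow> real"
  assumes g: "\<And>i. integrable lborel (g i)"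
  shows "integrable lborel (\<lambda>z::real^'n. \<Prod>i\<in>UNIV. g i (z $ i))"
    and "(\<integral>z. (\<Prod>i\<in>UNIV. g i (z $ i)) \<partial>(lborel :: (real^'n) measure)) = (\<Prod>i\<in>UNIV. (\<integral>x. g i x \<partial>lborel))"
proof -
  interpret product_sigma_finite "\<lambda>_::real^'n. lborel :: real measure" ..
  define idx :: "real^'n \<Rightarrow> 'n" where "idx b = (THE i. b = axis i 1)" for b
  have idx: "idx (axis i 1) = i" for i
    unfolding idx_def by (rule the_equality) (auto simp: axis_eq_axis)
  have Basis: "(Basis :: (real^'n) set) = (\<lambda>i. axis i 1) ` UNIV"
    by (auto simp: Basis_vec_def)
  have inj: "inj (\<lambda>i::'n. axis i (1::real))" by (auto intro!: injI simp: axis_eq_axis)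
  have m: "(\<lambda>f. \<Sum>b\<in>Basis. f b *\<^sub>R b) \<in> (\<Pi>\<^sub>M b\<in>(Basis :: (real^'n) set). lborel) \<rightarrow>\<^sub>M borel"
    by measurable
  have gm [measurable]: "g i \<in> borel_measurable borel" for i using borel_measurable_integrable[OF g[of i]] by simp
  have gm': "(\<lambda>z::real^'n. \<Prod>i\<in>UNIV. g i (z $ i)) \<in> borel_measurable borel"
    by (intro borel_measurable_prod measurable_compose[OF _ gm] borel_measurable_continuous_onI continuous_intros)
  have comp: "(\<Prod>i\<in>UNIV. g i ((\<Sum>b\<in>Basis. f b *\<^sub>R b) $ i)) = (\<Prod>b\<in>Basis. g (idx b) (f b))"
    for f :: "real^'n \<Rightarrow> real"
  proof -
    have "(\<Sum>b\<in>Basis. f b *\<^sub>R b) $ i = f (axis i 1)" for i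
    proof -
      have "(\<Sum>b\<in>Basis. f b *\<^sub>R b) $ i = (\<Sum>j\<in>UNIV. f (axis j 1) * (axis j 1 :: real^'n) $ i)"
        unfolding Basis by (subst sum.reindex[OF inj]) simp
      also have "\<dots> = (\<Sum>j\<in>UNIV. if j = i then f (axis j 1) else 0)"
        by (rule sum.cong) (auto simp: axis_def)
      finally show ?thesis by simp
    qed
    then show ?thesis unfolding Basis by (subst prod.reindex[OF inj]) (simp add: idx)
  qed
  show "integrable lborel (\<lambda>z::real^'n. \<Prod>i\<in>UNIV. g i (z $ i))"
    unfolding lborel_eq[where 'a="real^'n"] using product_integrable_prod[OF finite_Basis g, of "idx" ] comp
    by (subst integrable_distr_eq[OF m gm']) simp
  have "(\<integral>z. (\<Prod>i\<in>UNIV. g i (z $ i)) \<partial>(lborel :: (real^'n) measure)) = (\<integral>f. (\<Prod>b\<in>Basis. g (idx b) (f b)) \<partial>(\<Pi>\<^sub>M b\<in>(Basis :: (real^'n) set). lborel))"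
    unfolding lborel_eq[where 'a="real^'n"] by (subst integral_distr[OF m gm']) (simp only: comp)
  also have "\<dots> = (\<Prod>b\<in>(Basis :: (real^'n) set). (\<integral>x. g (idx b) x \<partial>lborel))"
    by (rule product_integral_prod[OF finite_Basis g])
  also have "\<dots> = (\<Prod>i\<in>UNIV. (\<integral>x. g i x \<partial>lborel))"
    unfolding Basis by (subst prod.reindex[OF inj]) (simp add: idx)
  finally show "(\<integral>z. (\<Prod>i\<in>UNIV. g i (z $ i)) \<partial>(lborel :: (real^'n) measure)) = (\<Prod>i\<in>UNIV. (\<integral>x. g i x \<partial>lborel))" .
qed

text \<open>Makes pathwise time integrals limits of finite sums, through which measurability and
  second-moment bounds can pass.\<close>

lemma riemann_sum_tendsto:
  fixes f :: "real \<Rightarrow> real"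
  assumes "0 \<le> t" and f: "continuous_on {0..t} f"
  shows "(\<lambda>n. (\<Sum>i<n. f (t * real i / real n)) * (t / real n)) \<longlonglongrightarrow> integral {0..t} f"
proof (rule LIMSEQ_I)
  fix r :: real assume "0 < r"
  define e where "e = r / (2 * (t + 1))"
  have e: "0 < e" using \<open>0 < r\<close> assms by (simp add: e_def)
  obtain d where d: "d > 0" "\<And>x y. x \<in> {0..t} \<Longrightarrow> y \<in> {0..t} \<Longrightarrow> dist y x < d \<Longrightarrow> dist (f y) (f x) < e"
    using compact_uniformly_continuous[OF f] e unfolding uniformly_continuous_on_def by fastforce
  obtain N :: nat where N: "t / d < N" using reals_Archimedean2 by blast
  show "\<exists>no. \<forall>n\<ge>no. norm ((\<Sum>i<n. f (t * real i / real n)) * (t / real n) - integral {0..t} f) < r"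
  proof (intro exI allI impI)
    fix n assume n: "n \<ge> N + 1"
    then have n0: "0 < real n" by simp
    have "t / d < real n" using N n by simp
    then have small: "t / real n < d" using d n0 by (simp add: field_simps)
    define p where "p i = t * real i / real n" for i
    have p: "p i \<in> {0..t}" if "i \<le> n" for i
    proof -
      have "t * real i \<le> t * real n" using that assms by (intro mult_left_mono) auto
      then show ?thesis using assms n0 by (simp add: p_def divide_le_eq)
    qed
    have p_Suc: "p (Suc i) = p i + t / real n" for i by (simp add: p_def distrib_left add_divide_distrib)
    have p_mono: "p i \<le> p (Suc i)" for i using assms n0 by (simp add: p_Suc)
    have int: "f integrable_on {a..b}" if "0 \<le> a" "b \<le> t" for a b
      by (rule integrable_continuous_interval) (use that in \<open>auto intro: continuous_on_subset[OF f]\<close>)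
    have part: "\<bar>f (p i) * (t / real n) - integral {p i..p (Suc i)} f\<bar> \<le> e * (t / real n)" if "i < n" for i
    proof -
      have pi: "p i \<in> {0..t}" "p (Suc i) \<in> {0..t}" using p that by auto
      have i1: "f integrable_on {p i..p (Suc i)}" using int pi by auto
      have "f (p i) * (t / real n) - integral {p i..p (Suc i)} f = integral {p i..p (Suc i)} (\<lambda>x. f (p i) - f x)"
        using i1 p_mono[of i] by (subst integral_diff) (auto simp: p_Suc)
      also have "norm \<dots> \<le> e * (p (Suc i) - p i)"
      proof (rule integral_bound[OF p_mono])
        show "continuous_on {p i..p (Suc i)} (\<lambda>x. f (p i) - f x)"
          using pi by (intro continuous_intros continuous_on_subset[OF f]) auto
        fix x assume x: "x \<in> {p i..p (Suc i)}"
        then have "dist (p i) x < d" using small by (simp add: dist_real_def p_Suc)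
        then show "norm (f (p i) - f x) \<le> e" using d(2)[of x "p i"] x pi by (auto simp: dist_norm)
      qed
      finally show ?thesis by (simp add: p_Suc)
    qed
    have total: "(\<Sum>i<m. integral {p i..p (Suc i)} f) = integral {0..p m} f" if "m \<le> n" for m
      using that
    proof (induction m)
      case 0
      then show ?case by (simp add: p_def)
    next
      case (Suc m)
      have "integral {0..p m} f + integral {p m..p (Suc m)} f = integral {0..p (Suc m)} f"
        using p[of m] p[of "Suc m"] Suc.prems p_mono[of m]
        by (intro Henstock_Kurzweil_Integration.integral_combine int) auto
      then show ?case using Suc by simp
    qed
    have "p n = t" using n0 by (simp add: p_def)
    then have "(\<Sum>i<n. f (p i)) * (t / real n) - integral {0..t} f = (\<Sum>i<n. f (p i) * (t / real n) - integral {p i..p (Suc i)} f)"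
      unfolding sum_subtractf sum_distrib_right total[OF order_refl] by (simp only: \<open>p n = t\<close>)
    also have "\<bar>\<dots>\<bar> \<le> (\<Sum>i<n. e * (t / real n))"
      by (intro order_trans[OF sum_abs] sum_mono part) auto
    also have "\<dots> = e * t" using n0 by simp
    also have "\<dots> < r"
    proof -
      have "e * t \<le> r / 2" using \<open>0 < r\<close> assms by (simp add: e_def field_simps)
      then show ?thesis using \<open>0 < r\<close> by simp
    qed
    finally show "norm ((\<Sum>i<n. f (t * real i / real n)) * (t / real n) - integral {0..t} f) < r"
      by (simp add: p_def)
  qed
qed

text \<open>Variation of constants for \<open>I' = j - k I\<close>.\<close>

lemma linear_integral_equation:
  fixes x :: "real \<Rightarrow> real" and k :: real
  assumes "0 \<le> t" and x: "continuous_on {0..t} x"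
  defines "j \<equiv> \<lambda>s. x s + k * integral {0..s} x"
  shows "x t = j t - k * integral {0..t} (\<lambda>s. exp (- k * (t - s)) * j s)"
proof -
  define I where "I s = integral {0..s} x" for s
  have I: "(I has_vector_derivative x s) (at s within {0..t})" if "s \<in> {0..t}" for s
    unfolding I_def by (rule integral_has_vector_derivative[OF x that])
  have "((\<lambda>s. exp (- k * (t - s)) * j s) has_integral exp (- k * (t - t)) * I t - exp (- k * (t - 0)) * I 0) {0..t}"
  proof (rule fundamental_theorem_of_calculus[OF assms(1)])
    fix s assume s: "s \<in> {0..t}"
    have "((\<lambda>s. exp (- k * (t - s)) * I s) has_real_derivative
        exp (- k * (t - s)) * x s + k * exp (- k * (t - s)) * I s) (at s within {0..t})"
      using I[OF s] by (auto intro!: derivative_eq_intros simp: has_real_derivative_iff_has_vector_derivative[symmetric])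
    then show "((\<lambda>s. exp (- k * (t - s)) * I s) has_vector_derivative exp (- k * (t - s)) * j s) (at s within {0..t})"
      by (simp add: has_real_derivative_iff_has_vector_derivative[symmetric] j_def I_def[symmetric] algebra_simps)
  qed
  then have "integral {0..t} (\<lambda>s. exp (- k * (t - s)) * j s) = I t"
    by (auto simp: integral_unique I_def)
  then show ?thesis by (simp add: j_def I_def)
qed

section \<open>Second-moment bounds and their passage to limits\<close>

context prob_space
begin

text \<open>Measurability and integrability travel with the bound: the integral of a nonintegrable
  function is 0, so the bare inequality would be void.\<close>

definition L2le :: "('a \<Rightarrow> real) \<Rightarrow> real \<Rightarrow> bool" where
  "L2le Z B \<longleftrightarrow> Z \<in> borel_measurable M \<and> integrable M (\<lambda>\<omega>. (Z \<omega>)\<^sup>2) \<and> expectation (\<lambda>\<omega>. (Z \<omega>)\<^sup>2) \<le> B"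

lemma L2leI_nn:
  assumes "Z \<in> borel_measurable M" "(\<integral>\<^sup>+\<omega>. ennreal ((Z \<omega>)\<^sup>2) \<partial>M) \<le> ennreal B" "0 \<le> B"
  shows "L2le Z B"
proof -
  have "integrable M (\<lambda>\<omega>. (Z \<omega>)\<^sup>2)"
    by (rule integrableI_bounded) (use assms in \<open>auto simp: order_le_less_trans[OF _ ennreal_less_top]\<close>)
  moreover have "expectation (\<lambda>\<omega>. (Z \<omega>)\<^sup>2) \<le> B"
    using assms by (simp add: integral_eq_nn_integral enn2real_leI)
  ultimately show ?thesis using assms by (simp add: L2le_def)
qed

lemma L2le_nn: "L2le Z B \<Longrightarrow> (\<integral>\<^sup>+\<omega>. ennreal ((Z \<omega>)\<^sup>2) \<partial>M) \<le> ennreal B"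
  unfolding L2le_def by (simp add: nn_integral_eq_integral ennreal_leI)

lemma L2le_nonneg: "L2le Z B \<Longrightarrow> 0 \<le> B"
  unfolding L2le_def
proof (elim conjE)
  assume "expectation (\<lambda>\<omega>. (Z \<omega>)\<^sup>2) \<le> B"
  moreover have "0 \<le> expectation (\<lambda>\<omega>. (Z \<omega>)\<^sup>2)" by (rule Bochner_Integration.integral_nonneg) simp
  ultimately show "0 \<le> B" by linarith
qed

lemma L2le_mono: "L2le Z B \<Longrightarrow> B \<le> B' \<Longrightarrow> L2le Z B'"
  by (auto simp: L2le_def)

lemma L2le_measurable: "L2le Z B \<Longrightarrow> Z \<in> borel_measurable M"
  by (simp add: L2le_def)

lemma L2le_const: "L2le (\<lambda>\<omega>. c) (c\<^sup>2)"
  by (simp add: L2le_def prob_space)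

lemma L2le_cmult: "L2le Z B \<Longrightarrow> L2le (\<lambda>\<omega>. c * Z \<omega>) (c\<^sup>2 * B)"
  by (auto simp: L2le_def power_mult_distrib mult_left_mono)

text \<open>From \<open>(x + y)\<^sup>2 \<le> 2 * x\<^sup>2 + 2 * y\<^sup>2\<close>. The factors 2
  accumulate in the constants below, of which only the finiteness matters.\<close>

lemma L2le_add:
  assumes "L2le X a" "L2le Y b" shows "L2le (\<lambda>\<omega>. X \<omega> + Y \<omega>) (2 * a + 2 * b)"
proof -
  have [measurable]: "X \<in> borel_measurable M" "Y \<in> borel_measurable M" using assms by (auto simp: L2le_def)
  have i: "integrable M (\<lambda>\<omega>. (X \<omega>)\<^sup>2)" "integrable M (\<lambda>\<omega>. (Y \<omega>)\<^sup>2)" using assms by (auto simp: L2le_def)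
  have i2: "integrable M (\<lambda>\<omega>. 2 * (X \<omega>)\<^sup>2 + 2 * (Y \<omega>)\<^sup>2)" using i by simp
  have le: "(X \<omega> + Y \<omega>)\<^sup>2 \<le> 2 * (X \<omega>)\<^sup>2 + 2 * (Y \<omega>)\<^sup>2" for \<omega>
    using zero_le_power2[of "X \<omega> - Y \<omega>"] by (simp add: power2_eq_square algebra_simps)
  have i3: "integrable M (\<lambda>\<omega>. (X \<omega> + Y \<omega>)\<^sup>2)"
    by (rule Bochner_Integration.integrable_bound[OF i2]) (use le in \<open>auto intro!: AE_I2\<close>)
  have "expectation (\<lambda>\<omega>. (X \<omega> + Y \<omega>)\<^sup>2) \<le> expectation (\<lambda>\<omega>. 2 * (X \<omega>)\<^sup>2 + 2 * (Y \<omega>)\<^sup>2)"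
    by (rule integral_mono[OF i3 i2 le])
  also have "\<dots> \<le> 2 * a + 2 * b" using i assms by (simp add: L2le_def)
  finally show ?thesis using i3 by (simp add: L2le_def)
qed

lemma L2le_diff:
  assumes "L2le X a" "L2le Y b" shows "L2le (\<lambda>\<omega>. X \<omega> - Y \<omega>) (2 * a + 2 * b)"
  using L2le_add[OF assms(1) L2le_cmult[OF assms(2), of "-1"]] by simp

lemma L2le_cong_AE:
  assumes "L2le X a" "Y \<in> borel_measurable M" "AE \<omega> in M. Y \<omega> = X \<omega>"
  shows "L2le Y a"
proof -
  have [measurable]: "X \<in> borel_measurable M" using assms by (simp add: L2le_def)
  note [measurable] = assms(2)
  have ae: "AE \<omega> in M. (Y \<omega>)\<^sup>2 = (X \<omega>)\<^sup>2" using assms(3) by eventually_elim simp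
  have "integrable M (\<lambda>\<omega>. (Y \<omega>)\<^sup>2) \<longleftrightarrow> integrable M (\<lambda>\<omega>. (X \<omega>)\<^sup>2)"
    by (rule integrable_cong_AE) (use ae in auto)
  moreover have "expectation (\<lambda>\<omega>. (Y \<omega>)\<^sup>2) = expectation (\<lambda>\<omega>. (X \<omega>)\<^sup>2)"
    by (rule integral_cong_AE) (use ae in auto)
  ultimately show ?thesis using assms by (simp add: L2le_def)
qed

text \<open>Young's inequality with a free weight. The choice \<open>c = sqrt t\<close> balances a
  Gaussian part of order \<open>sqrt t\<close> against a remainder of order
  \<open>t\<close>.\<close>

lemma L2le_product:
  assumes "L2le X a" "L2le Y b"
  shows "integrable M (\<lambda>\<omega>. X \<omega> * Y \<omega>)"
    and "0 < c \<Longrightarrow> expectation (\<lambda>\<omega>. \<bar>X \<omega> * Y \<omega>\<bar>) \<le> (c * a + b / c) / 2"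
proof -
  have [measurable]: "X \<in> borel_measurable M" "Y \<in> borel_measurable M" using assms by (auto simp: L2le_def)
  have i: "integrable M (\<lambda>\<omega>. (X \<omega>)\<^sup>2)" "integrable M (\<lambda>\<omega>. (Y \<omega>)\<^sup>2)" using assms by (auto simp: L2le_def)
  have le: "\<bar>X \<omega> * Y \<omega>\<bar> \<le> (c * (X \<omega>)\<^sup>2 + (Y \<omega>)\<^sup>2 / c) / 2" if "0 < c" for c \<omega>
  proof -
    have "0 \<le> (c * \<bar>X \<omega>\<bar> - \<bar>Y \<omega>\<bar>)\<^sup>2 / c" using that by simp
    also have "\<dots> = c * (X \<omega>)\<^sup>2 + (Y \<omega>)\<^sup>2 / c - 2 * \<bar>X \<omega> * Y \<omega>\<bar>"
    proof -
      have "(c * \<bar>X \<omega>\<bar> - \<bar>Y \<omega>\<bar>)\<^sup>2 = c\<^sup>2 * (X \<omega>)\<^sup>2 + (Y \<omega>)\<^sup>2 - 2 * c * \<bar>X \<omega> * Y \<omega>\<bar>"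
        by (simp add: power2_diff power_mult_distrib abs_mult)
      then show ?thesis using that by (simp add: power2_eq_square field_simps)
    qed
    finally show ?thesis by simp
  qed
  show i3: "integrable M (\<lambda>\<omega>. X \<omega> * Y \<omega>)"
  proof (rule Bochner_Integration.integrable_bound)
    show "integrable M (\<lambda>\<omega>. (1 * (X \<omega>)\<^sup>2 + (Y \<omega>)\<^sup>2 / 1) / 2)" using i by simp
    show "AE \<omega> in M. norm (X \<omega> * Y \<omega>) \<le> norm ((1 * (X \<omega>)\<^sup>2 + (Y \<omega>)\<^sup>2 / 1) / 2)"
      using le[of 1] by (intro AE_I2) (simp add: order_trans[OF _ abs_ge_self])
  qed simp
  show "expectation (\<lambda>\<omega>. \<bar>X \<omega> * Y \<omega>\<bar>) \<le> (c * a + b / c) / 2" if c: "0 < c"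
  proof -
    have "expectation (\<lambda>\<omega>. \<bar>X \<omega> * Y \<omega>\<bar>) \<le> expectation (\<lambda>\<omega>. (c * (X \<omega>)\<^sup>2 + (Y \<omega>)\<^sup>2 / c) / 2)"
      by (rule integral_mono) (use i i3 le[OF c] in auto)
    also have "\<dots> = (c * expectation (\<lambda>\<omega>. (X \<omega>)\<^sup>2) + expectation (\<lambda>\<omega>. (Y \<omega>)\<^sup>2) / c) / 2" using i by simp
    also have "\<dots> \<le> (c * a + b / c) / 2"
      using assms c by (intro divide_right_mono add_mono mult_left_mono) (auto simp: L2le_def)
    finally show ?thesis .
  qed
qed

lemma L2le_expectation:
  assumes "L2le X a"
  shows "integrable M X" and "(expectation X)\<^sup>2 \<le> a" and "0 < c \<Longrightarrow> expectation (\<lambda>\<omega>. \<bar>X \<omega>\<bar>) \<le> (c * a + 1 / c) / 2"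
proof -
  note p = L2le_product[OF assms L2le_const[of 1]]
  show i: "integrable M X" using p(1) by simp
  show "expectation (\<lambda>\<omega>. \<bar>X \<omega>\<bar>) \<le> (c * a + 1 / c) / 2" if "0 < c" using p(2)[OF that] by simp
  have i2: "integrable M (\<lambda>\<omega>. (X \<omega>)\<^sup>2)" using assms by (simp add: L2le_def)
  have "0 \<le> variance X" by (rule variance_positive)
  then show "(expectation X)\<^sup>2 \<le> a" using variance_eq[OF i i2] assms by (simp add: L2le_def)
qed

text \<open>Fatou's lemma.\<close>

lemma L2le_pointwise_limit:
  assumes Z: "Z \<in> borel_measurable M" and X: "\<And>n. L2le (X n) B"
    and lim: "\<And>\<omega>. \<omega> \<in> space M \<Longrightarrow> (\<lambda>n. X n \<omega>) \<longlonglongrightarrow> Z \<omega>"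
  shows "L2le Z B"
proof (rule L2leI_nn[OF Z _ L2le_nonneg[OF X]])
  have [measurable]: "X n \<in> borel_measurable M" for n using X[of n] by (simp add: L2le_def)
  have "(\<integral>\<^sup>+\<omega>. ennreal ((Z \<omega>)\<^sup>2) \<partial>M) = (\<integral>\<^sup>+\<omega>. liminf (\<lambda>n. ennreal ((X n \<omega>)\<^sup>2)) \<partial>M)"
  proof (rule nn_integral_cong)
    fix \<omega> assume "\<omega> \<in> space M"
    then have "(\<lambda>n. ennreal ((X n \<omega>)\<^sup>2)) \<longlonglongrightarrow> ennreal ((Z \<omega>)\<^sup>2)"
      by (intro tendsto_ennrealI tendsto_power lim)
    then show "ennreal ((Z \<omega>)\<^sup>2) = liminf (\<lambda>n. ennreal ((X n \<omega>)\<^sup>2))"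
      using lim_imp_Liminf[OF sequentially_bot] by metis
  qed
  also have "\<dots> \<le> liminf (\<lambda>n. \<integral>\<^sup>+\<omega>. ennreal ((X n \<omega>)\<^sup>2) \<partial>M)"
    by (rule nn_integral_liminf) simp
  also have "\<dots> \<le> liminf (\<lambda>n. ennreal B)"
    by (intro Liminf_mono always_eventually allI L2le_nn X)
  also have "\<dots> = ennreal B" by (simp add: Liminf_const)
  finally show "(\<integral>\<^sup>+\<omega>. ennreal ((Z \<omega>)\<^sup>2) \<partial>M) \<le> ennreal B" .
qed

text \<open>Truncating \<open>Z\<close> at level \<open>N\<close> avoids the choice of an almost
  surely convergent subsequence: off a set of vanishing probability \<open>X n\<close> is within
  \<epsilon> of \<open>Z\<close>, and on that set the truncation costs at most a multiple of
  \<open>N\<^sup>2\<close>. Then \<open>N\<close> tends to infinity. The factor 2 comes from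
  splitting the square.\<close>

lemma L2le_limit_in_probability:
  assumes Z: "Z \<in> borel_measurable M" and X: "\<And>n. L2le (X n) B"
    and lim: "\<And>\<epsilon>. \<epsilon> > 0 \<Longrightarrow> (\<lambda>n. prob {\<omega>\<in>space M. \<bar>X n \<omega> - Z \<omega>\<bar> > \<epsilon>}) \<longlonglongrightarrow> 0"
  shows "L2le Z (2 * B)"
proof (rule L2le_pointwise_limit[OF Z])
  note [measurable] = Z
  have Xm [measurable]: "X n \<in> borel_measurable M" for n using X[of n] by (simp add: L2le_def)
  define Y where "Y N \<omega> = min \<bar>Z \<omega>\<bar> (real N) * sgn (Z \<omega>)" for N \<omega>
  have Ym [measurable]: "Y N \<in> borel_measurable M" for N unfolding Y_def[abs_def] by measurable
  have sq: "(Y N \<omega>)\<^sup>2 = (min \<bar>Z \<omega>\<bar> (real N))\<^sup>2" for N \<omega>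
    by (cases "Z \<omega> = 0") (auto simp: Y_def power_mult_distrib sgn_if)
  show "(\<lambda>N. Y N \<omega>) \<longlonglongrightarrow> Z \<omega>" for \<omega>
  proof (rule tendsto_eventually)
    obtain m :: nat where "\<bar>Z \<omega>\<bar> \<le> m" using real_arch_simple by blast
    then have "\<forall>N\<ge>m. Y N \<omega> = Z \<omega>" by (auto simp: Y_def min_def sgn_if)
    then show "\<forall>\<^sub>F N in sequentially. Y N \<omega> = Z \<omega>" by (auto simp: eventually_sequentially)
  qed
  show "L2le (Y N) (2 * B)" for N
  proof -
    have bnd: "(Y N \<omega>)\<^sup>2 \<le> (real N)\<^sup>2" for \<omega> unfolding sq by (intro power_mono) auto
    have iY: "integrable M (\<lambda>\<omega>. (Y N \<omega>)\<^sup>2)"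
      by (rule integrable_const_bound[where B="(real N)\<^sup>2"]) (use bnd in auto)
    have est: "expectation (\<lambda>\<omega>. (Y N \<omega>)\<^sup>2) \<le> 2 * B + 2 * \<epsilon>\<^sup>2" if e: "\<epsilon> > 0" for \<epsilon>
    proof -
      define P where "P n = {\<omega>\<in>space M. \<bar>X n \<omega> - Z \<omega>\<bar> > \<epsilon>}" for n
      have Pm [measurable]: "P n \<in> sets M" for n unfolding P_def by measurable
      have "expectation (\<lambda>\<omega>. (Y N \<omega>)\<^sup>2) \<le> 2 * B + 2 * \<epsilon>\<^sup>2 + 2 * (real N)\<^sup>2 * prob (P n)" for n
      proof -
        have iX: "integrable M (\<lambda>\<omega>. (X n \<omega>)\<^sup>2)" using X[of n] by (simp add: L2le_def)
        have "expectation (\<lambda>\<omega>. (Y N \<omega>)\<^sup>2) \<le> expectation (\<lambda>\<omega>. 2 * (X n \<omega>)\<^sup>2 + 2 * \<epsilon>\<^sup>2 + 2 * (real N)\<^sup>2 * indicator (P n) \<omega>)"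
        proof (rule integral_mono[OF iY])
          show "integrable M (\<lambda>\<omega>. 2 * (X n \<omega>)\<^sup>2 + 2 * \<epsilon>\<^sup>2 + 2 * (real N)\<^sup>2 * indicator (P n) \<omega>)"
            using iX by (auto simp: fmeasurable_def emeasure_eq_measure intro!: Bochner_Integration.integrable_add integrable_real_indicator)
          fix \<omega> assume w: "\<omega> \<in> space M"
          define m where "m = min \<bar>Z \<omega> - X n \<omega>\<bar> (real N)"
          have "min \<bar>Z \<omega>\<bar> (real N) \<le> \<bar>X n \<omega>\<bar> + m" by (auto simp: m_def min_def)
          then have "(Y N \<omega>)\<^sup>2 \<le> (\<bar>X n \<omega>\<bar> + m)\<^sup>2" unfolding sq by (intro power_mono) auto
          also have "\<dots> \<le> 2 * (X n \<omega>)\<^sup>2 + 2 * m\<^sup>2"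
            using zero_le_power2[of "\<bar>X n \<omega>\<bar> - m"] by (simp add: power2_eq_square algebra_simps)
          also have "m\<^sup>2 \<le> \<epsilon>\<^sup>2 + (real N)\<^sup>2 * indicator (P n) \<omega>"
          proof (cases "\<omega> \<in> P n")
            case True
            have "m\<^sup>2 \<le> (real N)\<^sup>2" unfolding m_def by (intro power_mono) auto
            then show ?thesis using True by (simp add: add_increasing)
          next
            case False
            have "m\<^sup>2 \<le> \<epsilon>\<^sup>2" using False w unfolding m_def P_def by (intro power_mono) (auto simp: abs_minus_commute)
            then show ?thesis using False by simp
          qed
          finally show "(Y N \<omega>)\<^sup>2 \<le> 2 * (X n \<omega>)\<^sup>2 + 2 * \<epsilon>\<^sup>2 + 2 * (real N)\<^sup>2 * indicator (P n) \<omega>" by simp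
        qed
        also have "\<dots> = 2 * expectation (\<lambda>\<omega>. (X n \<omega>)\<^sup>2) + 2 * \<epsilon>\<^sup>2 + 2 * (real N)\<^sup>2 * prob (P n)"
          using iX by (simp add: prob_space fmeasurable_def emeasure_eq_measure)
        also have "\<dots> \<le> 2 * B + 2 * \<epsilon>\<^sup>2 + 2 * (real N)\<^sup>2 * prob (P n)"
          using X[of n] by (simp add: L2le_def)
        finally show ?thesis .
      qed
      moreover have "(\<lambda>n. 2 * B + 2 * \<epsilon>\<^sup>2 + 2 * (real N)\<^sup>2 * prob (P n)) \<longlonglongrightarrow> 2 * B + 2 * \<epsilon>\<^sup>2 + 2 * (real N)\<^sup>2 * 0"
        unfolding P_def by (intro tendsto_intros lim e)
      ultimately show ?thesis using LIMSEQ_le_const[of _ "2 * B + 2 * \<epsilon>\<^sup>2 + 2 * (real N)\<^sup>2 * 0"] by (metis (no_types, lifting) add.right_neutral mult_zero_right)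
    qed
    have "expectation (\<lambda>\<omega>. (Y N \<omega>)\<^sup>2) \<le> 2 * B"
    proof (rule field_le_epsilon)
      fix e :: real assume "0 < e"
      then show "expectation (\<lambda>\<omega>. (Y N \<omega>)\<^sup>2) \<le> 2 * B + e" using est[of "sqrt (e / 2)"] by simp
    qed
    then show ?thesis using iY by (simp add: L2le_def)
  qed
qed

text \<open>The common second-moment bound acts as uniform integrability: on the exceptional set
  \<open>d \<le> c * d\<^sup>2 + 1 / c\<close>, where the first term costs at most
  \<open>c * (6 * B)\<close> and the second is multiplied by a vanishing probability.\<close>

lemma expectation_limit_in_probability:
  assumes Z: "Z \<in> borel_measurable M" and X: "\<And>n. L2le (X n) B" "\<And>n. expectation (X n) = 0"
    and lim: "\<And>\<epsilon>. \<epsilon> > 0 \<Longrightarrow> (\<lambda>n. prob {\<omega>\<in>space M. \<bar>X n \<omega> - Z \<omega>\<bar> > \<epsilon>}) \<longlonglongrightarrow> 0"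
  shows "expectation Z = 0"
proof -
  note [measurable] = Z
  have Xm [measurable]: "X n \<in> borel_measurable M" for n using X(1)[of n] by (simp add: L2le_def)
  have Z2: "L2le Z (2 * B)" by (rule L2le_limit_in_probability[OF Z X(1) lim])
  have B0: "0 \<le> B" by (rule L2le_nonneg[OF X(1)])
  have D: "L2le (\<lambda>\<omega>. X n \<omega> - Z \<omega>) (6 * B)" for n using L2le_diff[OF X(1) Z2, of n] by simp
  have est: "\<bar>expectation Z\<bar> \<le> \<epsilon> + c * (6 * B)" if e: "\<epsilon> > 0" and c: "c > 0" for \<epsilon> c
  proof -
    define P where "P n = {\<omega>\<in>space M. \<bar>X n \<omega> - Z \<omega>\<bar> > \<epsilon>}" for n
    have Pm [measurable]: "P n \<in> sets M" for n unfolding P_def by measurable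
    have "\<bar>expectation Z\<bar> \<le> \<epsilon> + c * (6 * B) + prob (P n) / c" for n
    proof -
      have iD: "integrable M (\<lambda>\<omega>. X n \<omega> - Z \<omega>)" "integrable M (\<lambda>\<omega>. (X n \<omega> - Z \<omega>)\<^sup>2)"
        using L2le_expectation(1)[OF D] D[of n] by (auto simp: L2le_def)
      have "expectation (\<lambda>\<omega>. X n \<omega> - Z \<omega>) = - expectation Z"
        using L2le_expectation(1)[OF X(1)] L2le_expectation(1)[OF Z2] X(2) by simp
      then have "\<bar>expectation Z\<bar> \<le> expectation (\<lambda>\<omega>. \<bar>X n \<omega> - Z \<omega>\<bar>)"
        using integral_abs_bound[of M "\<lambda>\<omega>. X n \<omega> - Z \<omega>"] by simp
      also have "\<dots> \<le> expectation (\<lambda>\<omega>. \<epsilon> + c * (X n \<omega> - Z \<omega>)\<^sup>2 + indicator (P n) \<omega> / c)"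
      proof (rule integral_mono)
        show "integrable M (\<lambda>\<omega>. \<bar>X n \<omega> - Z \<omega>\<bar>)" using iD by (intro integrable_abs)
        show "integrable M (\<lambda>\<omega>. \<epsilon> + c * (X n \<omega> - Z \<omega>)\<^sup>2 + indicator (P n) \<omega> / c)"
          using iD(2) by (auto simp: fmeasurable_def emeasure_eq_measure intro!: Bochner_Integration.integrable_add integrable_real_indicator integrable_divide)
        fix \<omega> assume w: "\<omega> \<in> space M"
        define d where "d = \<bar>X n \<omega> - Z \<omega>\<bar>"
        have d2: "(X n \<omega> - Z \<omega>)\<^sup>2 = d\<^sup>2" by (simp add: d_def)
        have "d \<le> c * d\<^sup>2 + 1 / c"
        proof -
          have "0 \<le> (c * d - 1)\<^sup>2 / c + d" using c by (simp add: d_def)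
          also have "\<dots> = c * d\<^sup>2 + 1 / c - d" using c by (simp add: power2_eq_square field_simps)
          finally show ?thesis by simp
        qed
        then show "\<bar>X n \<omega> - Z \<omega>\<bar> \<le> \<epsilon> + c * (X n \<omega> - Z \<omega>)\<^sup>2 + indicator (P n) \<omega> / c"
          using e c w unfolding d2 d_def[symmetric] by (cases "\<omega> \<in> P n") (auto simp: P_def d_def not_less add_increasing2)
      qed
      also have "\<dots> = \<epsilon> + c * expectation (\<lambda>\<omega>. (X n \<omega> - Z \<omega>)\<^sup>2) + prob (P n) / c"
        using iD(2) by (simp add: prob_space fmeasurable_def emeasure_eq_measure)
      also have "\<dots> \<le> \<epsilon> + c * (6 * B) + prob (P n) / c"
        using D[of n] c by (simp add: L2le_def)
      finally show ?thesis .
    qed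
    moreover have "(\<lambda>n. \<epsilon> + c * (6 * B) + prob (P n) / c) \<longlonglongrightarrow> \<epsilon> + c * (6 * B) + 0 / c"
      unfolding P_def using c by (intro tendsto_intros lim e) auto
    ultimately show ?thesis using LIMSEQ_le_const[of _ "\<epsilon> + c * (6 * B) + 0 / c"] by (metis (no_types, lifting) add.right_neutral div_0)
  qed
  have "\<bar>expectation Z\<bar> \<le> 0"
  proof (rule field_le_epsilon)
    fix e :: real assume e: "0 < e"
    \<comment> \<open>Makes \<open>c * (6 * B)\<close> at most \<open>e / 2\<close>; the added 1
      covers \<open>B = 0\<close>.\<close>
    define c where "c = e / (12 * (B + 1))"
    have "c * (6 * B) \<le> c * (6 * (B + 1))" using e B0 by (intro mult_left_mono) (auto simp: c_def)
    also have "\<dots> = e / 2" using B0 by (simp add: c_def field_simps)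
    finally have "c * (6 * B) \<le> e / 2" .
    moreover have "0 < c" using e B0 by (simp add: c_def)
    ultimately show "\<bar>expectation Z\<bar> \<le> 0 + e" using est[of "e / 2" c] e by simp
  qed
  then show ?thesis by simp
qed

text \<open>Cauchy-Schwarz gives the bound for Riemann sums, uniformly in their number of terms, and
  Fatou passes to the limit. Only measurability at fixed times is used, never joint
  measurability.\<close>

lemma L2le_time_integral:
  assumes t: "0 \<le> t" and X: "\<And>s. 0 \<le> s \<Longrightarrow> s \<le> t \<Longrightarrow> L2le (X s) B"
    and cont: "\<And>\<omega>. \<omega> \<in> space M \<Longrightarrow> continuous_on {0..t} (\<lambda>s. X s \<omega>)"
  shows "L2le (\<lambda>\<omega>. integral {0..t} (\<lambda>s. X s \<omega>)) (t\<^sup>2 * B)"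
proof -
  define R where "R n \<omega> = (\<Sum>i<n. X (t * real i / real n) \<omega>) * (t / real n)" for n \<omega>
  have p: "0 \<le> t * real i / real n" "t * real i / real n \<le> t" if "i < n" for i n
  proof -
    have "t * real i \<le> t * real n" using that t by (intro mult_left_mono) auto
    then show "0 \<le> t * real i / real n" "t * real i / real n \<le> t" using t that by (auto simp: divide_le_eq)
  qed
  have B0: "0 \<le> B" using L2le_nonneg[OF X[OF order_refl t]] .
  have lim: "(\<lambda>n. R n \<omega>) \<longlonglongrightarrow> integral {0..t} (\<lambda>s. X s \<omega>)" if "\<omega> \<in> space M" for \<omega>
    unfolding R_def by (rule riemann_sum_tendsto[OF t cont[OF that]])
  have Rm: "R n \<in> borel_measurable M" for n
    unfolding R_def[abs_def] using L2le_measurable[OF X[OF p]] by (intro borel_measurable_times borel_measurable_sum) auto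
  have RL: "L2le (R n) (t\<^sup>2 * B)" for n
  proof (cases "n = 0")
    case True
    then show ?thesis using L2le_mono[OF L2le_const[of 0]] B0 by (simp add: R_def[abs_def])
  next
    case False
    have i: "integrable M (\<lambda>\<omega>. (X (t * real i / real n) \<omega>)\<^sup>2)" if "i < n" for i
      using X[OF p[OF that]] by (simp add: L2le_def)
    have isum: "integrable M (\<lambda>\<omega>. \<Sum>i<n. (X (t * real i / real n) \<omega>)\<^sup>2)" using i by (intro Bochner_Integration.integrable_sum) auto
    have le: "(R n \<omega>)\<^sup>2 \<le> t\<^sup>2 / real n * (\<Sum>i<n. (X (t * real i / real n) \<omega>)\<^sup>2)" for \<omega>
    proof -
      have "(\<Sum>i<n. X (t * real i / real n) \<omega> * 1)\<^sup>2 \<le> (\<Sum>i<n. (X (t * real i / real n) \<omega>)\<^sup>2) * (\<Sum>i<n. 1\<^sup>2)"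
        by (rule Cauchy_Schwarz_ineq_sum)
      then have "(\<Sum>i<n. X (t * real i / real n) \<omega>)\<^sup>2 \<le> (\<Sum>i<n. (X (t * real i / real n) \<omega>)\<^sup>2) * real n" by simp
      then have "(\<Sum>i<n. X (t * real i / real n) \<omega>)\<^sup>2 * (t / real n)\<^sup>2 \<le> (\<Sum>i<n. (X (t * real i / real n) \<omega>)\<^sup>2) * real n * (t / real n)\<^sup>2"
        by (intro mult_right_mono) auto
      then show ?thesis using False by (simp add: R_def power_mult_distrib power_divide power2_eq_square[of "real n"] mult_ac)
    qed
    have iR: "integrable M (\<lambda>\<omega>. (R n \<omega>)\<^sup>2)"
    proof (rule Bochner_Integration.integrable_bound[OF integrable_mult_right[OF isum, of "t\<^sup>2 / real n"]])
      show "AE \<omega> in M. norm ((R n \<omega>)\<^sup>2) \<le> norm (t\<^sup>2 / real n * (\<Sum>i<n. (X (t * real i / real n) \<omega>)\<^sup>2))"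
        using order_trans[OF le abs_ge_self] by (intro AE_I2) (simp only: real_norm_def abs_power2)
    qed (use Rm in simp)
    have "expectation (\<lambda>\<omega>. (R n \<omega>)\<^sup>2) \<le> expectation (\<lambda>\<omega>. t\<^sup>2 / real n * (\<Sum>i<n. (X (t * real i / real n) \<omega>)\<^sup>2))"
      by (rule integral_mono[OF iR integrable_mult_right[OF isum] le])
    also have "\<dots> = t\<^sup>2 / real n * (\<Sum>i<n. expectation (\<lambda>\<omega>. (X (t * real i / real n) \<omega>)\<^sup>2))" using i by simp
    also have "\<dots> \<le> t\<^sup>2 / real n * (\<Sum>i<n. B)"
      using X[OF p] by (intro mult_left_mono sum_mono) (auto simp: L2le_def)
    finally show ?thesis using False iR Rm by (simp add: L2le_def)
  qed
  have "(\<lambda>\<omega>. integral {0..t} (\<lambda>s. X s \<omega>)) \<in> borel_measurable M"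
    by (rule borel_measurable_LIMSEQ_real[OF lim Rm])
  then show ?thesis by (rule L2le_pointwise_limit[OF _ RL lim])
qed

text \<open>The bound passes from the forcing \<open>x + k \<integral> x\<close> of a linear equation to its solution \<open>x\<close>.\<close>

lemma L2le_linear_equation:
  assumes t: "0 \<le> t" and k: "0 \<le> k"
    and xm: "\<And>s. 0 \<le> s \<Longrightarrow> s \<le> t \<Longrightarrow> x s \<in> borel_measurable M"
    and cont: "\<And>\<omega>. \<omega> \<in> space M \<Longrightarrow> continuous_on {0..t} (\<lambda>s. x s \<omega>)"
    and j: "\<And>s. 0 \<le> s \<Longrightarrow> s \<le> t \<Longrightarrow> L2le (\<lambda>\<omega>. x s \<omega> + k * integral {0..s} (\<lambda>r. x r \<omega>)) B"
  shows "L2le (x t) ((2 + 2 * k\<^sup>2 * t\<^sup>2) * B)"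
proof -
  define J where "J s \<omega> = x s \<omega> + k * integral {0..s} (\<lambda>r. x r \<omega>)" for s \<omega>
  have Jcont: "continuous_on {0..t} (\<lambda>s. J s \<omega>)" if "\<omega> \<in> space M" for \<omega>
    unfolding J_def by (intro continuous_intros cont that indefinite_integral_continuous_1 integrable_continuous_interval)
  have "L2le (\<lambda>\<omega>. integral {0..t} (\<lambda>s. exp (- k * (t - s)) * J s \<omega>)) (t\<^sup>2 * B)"
  proof (rule L2le_time_integral[OF t])
    fix s assume s: "0 \<le> s" "s \<le> t"
    have e: "0 \<le> exp (- k * (t - s))" "exp (- k * (t - s)) \<le> 1" using k s by auto
    have "L2le (\<lambda>\<omega>. exp (- k * (t - s)) * J s \<omega>) ((exp (- k * (t - s)))\<^sup>2 * B)"
      unfolding J_def by (intro L2le_cmult j s)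
    moreover have "(exp (- k * (t - s)))\<^sup>2 * B \<le> 1 * B"
      using e L2le_nonneg[OF j[OF s]] by (intro mult_right_mono power_le_one) auto
    ultimately show "L2le (\<lambda>\<omega>. exp (- k * (t - s)) * J s \<omega>) B" by (auto intro: L2le_mono)
  qed (intro continuous_intros Jcont)
  from L2le_diff[OF j[OF t order_refl] L2le_cmult[OF this, of k]]
  have *: "L2le (\<lambda>\<omega>. J t \<omega> - k * integral {0..t} (\<lambda>s. exp (- k * (t - s)) * J s \<omega>)) (2 * B + 2 * (k\<^sup>2 * (t\<^sup>2 * B)))"
    by (simp add: J_def)
  have "L2le (x t) (2 * B + 2 * (k\<^sup>2 * (t\<^sup>2 * B)))"
  proof (rule L2le_cong_AE[OF * xm[OF t order_refl]])
    show "AE \<omega> in M. x t \<omega> = J t \<omega> - k * integral {0..t} (\<lambda>s. exp (- k * (t - s)) * J s \<omega>)"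
      unfolding J_def by (intro AE_I2 linear_integral_equation[OF t cont])
  qed
  then show ?thesis by (simp add: algebra_simps)
qed

end

section \<open>Wiener increments and Ito integrals\<close>

lemma (in prob_space) time_integral_measurable:
  fixes X :: "real \<Rightarrow> 'a \<Rightarrow> real"
  assumes t: "0 \<le> t" and X: "\<And>s. 0 \<le> s \<Longrightarrow> s \<le> t \<Longrightarrow> X s \<in> borel_measurable M"
    and cont: "\<And>\<omega>. \<omega> \<in> space M \<Longrightarrow> continuous_on {0..t} (\<lambda>s. X s \<omega>)"
  shows "(\<lambda>\<omega>. integral {0..t} (\<lambda>s. X s \<omega>)) \<in> borel_measurable M"
proof (rule borel_measurable_LIMSEQ_real)
  show "(\<lambda>n. (\<Sum>i<n. X (t * real i / real n) \<omega>) * (t / real n)) \<longlonglongrightarrow> integral {0..t} (\<lambda>s. X s \<omega>)"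
    if "\<omega> \<in> space M" for \<omega>
    by (rule riemann_sum_tendsto[OF t cont[OF that]])
  show "(\<lambda>\<omega>. (\<Sum>i<n. X (t * real i / real n) \<omega>) * (t / real n)) \<in> borel_measurable M" for n
  proof (intro borel_measurable_times borel_measurable_sum borel_measurable_const X)
    fix i assume "i \<in> {..<n}"
    then have "t * real i \<le> t * real n" "0 < n" using t by (auto intro: mult_left_mono)
    then show "0 \<le> t * real i / real n" "t * real i / real n \<le> t" using t by (auto simp: divide_le_eq)
  qed
qed

definition (in prob_space) tends_prob :: "(nat \<Rightarrow> 'a \<Rightarrow> real) \<Rightarrow> ('a \<Rightarrow> real) \<Rightarrow> bool" where
  "tends_prob X Z \<longleftrightarrow> (\<forall>\<epsilon>>0. (\<lambda>n. prob {\<omega>\<in>space M. \<bar>X n \<omega> - Z \<omega>\<bar> > \<epsilon>}) \<longlonglongrightarrow> 0)"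

lemma (in prob_space) tends_prob_diff:
  assumes [measurable]: "\<And>n. X n \<in> borel_measurable M" "\<And>n. X' n \<in> borel_measurable M"
    "Z \<in> borel_measurable M" "Z' \<in> borel_measurable M"
    and "tends_prob X Z" "tends_prob X' Z'"
  shows "tends_prob (\<lambda>n \<omega>. X n \<omega> - X' n \<omega>) (\<lambda>\<omega>. Z \<omega> - Z' \<omega>)"
  unfolding tends_prob_def
proof (intro allI impI)
  fix \<epsilon> :: real assume e: "0 < \<epsilon>"
  define P Q where "P n = {\<omega>\<in>space M. \<bar>X n \<omega> - Z \<omega>\<bar> > \<epsilon> / 2}"
    and "Q n = {\<omega>\<in>space M. \<bar>X' n \<omega> - Z' \<omega>\<bar> > \<epsilon> / 2}" for n
  have [measurable]: "P n \<in> events" "Q n \<in> events" for n unfolding P_def Q_def by measurable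
  show "(\<lambda>n. prob {\<omega> \<in> space M. \<epsilon> < \<bar>X n \<omega> - X' n \<omega> - (Z \<omega> - Z' \<omega>)\<bar>}) \<longlonglongrightarrow> 0"
  proof (rule Lim_null_comparison)
    show "\<forall>\<^sub>F n in sequentially. norm (prob {\<omega> \<in> space M. \<epsilon> < \<bar>X n \<omega> - X' n \<omega> - (Z \<omega> - Z' \<omega>)\<bar>}) \<le> prob (P n) + prob (Q n)"
    proof (intro always_eventually allI)
      fix n
      have "prob {\<omega> \<in> space M. \<epsilon> < \<bar>X n \<omega> - X' n \<omega> - (Z \<omega> - Z' \<omega>)\<bar>} \<le> prob (P n \<union> Q n)"
      proof (intro finite_measure_mono subsetI)
        fix \<omega> assume "\<omega> \<in> {\<omega> \<in> space M. \<epsilon> < \<bar>X n \<omega> - X' n \<omega> - (Z \<omega> - Z' \<omega>)\<bar>}"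
        then have w: "\<omega> \<in> space M" "\<epsilon> < \<bar>X n \<omega> - X' n \<omega> - (Z \<omega> - Z' \<omega>)\<bar>" by auto
        from w(2) have "\<epsilon> / 2 < \<bar>X n \<omega> - Z \<omega>\<bar> \<or> \<epsilon> / 2 < \<bar>X' n \<omega> - Z' \<omega>\<bar>" by linarith
        with w(1) show "\<omega> \<in> P n \<union> Q n" by (auto simp: P_def Q_def)
      qed simp
      also have "\<dots> \<le> prob (P n) + prob (Q n)" by (intro measure_Un_le) auto
      finally show "norm (prob {\<omega> \<in> space M. \<epsilon> < \<bar>X n \<omega> - X' n \<omega> - (Z \<omega> - Z' \<omega>)\<bar>}) \<le> prob (P n) + prob (Q n)" by simp
    qed
    have "(\<lambda>n. prob (P n)) \<longlonglongrightarrow> 0" "(\<lambda>n. prob (Q n)) \<longlonglongrightarrow> 0"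
      using assms(5,6) e unfolding tends_prob_def P_def Q_def by (auto dest: spec[of _ "\<epsilon> / 2"])
    from tendsto_add[OF this] show "(\<lambda>n. prob (P n) + prob (Q n)) \<longlonglongrightarrow> 0" by simp
  qed
qed

text \<open>The sequence is constant from index 1 on. Index 0 is set apart since an empty Riemann
  sum is 0 and cannot telescope to the increment.\<close>

lemma (in prob_space) tends_prob_const_AE:
  assumes [measurable]: "X \<in> borel_measurable M" "Z \<in> borel_measurable M"
    and "tends_prob (\<lambda>n. if n = 0 then X0 else X) Z"
  shows "AE \<omega> in M. Z \<omega> = X \<omega>"
proof -
  have "AE \<omega> in M. \<bar>X \<omega> - Z \<omega>\<bar> \<le> 1 / real (Suc k)" for k
  proof -
    have "(\<lambda>n. prob {\<omega>\<in>space M. \<bar>(if n = 0 then X0 else X) \<omega> - Z \<omega>\<bar> > 1 / real (Suc k)}) \<longlonglongrightarrow> 0"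
      using assms(3) unfolding tends_prob_def by simp
    then have "(\<lambda>n. prob {\<omega>\<in>space M. \<bar>(if Suc n = 0 then X0 else X) \<omega> - Z \<omega>\<bar> > 1 / real (Suc k)}) \<longlonglongrightarrow> 0"
      by (rule LIMSEQ_Suc)
    then have "prob {\<omega>\<in>space M. \<bar>X \<omega> - Z \<omega>\<bar> > 1 / real (Suc k)} = 0"
      by (simp add: LIMSEQ_const_iff)
    then have "AE \<omega> in M. \<not> \<bar>X \<omega> - Z \<omega>\<bar> > 1 / real (Suc k)"
      by (subst AE_iff_measurable[OF _ refl]) (auto simp: emeasure_eq_measure)
    then show ?thesis by (simp add: not_less)
  qed
  then have "AE \<omega> in M. \<forall>k. \<bar>X \<omega> - Z \<omega>\<bar> \<le> 1 / real (Suc k)" by (simp add: AE_all_countable)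
  then show ?thesis
  proof eventually_elim
    case (elim \<omega>)
    have "\<bar>X \<omega> - Z \<omega>\<bar> \<le> 0"
    proof (rule field_le_epsilon)
      fix e :: real assume "0 < e"
      then obtain k where "inverse (real (Suc k)) < e" using reals_Archimedean by blast
      then show "\<bar>X \<omega> - Z \<omega>\<bar> \<le> 0 + e" using elim[rule_format, of k] by (simp add: inverse_eq_divide)
    qed
    then show ?case by simp
  qed
qed

lemma (in prob_space) tends_prob_component:
  fixes X :: "nat \<Rightarrow> 'a \<Rightarrow> real^'m"
  assumes [measurable]: "\<And>n. X n \<in> borel_measurable M" "Z \<in> borel_measurable M"
    and c: "converges_in_probability M X Z"
  shows "tends_prob (\<lambda>n \<omega>. X n \<omega> $ i) (\<lambda>\<omega>. Z \<omega> $ i)"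
  unfolding tends_prob_def
proof (intro allI impI)
  fix \<epsilon> :: real assume e: "0 < \<epsilon>"
  show "(\<lambda>n. prob {\<omega> \<in> space M. \<epsilon> < \<bar>X n \<omega> $ i - Z \<omega> $ i\<bar>}) \<longlonglongrightarrow> 0"
  proof (rule Lim_null_comparison)
    show "(\<lambda>n. prob {\<omega>\<in>space M. norm (X n \<omega> - Z \<omega>) > \<epsilon>}) \<longlonglongrightarrow> 0"
      using c e by (simp add: converges_in_probability_def)
    show "\<forall>\<^sub>F n in sequentially. norm (prob {\<omega> \<in> space M. \<epsilon> < \<bar>X n \<omega> $ i - Z \<omega> $ i\<bar>})
        \<le> prob {\<omega>\<in>space M. norm (X n \<omega> - Z \<omega>) > \<epsilon>}"
    proof (intro always_eventually allI)
      fix n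
      have "{\<omega> \<in> space M. \<epsilon> < \<bar>X n \<omega> $ i - Z \<omega> $ i\<bar>} \<subseteq> {\<omega>\<in>space M. norm (X n \<omega> - Z \<omega>) > \<epsilon>}"
        using component_le_norm_cart[of "X n \<omega> - Z \<omega>" i for \<omega>] by (fastforce intro: less_le_trans)
      then show "norm (prob {\<omega> \<in> space M. \<epsilon> < \<bar>X n \<omega> $ i - Z \<omega> $ i\<bar>})
        \<le> prob {\<omega>\<in>space M. norm (X n \<omega> - Z \<omega>) > \<epsilon>}"
        by (simp add: finite_measure_mono)
    qed
  qed
qed

lemma vec_nth_measurable [measurable (raw)]:
  fixes f :: "'a \<Rightarrow> real^'m"
  assumes "f \<in> borel_measurable N" shows "(\<lambda>x. f x $ i) \<in> borel_measurable N"
  by (rule measurable_compose[OF assms]) (intro borel_measurable_continuous_onI continuous_intros)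

lemma vec_measurableI:
  fixes f :: "'a \<Rightarrow> real^'m"
  assumes "\<And>i. (\<lambda>x. f x $ i) \<in> borel_measurable N"
  shows "f \<in> borel_measurable N"
  by (subst borel_measurable_euclidean_space) (use assms in \<open>auto simp: Basis_vec_def inner_axis\<close>)

definition normal_moment :: "real \<Rightarrow> nat \<Rightarrow> real" where
  "normal_moment s a = (\<integral>x. normal_density 0 s x * x ^ a \<partial>lborel)"

lemma normal_moment_values:
  assumes "0 < s"
  shows "normal_moment s 0 = 1" "normal_moment s 1 = 0" "normal_moment s 2 = s\<^sup>2" "normal_moment s 4 = 3 * s ^ 4"
  using integral_normal_moment_even[OF assms, of 0 0] integral_normal_moment_even[OF assms, of 0 1]
    integral_normal_moment_even[OF assms, of 0 2] integral_normal_moment_odd[OF assms, of 0 0] assms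
  by (simp_all add: normal_moment_def fact_numeral power2_eq_square field_simps power4_eq_xxxx)

section \<open>Brownian increments and the Ito isometry\<close>

locale wiener =
  fixes M :: "'w measure" and F :: "real \<Rightarrow> 'w measure" and W :: "real \<Rightarrow> 'w \<Rightarrow> real^2"
  assumes bm: "brownian_motion M F W"

sublocale wiener \<subseteq> prob_space M
  using bm by (simp add: brownian_motion_def)

context wiener
begin

lemma space_F: "space (F s) = space M"
  using bm filtration.space_F by (fastforce simp: brownian_motion_def)

lemma F_mono: "s \<le> t \<Longrightarrow> sets (F s) \<subseteq> sets (F t)"
  using bm filtration.sets_F_mono by (fastforce simp: brownian_motion_def)

lemma F_sub: "0 \<le> s \<Longrightarrow> sets (F s) \<subseteq> sets M"
  using bm by (simp add: brownian_motion_def)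

lemma measurable_F_mono: "X \<in> borel_measurable (F s) \<Longrightarrow> s \<le> t \<Longrightarrow> X \<in> borel_measurable (F t)"
  using F_mono[of s t] measurable_mono[of borel borel "F s" "F t"] space_F by auto

lemma measurable_F_M: "X \<in> borel_measurable (F s) \<Longrightarrow> 0 \<le> s \<Longrightarrow> X \<in> borel_measurable M"
  using F_sub[of s] measurable_mono[of borel borel "F s" M] space_F by auto

lemma W_measurable_F: "0 \<le> t \<Longrightarrow> W t \<in> borel_measurable (F t)"
  using bm by (simp add: brownian_motion_def)

lemma W_measurable: "0 \<le> t \<Longrightarrow> W t \<in> borel_measurable M"
  using measurable_F_M W_measurable_F by blast

lemma W_0: "\<omega> \<in> space M \<Longrightarrow> W 0 \<omega> = 0"
  using bm by (simp add: brownian_motion_def)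

lemma increment_moment:
  assumes "0 \<le> s" "s < t"
  shows "integrable M (\<lambda>\<omega>. (W t \<omega> $ 1 - W s \<omega> $ 1) ^ a * (W t \<omega> $ 2 - W s \<omega> $ 2) ^ b)"
    and "expectation (\<lambda>\<omega>. (W t \<omega> $ 1 - W s \<omega> $ 1) ^ a * (W t \<omega> $ 2 - W s \<omega> $ 2) ^ b) =
      normal_moment (sqrt (t - s)) a * normal_moment (sqrt (t - s)) b"
proof -
  define r where "r = sqrt (t - s)"
  have r: "0 < r" using assms by (simp add: r_def)
  define g where "g i x = normal_density 0 r x * x ^ (if i = 1 then a else b)" for i :: 2 and x
  have gi: "integrable lborel (g i)" for i
    unfolding g_def using integrable_normal_moment[OF r, of 0] by simp
  have dist: "distributed M lborel (\<lambda>\<omega>. W t \<omega> - W s \<omega>)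
      (\<lambda>z. ennreal (\<Prod>i\<in>UNIV. normal_density 0 r (z $ i)))"
    using bm assms by (simp add: brownian_motion_def r_def)
  define h where "h z = (z $ 1) ^ a * (z $ 2) ^ b" for z :: "real^2"
  have hm: "h \<in> borel_measurable lborel"
    unfolding h_def by (auto intro!: borel_measurable_continuous_onI continuous_intros)
  have eq: "(\<Prod>i\<in>UNIV. normal_density 0 r (z $ i)) * h z = (\<Prod>i\<in>UNIV. g i (z $ i))" for z
    by (simp add: UNIV_2 g_def h_def mult_ac)
  have pos: "0 \<le> (\<Prod>i\<in>UNIV. normal_density 0 r ((z::real^2) $ i))" for z
    by (intro prod_nonneg) (auto simp: normal_density_nonneg)
  have "integrable lborel (\<lambda>z. (\<Prod>i\<in>UNIV. normal_density 0 r (z $ i)) * h z)"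
    unfolding eq by (rule integral_prod_vec(1)[OF gi])
  then have "integrable M (\<lambda>\<omega>. h (W t \<omega> - W s \<omega>))"
    using distributed_integrable[OF dist hm pos] by simp
  then show "integrable M (\<lambda>\<omega>. (W t \<omega> $ 1 - W s \<omega> $ 1) ^ a * (W t \<omega> $ 2 - W s \<omega> $ 2) ^ b)"
    by (simp add: h_def)
  have "expectation (\<lambda>\<omega>. h (W t \<omega> - W s \<omega>)) = (\<integral>z. (\<Prod>i\<in>UNIV. g i (z $ i)) \<partial>(lborel :: (real^2) measure))"
    using distributed_integral[OF dist hm pos] unfolding eq by simp
  also have "\<dots> = (\<Prod>i\<in>UNIV. (\<integral>x. g i x \<partial>lborel))" by (rule integral_prod_vec(2)[OF gi])
  also have "\<dots> = normal_moment r a * normal_moment r b"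
    by (simp add: UNIV_2 g_def normal_moment_def)
  finally show "expectation (\<lambda>\<omega>. (W t \<omega> $ 1 - W s \<omega> $ 1) ^ a * (W t \<omega> $ 2 - W s \<omega> $ 2) ^ b) =
      normal_moment (sqrt (t - s)) a * normal_moment (sqrt (t - s)) b"
    by (simp add: h_def r_def)
qed

lemma increment_component:
  assumes "0 \<le> s" "s < t"
  shows "integrable M (\<lambda>\<omega>. (W t \<omega> $ i - W s \<omega> $ i) ^ a)"
    and "expectation (\<lambda>\<omega>. (W t \<omega> $ i - W s \<omega> $ i) ^ a) = normal_moment (sqrt (t - s)) a"
  using increment_moment[OF assms, of a 0] increment_moment[OF assms, of 0 a] normal_moment_values(1)[of "sqrt (t - s)"] assms
    exhaust_2[of i] by auto

text \<open>Independence is given for a family of events; it passes to the sigma-algebras generated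
  by \<open>X\<close> and by a function of the increment, and then expectations of products
  factorise.\<close>

lemma increment_indep:
  fixes \<phi> :: "real^2 \<Rightarrow> real"
  assumes st: "0 \<le> s" "s < t" and X: "X \<in> borel_measurable (F s)" and iX: "integrable M X"
    and \<phi>: "\<phi> \<in> borel_measurable borel" and i\<phi>: "integrable M (\<lambda>\<omega>. \<phi> (W t \<omega> - W s \<omega>))"
  shows "integrable M (\<lambda>\<omega>. X \<omega> * \<phi> (W t \<omega> - W s \<omega>))"
    and "expectation (\<lambda>\<omega>. X \<omega> * \<phi> (W t \<omega> - W s \<omega>)) = expectation X * expectation (\<lambda>\<omega>. \<phi> (W t \<omega> - W s \<omega>))"
proof -
  have Xm: "X \<in> borel_measurable M" by (rule measurable_F_M[OF X st(1)])
  have Wm: "(\<lambda>\<omega>. W t \<omega> - W s \<omega>) \<in> borel_measurable M" using W_measurable st by (intro borel_measurable_diff) auto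
  have ind: "indep_set (sets (F s)) {(\<lambda>\<omega>. W t \<omega> - W s \<omega>) -` B \<inter> space M |B. B \<in> sets borel}"
    using bm st by (simp add: brownian_motion_def)
  have s1: "sigma_sets (space M) {X -` A \<inter> space M |A. A \<in> sets borel} \<subseteq> sets (F s)"
    using sets.sigma_sets_subset[of "{X -` A \<inter> space M |A. A \<in> sets borel}" "F s"] measurable_sets[OF X] space_F by auto
  \<comment> \<open>The preimages under the increment already form a sigma-algebra, which is what
    allows the independence hypothesis to be used without a generator argument.\<close>
  define V where "V = vimage_algebra (space M) (\<lambda>\<omega>. W t \<omega> - W s \<omega>) borel"
  have V: "sets V = {(\<lambda>\<omega>. W t \<omega> - W s \<omega>) -` B \<inter> space M |B. B \<in> sets borel}" "space V = space M"
    unfolding V_def by (auto simp: sets_vimage_algebra2)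
  have "\<phi> -` A \<in> sets borel" if "A \<in> sets borel" for A
    using measurable_sets[OF \<phi> that] by simp
  then have "{(\<lambda>\<omega>. \<phi> (W t \<omega> - W s \<omega>)) -` A \<inter> space M |A. A \<in> sets borel} \<subseteq> sets V"
    unfolding V(1) by (auto simp: vimage_def)
  then have s2: "sigma_sets (space M) {(\<lambda>\<omega>. \<phi> (W t \<omega> - W s \<omega>)) -` A \<inter> space M |A. A \<in> sets borel} \<subseteq> sets V"
    using sets.sigma_sets_subset[of _ V] V(2) by simp
  have iv: "indep_var borel X borel (\<lambda>\<omega>. \<phi> (W t \<omega> - W s \<omega>))"
    unfolding indep_var_eq
  proof (intro conjI)
    have ind': "sets (F s) \<subseteq> events" "sets V \<subseteq> events" "\<forall>a\<in>sets (F s). \<forall>b\<in>sets V. prob (a \<inter> b) = prob a * prob b"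
      using ind unfolding indep_sets2_eq V(1) by blast+
    show "indep_set (sigma_sets (space M) {X -` A \<inter> space M |A. A \<in> sets borel})
        (sigma_sets (space M) {(\<lambda>\<omega>. \<phi> (W t \<omega> - W s \<omega>)) -` A \<inter> space M |A. A \<in> sets borel})"
      unfolding indep_sets2_eq
      by (intro conjI order_trans[OF s1 ind'(1)] order_trans[OF s2 ind'(2)] ballI ind'(3)[rule_format] subsetD[OF s1] subsetD[OF s2])
    show "X \<in> borel_measurable M" by (rule Xm)
    show "(\<lambda>\<omega>. \<phi> (W t \<omega> - W s \<omega>)) \<in> borel_measurable M" by (rule measurable_compose[OF Wm \<phi>])
  qed
  show "integrable M (\<lambda>\<omega>. X \<omega> * \<phi> (W t \<omega> - W s \<omega>))" by (rule indep_var_integrable[OF iv iX i\<phi>])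
  show "expectation (\<lambda>\<omega>. X \<omega> * \<phi> (W t \<omega> - W s \<omega>)) = expectation X * expectation (\<lambda>\<omega>. \<phi> (W t \<omega> - W s \<omega>))"
    by (rule indep_var_lebesgue_integral[OF iv iX i\<phi>])
qed

text \<open>The Ito isometry for sums. The increment after \<open>p m\<close> is centred and
  independent of \<open>F (p m)\<close>, so the mixed term vanishes and second moments add up.
  Measurability of the partial sum at time \<open>p m\<close> is carried through the induction
  because the next step needs it.\<close>

lemma riemann_sum_L2:
  fixes \<alpha> :: "real \<Rightarrow> 'w \<Rightarrow> real" and c :: 2
  assumes t: "0 < t" and n: "0 < n" and m: "m \<le> n"
    and \<alpha>m: "\<And>s. 0 \<le> s \<Longrightarrow> s \<le> t \<Longrightarrow> \<alpha> s \<in> borel_measurable (F s)"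
    and \<alpha>: "\<And>s. 0 \<le> s \<Longrightarrow> s \<le> t \<Longrightarrow> L2le (\<alpha> s) B"
  defines "p \<equiv> \<lambda>i. t * real i / real n"
  defines "S \<equiv> \<lambda>m \<omega>. \<Sum>i<m. \<alpha> (p i) \<omega> * (W (p (Suc i)) \<omega> $ c - W (p i) \<omega> $ c)"
  shows "S m \<in> borel_measurable (F (p m)) \<and> L2le (S m) (B * p m) \<and> expectation (S m) = 0"
  using m
proof (induction m)
  case 0
  have "S 0 = (\<lambda>\<omega>. 0)" by (simp add: S_def)
  then show ?case using L2le_const[of 0] by (simp add: p_def)
next
  case (Suc m)
  have pn: "p i \<le> t" "0 \<le> p i" if "i \<le> n" for i
  proof -
    have "t * real i \<le> t * real n" using that t by (intro mult_left_mono) auto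
    then show "p i \<le> t" "0 \<le> p i" using t n by (auto simp: p_def divide_le_eq)
  qed
  have lt: "p m < p (Suc m)" using t n by (simp add: p_def divide_strict_right_mono)
  have p0: "0 \<le> p m" "p m \<le> t" using pn Suc.prems by auto
  have IH: "S m \<in> borel_measurable (F (p m))" "L2le (S m) (B * p m)" "expectation (S m) = 0"
    using Suc by auto
  define d where "d \<omega> = W (p (Suc m)) \<omega> $ c - W (p m) \<omega> $ c" for \<omega>
  define a where "a = \<alpha> (p m)"
  have am: "a \<in> borel_measurable (F (p m))" and a2: "L2le a B" using \<alpha>m \<alpha> p0 by (auto simp: a_def)
  have S_Suc: "S (Suc m) = (\<lambda>\<omega>. S m \<omega> + a \<omega> * d \<omega>)" by (simp add: S_def a_def d_def)
  have lt': "0 \<le> p (Suc m)" using lt p0 by simp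
  have [measurable]: "W (p m) \<in> borel_measurable (F (p (Suc m)))" "W (p (Suc m)) \<in> borel_measurable (F (p (Suc m)))"
    "S m \<in> borel_measurable (F (p (Suc m)))" "a \<in> borel_measurable (F (p (Suc m)))"
    using measurable_F_mono[OF W_measurable_F[OF p0(1)]] W_measurable_F[OF lt'] IH(1) am lt
      measurable_F_mono[of _ "p m" "p (Suc m)"] by auto
  have Sm: "S (Suc m) \<in> borel_measurable (F (p (Suc m)))"
    unfolding S_Suc d_def by measurable
  have id: "integrable M (\<lambda>\<omega>. d \<omega> ^ k)" for k unfolding d_def by (rule increment_component(1)[OF p0(1) lt])
  have Ed: "expectation d = 0" "expectation (\<lambda>\<omega>. (d \<omega>)\<^sup>2) = p (Suc m) - p m"
    using increment_component(2)[OF p0(1) lt, of c 1] increment_component(2)[OF p0(1) lt, of c 2]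
      normal_moment_values[of "sqrt (p (Suc m) - p m)"] lt by (simp_all add: d_def[abs_def])
  have nthm: "(\<lambda>z::real^2. (z $ c) ^ k) \<in> borel_measurable borel" for k
    by (intro borel_measurable_continuous_onI continuous_intros)
  have ind: "integrable M (\<lambda>\<omega>. X \<omega> * d \<omega> ^ k)"
      "expectation (\<lambda>\<omega>. X \<omega> * d \<omega> ^ k) = expectation X * expectation (\<lambda>\<omega>. d \<omega> ^ k)"
    if "X \<in> borel_measurable (F (p m))" "integrable M X" for X k
    using increment_indep[OF p0(1) lt that nthm, of k] id[of k] by (simp_all add: d_def)
  have ia: "integrable M a" "integrable M (\<lambda>\<omega>. (a \<omega>)\<^sup>2)" "integrable M (\<lambda>\<omega>. S m \<omega> * a \<omega>)" "integrable M (S m)"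
      "integrable M (\<lambda>\<omega>. (S m \<omega>)\<^sup>2)"
    using L2le_expectation(1)[OF a2] a2 L2le_product(1)[OF IH(2) a2] L2le_expectation(1)[OF IH(2)] IH(2) by (auto simp: L2le_def)
  have m2: "(\<lambda>\<omega>. (a \<omega>)\<^sup>2) \<in> borel_measurable (F (p m))" "(\<lambda>\<omega>. S m \<omega> * a \<omega>) \<in> borel_measurable (F (p m))"
    using am IH(1) by auto
  have E1: "integrable M (\<lambda>\<omega>. a \<omega> * d \<omega>)" "expectation (\<lambda>\<omega>. a \<omega> * d \<omega>) = 0"
    using ind[OF am ia(1), of 1] Ed by simp_all
  have E2: "integrable M (\<lambda>\<omega>. (S m \<omega> * a \<omega>) * d \<omega>)" "expectation (\<lambda>\<omega>. (S m \<omega> * a \<omega>) * d \<omega>) = 0"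
    using ind[OF m2(2) ia(3), of 1] Ed by simp_all
  have E3: "integrable M (\<lambda>\<omega>. (a \<omega>)\<^sup>2 * (d \<omega>)\<^sup>2)"
      "expectation (\<lambda>\<omega>. (a \<omega>)\<^sup>2 * (d \<omega>)\<^sup>2) = expectation (\<lambda>\<omega>. (a \<omega>)\<^sup>2) * (p (Suc m) - p m)"
    using ind[OF m2(1) ia(2), of 2] Ed by simp_all
  have sq: "(S (Suc m) \<omega>)\<^sup>2 = (S m \<omega>)\<^sup>2 + 2 * ((S m \<omega> * a \<omega>) * d \<omega>) + (a \<omega>)\<^sup>2 * (d \<omega>)\<^sup>2" for \<omega>
    by (simp add: S_Suc power2_eq_square algebra_simps)
  have i: "integrable M (\<lambda>\<omega>. (S (Suc m) \<omega>)\<^sup>2)"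
    unfolding sq using ia(5) E2(1) E3(1) by auto
  have "expectation (\<lambda>\<omega>. (S (Suc m) \<omega>)\<^sup>2) = expectation (\<lambda>\<omega>. (S m \<omega>)\<^sup>2) + expectation (\<lambda>\<omega>. (a \<omega>)\<^sup>2) * (p (Suc m) - p m)"
    unfolding sq using ia(5) E2 E3 by simp
  also have "\<dots> \<le> B * p m + B * (p (Suc m) - p m)"
    using IH(2) a2 lt by (intro add_mono mult_right_mono) (auto simp: L2le_def)
  finally have "expectation (\<lambda>\<omega>. (S (Suc m) \<omega>)\<^sup>2) \<le> B * p (Suc m)" by (simp add: algebra_simps)
  moreover have "expectation (S (Suc m)) = 0"
    unfolding S_Suc using ia(4) E1 IH(3) by simp
  ultimately show ?case using Sm i measurable_F_M[OF Sm lt'] by (simp add: L2le_def)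
qed

text \<open>Martingale property and isometry bound for a limit in probability of left-endpoint sums.
  The factor 8 is 4 from adding the two noise components times 2 from the limit.\<close>

lemma ito_limit:
  assumes t: "0 < t"
    and \<alpha>m: "\<And>s. 0 \<le> s \<Longrightarrow> s \<le> t \<Longrightarrow> \<alpha> s \<in> borel_measurable (F s)"
    and \<alpha>: "\<And>s. 0 \<le> s \<Longrightarrow> s \<le> t \<Longrightarrow> L2le (\<alpha> s) B"
    and \<beta>m: "\<And>s. 0 \<le> s \<Longrightarrow> s \<le> t \<Longrightarrow> \<beta> s \<in> borel_measurable (F s)"
    and \<beta>: "\<And>s. 0 \<le> s \<Longrightarrow> s \<le> t \<Longrightarrow> L2le (\<beta> s) B"
    and Z: "Z \<in> borel_measurable M"
    and lim: "tends_prob (\<lambda>n \<omega>. \<Sum>i<n. \<alpha> (t * real i / real n) \<omega> * (W (t * real (Suc i) / real n) \<omega> $ 1 - W (t * real i / real n) \<omega> $ 1)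
       + \<beta> (t * real i / real n) \<omega> * (W (t * real (Suc i) / real n) \<omega> $ 2 - W (t * real i / real n) \<omega> $ 2)) Z"
  shows "L2le Z (8 * B * t)" "expectation Z = 0"
proof -
  define R where "R n \<omega> = (\<Sum>i<n. \<alpha> (t * real i / real n) \<omega> * (W (t * real (Suc i) / real n) \<omega> $ 1 - W (t * real i / real n) \<omega> $ 1)
       + \<beta> (t * real i / real n) \<omega> * (W (t * real (Suc i) / real n) \<omega> $ 2 - W (t * real i / real n) \<omega> $ 2))" for n \<omega>
  have B0: "0 \<le> B" using L2le_nonneg[OF \<alpha>[of 0]] t by simp
  have R: "L2le (R n) (4 * B * t)" "expectation (R n) = 0" for n
  proof -
    have "L2le (R n) (4 * B * t) \<and> expectation (R n) = 0"
    proof (cases "n = 0")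
      case True
      then have "R n = (\<lambda>\<omega>. 0)" by (simp add: R_def fun_eq_iff)
      then show ?thesis using L2le_mono[OF L2le_const[of 0], of "4 * B * t"] B0 t by simp
    next
      case False
      then have n: "0 < n" by simp
      note a = riemann_sum_L2[OF t n order_refl \<alpha>m \<alpha>, where c=1] and b = riemann_sum_L2[OF t n order_refl \<beta>m \<beta>, where c=2]
      have eq: "R n = (\<lambda>\<omega>. (\<Sum>i<n. \<alpha> (t * real i / real n) \<omega> * (W (t * real (Suc i) / real n) \<omega> $ 1 - W (t * real i / real n) \<omega> $ 1))
        + (\<Sum>i<n. \<beta> (t * real i / real n) \<omega> * (W (t * real (Suc i) / real n) \<omega> $ 2 - W (t * real i / real n) \<omega> $ 2)))"
        by (simp only: R_def[abs_def] sum.distrib)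
      have e1: "expectation (R n) = 0"
        unfolding eq using a b L2le_expectation(1) by (subst Bochner_Integration.integral_add) auto
      have "L2le (R n) (2 * (B * t) + 2 * (B * t))"
        unfolding eq using a b n by (intro L2le_add) auto
      then show ?thesis using e1 by (simp add: algebra_simps)
    qed
    then show "L2le (R n) (4 * B * t)" "expectation (R n) = 0" by auto
  qed
  have lim': "(\<lambda>n. prob {\<omega>\<in>space M. \<bar>R n \<omega> - Z \<omega>\<bar> > \<epsilon>}) \<longlonglongrightarrow> 0" if "\<epsilon> > 0" for \<epsilon>
    using lim that unfolding tends_prob_def R_def by simp
  show "L2le Z (8 * B * t)" using L2le_limit_in_probability[OF Z R(1) lim'] by (simp add: mult.assoc)
  show "expectation Z = 0" by (rule expectation_limit_in_probability[OF Z R lim'])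
qed

end

section \<open>One-step expansion of the diffusion\<close>

lemma (in prob_space) tends_prob_cong:
  assumes "\<And>n \<omega>. \<omega> \<in> space M \<Longrightarrow> X n \<omega> = X' n \<omega>" "\<And>\<omega>. \<omega> \<in> space M \<Longrightarrow> Z \<omega> = Z' \<omega>"
    and "tends_prob X Z"
  shows "tends_prob X' Z'"
proof -
  have "{\<omega>\<in>space M. \<bar>X n \<omega> - Z \<omega>\<bar> > \<epsilon>} = {\<omega>\<in>space M. \<bar>X' n \<omega> - Z' \<omega>\<bar> > \<epsilon>}" for n \<epsilon>
    using assms(1,2) by auto
  then show ?thesis using assms(3) by (simp add: tends_prob_def)
qed

locale diffusion = coeffs k1 k2 k3 + wiener M F W
  for k1 k2 k3 :: real and M :: "'w measure" and F :: "real \<Rightarrow> 'w measure" and W :: "real \<Rightarrow> 'w \<Rightarrow> real^2" +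
  fixes Y :: "real^3 \<Rightarrow> real \<Rightarrow> 'w \<Rightarrow> real^3"
  assumes sde: "\<And>y. sde_solution M F W (drift k1 k2 k3) (\<lambda>z. sqrt 2 *\<^sub>R sig z) y (Y y)"
begin

definition kv :: "real^3" where "kv = vector [k1, k2, k3]"

lemma kv: "0 \<le> kv $ i" "kv $ i \<le> km" "(kv $ i)\<^sup>2 \<le> km\<^sup>2"
proof -
  have "kv $ i = k1 \<or> kv $ i = k2 \<or> kv $ i = k3" using exhaust_3[of i] by (auto simp: kv_def)
  then show "0 \<le> kv $ i" "kv $ i \<le> km" using k km_pos by auto
  then show "(kv $ i)\<^sup>2 \<le> km\<^sup>2" by (intro power_mono)
qed

lemma drift_component: "drift k1 k2 k3 z $ i = - (kv $ i * z $ i)"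
  using exhaust_3[of i] by (auto simp: drift_def kv_def)

lemma sig_component:
  "(sig z *v d) $ 1 = d $ 1" "(sig z *v d) $ 2 = d $ 2"
  "(sig z *v d) $ 3 = 2 * z $ 2 * d $ 1 - 2 * z $ 1 * d $ 2"
  by (simp_all add: matrix_vector_mult_def sig_def sum_2)

lemma Y_F: "0 \<le> t \<Longrightarrow> (\<lambda>\<omega>. Y y t \<omega> $ i) \<in> borel_measurable (F t)"
  using sde[of y] by (intro vec_nth_measurable) (simp add: sde_solution_def)

lemma Y_M: "0 \<le> t \<Longrightarrow> Y y t \<in> borel_measurable M"
  using sde[of y] measurable_F_M[of "Y y t" t] by (simp add: sde_solution_def)

lemma Y_0: "\<omega> \<in> space M \<Longrightarrow> Y y 0 \<omega> = y"
  using sde[of y] by (simp add: sde_solution_def)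

lemma Y_cont: "\<omega> \<in> space M \<Longrightarrow> continuous_on {0..t} (\<lambda>s. Y y s \<omega>)"
  using sde[of y] by (auto simp: sde_solution_def intro: continuous_on_subset)

lemma Y_cont': "\<omega> \<in> space M \<Longrightarrow> continuous_on {0..t} (\<lambda>s. Y y s \<omega> $ i)"
  by (rule bounded_linear.continuous_on[OF bounded_linear_vec_nth Y_cont])

text \<open>Component \<open>i\<close> of \<open>sqrt 2 \<integral> sig(Y) dW\<close>, read off the
  path by solving the equation for it. As the drift is diagonal, it is at the same time the forcing
  of a scalar linear equation for that component.\<close>

definition J :: "real^3 \<Rightarrow> 3 \<Rightarrow> real \<Rightarrow> 'w \<Rightarrow> real" where
  "J y i t \<omega> = Y y t \<omega> $ i - y $ i + kv $ i * integral {0..t} (\<lambda>s. Y y s \<omega> $ i)"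

lemma J_M: "0 \<le> t \<Longrightarrow> J y i t \<in> borel_measurable M"
  unfolding J_def[abs_def]
  by (intro borel_measurable_add borel_measurable_diff borel_measurable_times borel_measurable_const
      time_integral_measurable vec_nth_measurable Y_M Y_cont') auto

lemma J_eq:
  assumes "0 \<le> t" "\<omega> \<in> space M"
  shows "(Y y t \<omega> - Y y 0 \<omega> - integral {0..t} (\<lambda>s. drift k1 k2 k3 (Y y s \<omega>))) $ i = J y i t \<omega>"
proof -
  have "continuous_on {0..t} (\<lambda>s. drift k1 k2 k3 (Y y s \<omega>))"
  proof -
    have "continuous_on {0..t} (\<lambda>s. \<chi> j. - (kv $ j * Y y s \<omega> $ j))"
      by (intro continuous_on_vec_lambda continuous_intros Y_cont' assms)
    moreover have "drift k1 k2 k3 z = (\<chi> j. - (kv $ j * z $ j))" for z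
      by (simp add: vec_eq_iff drift_component)
    ultimately show ?thesis by simp
  qed
  then have "integral {0..t} (\<lambda>s. drift k1 k2 k3 (Y y s \<omega>)) $ i = integral {0..t} (\<lambda>s. drift k1 k2 k3 (Y y s \<omega>) $ i)"
    by (intro integral_component_eq_cart[symmetric] integrable_continuous_interval)
  then show ?thesis by (simp add: J_def drift_component Y_0[OF assms(2)])
qed

definition Rsum :: "real^3 \<Rightarrow> 3 \<Rightarrow> real \<Rightarrow> nat \<Rightarrow> 'w \<Rightarrow> real" where
  "Rsum y c t n \<omega> = (\<Sum>i<n. sqrt 2 * (sig (Y y (t * real i / real n) \<omega>) *v
     (W (t * real (Suc i) / real n) \<omega> - W (t * real i / real n) \<omega>)) $ c)"

lemma grid: "0 < t \<Longrightarrow> i < n \<Longrightarrow> 0 \<le> t * real i / real n"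
  "0 < t \<Longrightarrow> i < n \<Longrightarrow> 0 \<le> t * real (Suc i) / real n"
  "0 < t \<Longrightarrow> i < n \<Longrightarrow> t * real i / real n \<le> t"
  by (auto simp: divide_le_eq intro: mult_left_mono)

lemma Rsum_term_M:
  assumes "0 < t" "i < n"
  shows "(\<lambda>\<omega>. sqrt 2 * (sig (Y y (t * real i / real n) \<omega>) *v
     (W (t * real (Suc i) / real n) \<omega> - W (t * real i / real n) \<omega>)) $ c) \<in> borel_measurable M"
proof -
  have [measurable]: "Y y (t * real i / real n) \<in> borel_measurable M" "W (t * real i / real n) \<in> borel_measurable M"
    "W (t * real (Suc i) / real n) \<in> borel_measurable M"
    using grid[OF assms] by (auto intro: Y_M W_measurable)
  show ?thesis using exhaust_3[of c] by (auto simp: sig_component simp del: of_nat_Suc)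
qed

lemma Rsum_M: "0 < t \<Longrightarrow> Rsum y c t n \<in> borel_measurable M"
  unfolding Rsum_def[abs_def] by (intro borel_measurable_sum Rsum_term_M) auto

lemma J_limit:
  assumes t: "0 < t"
  shows "tends_prob (Rsum y c t) (J y c t)"
proof -
  define X where "X n \<omega> = (\<Sum>i<n. (sqrt 2 *\<^sub>R sig (Y y (t * real i / real n) \<omega>)) *v
     (W (t * real (Suc i) / real n) \<omega> - W (t * real i / real n) \<omega>))" for n \<omega>
  define Z where "Z \<omega> = Y y t \<omega> - Y y 0 \<omega> - integral {0..t} (\<lambda>s. drift k1 k2 k3 (Y y s \<omega>))" for \<omega>
  have "is_ito_integral M W (\<lambda>s \<omega>. sqrt 2 *\<^sub>R sig (Y y s \<omega>)) t Z"
    using sde[of y] t by (simp add: sde_solution_def Z_def[abs_def])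
  then have conv: "converges_in_probability M X Z" unfolding is_ito_integral_def X_def[abs_def] .
  have Xc: "X n \<omega> $ c = Rsum y c t n \<omega>" for n \<omega> c
    by (simp add: X_def Rsum_def scaleR_matrix_vector_assoc[symmetric] del: of_nat_Suc)
  have Zc: "Z \<omega> $ c = J y c t \<omega>" if "\<omega> \<in> space M" for \<omega> c
    unfolding Z_def using J_eq[OF _ that] t by simp
  have Xm: "X n \<in> borel_measurable M" for n
    by (rule vec_measurableI) (use Rsum_M[OF t] in \<open>simp add: Xc\<close>)
  have Zm: "Z \<in> borel_measurable M"
  proof (rule vec_measurableI)
    fix c
    show "(\<lambda>\<omega>. Z \<omega> $ c) \<in> borel_measurable M"
      using J_M[of t y c] t by (subst measurable_cong[OF Zc]) auto
  qed
  show ?thesis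
    by (rule tends_prob_cong[OF _ _ tends_prob_component[OF Xm Zm conv, of c]]) (auto simp: Xc Zc)
qed

lemma W_telescope:
  assumes "0 < t" "0 < n" "\<omega> \<in> space M"
  shows "(\<Sum>i<n. W (t * real (Suc i) / real n) \<omega> $ c - W (t * real i / real n) \<omega> $ c) = W t \<omega> $ c"
  using sum_lessThan_telescope[of "\<lambda>i. W (t * real i / real n) \<omega> $ c" n] assms W_0[OF assms(3)] by simp

text \<open>A row of \<open>sig\<close> that does not depend on the state makes the Riemann sums
  telescope to \<open>W t\<close> exactly; the limit in probability then determines the integral up
  to a null set.\<close>

lemma J_horizontal:
  assumes t: "0 \<le> t" and row: "\<And>z d. (sig z *v d) $ c = d $ c'"
  shows "AE \<omega> in M. J y c t \<omega> = sqrt 2 * W t \<omega> $ c'"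
proof (cases "t = 0")
  case True
  then show ?thesis by (auto intro!: AE_I2 simp: J_def Y_0 W_0)
next
  case False
  then have t: "0 < t" using t by simp
  have Wm: "W t \<in> borel_measurable M" using W_measurable t by simp
  have "tends_prob (\<lambda>n. if n = 0 then (\<lambda>\<omega>. 0) else (\<lambda>\<omega>. sqrt 2 * W t \<omega> $ c')) (J y c t)"
  proof (rule tends_prob_cong[OF _ _ J_limit[OF t]])
    fix n \<omega> assume w: "\<omega> \<in> space M"
    show "Rsum y c t n \<omega> = (if n = 0 then (\<lambda>\<omega>. 0) else (\<lambda>\<omega>. sqrt 2 * W t \<omega> $ c')) \<omega>"
      using W_telescope[OF t _ w, of n c'] by (auto simp: Rsum_def row sum_distrib_left[symmetric])
  qed simp
  then show ?thesis
    by (rule tends_prob_const_AE[rotated 2]) (use Wm t in \<open>auto intro: J_M\<close>)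
qed

lemma W_L2: "0 \<le> t \<Longrightarrow> L2le (\<lambda>\<omega>. W t \<omega> $ c) t"
proof (cases "t = 0")
  case True
  then show ?thesis
    by (intro L2le_cong_AE[OF L2le_mono[OF L2le_const[of 0]]]) (auto intro!: AE_I2 W_measurable vec_nth_measurable simp: W_0)
next
  case False
  assume "0 \<le> t"
  with False have t: "0 < t" by simp
  have [measurable]: "W t \<in> borel_measurable M" "W 0 \<in> borel_measurable M" using W_measurable t by auto
  have "L2le (\<lambda>\<omega>. W t \<omega> $ c - W 0 \<omega> $ c) t"
    using increment_component[OF order_refl t, of c 2] normal_moment_values(3)[of "sqrt t"] t by (simp add: L2le_def)
  then show ?thesis
    by (rule L2le_cong_AE) (auto intro!: AE_I2 simp: W_0)
qed

lemma integral_shift_const: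
  fixes x :: "real \<Rightarrow> real"
  assumes "0 \<le> s" "continuous_on {0..s} x"
  shows "integral {0..s} (\<lambda>r. x r - c) = integral {0..s} x - s * c"
  using assms by (subst integral_diff) (auto intro!: integrable_continuous_interval)

text \<open>The factors given by \<open>displacement_from_forcing\<close>: \<open>C1\<close> for the
  horizontal components with \<open>B = 2\<close>, and \<open>Cx\<close> for the third with
  \<open>B = 64 * (2 * C1 + 2)\<close>, enlarged by 4 in its last factor so as to dominate
  \<open>C1\<close>.\<close>

definition C1 :: real where "C1 = (2 + 2 * km\<^sup>2) * (4 + 2 * km\<^sup>2)"
definition Cx :: real where "Cx = (2 + 2 * km\<^sup>2) * (128 * (2 * C1 + 2) + 2 * km\<^sup>2 + 4)"

lemma C1: "0 \<le> C1" "C1 \<le> Cx"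
proof -
  show C1: "0 \<le> C1" by (simp add: C1_def)
  then show "C1 \<le> Cx" unfolding Cx_def by (subst C1_def, intro mult_left_mono) auto
qed

text \<open>The component of \<open>Y - y\<close> solves a linear equation whose forcing is
  \<open>J\<close> minus \<open>kv $ c * y $ c * s\<close>. For times up to 1 the square of the
  latter is also linear in time, so the order of the forcing is kept.\<close>

lemma displacement_from_forcing:
  assumes t: "0 \<le> t" "t \<le> 1" and J: "\<And>s. 0 \<le> s \<Longrightarrow> s \<le> t \<Longrightarrow> L2le (J y c s) (B * (1 + (norm y)\<^sup>2) * s)" and B: "0 \<le> B"
  shows "L2le (\<lambda>\<omega>. Y y t \<omega> $ c - y $ c) ((2 + 2 * km\<^sup>2) * ((2 * B + 2 * km\<^sup>2) * (1 + (norm y)\<^sup>2) * t))"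
proof -
  define q where "q = 1 + (norm y)\<^sup>2"
  have q: "1 \<le> q" "(y $ c)\<^sup>2 \<le> q"
    using power_mono[OF component_le_norm_cart[of y c], of 2] by (auto simp: q_def)
  have "L2le (\<lambda>\<omega>. Y y t \<omega> $ c - y $ c) ((2 + 2 * (kv $ c)\<^sup>2 * t\<^sup>2) * ((2 * B + 2 * km\<^sup>2) * q * t))"
  proof (rule L2le_linear_equation[OF t(1) kv(1)])
    fix s assume s: "0 \<le> s" "s \<le> t"
    show "(\<lambda>\<omega>. Y y s \<omega> $ c - y $ c) \<in> borel_measurable M"
      using Y_M s by (intro borel_measurable_diff vec_nth_measurable) auto
    have "L2le (\<lambda>\<omega>. J y c s \<omega> - kv $ c * y $ c * s) (2 * (B * q * s) + 2 * (kv $ c * y $ c * s)\<^sup>2)"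
      unfolding q_def by (intro L2le_diff J s L2le_const)
    moreover have "2 * (B * q * s) + 2 * (kv $ c * y $ c * s)\<^sup>2 \<le> (2 * B + 2 * km\<^sup>2) * q * t"
    proof -
      have "B * q * s \<le> B * q * t" using s B q by (intro mult_left_mono) auto
      moreover have "(kv $ c * y $ c * s)\<^sup>2 \<le> km\<^sup>2 * q * t"
      proof -
        have "s\<^sup>2 \<le> t" using s t mult_mono[of s t s 1] by (simp add: power2_eq_square)
        then have "(kv $ c)\<^sup>2 * (y $ c)\<^sup>2 * s\<^sup>2 \<le> km\<^sup>2 * q * t"
          using kv(3)[of c] q by (intro mult_mono) auto
        then show ?thesis by (simp add: power_mult_distrib)
      qed
      ultimately show ?thesis by (simp add: algebra_simps)
    qed
    ultimately have "L2le (\<lambda>\<omega>. J y c s \<omega> - kv $ c * y $ c * s) ((2 * B + 2 * km\<^sup>2) * q * t)" by (rule L2le_mono)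
    then show "L2le (\<lambda>\<omega>. Y y s \<omega> $ c - y $ c + kv $ c * integral {0..s} (\<lambda>r. Y y r \<omega> $ c - y $ c)) ((2 * B + 2 * km\<^sup>2) * q * t)"
    proof (rule L2le_cong_AE)
      show "(\<lambda>\<omega>. Y y s \<omega> $ c - y $ c + kv $ c * integral {0..s} (\<lambda>r. Y y r \<omega> $ c - y $ c)) \<in> borel_measurable M"
        by (intro borel_measurable_add borel_measurable_diff borel_measurable_times borel_measurable_const
            time_integral_measurable vec_nth_measurable Y_M continuous_intros Y_cont') (use s in auto)
      show "AE \<omega> in M. Y y s \<omega> $ c - y $ c + kv $ c * integral {0..s} (\<lambda>r. Y y r \<omega> $ c - y $ c) = J y c s \<omega> - kv $ c * y $ c * s"
        using s by (intro AE_I2) (simp add: integral_shift_const Y_cont' J_def algebra_simps)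
    qed
  qed (intro continuous_intros Y_cont')
  moreover have "(2 + 2 * (kv $ c)\<^sup>2 * t\<^sup>2) * ((2 * B + 2 * km\<^sup>2) * q * t) \<le> (2 + 2 * km\<^sup>2) * ((2 * B + 2 * km\<^sup>2) * q * t)"
  proof (rule mult_right_mono)
    have "(kv $ c)\<^sup>2 * t\<^sup>2 \<le> km\<^sup>2 * 1" using kv(3)[of c] t by (intro mult_mono power_le_one) auto
    then show "2 + 2 * (kv $ c)\<^sup>2 * t\<^sup>2 \<le> 2 + 2 * km\<^sup>2" by simp
    show "0 \<le> (2 * B + 2 * km\<^sup>2) * q * t" using B q t by simp
  qed
  ultimately show ?thesis unfolding q_def by (rule L2le_mono)
qed

lemma displacement_horizontal:
  assumes t: "0 \<le> t" "t \<le> 1" and row: "\<And>z d. (sig z *v d) $ c = d $ c'"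
  shows "L2le (\<lambda>\<omega>. Y y t \<omega> $ c - y $ c) (C1 * (1 + (norm y)\<^sup>2) * t)"
proof -
  have "L2le (\<lambda>\<omega>. Y y t \<omega> $ c - y $ c) ((2 + 2 * km\<^sup>2) * ((2 * 2 + 2 * km\<^sup>2) * (1 + (norm y)\<^sup>2) * t))"
  proof (rule displacement_from_forcing[OF t])
    fix s assume s: "0 \<le> s" "s \<le> t"
    have "L2le (\<lambda>\<omega>. sqrt 2 * W s \<omega> $ c') ((sqrt 2)\<^sup>2 * s)" by (intro L2le_cmult W_L2 s)
    then have "L2le (\<lambda>\<omega>. sqrt 2 * W s \<omega> $ c') (2 * (1 + (norm y)\<^sup>2) * s)"
      by (rule L2le_mono) (use s in \<open>simp add: algebra_simps\<close>)
    then show "L2le (J y c s) (2 * (1 + (norm y)\<^sup>2) * s)"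
      by (rule L2le_cong_AE[OF _ J_M J_horizontal[OF _ row]]) (use s in auto)
  qed simp
  then show ?thesis by (simp add: C1_def mult_ac)
qed

lemma horizontal_size:
  assumes t: "0 \<le> t" "t \<le> 1" and row: "\<And>z d. (sig z *v d) $ c = d $ c'"
  shows "L2le (\<lambda>\<omega>. Y y t \<omega> $ c) ((2 * C1 + 2) * (1 + (norm y)\<^sup>2))"
proof -
  have "L2le (\<lambda>\<omega>. (Y y t \<omega> $ c - y $ c) + y $ c) (2 * (C1 * (1 + (norm y)\<^sup>2) * t) + 2 * (y $ c)\<^sup>2)"
    by (rule L2le_add[OF displacement_horizontal[OF t row] L2le_const])
  moreover have "2 * (C1 * (1 + (norm y)\<^sup>2) * t) + 2 * (y $ c)\<^sup>2 \<le> (2 * C1 + 2) * (1 + (norm y)\<^sup>2)"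
  proof -
    have "C1 * (1 + (norm y)\<^sup>2) * t \<le> C1 * (1 + (norm y)\<^sup>2) * 1"
      using C1 t by (intro mult_left_mono) auto
    moreover have "(y $ c)\<^sup>2 \<le> (norm y)\<^sup>2"
      using power_mono[OF component_le_norm_cart[of y c], of 2] by simp
    ultimately show ?thesis by (simp add: algebra_simps)
  qed
  ultimately show ?thesis by (auto intro: L2le_mono)
qed

lemma Rsum_3: "Rsum y 3 t n \<omega> = (\<Sum>i<n. (2 * sqrt 2 * Y y (t * real i / real n) \<omega> $ 2) *
      (W (t * real (Suc i) / real n) \<omega> $ 1 - W (t * real i / real n) \<omega> $ 1)
    + (- 2 * sqrt 2 * Y y (t * real i / real n) \<omega> $ 1) *
      (W (t * real (Suc i) / real n) \<omega> $ 2 - W (t * real i / real n) \<omega> $ 2))"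
  unfolding Rsum_def sig_component by (rule sum.cong) (auto simp: algebra_simps)

text \<open>The system is triangular: the integrand of the third component involves only the first
  two, which \<open>horizontal_size\<close> has already bounded, so no Gronwall argument
  enters.\<close>

lemma J3_L2:
  assumes t: "0 \<le> t" "t \<le> 1"
  shows "L2le (J y 3 t) (64 * (2 * C1 + 2) * (1 + (norm y)\<^sup>2) * t)"
proof (cases "t = 0")
  case True
  have "L2le (J y 3 t) 0"
    by (rule L2le_cong_AE[OF L2le_mono[OF L2le_const[of 0]]]) (use True in \<open>auto intro!: J_M AE_I2 simp: J_def Y_0\<close>)
  then show ?thesis using True by simp
next
  case False
  then have t0: "0 < t" using t by simp
  define B where "B = 8 * ((2 * C1 + 2) * (1 + (norm y)\<^sup>2))"
  have "L2le (J y 3 t) (8 * B * t)"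
  proof (rule ito_limit(1)[OF t0, where \<alpha>="\<lambda>s \<omega>. 2 * sqrt 2 * Y y s \<omega> $ 2" and \<beta>="\<lambda>s \<omega>. - 2 * sqrt 2 * Y y s \<omega> $ 1"])
    fix s assume s: "0 \<le> s" "s \<le> t"
    show "(\<lambda>\<omega>. 2 * sqrt 2 * Y y s \<omega> $ 2) \<in> borel_measurable (F s)" "(\<lambda>\<omega>. - 2 * sqrt 2 * Y y s \<omega> $ 1) \<in> borel_measurable (F s)"
      using Y_F[OF s(1)] by (auto intro!: borel_measurable_times)
    have s1: "s \<le> 1" using s t by simp
    show "L2le (\<lambda>\<omega>. 2 * sqrt 2 * Y y s \<omega> $ 2) B" "L2le (\<lambda>\<omega>. - 2 * sqrt 2 * Y y s \<omega> $ 1) B"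
      using L2le_cmult[OF horizontal_size[OF s(1) s1 sig_component(2), of y], of "2 * sqrt 2"]
        L2le_cmult[OF horizontal_size[OF s(1) s1 sig_component(1), of y], of "- 2 * sqrt 2"]
      by (simp_all add: B_def power_mult_distrib)
  next
    show "J y 3 t \<in> borel_measurable M" using J_M t by simp
    show "tends_prob (\<lambda>n \<omega>. \<Sum>i<n. 2 * sqrt 2 * Y y (t * real i / real n) \<omega> $ 2 * (W (t * real (Suc i) / real n) \<omega> $ 1 - W (t * real i / real n) \<omega> $ 1) +
                        - 2 * sqrt 2 * Y y (t * real i / real n) \<omega> $ 1 * (W (t * real (Suc i) / real n) \<omega> $ 2 - W (t * real i / real n) \<omega> $ 2)) (J y 3 t)"
      using J_limit[OF t0, of y 3] unfolding Rsum_3[abs_def] .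
  qed
  then show ?thesis by (simp add: B_def mult_ac)
qed

lemma displacement:
  assumes t: "0 \<le> t" "t \<le> 1"
  shows "L2le (\<lambda>\<omega>. Y y t \<omega> $ c - y $ c) (Cx * (1 + (norm y)\<^sup>2) * t)"
proof -
  consider "c = 1" | "c = 2" | "c = 3" using exhaust_3[of c] by blast
  then show ?thesis
  proof cases
    case 1
    have "C1 * (1 + (norm y)\<^sup>2) * t \<le> Cx * (1 + (norm y)\<^sup>2) * t" using C1 t by (intro mult_right_mono) auto
    with 1 show ?thesis using L2le_mono[OF displacement_horizontal[OF t sig_component(1)]] by simp
  next
    case 2
    have "C1 * (1 + (norm y)\<^sup>2) * t \<le> Cx * (1 + (norm y)\<^sup>2) * t" using C1 t by (intro mult_right_mono) auto
    with 2 show ?thesis using L2le_mono[OF displacement_horizontal[OF t sig_component(2)]] by simp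
  next
    case 3
    have "L2le (\<lambda>\<omega>. Y y t \<omega> $ 3 - y $ 3) ((2 + 2 * km\<^sup>2) * ((2 * (64 * (2 * C1 + 2)) + 2 * km\<^sup>2) * (1 + (norm y)\<^sup>2) * t))"
      by (rule displacement_from_forcing[OF t]) (use J3_L2 t C1 in auto)
    moreover have "(2 + 2 * km\<^sup>2) * ((2 * (64 * (2 * C1 + 2)) + 2 * km\<^sup>2) * (1 + (norm y)\<^sup>2) * t) \<le> Cx * (1 + (norm y)\<^sup>2) * t"
    proof -
      have "(2 + 2 * km\<^sup>2) * (2 * (64 * (2 * C1 + 2)) + 2 * km\<^sup>2) \<le> Cx"
        unfolding Cx_def by (intro mult_left_mono) auto
      then have "(2 + 2 * km\<^sup>2) * (2 * (64 * (2 * C1 + 2)) + 2 * km\<^sup>2) * ((1 + (norm y)\<^sup>2) * t) \<le> Cx * ((1 + (norm y)\<^sup>2) * t)"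
        using t by (intro mult_right_mono) auto
      then show ?thesis by (simp add: mult.assoc)
    qed
    ultimately show ?thesis using 3 L2le_mono by blast
  qed
qed

text \<open>One-step expansion \<open>Y\<^sub>t = y + t b(y) + \<surd>2 \<sigma>(y) W\<^sub>t + p + m\<close>: \<open>p\<close> is the error of freezing the drift,
  \<open>m\<close> the centred error of freezing \<open>\<sigma>\<close> in the stochastic integral.\<close>

definition pterm :: "real^3 \<Rightarrow> real \<Rightarrow> 3 \<Rightarrow> 'w \<Rightarrow> real" where
  "pterm y t c \<omega> = - kv $ c * integral {0..t} (\<lambda>s. Y y s \<omega> $ c - y $ c)"

definition mterm :: "real^3 \<Rightarrow> real \<Rightarrow> 3 \<Rightarrow> 'w \<Rightarrow> real" where
  "mterm y t c \<omega> = J y c t \<omega> - sqrt 2 * (sig y *v W t \<omega>) $ c"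

lemma one_step_expansion:
  assumes "0 \<le> t" "\<omega> \<in> space M"
  shows "Y y t \<omega> $ c - y $ c = t * drift k1 k2 k3 y $ c + sqrt 2 * (sig y *v W t \<omega>) $ c + pterm y t c \<omega> + mterm y t c \<omega>"
  using assms by (simp add: pterm_def mterm_def J_def drift_component integral_shift_const Y_cont' algebra_simps)

text \<open>\<open>64 * Cx\<close> serves \<open>mterm\<close>, with one factor 8 from
  \<open>ito_limit\<close> and another from the square of \<open>2 * sqrt 2\<close>;
  \<open>km\<^sup>2 * Cx\<close> serves \<open>pterm\<close>.\<close>

definition Cr :: real where "Cr = 64 * Cx + km\<^sup>2 * Cx"

lemma Cr: "0 \<le> Cr" "0 \<le> Cx" using C1 by (auto simp: Cr_def)

lemma pterm_L2:
  assumes t: "0 \<le> t" "t \<le> 1"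
  shows "L2le (pterm y t c) (Cr * (1 + (norm y)\<^sup>2) * t ^ 3)"
proof -
  have "L2le (\<lambda>\<omega>. integral {0..t} (\<lambda>s. Y y s \<omega> $ c - y $ c)) (t\<^sup>2 * (Cx * (1 + (norm y)\<^sup>2) * t))"
  proof (rule L2le_time_integral[OF t(1)])
    fix s assume s: "0 \<le> s" "s \<le> t"
    have "Cx * (1 + (norm y)\<^sup>2) * s \<le> Cx * (1 + (norm y)\<^sup>2) * t" using s Cr by (intro mult_left_mono) auto
    then show "L2le (\<lambda>\<omega>. Y y s \<omega> $ c - y $ c) (Cx * (1 + (norm y)\<^sup>2) * t)"
      using L2le_mono[OF displacement] s t by simp
  qed (intro continuous_intros Y_cont')
  then have "L2le (pterm y t c) ((- kv $ c)\<^sup>2 * (t\<^sup>2 * (Cx * (1 + (norm y)\<^sup>2) * t)))"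
    unfolding pterm_def[abs_def] by (rule L2le_cmult)
  moreover have "(- kv $ c)\<^sup>2 * (t\<^sup>2 * (Cx * (1 + (norm y)\<^sup>2) * t)) \<le> Cr * (1 + (norm y)\<^sup>2) * t ^ 3"
  proof -
    have "(kv $ c)\<^sup>2 * Cx \<le> Cr" using mult_right_mono[OF kv(3)[of c] Cr(2)] Cr(2) by (simp add: Cr_def)
    then have "(kv $ c)\<^sup>2 * Cx * ((1 + (norm y)\<^sup>2) * t ^ 3) \<le> Cr * ((1 + (norm y)\<^sup>2) * t ^ 3)"
      using t by (intro mult_right_mono) auto
    then show ?thesis by (simp add: power2_eq_square power3_eq_cube mult_ac)
  qed
  ultimately show ?thesis by (rule L2le_mono)
qed

lemma sigW_M:
  assumes "0 \<le> t" shows "(\<lambda>\<omega>. (sig y *v W t \<omega>) $ c) \<in> borel_measurable M"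
proof -
  have [measurable]: "W t \<in> borel_measurable M" using W_measurable assms by simp
  show ?thesis using exhaust_3[of c] by (auto simp: sig_component)
qed

lemma mterm_M: "0 \<le> t \<Longrightarrow> mterm y t c \<in> borel_measurable M"
  unfolding mterm_def[abs_def]
  by (intro borel_measurable_diff borel_measurable_times borel_measurable_const J_M sigW_M)

text \<open>The integrand is \<open>sig(Y_s) - sig(y)\<close>, whose second moment is of order
  \<open>s\<close>, so the isometry yields order \<open>t\<^sup>2\<close>. The constant rows of
  \<open>sig\<close> contribute nothing.\<close>

lemma mterm_L2:
  assumes t: "0 < t" "t \<le> 1"
  shows "L2le (mterm y t c) (Cr * (1 + (norm y)\<^sup>2) * t\<^sup>2)" "expectation (mterm y t c) = 0"
proof -
  have B0: "0 \<le> Cr * (1 + (norm y)\<^sup>2) * t\<^sup>2" using Cr t by simp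
  have mm: "mterm y t c \<in> borel_measurable M" for c using mterm_M t by simp
  have hor: "L2le (mterm y t c) (Cr * (1 + (norm y)\<^sup>2) * t\<^sup>2) \<and> expectation (mterm y t c) = 0"
    if row: "\<And>z d. (sig z *v d) $ c = d $ c'" for c c'
  proof -
    have ae: "AE \<omega> in M. mterm y t c \<omega> = 0"
      using J_horizontal[OF less_imp_le[OF t(1)] row, of y] by eventually_elim (simp add: mterm_def row)
    have "L2le (mterm y t c) 0" by (rule L2le_cong_AE[OF L2le_mono[OF L2le_const[of 0]] mm ae]) simp
    moreover have "expectation (mterm y t c) = expectation (\<lambda>\<omega>. 0)"
      by (rule integral_cong_AE) (use ae mm in auto)
    ultimately show ?thesis using B0 by (auto intro: L2le_mono)
  qed
  have ver: "L2le (mterm y t 3) (Cr * (1 + (norm y)\<^sup>2) * t\<^sup>2) \<and> expectation (mterm y t 3) = 0"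
  proof -
    define B where "B = 8 * (Cx * (1 + (norm y)\<^sup>2) * t)"
    have lim: "tends_prob (\<lambda>n \<omega>. \<Sum>i<n. 2 * sqrt 2 * (Y y (t * real i / real n) \<omega> $ 2 - y $ 2) * (W (t * real (Suc i) / real n) \<omega> $ 1 - W (t * real i / real n) \<omega> $ 1)
       + - 2 * sqrt 2 * (Y y (t * real i / real n) \<omega> $ 1 - y $ 1) * (W (t * real (Suc i) / real n) \<omega> $ 2 - W (t * real i / real n) \<omega> $ 2)) (mterm y t 3)"
    proof (rule tends_prob_cong)
      show "tends_prob (\<lambda>n \<omega>. Rsum y 3 t n \<omega> - (if n = 0 then (\<lambda>\<omega>. 0) else (\<lambda>\<omega>. sqrt 2 * (sig y *v W t \<omega>) $ 3)) \<omega>) (\<lambda>\<omega>. J y 3 t \<omega> - sqrt 2 * (sig y *v W t \<omega>) $ 3)"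
      proof (rule tends_prob_diff)
        show "tends_prob (\<lambda>n \<omega>. (if n = 0 then (\<lambda>\<omega>. 0) else (\<lambda>\<omega>. sqrt 2 * (sig y *v W t \<omega>) $ 3)) \<omega>) (\<lambda>\<omega>. sqrt 2 * (sig y *v W t \<omega>) $ 3)"
          unfolding tends_prob_def
        proof (intro allI impI)
          fix \<epsilon> :: real assume "0 < \<epsilon>"
          then show "(\<lambda>n. prob {\<omega> \<in> space M. \<epsilon> < \<bar>(if n = 0 then (\<lambda>\<omega>. 0) else (\<lambda>\<omega>. sqrt 2 * (sig y *v W t \<omega>) $ 3)) \<omega> - sqrt 2 * (sig y *v W t \<omega>) $ 3\<bar>}) \<longlonglongrightarrow> 0"
            by (intro tendsto_eventually eventually_sequentiallyI[of 1]) auto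
        qed
      qed (use J_limit[OF t(1)] Rsum_M[OF t(1)] J_M[of t y 3] sigW_M[of t y 3] t in auto)
      fix n \<omega> assume w: "\<omega> \<in> space M"
      show "J y 3 t \<omega> - sqrt 2 * (sig y *v W t \<omega>) $ 3 = mterm y t 3 \<omega>" by (simp add: mterm_def)
      show "Rsum y 3 t n \<omega> - (if n = 0 then (\<lambda>\<omega>. 0) else (\<lambda>\<omega>. sqrt 2 * (sig y *v W t \<omega>) $ 3)) \<omega> =
        (\<Sum>i<n. 2 * sqrt 2 * (Y y (t * real i / real n) \<omega> $ 2 - y $ 2) * (W (t * real (Suc i) / real n) \<omega> $ 1 - W (t * real i / real n) \<omega> $ 1)
       + - 2 * sqrt 2 * (Y y (t * real i / real n) \<omega> $ 1 - y $ 1) * (W (t * real (Suc i) / real n) \<omega> $ 2 - W (t * real i / real n) \<omega> $ 2))"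
      proof (cases "n = 0")
        case True
        then show ?thesis by (simp add: Rsum_def)
      next
        case False
        then have n: "0 < n" by simp
        \<comment> \<open>The sums with integrand frozen at \<open>y\<close> telescope. Subtracting
          them from \<open>Rsum\<close> leaves sums whose integrand is the displacement.\<close>
        have "sqrt 2 * (sig y *v W t \<omega>) $ 3 =
          (\<Sum>i<n. 2 * sqrt 2 * y $ 2 * (W (t * real (Suc i) / real n) \<omega> $ 1 - W (t * real i / real n) \<omega> $ 1)
       + - 2 * sqrt 2 * y $ 1 * (W (t * real (Suc i) / real n) \<omega> $ 2 - W (t * real i / real n) \<omega> $ 2))"
          unfolding sum.distrib sum_distrib_left[symmetric] W_telescope[OF t(1) n w]
          by (simp add: sig_component algebra_simps)
        then show ?thesis using False unfolding Rsum_3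
          by (simp only: if_False sum_subtractf[symmetric]) (simp add: algebra_simps)
      qed
    qed
    have meas: "(\<lambda>\<omega>. 2 * sqrt 2 * (Y y s \<omega> $ 2 - y $ 2)) \<in> borel_measurable (F s)"
        "(\<lambda>\<omega>. - 2 * sqrt 2 * (Y y s \<omega> $ 1 - y $ 1)) \<in> borel_measurable (F s)" if "0 \<le> s" "s \<le> t" for s
      by (intro borel_measurable_times borel_measurable_diff borel_measurable_const Y_F that)+
    have L2: "L2le (\<lambda>\<omega>. 2 * sqrt 2 * (Y y s \<omega> $ 2 - y $ 2)) B" "L2le (\<lambda>\<omega>. - 2 * sqrt 2 * (Y y s \<omega> $ 1 - y $ 1)) B"
      if s: "0 \<le> s" "s \<le> t" for s
    proof -
      have s1: "s \<le> 1" using s t by simp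
      have le: "Cx * (1 + (norm y)\<^sup>2) * s \<le> Cx * (1 + (norm y)\<^sup>2) * t" using s Cr by (intro mult_left_mono) auto
      show "L2le (\<lambda>\<omega>. 2 * sqrt 2 * (Y y s \<omega> $ 2 - y $ 2)) B" "L2le (\<lambda>\<omega>. - 2 * sqrt 2 * (Y y s \<omega> $ 1 - y $ 1)) B"
        using L2le_cmult[OF L2le_mono[OF displacement[OF s(1) s1, of y 2] le], of "2 * sqrt 2"]
          L2le_cmult[OF L2le_mono[OF displacement[OF s(1) s1, of y 1] le], of "- 2 * sqrt 2"]
        by (simp_all add: B_def power_mult_distrib)
    qed
    note * = ito_limit[OF t(1) meas(1) L2(1) meas(2) L2(2) mm lim]
    have "8 * B * t \<le> Cr * (1 + (norm y)\<^sup>2) * t\<^sup>2"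
    proof -
      have "64 * Cx * ((1 + (norm y)\<^sup>2) * t\<^sup>2) \<le> Cr * ((1 + (norm y)\<^sup>2) * t\<^sup>2)"
        using Cr(2) by (intro mult_right_mono) (auto simp: Cr_def)
      then show ?thesis by (simp add: B_def power2_eq_square mult_ac)
    qed
    then show ?thesis using * L2le_mono by blast
  qed
  show "L2le (mterm y t c) (Cr * (1 + (norm y)\<^sup>2) * t\<^sup>2)" "expectation (mterm y t c) = 0"
    using exhaust_3[of c] hor[OF sig_component(1)] hor[OF sig_component(2)] ver by auto
qed

end

section \<open>Contraction and moments of the diffusion\<close>

context diffusion
begin

lemma J_difference:
  assumes "0 \<le> s"
  shows "(Y y s \<omega> $ c - Y z s \<omega> $ c) + kv $ c * (integral {0..s} (\<lambda>r. Y y r \<omega> $ c) - integral {0..s} (\<lambda>r. Y z r \<omega> $ c))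
    = (J y c s \<omega> - J z c s \<omega>) + (y $ c - z $ c)"
  by (simp add: J_def algebra_simps)

lemma difference_from_forcing:
  assumes t: "0 \<le> t" "t \<le> 1" and B: "0 \<le> B"
    and J: "\<And>s. 0 \<le> s \<Longrightarrow> s \<le> t \<Longrightarrow> L2le (\<lambda>\<omega>. J y c s \<omega> - J z c s \<omega>) B"
  shows "L2le (\<lambda>\<omega>. Y y t \<omega> $ c - Y z t \<omega> $ c) ((2 + 2 * km\<^sup>2) * (2 * B + 2 * (norm (y - z))\<^sup>2))"
proof -
  have yz: "(y $ c - z $ c)\<^sup>2 \<le> (norm (y - z))\<^sup>2"
    using power_mono[OF component_le_norm_cart[of "y - z" c], of 2] by simp
  have "L2le (\<lambda>\<omega>. Y y t \<omega> $ c - Y z t \<omega> $ c) ((2 + 2 * (kv $ c)\<^sup>2 * t\<^sup>2) * (2 * B + 2 * (norm (y - z))\<^sup>2))"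
  proof (rule L2le_linear_equation[OF t(1) kv(1)])
    fix s assume s: "0 \<le> s" "s \<le> t"
    show "(\<lambda>\<omega>. Y y s \<omega> $ c - Y z s \<omega> $ c) \<in> borel_measurable M"
      by (intro borel_measurable_diff vec_nth_measurable Y_M s)
    have "L2le (\<lambda>\<omega>. (J y c s \<omega> - J z c s \<omega>) + (y $ c - z $ c)) (2 * B + 2 * (y $ c - z $ c)\<^sup>2)"
      by (intro L2le_add J s L2le_const)
    then have "L2le (\<lambda>\<omega>. (J y c s \<omega> - J z c s \<omega>) + (y $ c - z $ c)) (2 * B + 2 * (norm (y - z))\<^sup>2)"
      by (rule L2le_mono) (use yz in simp)
    then show "L2le (\<lambda>\<omega>. Y y s \<omega> $ c - Y z s \<omega> $ c + kv $ c * integral {0..s} (\<lambda>r. Y y r \<omega> $ c - Y z r \<omega> $ c)) (2 * B + 2 * (norm (y - z))\<^sup>2)"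
    proof (rule L2le_cong_AE)
      show "(\<lambda>\<omega>. Y y s \<omega> $ c - Y z s \<omega> $ c + kv $ c * integral {0..s} (\<lambda>r. Y y r \<omega> $ c - Y z r \<omega> $ c)) \<in> borel_measurable M"
        by (intro borel_measurable_add borel_measurable_diff borel_measurable_times borel_measurable_const
            time_integral_measurable vec_nth_measurable Y_M continuous_intros Y_cont') (use s in auto)
      have "integral {0..s} (\<lambda>r. Y y r \<omega> $ c - Y z r \<omega> $ c) = integral {0..s} (\<lambda>r. Y y r \<omega> $ c) - integral {0..s} (\<lambda>r. Y z r \<omega> $ c)"
        if "\<omega> \<in> space M" for \<omega>
        by (intro integral_diff integrable_continuous_interval Y_cont' that)
      then show "AE \<omega> in M. Y y s \<omega> $ c - Y z s \<omega> $ c + kv $ c * integral {0..s} (\<lambda>r. Y y r \<omega> $ c - Y z r \<omega> $ c) = (J y c s \<omega> - J z c s \<omega>) + (y $ c - z $ c)"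
        using J_difference[OF s(1)] by (intro AE_I2) simp
    qed
  qed (intro continuous_intros Y_cont')
  moreover have "(2 + 2 * (kv $ c)\<^sup>2 * t\<^sup>2) * (2 * B + 2 * (norm (y - z))\<^sup>2) \<le> (2 + 2 * km\<^sup>2) * (2 * B + 2 * (norm (y - z))\<^sup>2)"
  proof (rule mult_right_mono)
    have "(kv $ c)\<^sup>2 * t\<^sup>2 \<le> km\<^sup>2 * 1" using kv(3)[of c] t by (intro mult_mono power_le_one) auto
    then show "2 + 2 * (kv $ c)\<^sup>2 * t\<^sup>2 \<le> 2 + 2 * km\<^sup>2" by simp
  qed (use B in simp)
  ultimately show ?thesis by (rule L2le_mono)
qed

lemma difference_horizontal:
  assumes t: "0 \<le> t" "t \<le> 1" and row: "\<And>z d. (sig z *v d) $ c = d $ c'"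
  shows "L2le (\<lambda>\<omega>. Y y t \<omega> $ c - Y z t \<omega> $ c) ((2 + 2 * km\<^sup>2) * (2 * (norm (y - z))\<^sup>2))"
proof -
  have "L2le (\<lambda>\<omega>. Y y t \<omega> $ c - Y z t \<omega> $ c) ((2 + 2 * km\<^sup>2) * (2 * 0 + 2 * (norm (y - z))\<^sup>2))"
  proof (rule difference_from_forcing[OF t order_refl])
    fix s assume s: "0 \<le> s" "s \<le> t"
    have "L2le (\<lambda>\<omega>. 0) 0" using L2le_const[of 0] by simp
    then show "L2le (\<lambda>\<omega>. J y c s \<omega> - J z c s \<omega>) 0"
    proof (rule L2le_cong_AE)
      show "(\<lambda>\<omega>. J y c s \<omega> - J z c s \<omega>) \<in> borel_measurable M" by (intro borel_measurable_diff J_M s)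
      show "AE \<omega> in M. J y c s \<omega> - J z c s \<omega> = 0"
        using J_horizontal[OF s(1) row, of y] J_horizontal[OF s(1) row, of z] by eventually_elim simp
    qed
  qed
  then show ?thesis by simp
qed

definition Cd :: real where
  "Cd = (2 + 2 * km\<^sup>2) * (2 * (64 * ((2 + 2 * km\<^sup>2) * 2)) + 2)"

lemma Cd: "0 \<le> Cd" by (simp add: Cd_def)

text \<open>Again the horizontal components come first: their stochastic integrals agree almost
  surely for both starting points, and they bound the integrand of the third. The constant
  \<open>Cd\<close> need not contract; it makes \<open>P t \<psi>\<close> Lipschitz and thereby
  measurable.\<close>

lemma difference:
  assumes t: "0 \<le> t" "t \<le> 1"
  shows "L2le (\<lambda>\<omega>. Y y t \<omega> $ c - Y z t \<omega> $ c) (Cd * (norm (y - z))\<^sup>2)"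
proof -
  define n where "n = (norm (y - z))\<^sup>2"
  define H where "H = (2 + 2 * km\<^sup>2) * (2 * n)"
  have n0: "0 \<le> n" by (simp add: n_def)
  have H0: "0 \<le> H" using n0 by (simp add: H_def)
  have hor: "L2le (\<lambda>\<omega>. Y y t \<omega> $ c - Y z t \<omega> $ c) (Cd * n)" if row: "\<And>z d. (sig z *v d) $ c = d $ c'" for c c'
  proof (rule L2le_mono[OF difference_horizontal[OF t row]])
    have "(2 + 2 * km\<^sup>2) * 2 \<le> Cd" unfolding Cd_def by (intro mult_left_mono) auto
    then have "(2 + 2 * km\<^sup>2) * 2 * n \<le> Cd * n" using n0 by (rule mult_right_mono)
    then show "(2 + 2 * km\<^sup>2) * (2 * (norm (y - z))\<^sup>2) \<le> Cd * n" unfolding n_def by (simp only: mult.assoc)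
  qed
  have "L2le (\<lambda>\<omega>. Y y t \<omega> $ 3 - Y z t \<omega> $ 3) ((2 + 2 * km\<^sup>2) * (2 * (64 * H) + 2 * n))"
    unfolding n_def
  proof (rule difference_from_forcing[OF t])
    show "0 \<le> 64 * H" using H0 by simp
    fix s assume s: "0 \<le> s" "s \<le> t"
    show "L2le (\<lambda>\<omega>. J y 3 s \<omega> - J z 3 s \<omega>) (64 * H)"
    proof (cases "s = 0")
      case True
      have "L2le (\<lambda>\<omega>. 0) (64 * H)" using L2le_mono[OF L2le_const[of 0]] H0 by simp
      then show ?thesis
      proof (rule L2le_cong_AE)
        show "(\<lambda>\<omega>. J y 3 s \<omega> - J z 3 s \<omega>) \<in> borel_measurable M" by (intro borel_measurable_diff J_M s)
      qed (use True in \<open>auto intro!: AE_I2 simp: J_def Y_0\<close>)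
    next
      case False
      then have s0: "0 < s" using s by simp
      have meas: "(\<lambda>\<omega>. 2 * sqrt 2 * (Y y r \<omega> $ 2 - Y z r \<omega> $ 2)) \<in> borel_measurable (F r)"
        "(\<lambda>\<omega>. - 2 * sqrt 2 * (Y y r \<omega> $ 1 - Y z r \<omega> $ 1)) \<in> borel_measurable (F r)" if "0 \<le> r" "r \<le> s" for r
        by (intro borel_measurable_times borel_measurable_diff borel_measurable_const Y_F that)+
      have L2: "L2le (\<lambda>\<omega>. 2 * sqrt 2 * (Y y r \<omega> $ 2 - Y z r \<omega> $ 2)) (8 * H)"
        "L2le (\<lambda>\<omega>. - 2 * sqrt 2 * (Y y r \<omega> $ 1 - Y z r \<omega> $ 1)) (8 * H)" if r: "0 \<le> r" "r \<le> s" for r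
      proof -
        have r1: "r \<le> 1" using r s t by simp
        show "L2le (\<lambda>\<omega>. 2 * sqrt 2 * (Y y r \<omega> $ 2 - Y z r \<omega> $ 2)) (8 * H)"
          "L2le (\<lambda>\<omega>. - 2 * sqrt 2 * (Y y r \<omega> $ 1 - Y z r \<omega> $ 1)) (8 * H)"
          using L2le_cmult[OF difference_horizontal[OF r(1) r1 sig_component(2), of y z], of "2 * sqrt 2"]
            L2le_cmult[OF difference_horizontal[OF r(1) r1 sig_component(1), of y z], of "- 2 * sqrt 2"]
          by (simp_all add: H_def n_def power_mult_distrib)
      qed
      have lim: "tends_prob (\<lambda>n \<omega>. \<Sum>i<n. 2 * sqrt 2 * (Y y (s * real i / real n) \<omega> $ 2 - Y z (s * real i / real n) \<omega> $ 2) * (W (s * real (Suc i) / real n) \<omega> $ 1 - W (s * real i / real n) \<omega> $ 1)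
       + - 2 * sqrt 2 * (Y y (s * real i / real n) \<omega> $ 1 - Y z (s * real i / real n) \<omega> $ 1) * (W (s * real (Suc i) / real n) \<omega> $ 2 - W (s * real i / real n) \<omega> $ 2))
        (\<lambda>\<omega>. J y 3 s \<omega> - J z 3 s \<omega>)"
      proof (rule tends_prob_cong)
        show "tends_prob (\<lambda>n \<omega>. Rsum y 3 s n \<omega> - Rsum z 3 s n \<omega>) (\<lambda>\<omega>. J y 3 s \<omega> - J z 3 s \<omega>)"
          by (intro tends_prob_diff J_limit s0 Rsum_M J_M s)
      qed (simp_all only: Rsum_3 sum_subtractf[symmetric], simp_all add: algebra_simps)
      have "L2le (\<lambda>\<omega>. J y 3 s \<omega> - J z 3 s \<omega>) (8 * (8 * H) * s)"
        by (rule ito_limit(1)[OF s0 meas(1) L2(1) meas(2) L2(2) _ lim]) (auto intro!: borel_measurable_diff J_M s)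
      moreover have "8 * (8 * H) * s \<le> 64 * H" using H0 s t mult_left_le[of s "64 * H"] by simp
      ultimately show ?thesis by (rule L2le_mono)
    qed
  qed
  moreover have "(2 + 2 * km\<^sup>2) * (2 * (64 * H) + 2 * n) = Cd * n" by (simp add: Cd_def H_def algebra_simps)
  ultimately have ver: "L2le (\<lambda>\<omega>. Y y t \<omega> $ 3 - Y z t \<omega> $ 3) (Cd * n)" by simp
  show ?thesis
    using exhaust_3[of c] hor[OF sig_component(1)] hor[OF sig_component(2)] ver by (auto simp: n_def)
qed

lemma norm_le_sum3: "norm (x :: real^3) \<le> \<bar>x $ 1\<bar> + \<bar>x $ 2\<bar> + \<bar>x $ 3\<bar>"
  using norm_le_l1_cart[of x] by (simp add: sum_3)

lemma L2_to_L1: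
  assumes "L2le X (C * a\<^sup>2)" "0 \<le> C" "0 \<le> a"
  shows "expectation (\<lambda>\<omega>. \<bar>X \<omega>\<bar>) \<le> (C + 1) * a"
proof (cases "a = 0")
  case True
  show ?thesis
  proof (rule field_le_epsilon)
    \<comment> \<open>Here the second moment vanishes, and Young's inequality with weight
      \<open>1 / e\<close> leaves only \<open>e / 2\<close>.\<close>
    fix e :: real assume "0 < e"
    then show "expectation (\<lambda>\<omega>. \<bar>X \<omega>\<bar>) \<le> (C + 1) * a + e"
      using L2le_expectation(3)[OF assms(1), of "1 / e"] True by simp
  qed
next
  case False
  then have a: "0 < a" using assms by simp
  have "expectation (\<lambda>\<omega>. \<bar>X \<omega>\<bar>) \<le> (1 / a * (C * a\<^sup>2) + 1 / (1 / a)) / 2"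
    by (rule L2le_expectation(3)[OF assms(1)]) (use a in simp)
  also have "\<dots> = (C + 1) * a / 2" using a by (simp add: power2_eq_square algebra_simps)
  also have "\<dots> \<le> (C + 1) * a" using a assms by simp
  finally show ?thesis .
qed

section \<open>Transition operators and moments of the one-step displacement\<close>

definition P :: "real \<Rightarrow> (real^3 \<Rightarrow> real) \<Rightarrow> real^3 \<Rightarrow> real" where
  "P t \<psi> y = expectation (\<lambda>\<omega>. \<psi> (Y y t \<omega>))"

lemma Y_L1:
  assumes t: "0 \<le> t" "t \<le> 1"
  shows "integrable M (\<lambda>\<omega>. norm (Y y t \<omega> - Y z t \<omega>))"
    "expectation (\<lambda>\<omega>. norm (Y y t \<omega> - Y z t \<omega>)) \<le> 3 * (Cd + 1) * norm (y - z)"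
proof -
  have m: "(\<lambda>\<omega>. norm (Y y t \<omega> - Y z t \<omega>)) \<in> borel_measurable M"
    using borel_measurable_diff[OF Y_M[OF t(1), of y] Y_M[OF t(1), of z]] by simp
  have i: "integrable M (\<lambda>\<omega>. Y y t \<omega> $ c - Y z t \<omega> $ c)" for c using L2le_expectation(1)[OF difference[OF t]] .
  have i3: "integrable M (\<lambda>\<omega>. \<bar>Y y t \<omega> $ 1 - Y z t \<omega> $ 1\<bar> + \<bar>Y y t \<omega> $ 2 - Y z t \<omega> $ 2\<bar> + \<bar>Y y t \<omega> $ 3 - Y z t \<omega> $ 3\<bar>)"
    using i by (intro Bochner_Integration.integrable_add integrable_abs)
  have le: "norm (Y y t \<omega> - Y z t \<omega>) \<le> \<bar>Y y t \<omega> $ 1 - Y z t \<omega> $ 1\<bar> + \<bar>Y y t \<omega> $ 2 - Y z t \<omega> $ 2\<bar> + \<bar>Y y t \<omega> $ 3 - Y z t \<omega> $ 3\<bar>" for \<omega>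
    using norm_le_sum3[of "Y y t \<omega> - Y z t \<omega>"] by simp
  show int: "integrable M (\<lambda>\<omega>. norm (Y y t \<omega> - Y z t \<omega>))"
    by (rule Bochner_Integration.integrable_bound[OF i3 m]) (use le in \<open>auto intro!: AE_I2\<close>)
  have "expectation (\<lambda>\<omega>. norm (Y y t \<omega> - Y z t \<omega>)) \<le>
      expectation (\<lambda>\<omega>. \<bar>Y y t \<omega> $ 1 - Y z t \<omega> $ 1\<bar> + \<bar>Y y t \<omega> $ 2 - Y z t \<omega> $ 2\<bar> + \<bar>Y y t \<omega> $ 3 - Y z t \<omega> $ 3\<bar>)"
    by (rule integral_mono[OF int i3 le])
  also have "\<dots> = expectation (\<lambda>\<omega>. \<bar>Y y t \<omega> $ 1 - Y z t \<omega> $ 1\<bar>) + expectation (\<lambda>\<omega>. \<bar>Y y t \<omega> $ 2 - Y z t \<omega> $ 2\<bar>) + expectation (\<lambda>\<omega>. \<bar>Y y t \<omega> $ 3 - Y z t \<omega> $ 3\<bar>)"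
    using i by (simp add: integrable_abs)
  also have "\<dots> \<le> (Cd + 1) * norm (y - z) + (Cd + 1) * norm (y - z) + (Cd + 1) * norm (y - z)"
    by (intro add_mono L2_to_L1 difference t Cd) auto
  finally show "expectation (\<lambda>\<omega>. norm (Y y t \<omega> - Y z t \<omega>)) \<le> 3 * (Cd + 1) * norm (y - z)" by (simp add: algebra_simps)
qed

lemma P_lip:
  assumes t: "0 \<le> t" "t \<le> 1" and \<psi>: "\<And>x y. \<bar>\<psi> x - \<psi> y\<bar> \<le> l * norm (x - y)"
    and i: "\<And>y. integrable M (\<lambda>\<omega>. \<psi> (Y y t \<omega>))"
  shows "\<bar>P t \<psi> y - P t \<psi> z\<bar> \<le> l * (3 * (Cd + 1)) * norm (y - z)"
proof -
  have l0: "0 \<le> l" using \<psi>[of "axis 1 1" 0] abs_ge_zero order_trans by fastforce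
  have "\<bar>P t \<psi> y - P t \<psi> z\<bar> = \<bar>expectation (\<lambda>\<omega>. \<psi> (Y y t \<omega>) - \<psi> (Y z t \<omega>))\<bar>"
    using i by (simp add: P_def)
  also have "\<dots> \<le> expectation (\<lambda>\<omega>. \<bar>\<psi> (Y y t \<omega>) - \<psi> (Y z t \<omega>)\<bar>)" by (rule integral_abs_bound)
  also have "\<dots> \<le> expectation (\<lambda>\<omega>. l * norm (Y y t \<omega> - Y z t \<omega>))"
    using i Y_L1(1)[OF t] by (intro integral_mono \<psi>) auto
  also have "\<dots> = l * expectation (\<lambda>\<omega>. norm (Y y t \<omega> - Y z t \<omega>))" by simp
  also have "\<dots> \<le> l * (3 * (Cd + 1) * norm (y - z))" using Y_L1(2)[OF t] l0 by (rule mult_left_mono)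
  finally show ?thesis by (simp add: mult.assoc)
qed

text \<open>The Gaussian part of the displacement, of order \<open>sqrt t\<close> and with explicit
  moments; what remains is \<open>rterm\<close>, of order \<open>t\<close>, for which only second
  moments are available.\<close>

definition aterm :: "real^3 \<Rightarrow> real \<Rightarrow> 3 \<Rightarrow> 'w \<Rightarrow> real" where
  "aterm y t c \<omega> = sqrt 2 * (sig y *v W t \<omega>) $ c"

definition rterm :: "real^3 \<Rightarrow> real \<Rightarrow> 3 \<Rightarrow> 'w \<Rightarrow> real" where
  "rterm y t c \<omega> = t * drift k1 k2 k3 y $ c + pterm y t c \<omega> + mterm y t c \<omega>"

lemma displacement_split:
  assumes "0 \<le> t" "\<omega> \<in> space M"
  shows "Y y t \<omega> $ c - y $ c = aterm y t c \<omega> + rterm y t c \<omega>"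
  using one_step_expansion[OF assms] by (simp add: aterm_def rterm_def)

lemma aterm_eq: "aterm y t c \<omega> = sqrt 2 * (sig y $ c $ 1 * W t \<omega> $ 1 + sig y $ c $ 2 * W t \<omega> $ 2)"
  by (simp add: aterm_def matrix_vector_mult_def sum_2)

lemma sig_bound: "(sig y $ c $ 1)\<^sup>2 + (sig y $ c $ 2)\<^sup>2 \<le> 4 * (1 + (norm y)\<^sup>2)"
  using exhaust_3[of c] norm3[of y] by (auto simp: sig_def power_mult_distrib)

lemma W_moments:
  assumes t: "0 < t"
  shows "integrable M (\<lambda>\<omega>. W t \<omega> $ i)" "expectation (\<lambda>\<omega>. W t \<omega> $ i) = 0"
    "integrable M (\<lambda>\<omega>. (W t \<omega> $ i)\<^sup>2)" "expectation (\<lambda>\<omega>. (W t \<omega> $ i)\<^sup>2) = t"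
    "integrable M (\<lambda>\<omega>. (W t \<omega> $ i) ^ 4)" "expectation (\<lambda>\<omega>. (W t \<omega> $ i) ^ 4) = 3 * t\<^sup>2"
    "integrable M (\<lambda>\<omega>. W t \<omega> $ 1 * W t \<omega> $ 2)" "expectation (\<lambda>\<omega>. W t \<omega> $ 1 * W t \<omega> $ 2) = 0"
proof -
  have *: "integrable M (\<lambda>\<omega>. (W t \<omega> $ i) ^ a) \<and> expectation (\<lambda>\<omega>. (W t \<omega> $ i) ^ a) = normal_moment (sqrt t) a" for a
  proof -
    have "integrable M (\<lambda>\<omega>. (W t \<omega> $ i) ^ a) \<longleftrightarrow> integrable M (\<lambda>\<omega>. (W t \<omega> $ i - W 0 \<omega> $ i) ^ a)"
      by (rule Bochner_Integration.integrable_cong) (auto simp: W_0)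
    moreover have "expectation (\<lambda>\<omega>. (W t \<omega> $ i) ^ a) = expectation (\<lambda>\<omega>. (W t \<omega> $ i - W 0 \<omega> $ i) ^ a)"
      by (rule Bochner_Integration.integral_cong) (auto simp: W_0)
    ultimately show ?thesis using increment_component[OF order_refl t, of i a] by simp
  qed
  have v: "normal_moment (sqrt t) 1 = 0" "normal_moment (sqrt t) 2 = t" "normal_moment (sqrt t) 4 = 3 * t\<^sup>2"
    using normal_moment_values[of "sqrt t"] t by (auto simp: power2_eq_square power4_eq_xxxx)
  show "integrable M (\<lambda>\<omega>. W t \<omega> $ i)" "expectation (\<lambda>\<omega>. W t \<omega> $ i) = 0"
    using *[of 1] v by auto
  show "integrable M (\<lambda>\<omega>. (W t \<omega> $ i)\<^sup>2)" "expectation (\<lambda>\<omega>. (W t \<omega> $ i)\<^sup>2) = t"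
    using *[of 2] v by auto
  show "integrable M (\<lambda>\<omega>. (W t \<omega> $ i) ^ 4)" "expectation (\<lambda>\<omega>. (W t \<omega> $ i) ^ 4) = 3 * t\<^sup>2"
    using *[of 4] v by auto
  have "integrable M (\<lambda>\<omega>. W t \<omega> $ 1 * W t \<omega> $ 2) \<longleftrightarrow> integrable M (\<lambda>\<omega>. (W t \<omega> $ 1 - W 0 \<omega> $ 1) ^ 1 * (W t \<omega> $ 2 - W 0 \<omega> $ 2) ^ 1)"
    by (rule Bochner_Integration.integrable_cong) (auto simp: W_0)
  then show "integrable M (\<lambda>\<omega>. W t \<omega> $ 1 * W t \<omega> $ 2)" using increment_moment(1)[OF order_refl t, of 1 1] by simp
  have "expectation (\<lambda>\<omega>. W t \<omega> $ 1 * W t \<omega> $ 2) = expectation (\<lambda>\<omega>. (W t \<omega> $ 1 - W 0 \<omega> $ 1) ^ 1 * (W t \<omega> $ 2 - W 0 \<omega> $ 2) ^ 1)"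
    by (rule Bochner_Integration.integral_cong) (auto simp: W_0)
  then show "expectation (\<lambda>\<omega>. W t \<omega> $ 1 * W t \<omega> $ 2) = 0"
    using increment_moment(2)[OF order_refl t, of 1 1] v by simp
qed

lemma aterm_moments:
  assumes t: "0 < t"
  shows "integrable M (aterm y t c)" "expectation (aterm y t c) = 0"
    "integrable M (\<lambda>\<omega>. aterm y t c \<omega> * aterm y t d \<omega>)"
    "expectation (\<lambda>\<omega>. aterm y t c \<omega> * aterm y t d \<omega>) = 2 * t * (sig y ** transpose (sig y)) $ c $ d"
    "L2le (aterm y t c) (8 * (1 + (norm y)\<^sup>2) * t)"
proof -
  note w = W_moments[OF t]
  show "integrable M (aterm y t c)" "expectation (aterm y t c) = 0"
    unfolding aterm_eq[abs_def] using w by auto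
  have eq: "aterm y t c \<omega> * aterm y t d \<omega> = 2 * (sig y $ c $ 1 * sig y $ d $ 1) * (W t \<omega> $ 1)\<^sup>2
     + 2 * (sig y $ c $ 2 * sig y $ d $ 2) * (W t \<omega> $ 2)\<^sup>2
     + 2 * (sig y $ c $ 1 * sig y $ d $ 2 + sig y $ c $ 2 * sig y $ d $ 1) * (W t \<omega> $ 1 * W t \<omega> $ 2)" for c d \<omega>
  proof -
    have "sqrt 2 * a * (sqrt 2 * b) = 2 * (a * b)" for a b :: real
      by (simp add: mult.assoc mult.left_commute[of a])
    then show ?thesis unfolding aterm_eq by (simp only: power2_eq_square) (simp only: algebra_simps)
  qed
  show i: "integrable M (\<lambda>\<omega>. aterm y t c \<omega> * aterm y t d \<omega>)" for c d
    unfolding eq using w by auto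
  have e: "expectation (\<lambda>\<omega>. aterm y t c \<omega> * aterm y t d \<omega>) = 2 * t * (sig y $ c $ 1 * sig y $ d $ 1 + sig y $ c $ 2 * sig y $ d $ 2)" for c d
  proof -
    have "expectation (\<lambda>\<omega>. aterm y t c \<omega> * aterm y t d \<omega>) = 2 * (sig y $ c $ 1 * sig y $ d $ 1) * t
      + 2 * (sig y $ c $ 2 * sig y $ d $ 2) * t
      + 2 * (sig y $ c $ 1 * sig y $ d $ 2 + sig y $ c $ 2 * sig y $ d $ 1) * 0"
      unfolding eq using w by simp
    then show ?thesis by (simp add: algebra_simps)
  qed
  then show "expectation (\<lambda>\<omega>. aterm y t c \<omega> * aterm y t d \<omega>) = 2 * t * (sig y ** transpose (sig y)) $ c $ d"
    by (simp add: matrix_matrix_mult_def transpose_def sum_2)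
  have "2 * t * ((sig y $ c $ 1)\<^sup>2 + (sig y $ c $ 2)\<^sup>2) \<le> 2 * t * (4 * (1 + (norm y)\<^sup>2))"
    using sig_bound t by (intro mult_left_mono) auto
  then show "L2le (aterm y t c) (8 * (1 + (norm y)\<^sup>2) * t)"
    using i[of c c] e[of c c] \<open>integrable M (aterm y t c)\<close> by (simp add: L2le_def power2_eq_square algebra_simps)
qed

definition C\<rho> :: real where "C\<rho> = 4 * km\<^sup>2 + 6 * Cr"

lemma rterm_L2:
  assumes t: "0 < t" "t \<le> 1"
  shows "L2le (rterm y t c) (C\<rho> * (1 + (norm y)\<^sup>2) * t\<^sup>2)"
proof -
  define q where "q = 1 + (norm y)\<^sup>2"
  have q: "0 \<le> q" by (simp add: q_def)
  have "L2le (rterm y t c) (2 * (2 * (t * drift k1 k2 k3 y $ c)\<^sup>2 + 2 * (Cr * q * t ^ 3)) + 2 * (Cr * q * t\<^sup>2))"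
    unfolding rterm_def[abs_def] q_def using t by (intro L2le_add L2le_const pterm_L2 mterm_L2) auto
  moreover have "2 * (2 * (t * drift k1 k2 k3 y $ c)\<^sup>2 + 2 * (Cr * q * t ^ 3)) + 2 * (Cr * q * t\<^sup>2) \<le> C\<rho> * q * t\<^sup>2"
  proof -
    have "\<bar>drift k1 k2 k3 y $ c\<bar> \<le> km * norm y"
      using component_le_norm_cart[of "drift k1 k2 k3 y" c] drift_norm[of y] by linarith
    then have "(drift k1 k2 k3 y $ c)\<^sup>2 \<le> (km * norm y)\<^sup>2"
      using km_pos by (simp add: abs_le_square_iff[symmetric])
    also have "\<dots> \<le> km\<^sup>2 * q" by (simp add: power_mult_distrib q_def mult_left_mono)
    finally have 1: "(t * drift k1 k2 k3 y $ c)\<^sup>2 \<le> km\<^sup>2 * q * t\<^sup>2"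
      by (simp add: power_mult_distrib mult.commute mult_left_mono)
    have "t ^ 3 \<le> t\<^sup>2" using t by (intro power_decreasing) auto
    then have 2: "Cr * q * t ^ 3 \<le> Cr * q * t\<^sup>2" using Cr q by (intro mult_left_mono) auto
    have "2 * (2 * (t * drift k1 k2 k3 y $ c)\<^sup>2 + 2 * (Cr * q * t ^ 3)) + 2 * (Cr * q * t\<^sup>2)
      \<le> 2 * (2 * (km\<^sup>2 * q * t\<^sup>2) + 2 * (Cr * q * t\<^sup>2)) + 2 * (Cr * q * t\<^sup>2)"
      by (intro add_mono order_refl mult_left_mono[where c=2] 1 2) auto
    also have "\<dots> = C\<rho> * q * t\<^sup>2" by (simp add: C\<rho>_def algebra_simps)
    finally show ?thesis .
  qed
  ultimately show ?thesis unfolding q_def by (rule L2le_mono)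
qed

lemma C\<rho>: "0 \<le> C\<rho>" using Cr by (simp add: C\<rho>_def)

text \<open>\<open>aterm\<close> and \<open>mterm\<close> are centred, so the error of the mean
  comes from \<open>pterm\<close> alone, whose second moment is of order
  \<open>t ^ 3\<close>.\<close>

lemma displacement_mean:
  assumes t: "0 < t" "t \<le> 1"
  shows "\<bar>expectation (\<lambda>\<omega>. Y y t \<omega> $ c - y $ c) - t * drift k1 k2 k3 y $ c\<bar> \<le> (Cr + 1) * (1 + norm y) * (t * sqrt t)"
proof -
  have ip: "integrable M (pterm y t c)" by (rule L2le_expectation(1)[OF pterm_L2]) (use t in auto)
  have im: "integrable M (mterm y t c)" by (rule L2le_expectation(1)[OF mterm_L2(1)[OF t]])
  have "expectation (\<lambda>\<omega>. Y y t \<omega> $ c - y $ c) = expectation (\<lambda>\<omega>. aterm y t c \<omega> + (t * drift k1 k2 k3 y $ c + pterm y t c \<omega> + mterm y t c \<omega>))"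
    using displacement_split[of t] t by (intro Bochner_Integration.integral_cong) (auto simp: rterm_def)
  also have "\<dots> = t * drift k1 k2 k3 y $ c + expectation (pterm y t c)"
    using aterm_moments(1,2)[OF t(1), of y c] ip im mterm_L2(2)[OF t, of y c] by (simp add: prob_space)
  finally have eq: "expectation (\<lambda>\<omega>. Y y t \<omega> $ c - y $ c) - t * drift k1 k2 k3 y $ c = expectation (pterm y t c)" by simp
  have "(expectation (pterm y t c))\<^sup>2 \<le> Cr * (1 + (norm y)\<^sup>2) * t ^ 3"
    by (rule L2le_expectation(2)[OF pterm_L2]) (use t in auto)
  also have "\<dots> \<le> (Cr + 1)\<^sup>2 * (1 + norm y)\<^sup>2 * t ^ 3"
    using Cr t by (intro mult_right_mono mult_mono) (auto simp: power2_eq_square algebra_simps)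
  also have "\<dots> = ((Cr + 1) * (1 + norm y) * (t * sqrt t))\<^sup>2"
    using t by (simp add: power_mult_distrib power2_eq_square power3_eq_cube)
  finally have "\<bar>expectation (pterm y t c)\<bar> \<le> \<bar>(Cr + 1) * (1 + norm y) * (t * sqrt t)\<bar>"
    by (simp add: abs_le_square_iff)
  then show ?thesis unfolding eq using Cr t by (simp add: abs_mult)
qed

text \<open>The product of the Gaussian parts gives the covariance exactly. Mixed terms are of order
  \<open>t * sqrt t\<close> by Young's inequality with weight \<open>sqrt t\<close>, and the product
  of two remainders is of order \<open>t\<^sup>2\<close>.\<close>

lemma displacement_covariance:
  assumes t: "0 < t" "t \<le> 1"
  shows "integrable M (\<lambda>\<omega>. (Y y t \<omega> $ c - y $ c) * (Y y t \<omega> $ d - y $ d))"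
    "\<bar>expectation (\<lambda>\<omega>. (Y y t \<omega> $ c - y $ c) * (Y y t \<omega> $ d - y $ d)) - 2 * t * (sig y ** transpose (sig y)) $ c $ d\<bar>
      \<le> (8 + 2 * C\<rho>) * (1 + (norm y)\<^sup>2) * (t * sqrt t)"
proof -
  define q where "q = 1 + (norm y)\<^sup>2"
  have q: "1 \<le> q" by (simp add: q_def)
  have D: "L2le (\<lambda>\<omega>. Y y t \<omega> $ c - y $ c) (Cx * q * t)" for c unfolding q_def by (rule displacement) (use t in auto)
  show "integrable M (\<lambda>\<omega>. (Y y t \<omega> $ c - y $ c) * (Y y t \<omega> $ d - y $ d))" by (rule L2le_product(1)[OF D D])
  note a = aterm_moments[OF t(1), of y, folded q_def] and r = rterm_L2[OF t, of y, folded q_def]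
  have "expectation (\<lambda>\<omega>. (Y y t \<omega> $ c - y $ c) * (Y y t \<omega> $ d - y $ d)) =
     expectation (\<lambda>\<omega>. aterm y t c \<omega> * aterm y t d \<omega> + (aterm y t c \<omega> * rterm y t d \<omega> + (aterm y t d \<omega> * rterm y t c \<omega> + rterm y t c \<omega> * rterm y t d \<omega>)))"
    by (rule Bochner_Integration.integral_cong) (use displacement_split[of t] t in \<open>auto simp: algebra_simps\<close>)
  also have "\<dots> = expectation (\<lambda>\<omega>. aterm y t c \<omega> * aterm y t d \<omega>) + (expectation (\<lambda>\<omega>. aterm y t c \<omega> * rterm y t d \<omega>)
      + (expectation (\<lambda>\<omega>. aterm y t d \<omega> * rterm y t c \<omega>) + expectation (\<lambda>\<omega>. rterm y t c \<omega> * rterm y t d \<omega>)))"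
    using a(3) L2le_product(1)[OF a(5) r] L2le_product(1)[OF r r] by simp
  finally have eq: "expectation (\<lambda>\<omega>. (Y y t \<omega> $ c - y $ c) * (Y y t \<omega> $ d - y $ d)) - 2 * t * (sig y ** transpose (sig y)) $ c $ d
    = expectation (\<lambda>\<omega>. aterm y t c \<omega> * rterm y t d \<omega>)
      + (expectation (\<lambda>\<omega>. aterm y t d \<omega> * rterm y t c \<omega>) + expectation (\<lambda>\<omega>. rterm y t c \<omega> * rterm y t d \<omega>))"
    using a(4) by simp
  have st: "0 < sqrt t" "sqrt t * sqrt t = t" "t \<le> sqrt t"
    using t real_sqrt_le_1_iff[of t] mult_left_le[of "sqrt t" "sqrt t"] by auto
  have ar: "\<bar>expectation (\<lambda>\<omega>. aterm y t c \<omega> * rterm y t d \<omega>)\<bar> \<le> (4 + C\<rho> / 2) * q * (t * sqrt t)" for c d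
  proof -
    have "\<bar>expectation (\<lambda>\<omega>. aterm y t c \<omega> * rterm y t d \<omega>)\<bar> \<le> (sqrt t * (8 * q * t) + (C\<rho> * q * t\<^sup>2) / sqrt t) / 2"
      by (rule order_trans[OF integral_abs_bound L2le_product(2)[OF a(5) r st(1)]])
    also have "(C\<rho> * q * t\<^sup>2) / sqrt t = C\<rho> * q * (t * sqrt t)"
      using st by (simp add: divide_eq_eq power2_eq_square mult.assoc)
    finally show ?thesis by (simp add: algebra_simps)
  qed
  have rr: "\<bar>expectation (\<lambda>\<omega>. rterm y t c \<omega> * rterm y t d \<omega>)\<bar> \<le> C\<rho> * q * (t * sqrt t)"
  proof -
    have "\<bar>expectation (\<lambda>\<omega>. rterm y t c \<omega> * rterm y t d \<omega>)\<bar> \<le> (1 * (C\<rho> * q * t\<^sup>2) + (C\<rho> * q * t\<^sup>2) / 1) / 2"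
      by (rule order_trans[OF integral_abs_bound L2le_product(2)[OF r r]]) simp
    also have "\<dots> = C\<rho> * q * (t * t)" by (simp add: power2_eq_square)
    also have "\<dots> \<le> C\<rho> * q * (t * sqrt t)" using C\<rho> q st t by (intro mult_left_mono) auto
    finally show ?thesis .
  qed
  show "\<bar>expectation (\<lambda>\<omega>. (Y y t \<omega> $ c - y $ c) * (Y y t \<omega> $ d - y $ d)) - 2 * t * (sig y ** transpose (sig y)) $ c $ d\<bar>
      \<le> (8 + 2 * C\<rho>) * (1 + (norm y)\<^sup>2) * (t * sqrt t)"
  proof -
    have "\<bar>expectation (\<lambda>\<omega>. aterm y t c \<omega> * rterm y t d \<omega>)
      + (expectation (\<lambda>\<omega>. aterm y t d \<omega> * rterm y t c \<omega>) + expectation (\<lambda>\<omega>. rterm y t c \<omega> * rterm y t d \<omega>))\<bar>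
      \<le> 2 * ((4 + C\<rho> / 2) * q * (t * sqrt t)) + C\<rho> * q * (t * sqrt t)"
      using ar[of c d] ar[of d c] rr by linarith
    also have "\<dots> = (8 + 2 * C\<rho>) * q * (t * sqrt t)" by (simp add: algebra_simps)
    finally show ?thesis unfolding eq by (simp add: q_def)
  qed
qed

lemma aterm_fourth:
  assumes t: "0 < t"
  shows "integrable M (\<lambda>\<omega>. (aterm y t c \<omega>) ^ 4)"
    "expectation (\<lambda>\<omega>. (aterm y t c \<omega>) ^ 4) \<le> 3072 * (1 + (norm y)\<^sup>2)\<^sup>2 * t\<^sup>2"
proof -
  define q where "q = 1 + (norm y)\<^sup>2"
  note w = W_moments[OF t]
  have le: "(aterm y t c \<omega>) ^ 4 \<le> 512 * q\<^sup>2 * ((W t \<omega> $ 1) ^ 4 + (W t \<omega> $ 2) ^ 4)" for \<omega>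
  proof -
    define a b u v where "a = sig y $ c $ 1" and "b = sig y $ c $ 2" and "u = W t \<omega> $ 1" and "v = W t \<omega> $ 2"
    have ab: "a\<^sup>2 + b\<^sup>2 \<le> 4 * q" using sig_bound[of y c] by (simp add: a_def b_def q_def)
    have "(a * u + b * v)\<^sup>2 \<le> (a\<^sup>2 + b\<^sup>2) * (u\<^sup>2 + v\<^sup>2)"
      using zero_le_power2[of "a * v - b * u"] by (simp add: power2_eq_square algebra_simps)
    also have "\<dots> \<le> 4 * q * (u\<^sup>2 + v\<^sup>2)" using ab by (intro mult_right_mono) auto
    finally have "2 * (a * u + b * v)\<^sup>2 \<le> 8 * q * (u\<^sup>2 + v\<^sup>2)" by simp
    then have "(2 * (a * u + b * v)\<^sup>2)\<^sup>2 \<le> (8 * q * (u\<^sup>2 + v\<^sup>2))\<^sup>2" by (intro power_mono) auto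
    also have "\<dots> = 64 * q\<^sup>2 * (u\<^sup>2 + v\<^sup>2)\<^sup>2" by (simp add: power_mult_distrib)
    also have "(u\<^sup>2 + v\<^sup>2)\<^sup>2 \<le> 8 * (u ^ 4 + v ^ 4)"
    proof -
      have "0 \<le> (u\<^sup>2 - v\<^sup>2)\<^sup>2 + 6 * (u ^ 4 + v ^ 4)" by simp
      also have "\<dots> = 8 * (u ^ 4 + v ^ 4) - (u\<^sup>2 + v\<^sup>2)\<^sup>2"
        by (simp add: power2_eq_square power4_eq_xxxx algebra_simps)
      finally show ?thesis by simp
    qed
    finally have "(2 * (a * u + b * v)\<^sup>2)\<^sup>2 \<le> 64 * q\<^sup>2 * (8 * (u ^ 4 + v ^ 4))" by (simp add: mult_left_mono)
    also have "\<dots> = 512 * q\<^sup>2 * (u ^ 4 + v ^ 4)" by simp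
    finally have "(2 * (a * u + b * v)\<^sup>2)\<^sup>2 \<le> 512 * q\<^sup>2 * (u ^ 4 + v ^ 4)" .
    moreover have "(sqrt 2 * (a * u + b * v)) ^ 4 = (2 * (a * u + b * v)\<^sup>2)\<^sup>2"
      using power_mult[of "sqrt 2 * (a * u + b * v)" 2 2] by (simp add: power_mult_distrib)
    ultimately show ?thesis by (simp only: aterm_eq a_def b_def u_def v_def)
  qed
  have i: "integrable M (\<lambda>\<omega>. 512 * q\<^sup>2 * ((W t \<omega> $ 1) ^ 4 + (W t \<omega> $ 2) ^ 4))" using w by simp
  have am: "aterm y t c \<in> borel_measurable M" using aterm_moments(1)[OF t] by simp
  show i4: "integrable M (\<lambda>\<omega>. (aterm y t c \<omega>) ^ 4)"
  proof (rule Bochner_Integration.integrable_bound[OF i])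
    have "norm ((aterm y t c \<omega>) ^ 4) = (aterm y t c \<omega>) ^ 4" for \<omega> by simp
    then show "AE \<omega> in M. norm ((aterm y t c \<omega>) ^ 4) \<le> norm (512 * q\<^sup>2 * ((W t \<omega> $ 1) ^ 4 + (W t \<omega> $ 2) ^ 4))"
      using order_trans[OF le abs_ge_self] by (intro AE_I2) (simp only: real_norm_def)
  qed (use am in simp)
  have "expectation (\<lambda>\<omega>. (aterm y t c \<omega>) ^ 4) \<le> expectation (\<lambda>\<omega>. 512 * q\<^sup>2 * ((W t \<omega> $ 1) ^ 4 + (W t \<omega> $ 2) ^ 4))"
    by (rule integral_mono[OF i4 i le])
  also have "\<dots> = 512 * q\<^sup>2 * (3 * t\<^sup>2 + 3 * t\<^sup>2)" using w by simp
  finally show "expectation (\<lambda>\<omega>. (aterm y t c \<omega>) ^ 4) \<le> 3072 * (1 + (norm y)\<^sup>2)\<^sup>2 * t\<^sup>2"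
    by (simp add: q_def)
qed

text \<open>The square of the norm is a Lyapunov function: its generator is at most
  \<open>4 - 4 * \<delta> * (norm y)\<^sup>2\<close>, again by \<open>k1, k2 > 4\<close>. The
  expansion error is of order \<open>t * sqrt t * (1 + (norm y)\<^sup>2)\<close> and is absorbed by
  half of this decay at one fixed small time, which is all that moments of \<mu> require.\<close>

lemma mean_square_contraction:
  obtains t \<theta> C where "0 < t" "t \<le> 1" "0 < \<theta>" "\<theta> < 1" "0 \<le> C"
    "\<And>y. integrable M (\<lambda>\<omega>. (norm (Y y t \<omega>))\<^sup>2)"
    "\<And>y. expectation (\<lambda>\<omega>. (norm (Y y t \<omega>))\<^sup>2) \<le> \<theta> * (norm y)\<^sup>2 + C"
proof -
  define Ce where "Ce = 3 * (4 * (Cr + 1) + (8 + 2 * C\<rho>))"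
  have Ce: "0 \<le> Ce" using Cr C\<rho> by (simp add: Ce_def)
  \<comment> \<open>The second bound keeps \<theta> at least 1/2; the third gives
    \<open>Ce * sqrt t \<le> 2 * \<delta>\<close>, so that the error takes away at most half of the
    decay.\<close>
  define t where "t = min 1 (min (1 / (4 * \<delta>)) ((2 * \<delta> / (Ce + 1))\<^sup>2))"
  have t: "0 < t" "t \<le> 1" "t \<le> 1 / (4 * \<delta>)" "t \<le> (2 * \<delta> / (Ce + 1))\<^sup>2"
    using delta(1) Ce by (auto simp: t_def)
  have "sqrt t \<le> 2 * \<delta> / (Ce + 1)"
    using t(4) delta(1) Ce by (intro real_le_lsqrt) auto
  then have "sqrt t * (Ce + 1) \<le> 2 * \<delta>" using Ce by (simp add: le_divide_eq)
  then have st: "Ce * sqrt t \<le> 2 * \<delta>" 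
  proof -
    have "sqrt t * (Ce + 1) = Ce * sqrt t + sqrt t" by (simp add: algebra_simps)
    moreover have "0 \<le> sqrt t" using t(1) by simp
    ultimately show ?thesis using \<open>sqrt t * (Ce + 1) \<le> 2 * \<delta>\<close> by linarith
  qed
  define \<theta> where "\<theta> = 1 - 2 * \<delta> * t"
  have "2 * \<delta> * t \<le> 2 * \<delta> * (1 / (4 * \<delta>))" using t delta(1) by (intro mult_left_mono) auto
  then have "2 * \<delta> * t \<le> 1 / 2" using delta(1) by simp
  then have \<theta>: "0 < \<theta>" "\<theta> < 1" using t delta(1) by (auto simp: \<theta>_def)
  have main: "integrable M (\<lambda>\<omega>. (norm (Y y t \<omega>))\<^sup>2) \<and> expectation (\<lambda>\<omega>. (norm (Y y t \<omega>))\<^sup>2) \<le> \<theta> * (norm y)\<^sup>2 + (4 + 2 * \<delta>)" for y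
  proof -
    define q where "q = 1 + (norm y)\<^sup>2"
    define d where "d c \<omega> = Y y t \<omega> $ c - y $ c" for c \<omega>
    define S where "S = sig y ** transpose (sig y)"
    define e where "e = q * (t * sqrt t)"
    have D: "L2le (d c) (Cx * (1 + (norm y)\<^sup>2) * t)" for c unfolding d_def[abs_def] by (rule displacement) (use t in auto)
    have i: "integrable M (d c)" "integrable M (\<lambda>\<omega>. (d c \<omega>)\<^sup>2)" for c
      using L2le_expectation(1)[OF D] D[of c] by (auto simp: L2le_def)
    have sq: "(Y y t \<omega> $ c)\<^sup>2 = (y $ c)\<^sup>2 + 2 * y $ c * d c \<omega> + (d c \<omega>)\<^sup>2" for c \<omega>
      by (simp add: d_def power2_eq_square algebra_simps)
    have ic: "integrable M (\<lambda>\<omega>. (Y y t \<omega> $ c)\<^sup>2)" for c unfolding sq using i by simp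
    have q: "1 \<le> q" "(norm y)\<^sup>2 \<le> q" by (auto simp: q_def)
    have nq: "norm y * (1 + norm y) \<le> 2 * q"
    proof -
      have "0 \<le> (1 - norm y)\<^sup>2" by simp
      then have "norm y \<le> q" by (simp add: q_def power2_eq_square algebra_simps) (smt (verit) zero_le_square)
      then show ?thesis using q by (simp add: algebra_simps power2_eq_square)
    qed
    have e0: "0 \<le> e" using q t by (simp add: e_def)
    have Ec: "expectation (\<lambda>\<omega>. (Y y t \<omega> $ c)\<^sup>2) \<le> (y $ c)\<^sup>2 + t * (2 * (y $ c * drift k1 k2 k3 y $ c) + 2 * S $ c $ c)
        + (4 * (Cr + 1) + (8 + 2 * C\<rho>)) * e" for c
    proof -
      have "expectation (\<lambda>\<omega>. (Y y t \<omega> $ c)\<^sup>2) = (y $ c)\<^sup>2 + 2 * y $ c * expectation (d c) + expectation (\<lambda>\<omega>. (d c \<omega>)\<^sup>2)"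
        unfolding sq using i by (simp add: prob_space)
      moreover have "2 * y $ c * expectation (d c) \<le> 2 * y $ c * (t * drift k1 k2 k3 y $ c) + 4 * (Cr + 1) * e"
      proof -
        have "y $ c * (expectation (d c) - t * drift k1 k2 k3 y $ c) \<le> \<bar>y $ c\<bar> * \<bar>expectation (d c) - t * drift k1 k2 k3 y $ c\<bar>"
          by (metis abs_ge_self abs_mult)
        also have "\<dots> \<le> norm y * ((Cr + 1) * (1 + norm y) * (t * sqrt t))"
          using displacement_mean[OF t(1,2), of y c] component_le_norm_cart[of y c]
          unfolding d_def[abs_def] by (intro mult_mono) auto
        also have "\<dots> = (Cr + 1) * (t * sqrt t) * (norm y * (1 + norm y))" by (simp add: mult_ac)
        also have "\<dots> \<le> (Cr + 1) * (t * sqrt t) * (2 * q)" using nq Cr t by (intro mult_left_mono) auto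
        finally show ?thesis by (simp add: e_def algebra_simps)
      qed
      moreover have "expectation (\<lambda>\<omega>. (d c \<omega>)\<^sup>2) \<le> 2 * t * S $ c $ c + (8 + 2 * C\<rho>) * e"
        using displacement_covariance(2)[OF t(1,2), of y c c] unfolding d_def S_def e_def q_def
        by (simp add: power2_eq_square mult.assoc)
      ultimately show ?thesis by (simp add: algebra_simps)
    qed
    have n: "(norm (Y y t \<omega>))\<^sup>2 = (Y y t \<omega> $ 1)\<^sup>2 + (Y y t \<omega> $ 2)\<^sup>2 + (Y y t \<omega> $ 3)\<^sup>2" for \<omega> by (rule norm3)
    have int: "integrable M (\<lambda>\<omega>. (norm (Y y t \<omega>))\<^sup>2)" unfolding n using ic by simp
    have "expectation (\<lambda>\<omega>. (norm (Y y t \<omega>))\<^sup>2) = expectation (\<lambda>\<omega>. (Y y t \<omega> $ 1)\<^sup>2) + expectation (\<lambda>\<omega>. (Y y t \<omega> $ 2)\<^sup>2) + expectation (\<lambda>\<omega>. (Y y t \<omega> $ 3)\<^sup>2)"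
      unfolding n using ic by simp
    also have "\<dots> \<le> (norm y)\<^sup>2 + t * (2 * (y $ 1 * drift k1 k2 k3 y $ 1 + y $ 2 * drift k1 k2 k3 y $ 2 + y $ 3 * drift k1 k2 k3 y $ 3)
        + 2 * (S $ 1 $ 1 + S $ 2 $ 2 + S $ 3 $ 3)) + Ce * e"
      using Ec[of 1] Ec[of 2] Ec[of 3] unfolding norm3[of y] Ce_def by (simp add: algebra_simps)
    also have "2 * (y $ 1 * drift k1 k2 k3 y $ 1 + y $ 2 * drift k1 k2 k3 y $ 2 + y $ 3 * drift k1 k2 k3 y $ 3)
        + 2 * (S $ 1 $ 1 + S $ 2 $ 2 + S $ 3 $ 3) = 4 - 2 * ((k1 - 4) * (y $ 1)\<^sup>2 + (k2 - 4) * (y $ 2)\<^sup>2 + k3 * (y $ 3)\<^sup>2)"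
      by (simp add: S_def drift_def matrix_matrix_mult_def transpose_def sig_def sum_2 power2_eq_square algebra_simps)
    also have "(norm y)\<^sup>2 + t * (4 - 2 * ((k1 - 4) * (y $ 1)\<^sup>2 + (k2 - 4) * (y $ 2)\<^sup>2 + k3 * (y $ 3)\<^sup>2)) + Ce * e
      \<le> (norm y)\<^sup>2 + t * (4 - 4 * \<delta> * (norm y)\<^sup>2) + t * (2 * \<delta> * q)"
    proof (intro add_mono order_refl mult_left_mono)
      have "2 * \<delta> * (y $ 1)\<^sup>2 + 2 * \<delta> * (y $ 2)\<^sup>2 + 2 * \<delta> * (y $ 3)\<^sup>2 \<le> (k1 - 4) * (y $ 1)\<^sup>2 + (k2 - 4) * (y $ 2)\<^sup>2 + k3 * (y $ 3)\<^sup>2"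
        using delta by (intro add_mono mult_right_mono) auto
      then show "4 - 2 * ((k1 - 4) * (y $ 1)\<^sup>2 + (k2 - 4) * (y $ 2)\<^sup>2 + k3 * (y $ 3)\<^sup>2) \<le> 4 - 4 * \<delta> * (norm y)\<^sup>2"
        unfolding norm3[of y] by (simp add: algebra_simps)
      have "Ce * e = t * (Ce * sqrt t * q)" by (simp add: e_def)
      also have "\<dots> \<le> t * (2 * \<delta> * q)" using st q t by (intro mult_left_mono mult_right_mono) auto
      finally show "Ce * e \<le> t * (2 * \<delta> * q)" .
    qed (use t in auto)
    also have "\<dots> = \<theta> * (norm y)\<^sup>2 + t * (4 + 2 * \<delta>)" by (simp add: q_def \<theta>_def algebra_simps)
    also have "\<dots> \<le> \<theta> * (norm y)\<^sup>2 + (4 + 2 * \<delta>)"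
      using t delta(1) mult_left_le_one_le[of "4 + 2 * \<delta>" t] by simp
    finally show ?thesis using int by simp
  qed
  show thesis
    by (rule that[OF t(1,2) \<theta>, of "4 + 2 * \<delta>"]) (use main delta(1) in auto)
qed

end

section \<open>Second moment of the invariant measure\<close>

locale stationary = diffusion k1 k2 k3 M F W Y
  for k1 k2 k3 :: real and M :: "'w measure" and F W Y +
  fixes \<mu> :: "(real^3) measure"
  assumes inv: "invariant_probability M Y \<mu>"
begin

interpretation mu: prob_space \<mu> using inv by (simp add: invariant_probability_def)

lemma sets_mu [measurable_cong]: "sets \<mu> = sets borel" using inv by (simp add: invariant_probability_def)

lemma invariance:
  assumes "0 \<le> t" "\<psi> \<in> borel_measurable borel" "bounded (range \<psi>)"
  shows "(\<integral>y. P t \<psi> y \<partial>\<mu>) = (\<integral>y. \<psi> y \<partial>\<mu>)"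
  using inv assms by (simp add: invariant_probability_def P_def)

lemma lip_measurable:
  fixes \<psi> :: "real^3 \<Rightarrow> real"
  assumes "\<And>x y. \<bar>\<psi> x - \<psi> y\<bar> \<le> l * norm (x - y)"
  shows "\<psi> \<in> borel_measurable borel"
proof -
  have "0 \<le> l" using assms[of "axis 1 1" 0] abs_ge_zero order_trans by fastforce
  then have "l-lipschitz_on UNIV \<psi>" using assms by (auto intro!: lipschitz_onI simp: dist_norm)
  then show ?thesis by (intro borel_measurable_continuous_onI lipschitz_on_continuous_on)
qed

lemma bounded_Y_integrable:
  assumes "0 \<le> t" "\<psi> \<in> borel_measurable borel" "\<And>y. \<bar>\<psi> y\<bar> \<le> (B::real)"
  shows "integrable M (\<lambda>\<omega>. \<psi> (Y y t \<omega>))"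
  by (rule integrable_const_bound[where B=B]) (use assms Y_M[of t y] in \<open>auto intro: measurable_compose\<close>)

text \<open>Through \<open>P_lip\<close> this makes the image of the clamped square under
  \<open>P t\<close> Lipschitz, hence measurable.\<close>

lemma clamp_lip: "\<bar>(min (norm x) R)\<^sup>2 - (min (norm y) R)\<^sup>2\<bar> \<le> 2 * R * norm (x - y)" if "0 \<le> R" for x y :: "real^3"
proof -
  define a b where "a = min (norm x) R" and "b = min (norm y) R"
  have ab: "0 \<le> a" "a \<le> R" "0 \<le> b" "b \<le> R" using that by (auto simp: a_def b_def)
  have d: "\<bar>a - b\<bar> \<le> norm (x - y)"
    using norm_triangle_ineq3[of x y] unfolding a_def b_def by linarith
  have "\<bar>a\<^sup>2 - b\<^sup>2\<bar> = (a + b) * \<bar>a - b\<bar>" using ab by (simp add: power2_eq_square square_diff_square_factored abs_mult)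
  also have "\<dots> \<le> (2 * R) * norm (x - y)" using ab d by (intro mult_mono) auto
  finally show ?thesis by (simp add: a_def b_def)
qed

text \<open>The invariance of \<open>\<mu>\<close> only concerns bounded functions, so the second moment is approached
  by clamping \<open>|y|\<close> at \<open>R\<close>; the contraction is iterated with \<open>R\<close> replaced by \<open>R / r\<^sup>n\<close>.\<close>

lemma second_moment: "integrable \<mu> (\<lambda>y. (norm y)\<^sup>2)"
proof -
  obtain t \<theta> C where t: "0 < t" "t \<le> 1" and \<theta>: "0 < \<theta>" "\<theta> < 1" and C: "0 \<le> C"
    and Yi: "\<And>y. integrable M (\<lambda>\<omega>. (norm (Y y t \<omega>))\<^sup>2)"
    and E: "\<And>y. expectation (\<lambda>\<omega>. (norm (Y y t \<omega>))\<^sup>2) \<le> \<theta> * (norm y)\<^sup>2 + C"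
    using mean_square_contraction by blast
  define r where "r = sqrt \<theta>"
  have r: "0 < r" "r < 1" "r\<^sup>2 = \<theta>" using \<theta> by (auto simp: r_def)
  define g where "g R y = (min (norm y) R)\<^sup>2" for R :: real and y :: "real^3"
  have gm: "g R \<in> borel_measurable borel" for R unfolding g_def[abs_def] by measurable
  have gb: "\<bar>g R y\<bar> \<le> R\<^sup>2" if "0 \<le> R" for R y using that unfolding g_def by (simp add: power_mono)
  have gi: "integrable \<mu> (g R)" if "0 \<le> R" for R
    by (rule mu.integrable_const_bound[where B="R\<^sup>2"]) (use gb[OF that] gm in auto)
  define m where "m R = (\<integral>y. g R y \<partial>\<mu>)" for R
  have step: "m R \<le> \<theta> * m (R / r) + C" if R: "0 \<le> R" for R
  proof -
    have i: "integrable M (\<lambda>\<omega>. g R (Y y t \<omega>))" for y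
      by (rule bounded_Y_integrable) (use t gm gb[OF R] in auto)
    have Pm: "P t (g R) \<in> borel_measurable borel"
      by (rule lip_measurable[where l="2 * R * (3 * (Cd + 1))"])
        (rule P_lip, use t clamp_lip[OF R] i in \<open>auto simp: g_def\<close>)
    have Pb: "\<bar>P t (g R) y\<bar> \<le> R\<^sup>2" for y
    proof -
      have "\<bar>P t (g R) y\<bar> \<le> expectation (\<lambda>\<omega>. \<bar>g R (Y y t \<omega>)\<bar>)" unfolding P_def by (rule integral_abs_bound)
      also have "\<dots> \<le> expectation (\<lambda>\<omega>. R\<^sup>2)" using i gb[OF R] by (intro integral_mono) auto
      finally show ?thesis by (simp add: prob_space)
    qed
    \<comment> \<open>Both bounds on the left side are used: the contraction inside radius
      \<open>R / r\<close>, and \<open>R\<^sup>2\<close> outside, where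
      \<open>\<theta> * (R / r)\<^sup>2 = R\<^sup>2\<close>. This identity dictates
      \<open>r = sqrt \<theta>\<close>.\<close>
    have Ple: "P t (g R) y \<le> \<theta> * g (R / r) y + C" for y
    proof -
      have 1: "P t (g R) y \<le> \<theta> * (norm y)\<^sup>2 + C"
      proof -
        have "P t (g R) y \<le> expectation (\<lambda>\<omega>. (norm (Y y t \<omega>))\<^sup>2)"
          unfolding P_def by (rule integral_mono[OF i Yi]) (use R in \<open>auto simp: g_def intro!: power_mono\<close>)
        then show ?thesis using E[of y] by simp
      qed
      show ?thesis
      proof (cases "norm y \<le> R / r")
        case True
        then show ?thesis using 1 by (simp add: g_def)
      next
        case False
        then have "\<theta> * g (R / r) y = R\<^sup>2" using r \<theta> by (simp add: g_def power_divide)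
        then show ?thesis using Pb[of y] C by linarith
      qed
    qed
    have "m R = (\<integral>y. P t (g R) y \<partial>\<mu>)"
      unfolding m_def by (rule invariance[symmetric]) (use t gm gb[OF R] in \<open>auto intro!: boundedI[where B="R\<^sup>2"]\<close>)
    also have "\<dots> \<le> (\<integral>y. \<theta> * g (R / r) y + C \<partial>\<mu>)"
      by (rule integral_mono) (use gi[of "R / r"] R r Pm Pb Ple in \<open>auto intro!: mu.integrable_const_bound[where B="R\<^sup>2"]\<close>)
    also have "\<dots> = \<theta> * m (R / r) + C" using gi[of "R / r"] R r by (simp add: m_def mu.prob_space)
    finally show ?thesis .
  qed
  have iter: "m R \<le> \<theta> ^ n * m (R / r ^ n) + C / (1 - \<theta>)" if R: "0 \<le> R" for R n
  proof (induction n)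
    case 0
    then show ?case using C \<theta> by simp
  next
    case (Suc n)
    \<comment> \<open>The partial geometric sums are kept explicit, because the bound with the full
      sum \<open>C / (1 - \<theta>)\<close> does not reproduce itself in one step.\<close>
    have "\<theta> ^ n * m (R / r ^ n) + C * (1 - \<theta> ^ n) / (1 - \<theta>) \<le> \<theta> ^ Suc n * m (R / r ^ Suc n) + C * (1 - \<theta> ^ Suc n) / (1 - \<theta>)" for n
    proof -
      have "\<theta> ^ n * m (R / r ^ n) \<le> \<theta> ^ n * (\<theta> * m (R / r ^ n / r) + C)"
        using step[of "R / r ^ n"] R r \<theta> by (intro mult_left_mono) auto
      also have "\<dots> = \<theta> ^ Suc n * m (R / r ^ Suc n) + C * \<theta> ^ n" by (simp add: algebra_simps)
      also have "C * \<theta> ^ n = C * (1 - \<theta> ^ Suc n) / (1 - \<theta>) - C * (1 - \<theta> ^ n) / (1 - \<theta>)"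
      proof -
        have "C * (1 - \<theta> ^ Suc n) - C * (1 - \<theta> ^ n) = C * \<theta> ^ n * (1 - \<theta>)" by (simp add: algebra_simps)
        then show ?thesis unfolding diff_divide_distrib[symmetric] using \<theta> by simp
      qed
      finally show ?thesis by simp
    qed
    then have "m R \<le> \<theta> ^ Suc n * m (R / r ^ Suc n) + C * (1 - \<theta> ^ Suc n) / (1 - \<theta>)"
      using lift_Suc_mono_le[of "\<lambda>n. \<theta> ^ n * m (R / r ^ n) + C * (1 - \<theta> ^ n) / (1 - \<theta>)" 0 "Suc n"] by simp
    moreover have "C * (1 - \<theta> ^ Suc n) / (1 - \<theta>) \<le> C / (1 - \<theta>)"
      using C \<theta> by (intro divide_right_mono mult_left_le) auto
    ultimately show ?case by simp
  qed
  have mb: "m R \<le> C / (1 - \<theta>)" if R: "0 \<le> R" for R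
  proof (rule LIMSEQ_le_const)
    \<comment> \<open>After rescaling, \<open>\<theta> ^ n * g (R / r ^ n)\<close> is the clamped
      square of \<open>r ^ n * norm y\<close>: it tends to 0 pointwise and stays below
      \<open>R\<^sup>2\<close>. The bound on \<open>m R\<close> that remains is independent of
      \<open>R\<close>.\<close>
    have "(\<lambda>n. \<integral>y. (min (r ^ n * norm y) R)\<^sup>2 \<partial>\<mu>) \<longlonglongrightarrow> (\<integral>y. 0 \<partial>\<mu>)"
    proof (rule integral_dominated_convergence[where w="\<lambda>y. R\<^sup>2"])
      show "AE y in \<mu>. (\<lambda>n. (min (r ^ n * norm y) R)\<^sup>2) \<longlonglongrightarrow> 0"
      proof (rule AE_I2)
        fix y :: "real^3"
        have "(\<lambda>n. (min (r ^ n * norm y) R)\<^sup>2) \<longlonglongrightarrow> (min (0 * norm y) R)\<^sup>2"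
          using r by (intro tendsto_intros LIMSEQ_power_zero) auto
        then show "(\<lambda>n. (min (r ^ n * norm y) R)\<^sup>2) \<longlonglongrightarrow> 0" using R by simp
      qed
      show "AE y in \<mu>. norm ((min (r ^ n * norm y) R)\<^sup>2) \<le> R\<^sup>2" for n
        using R r by (intro AE_I2) (auto intro!: power_mono)
    qed auto
    moreover have "(\<integral>y. (min (r ^ n * norm y) R)\<^sup>2 \<partial>\<mu>) = \<theta> ^ n * m (R / r ^ n)" for n
    proof -
      have "(min (r ^ n * norm y) R)\<^sup>2 = \<theta> ^ n * g (R / r ^ n) y" for y :: "real^3"
      proof -
        have "min (r ^ n * norm y) R = r ^ n * min (norm y) (R / r ^ n)"
          using r by (auto simp: min_def field_simps)
        then show ?thesis by (simp add: g_def power_mult_distrib r(3)[symmetric] power_mult[symmetric] mult.commute)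
      qed
      then show ?thesis by (simp add: m_def)
    qed
    ultimately have "(\<lambda>n. \<theta> ^ n * m (R / r ^ n)) \<longlonglongrightarrow> 0" by simp
    from tendsto_add[OF this tendsto_const[of "C / (1 - \<theta>)"]]
    show "(\<lambda>n. \<theta> ^ n * m (R / r ^ n) + C / (1 - \<theta>)) \<longlonglongrightarrow> C / (1 - \<theta>)" by simp
    show "\<exists>N. \<forall>n\<ge>N. m R \<le> \<theta> ^ n * m (R / r ^ n) + C / (1 - \<theta>)" using iter[OF R] by blast
  qed
  have "mu.L2le norm (C / (1 - \<theta>))"
  proof (rule mu.L2le_pointwise_limit[where X="\<lambda>n y. min (norm y) (real n)"])
    show "mu.L2le (\<lambda>y. min (norm y) (real n)) (C / (1 - \<theta>))" for n
      using mb[of "real n"] gi[of "real n"] by (auto simp: mu.L2le_def m_def g_def[abs_def])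
    show "(\<lambda>n. min (norm y) (real n)) \<longlonglongrightarrow> norm y" for y :: "real^3"
    proof (rule tendsto_eventually)
      obtain k :: nat where "norm y \<le> k" using real_arch_simple by blast
      then show "\<forall>\<^sub>F n in sequentially. min (norm y) (real n) = norm y"
        by (intro eventually_sequentiallyI[of k]) auto
    qed
  qed simp
  then show ?thesis by (simp add: mu.L2le_def)
qed

end

section \<open>Stationarity of the generator\<close>

lemma has_derivative_lip_bound:
  fixes f :: "'a::real_normed_vector \<Rightarrow> real"
  assumes d: "(f has_derivative F) (at x)" and lip: "\<And>u v. \<bar>f u - f v\<bar> \<le> c * norm (u - v)"
  shows "\<bar>F h\<bar> \<le> c * norm h"
proof -
  have line: "((\<lambda>s. x + s *\<^sub>R h) has_derivative (\<lambda>s. s *\<^sub>R h)) (at (0::real))"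
    by (auto intro!: derivative_eq_intros)
  have "((\<lambda>s. f (x + s *\<^sub>R h)) has_derivative (\<lambda>s. F (s *\<^sub>R h))) (at (0::real))"
    by (rule has_derivative_compose[OF line]) (use d in simp)
  moreover have "(\<lambda>s. F (s *\<^sub>R h)) = (*) (F h)"
    using linear_scale[OF has_derivative_linear[OF d]] by (simp add: fun_eq_iff mult.commute)
  ultimately have "((\<lambda>s. f (x + s *\<^sub>R h)) has_real_derivative F h) (at 0)"
    by (simp add: has_field_derivative_def)
  then have "((\<lambda>s. (f (x + s *\<^sub>R h) - f x) / s) \<longlongrightarrow> F h) (at 0)" by (simp add: DERIV_def)
  from tendsto_rabs[OF this] show ?thesis
  proof (rule tendsto_upperbound)
    have "\<bar>(f (x + s *\<^sub>R h) - f x) / s\<bar> \<le> c * norm h" if "s \<noteq> 0" for s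
      using lip[of "x + s *\<^sub>R h" x] that by (simp add: abs_divide divide_le_eq mult_ac)
    then show "\<forall>\<^sub>F s in at 0. \<bar>(f (x + s *\<^sub>R h) - f x) / s\<bar> \<le> c * norm h"
      by (auto simp: eventually_at intro!: exI[of _ 1])
  qed simp
qed

lemma lipschitz_gradient_le:
  assumes C: "C21 \<psi> D D2 C2 C3" and lip: "\<And>x y. \<bar>\<psi> x - \<psi> y\<bar> \<le> l * norm (x - y)"
  shows "norm (D y) \<le> l"
proof (cases "D y = 0")
  case True
  have "0 \<le> l" using lip[of "axis 1 1" 0] abs_ge_zero order_trans by fastforce
  with True show ?thesis by simp
next
  case False
  have "(\<psi> has_derivative (\<lambda>h. h \<bullet> D y)) (at y)" using C by (simp add: C21_def C2diff_def gderiv_def)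
  from has_derivative_lip_bound[OF this lip, of "D y"] have "norm (D y) * norm (D y) \<le> l * norm (D y)"
    by (simp add: power2_norm_eq_inner[symmetric] power2_eq_square)
  then show ?thesis using False by simp
qed

lemma quadratic_form_sum: "(d::real^3) \<bullet> (Q *v d) = (\<Sum>i\<in>UNIV. \<Sum>j\<in>UNIV. Q $ i $ j * (d $ i * d $ j))"
  by (simp add: inner_vec_def matrix_vector_mult_def sum_distrib_left mult_ac)

lemma abs_sum3_le:
  fixes f :: "3 \<Rightarrow> real"
  assumes "\<And>i. \<bar>f i\<bar> \<le> C"
  shows "\<bar>\<Sum>i\<in>UNIV. f i\<bar> \<le> 3 * C"
  using assms[of 1] assms[of 2] assms[of 3] unfolding sum_3 by linarith

context diffusion
begin

text \<open>Symmetry of \<open>sig y ** transpose (sig y)\<close> turns the trace into a plain sum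
  over entries; \<open>Q\<close> itself need not be symmetric.\<close>

lemma L_as_sum: "L y q Q = (\<Sum>i\<in>UNIV. q $ i * drift k1 k2 k3 y $ i)
    + (\<Sum>i\<in>UNIV. \<Sum>j\<in>UNIV. Q $ i $ j * (sig y ** transpose (sig y)) $ i $ j)"
proof -
  have "trace (sig y ** transpose (sig y) ** Q) = (\<Sum>i\<in>UNIV. \<Sum>j\<in>UNIV. Q $ j $ i * (sig y ** transpose (sig y)) $ i $ j)"
    by (simp add: trace_def matrix_matrix_mult_def mult.commute)
  also have "\<dots> = (\<Sum>i\<in>UNIV. \<Sum>j\<in>UNIV. Q $ i $ j * (sig y ** transpose (sig y)) $ j $ i)"
    by (rule sum.swap)
  also have "\<dots> = (\<Sum>i\<in>UNIV. \<Sum>j\<in>UNIV. Q $ i $ j * (sig y ** transpose (sig y)) $ i $ j)"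
    by (simp add: matrix_matrix_mult_def transpose_def mult.commute)
  finally show ?thesis by (simp add: Lgen_def inner_vec_def mult.commute)
qed

lemma lip_Y_integrable:
  assumes t: "0 \<le> t" "t \<le> 1" and \<psi>: "\<psi> \<in> borel_measurable borel"
    and lip: "\<And>x y. \<bar>\<psi> x - \<psi> y\<bar> \<le> l * norm (x - y)"
  shows "integrable M (\<lambda>\<omega>. \<psi> (Y y t \<omega>))"
proof -
  have d: "integrable M (\<lambda>\<omega>. Y y t \<omega> $ c - y $ c)" for c by (rule L2le_expectation(1)[OF displacement[OF t]])
  have i: "integrable M (\<lambda>\<omega>. \<bar>\<psi> y\<bar> + l * (\<bar>Y y t \<omega> $ 1 - y $ 1\<bar> + \<bar>Y y t \<omega> $ 2 - y $ 2\<bar> + \<bar>Y y t \<omega> $ 3 - y $ 3\<bar>))"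
    using d by (intro Bochner_Integration.integrable_add integrable_mult_right integrable_abs) auto
  have l0: "0 \<le> l" using lip[of "axis 1 1" 0] abs_ge_zero order_trans by fastforce
  show ?thesis
  proof (rule Bochner_Integration.integrable_bound[OF i])
    show "(\<lambda>\<omega>. \<psi> (Y y t \<omega>)) \<in> borel_measurable M" using measurable_compose[OF Y_M[OF t(1)] \<psi>] .
    show "AE \<omega> in M. norm (\<psi> (Y y t \<omega>)) \<le> norm (\<bar>\<psi> y\<bar> + l * (\<bar>Y y t \<omega> $ 1 - y $ 1\<bar> + \<bar>Y y t \<omega> $ 2 - y $ 2\<bar> + \<bar>Y y t \<omega> $ 3 - y $ 3\<bar>))"
    proof (rule AE_I2)
      fix \<omega>
      have "\<bar>\<psi> (Y y t \<omega>)\<bar> \<le> \<bar>\<psi> y\<bar> + l * norm (Y y t \<omega> - y)" using lip[of "Y y t \<omega>" y] by linarith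
      also have "\<dots> \<le> \<bar>\<psi> y\<bar> + l * (\<bar>Y y t \<omega> $ 1 - y $ 1\<bar> + \<bar>Y y t \<omega> $ 2 - y $ 2\<bar> + \<bar>Y y t \<omega> $ 3 - y $ 3\<bar>)"
        using norm_le_sum3[of "Y y t \<omega> - y"] l0 by (intro add_left_mono mult_left_mono) auto
      finally show "norm (\<psi> (Y y t \<omega>)) \<le> norm (\<bar>\<psi> y\<bar> + l * (\<bar>Y y t \<omega> $ 1 - y $ 1\<bar> + \<bar>Y y t \<omega> $ 2 - y $ 2\<bar> + \<bar>Y y t \<omega> $ 3 - y $ 3\<bar>))"
        by simp
    qed
  qed
qed

text \<open>With \<open>\<Delta> = Y\<^sub>t - y = a + r\<close>, the third-order Taylor remainder is cubic where \<open>|a|\<close> dominates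
  and only quadratic where \<open>|r|\<close> dominates, so fourth moments are needed for the Gaussian part \<open>a\<close> alone.\<close>

lemma short_time_expansion:
  assumes C: "C21 \<psi> D D2 C2 C3" and lip: "\<And>x y. \<bar>\<psi> x - \<psi> y\<bar> \<le> l * norm (x - y)"
  obtains A B where "0 \<le> B"
    "\<And>t y. 0 < t \<Longrightarrow> t \<le> 1 \<Longrightarrow> \<bar>P t \<psi> y - \<psi> y - t * L y (D y) (D2 y)\<bar> \<le> A y * (t * sqrt t)"
    "\<And>t y. 0 < t \<Longrightarrow> t \<le> 1 \<Longrightarrow> \<bar>P t \<psi> y - \<psi> y\<bar> \<le> B * (1 + (norm y)\<^sup>2) * t"
proof -
  have l0: "0 \<le> l" using lip[of "axis 1 1" 0] abs_ge_zero order_trans by fastforce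
  have C2diff: "C2diff \<psi> D D2" using C by (simp add: C21_def)
  have C2: "form_le (D2 y) C2" for y using C by (simp add: C21_def)
  have C3: "form_le (D2 y - D2 z) (C3 * norm (y - z))" for y z using C by (simp add: C21_def)
  have C20: "0 \<le> C2" using form_le_component[OF C2[of 0], of 1 1] by simp
  have C30: "0 \<le> C3" using form_le_component[OF C3[of "axis 1 1" 0], of 1 1] by simp
  have Dl: "norm (D y) \<le> l" for y by (rule lipschitz_gradient_le[OF C lip])
  have Dc: "\<bar>D y $ c\<bar> \<le> l" for y c using component_le_norm_cart[of "D y" c] Dl[of y] by linarith
  have \<psi>c: "continuous_on UNIV \<psi>"
    using C2diff by (auto simp: C2diff_def gderiv_def intro!: continuous_at_imp_continuous_on intro: has_derivative_continuous)
  have \<psi>m: "\<psi> \<in> borel_measurable borel" using \<psi>c by (rule borel_measurable_continuous_onI)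
  define Q where "Q y = 1 + (norm y)\<^sup>2" for y :: "real^3"
  have Q1: "1 \<le> Q y" for y by (simp add: Q_def)
  have nQ: "1 + norm y \<le> 2 * Q y" for y
  proof -
    have "2 * norm y \<le> 1 + (norm y)\<^sup>2" using zero_le_power2[of "1 - norm y"] unfolding power2_diff by simp
    moreover have "1 + (norm y)\<^sup>2 = Q y" by (simp add: Q_def)
    ultimately show ?thesis using Q1[of y] by linarith
  qed
  \<comment> \<open>\<open>A\<close> grows like the fourth power of \<open>norm y\<close>, which is
    harmless since it serves a pointwise limit only. The factor with \<open>B\<close> has to stay
    quadratic, as it is integrated against \<mu>.\<close>
  define A where "A y = 3 * (l * ((Cr + 1) * (1 + norm y))) + 9 * (C2 * ((8 + 2 * C\<rho>) * Q y)) / 2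
    + (2 * C3 * (24 * Q y + 9 * (3072 * (Q y)\<^sup>2)) + 4 * C2 * (3 * (C\<rho> * Q y)))" for y
  define B where "B = 3 * (l * (km + (Cr + 1))) * 2 + C2 * (3 * Cx)"
  have B0: "0 \<le> B" using l0 km_pos Cr C20 by (simp add: B_def)
  have main: "\<bar>P t \<psi> y - \<psi> y - t * L y (D y) (D2 y)\<bar> \<le> A y * (t * sqrt t) \<and> \<bar>P t \<psi> y - \<psi> y\<bar> \<le> B * Q y * t"
    if t: "0 < t" "t \<le> 1" for t y
  proof -
    define d where "d \<omega> = Y y t \<omega> - y" for \<omega>
    define S where "S = sig y ** transpose (sig y)"
    define R where "R \<omega> = \<psi> (Y y t \<omega>) - \<psi> y - D y \<bullet> d \<omega> - d \<omega> \<bullet> (D2 y *v d \<omega>) / 2" for \<omega>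
    define e where "e = t * sqrt t"
    have e0: "0 \<le> e" using t by (simp add: e_def)
    have st: "0 < sqrt t" "sqrt t * sqrt t = t" "sqrt t \<le> 1" "t \<le> sqrt t"
      using t real_sqrt_le_1_iff[of t] mult_left_le[of "sqrt t" "sqrt t"] by auto
    have tt: "t * t \<le> e" using st t by (simp add: e_def)
    have et: "e \<le> t" using st t by (simp add: e_def mult_left_le)
    have D1: "L2le (\<lambda>\<omega>. d \<omega> $ c) (Cx * Q y * t)" for c
      using displacement[of t y c] t by (simp add: d_def Q_def)
    have id: "integrable M (\<lambda>\<omega>. d \<omega> $ c)" "integrable M (\<lambda>\<omega>. d \<omega> $ c * d \<omega> $ c')" "integrable M (\<lambda>\<omega>. (d \<omega> $ c)\<^sup>2)" for c c'
      using L2le_expectation(1)[OF D1] L2le_product(1)[OF D1 D1] D1[of c] by (auto simp: L2le_def)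
    have i\<psi>: "integrable M (\<lambda>\<omega>. \<psi> (Y y t \<omega>))" by (rule lip_Y_integrable[OF _ t(2) \<psi>m lip]) (use t in auto)
    have lin: "D y \<bullet> d \<omega> = (\<Sum>i\<in>UNIV. D y $ i * d \<omega> $ i)" for \<omega> by (simp add: inner_vec_def)
    have iD: "integrable M (\<lambda>\<omega>. D y \<bullet> d \<omega>)" unfolding lin using id by simp
    have iD2: "integrable M (\<lambda>\<omega>. d \<omega> \<bullet> (D2 y *v d \<omega>))" unfolding quadratic_form_sum using id by simp
    have iR: "integrable M R" unfolding R_def[abs_def] using i\<psi> iD iD2 by simp
    have m1: "\<bar>expectation (\<lambda>\<omega>. d \<omega> $ c) - t * drift k1 k2 k3 y $ c\<bar> \<le> (Cr + 1) * (1 + norm y) * e" for c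
      using displacement_mean[OF t, of y c] by (simp add: d_def e_def)
    have m2: "\<bar>expectation (\<lambda>\<omega>. d \<omega> $ c * d \<omega> $ c') - 2 * t * S $ c $ c'\<bar> \<le> (8 + 2 * C\<rho>) * Q y * e" for c c'
      using displacement_covariance(2)[OF t, of y c c'] by (simp add: d_def e_def S_def Q_def)
    have ED: "expectation (\<lambda>\<omega>. D y \<bullet> d \<omega>) = (\<Sum>i\<in>UNIV. D y $ i * expectation (\<lambda>\<omega>. d \<omega> $ i))"
      unfolding lin using id by simp
    have ED2: "expectation (\<lambda>\<omega>. d \<omega> \<bullet> (D2 y *v d \<omega>)) = (\<Sum>i\<in>UNIV. \<Sum>j\<in>UNIV. D2 y $ i $ j * expectation (\<lambda>\<omega>. d \<omega> $ i * d \<omega> $ j))"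
      unfolding quadratic_form_sum using id by simp
    have Pe: "P t \<psi> y - \<psi> y = expectation (\<lambda>\<omega>. D y \<bullet> d \<omega>) + expectation (\<lambda>\<omega>. d \<omega> \<bullet> (D2 y *v d \<omega>)) / 2 + expectation R"
    proof -
      have "expectation R = P t \<psi> y - \<psi> y - expectation (\<lambda>\<omega>. D y \<bullet> d \<omega>) - expectation (\<lambda>\<omega>. d \<omega> \<bullet> (D2 y *v d \<omega>)) / 2"
        unfolding R_def[abs_def] P_def using i\<psi> iD iD2 by (simp add: prob_space)
      then show ?thesis by simp
    qed
    have R1: "\<bar>R \<omega>\<bar> \<le> C2 * (norm (d \<omega>))\<^sup>2" for \<omega>
    proof -
      have "\<bar>R \<omega>\<bar> \<le> (C2 + C2) * (norm (d \<omega>))\<^sup>2 / 2"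
        using C2diff_taylor_bound[OF C2diff, of y "d \<omega>" "C2 + C2"] form_le_diff[of _ 0 C2 _ C2] C2
        by (simp add: R_def d_def)
      then show ?thesis by simp
    qed
    have R2: "\<bar>R \<omega>\<bar> \<le> C3 * norm (d \<omega>) * (norm (d \<omega>))\<^sup>2 / 2" for \<omega>
    proof -
      have "form_le (D2 (y + s *\<^sub>R d \<omega>) - D2 y) (C3 * norm (d \<omega>))" if "0 < s" "s < 1" for s
      proof (rule form_le_mono[OF C3])
        show "C3 * norm (y + s *\<^sub>R d \<omega> - y) \<le> C3 * norm (d \<omega>)"
          using that C30 by (intro mult_left_mono) (auto simp: mult_left_le_one_le)
      qed
      from C2diff_taylor_bound[OF C2diff this] show ?thesis by (simp add: R_def d_def)
    qed
    define a r where "a \<omega> = (\<chi> c. aterm y t c \<omega>)" and "r \<omega> = (\<chi> c. rterm y t c \<omega>)" for \<omega>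
    have dar: "d \<omega> = a \<omega> + r \<omega>" if "\<omega> \<in> space M" for \<omega>
      using displacement_split[OF _ that, of t y] t by (simp add: vec_eq_iff d_def a_def r_def)
    have Rb: "\<bar>R \<omega>\<bar> \<le> 2 * C3 * (sqrt t * (norm (a \<omega>))\<^sup>2 + (norm (a \<omega>)) ^ 4 / sqrt t) + 4 * C2 * (norm (r \<omega>))\<^sup>2" if w: "\<omega> \<in> space M" for \<omega>
    proof -
      define u v where "u = norm (a \<omega>)" and "v = norm (r \<omega>)"
      have uv: "0 \<le> u" "0 \<le> v" "norm (d \<omega>) \<le> u + v" using norm_triangle_ineq[of "a \<omega>" "r \<omega>"] dar[OF w] by (auto simp: u_def v_def)
      have p: "0 \<le> 2 * C3 * (sqrt t * u\<^sup>2 + u ^ 4 / sqrt t)" "0 \<le> 4 * C2 * v\<^sup>2" using C30 C20 st uv by auto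
      show ?thesis
      proof (cases "v \<le> u")
        case True
        have n: "norm (d \<omega>) \<le> 2 * u" using True uv by simp
        have "C3 * norm (d \<omega>) * (norm (d \<omega>))\<^sup>2 / 2 \<le> C3 * (2 * u) * (2 * u)\<^sup>2 / 2"
          using n C30 uv by (intro divide_right_mono mult_mono power_mono) auto
        also have "\<dots> = 2 * C3 * (2 * (u * u\<^sup>2))" by (simp add: power2_eq_square)
        also have "\<dots> \<le> 2 * C3 * (sqrt t * u\<^sup>2 + u ^ 4 / sqrt t)"
        proof (intro mult_left_mono)
          \<comment> \<open>Trades the cube for a second and a fourth moment; with
            \<open>s = sqrt t\<close> both terms have expectation of order
            \<open>t * sqrt t\<close>.\<close>
          have gen: "(s * u - u\<^sup>2)\<^sup>2 / s = s * u\<^sup>2 + u ^ 4 / s - 2 * (u * u\<^sup>2)" if "0 < s" for s :: real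
            using that by (simp add: power2_eq_square power4_eq_xxxx field_simps)
          have "0 \<le> (sqrt t * u - u\<^sup>2)\<^sup>2 / sqrt t" using st by simp
          also note gen[OF st(1)]
          finally show "2 * (u * u\<^sup>2) \<le> sqrt t * u\<^sup>2 + u ^ 4 / sqrt t" by simp
        qed (use C30 in simp)
        finally show ?thesis using R2[of \<omega>] p by (simp add: u_def v_def)
      next
        case False
        have n: "norm (d \<omega>) \<le> 2 * v" using False uv by simp
        have "C2 * (norm (d \<omega>))\<^sup>2 \<le> C2 * (2 * v)\<^sup>2" using n C20 by (intro mult_left_mono power_mono) auto
        then show ?thesis using R1[of \<omega>] p by (simp add: u_def v_def power_mult_distrib)
      qed
    qed
    have na: "(norm (a \<omega>))\<^sup>2 = (aterm y t 1 \<omega>)\<^sup>2 + (aterm y t 2 \<omega>)\<^sup>2 + (aterm y t 3 \<omega>)\<^sup>2" for \<omega>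
      unfolding norm3 by (simp add: a_def)
    have nr: "(norm (r \<omega>))\<^sup>2 = (rterm y t 1 \<omega>)\<^sup>2 + (rterm y t 2 \<omega>)\<^sup>2 + (rterm y t 3 \<omega>)\<^sup>2" for \<omega>
      unfolding norm3 by (simp add: r_def)
    have na4: "(norm (a \<omega>)) ^ 4 \<le> 3 * ((aterm y t 1 \<omega>) ^ 4 + (aterm y t 2 \<omega>) ^ 4 + (aterm y t 3 \<omega>) ^ 4)" for \<omega>
    proof -
      define u v w where "u = (aterm y t 1 \<omega>)\<^sup>2" and "v = (aterm y t 2 \<omega>)\<^sup>2" and "w = (aterm y t 3 \<omega>)\<^sup>2"
      have "(norm (a \<omega>)) ^ 4 = ((norm (a \<omega>))\<^sup>2)\<^sup>2" by (simp flip: power_mult)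
      also have "\<dots> = (u + v + w)\<^sup>2" unfolding na u_def v_def w_def ..
      also have "\<dots> \<le> 3 * (u\<^sup>2 + v\<^sup>2 + w\<^sup>2)"
      proof -
        have "0 \<le> (u - v)\<^sup>2 + (v - w)\<^sup>2 + (u - w)\<^sup>2" by simp
        then show ?thesis by (simp add: power2_eq_square algebra_simps)
      qed
      finally show ?thesis by (simp add: u_def v_def w_def flip: power_mult)
    qed
    have a2: "integrable M (\<lambda>\<omega>. (aterm y t c \<omega>)\<^sup>2)" "expectation (\<lambda>\<omega>. (aterm y t c \<omega>)\<^sup>2) \<le> 8 * Q y * t"
      "integrable M (\<lambda>\<omega>. (rterm y t c \<omega>)\<^sup>2)" "expectation (\<lambda>\<omega>. (rterm y t c \<omega>)\<^sup>2) \<le> C\<rho> * Q y * t\<^sup>2" for c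
      using aterm_moments(5)[OF t(1), of y c] rterm_L2[OF t, of y c] by (auto simp: L2le_def Q_def)
    note a4 = aterm_fourth[OF t(1), of y, folded Q_def]
    have ER: "\<bar>expectation R\<bar> \<le> (2 * C3 * (24 * Q y + 9 * (3072 * (Q y)\<^sup>2)) + 4 * C2 * (3 * (C\<rho> * Q y))) * e"
    proof -
      define Z where "Z \<omega> = 2 * C3 * (sqrt t * ((aterm y t 1 \<omega>)\<^sup>2 + (aterm y t 2 \<omega>)\<^sup>2 + (aterm y t 3 \<omega>)\<^sup>2)
          + 3 * ((aterm y t 1 \<omega>) ^ 4 + (aterm y t 2 \<omega>) ^ 4 + (aterm y t 3 \<omega>) ^ 4) / sqrt t)
          + 4 * C2 * ((rterm y t 1 \<omega>)\<^sup>2 + (rterm y t 2 \<omega>)\<^sup>2 + (rterm y t 3 \<omega>)\<^sup>2)" for \<omega>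
      have iZ: "integrable M Z" unfolding Z_def[abs_def] using a2 a4 by simp
      have "\<bar>expectation R\<bar> \<le> expectation (\<lambda>\<omega>. \<bar>R \<omega>\<bar>)" by (rule integral_abs_bound)
      also have "\<dots> \<le> expectation Z"
      proof (rule integral_mono)
        fix \<omega> assume w: "\<omega> \<in> space M"
        have "2 * C3 * (sqrt t * (norm (a \<omega>))\<^sup>2 + (norm (a \<omega>)) ^ 4 / sqrt t) \<le>
          2 * C3 * (sqrt t * (norm (a \<omega>))\<^sup>2 + 3 * ((aterm y t 1 \<omega>) ^ 4 + (aterm y t 2 \<omega>) ^ 4 + (aterm y t 3 \<omega>) ^ 4) / sqrt t)"
          using na4[of \<omega>] C30 st by (intro mult_left_mono add_left_mono divide_right_mono) auto
        then show "\<bar>R \<omega>\<bar> \<le> Z \<omega>" using Rb[OF w] unfolding Z_def na nr by linarith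
      qed (use iR iZ in auto)
      also have "expectation Z = 2 * C3 * (sqrt t * (expectation (\<lambda>\<omega>. (aterm y t 1 \<omega>)\<^sup>2) + expectation (\<lambda>\<omega>. (aterm y t 2 \<omega>)\<^sup>2) + expectation (\<lambda>\<omega>. (aterm y t 3 \<omega>)\<^sup>2))
          + 3 * (expectation (\<lambda>\<omega>. (aterm y t 1 \<omega>) ^ 4) + expectation (\<lambda>\<omega>. (aterm y t 2 \<omega>) ^ 4) + expectation (\<lambda>\<omega>. (aterm y t 3 \<omega>) ^ 4)) / sqrt t)
          + 4 * C2 * (expectation (\<lambda>\<omega>. (rterm y t 1 \<omega>)\<^sup>2) + expectation (\<lambda>\<omega>. (rterm y t 2 \<omega>)\<^sup>2) + expectation (\<lambda>\<omega>. (rterm y t 3 \<omega>)\<^sup>2))"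
        unfolding Z_def[abs_def] using a2 a4 by simp
      also have "\<dots> \<le> 2 * C3 * (sqrt t * (8 * Q y * t + 8 * Q y * t + 8 * Q y * t)
          + 3 * (3072 * (Q y)\<^sup>2 * t\<^sup>2 + 3072 * (Q y)\<^sup>2 * t\<^sup>2 + 3072 * (Q y)\<^sup>2 * t\<^sup>2) / sqrt t)
          + 4 * C2 * (C\<rho> * Q y * t\<^sup>2 + C\<rho> * Q y * t\<^sup>2 + C\<rho> * Q y * t\<^sup>2)"
        using C20 C30 st by (intro add_mono mult_left_mono divide_right_mono a2 a4) auto
      also have "\<dots> = 2 * C3 * (24 * Q y * e + 9 * (3072 * (Q y)\<^sup>2) * (t\<^sup>2 / sqrt t)) + 4 * C2 * (3 * (C\<rho> * Q y)) * (t * t)"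
        by (simp add: e_def power2_eq_square algebra_simps)
      also have "t\<^sup>2 / sqrt t = e" using st by (simp add: divide_eq_eq e_def power2_eq_square mult.assoc)
      also have "2 * C3 * (24 * Q y * e + 9 * (3072 * (Q y)\<^sup>2) * e) + 4 * C2 * (3 * (C\<rho> * Q y)) * (t * t)
        \<le> 2 * C3 * (24 * Q y * e + 9 * (3072 * (Q y)\<^sup>2) * e) + 4 * C2 * (3 * (C\<rho> * Q y)) * e"
        using tt C20 C\<rho> Q1[of y] by (intro add_left_mono mult_left_mono) auto
      finally show ?thesis by (simp add: algebra_simps)
    qed
    have first: "\<bar>P t \<psi> y - \<psi> y - t * L y (D y) (D2 y)\<bar> \<le> A y * e"
    proof -
      have eq: "P t \<psi> y - \<psi> y - t * L y (D y) (D2 y) =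
        (\<Sum>i\<in>UNIV. D y $ i * (expectation (\<lambda>\<omega>. d \<omega> $ i) - t * drift k1 k2 k3 y $ i))
        + (\<Sum>i\<in>UNIV. \<Sum>j\<in>UNIV. D2 y $ i $ j * (expectation (\<lambda>\<omega>. d \<omega> $ i * d \<omega> $ j) - 2 * t * S $ i $ j)) / 2 + expectation R"
      proof -
        have e1: "(\<Sum>i\<in>UNIV. D y $ i * (expectation (\<lambda>\<omega>. d \<omega> $ i) - t * drift k1 k2 k3 y $ i)) =
            (\<Sum>i\<in>UNIV. D y $ i * expectation (\<lambda>\<omega>. d \<omega> $ i)) - t * (\<Sum>i\<in>UNIV. D y $ i * drift k1 k2 k3 y $ i)"
          by (simp add: right_diff_distrib sum_subtractf sum_distrib_left mult.left_commute)
        have e2: "(\<Sum>i\<in>UNIV. \<Sum>j\<in>UNIV. D2 y $ i $ j * (expectation (\<lambda>\<omega>. d \<omega> $ i * d \<omega> $ j) - 2 * t * S $ i $ j)) =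
            (\<Sum>i\<in>UNIV. \<Sum>j\<in>UNIV. D2 y $ i $ j * expectation (\<lambda>\<omega>. d \<omega> $ i * d \<omega> $ j))
            - 2 * t * (\<Sum>i\<in>UNIV. \<Sum>j\<in>UNIV. D2 y $ i $ j * S $ i $ j)"
          by (simp add: right_diff_distrib sum_subtractf sum_distrib_left mult.left_commute)
        show ?thesis
          unfolding Pe ED ED2 L_as_sum S_def[symmetric] e1 e2 by (simp add: diff_divide_distrib distrib_left)
      qed
      have s1: "\<bar>\<Sum>i\<in>UNIV. D y $ i * (expectation (\<lambda>\<omega>. d \<omega> $ i) - t * drift k1 k2 k3 y $ i)\<bar> \<le> 3 * (l * ((Cr + 1) * (1 + norm y) * e))"
      proof -
        have "\<bar>D y $ i * (expectation (\<lambda>\<omega>. d \<omega> $ i) - t * drift k1 k2 k3 y $ i)\<bar> \<le> l * ((Cr + 1) * (1 + norm y) * e)" for i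
          unfolding abs_mult by (intro mult_mono Dc m1) (use l0 in auto)
        from abs_sum3_le[OF this] show ?thesis by simp
      qed
      have s2: "\<bar>\<Sum>i\<in>UNIV. \<Sum>j\<in>UNIV. D2 y $ i $ j * (expectation (\<lambda>\<omega>. d \<omega> $ i * d \<omega> $ j) - 2 * t * S $ i $ j)\<bar> \<le> 9 * (C2 * ((8 + 2 * C\<rho>) * Q y * e))"
      proof -
        have 1: "\<bar>D2 y $ i $ j * (expectation (\<lambda>\<omega>. d \<omega> $ i * d \<omega> $ j) - 2 * t * S $ i $ j)\<bar> \<le> C2 * ((8 + 2 * C\<rho>) * Q y * e)" for i j
          unfolding abs_mult by (intro mult_mono form_le_component[OF C2] m2) (use C20 in auto)
        have "\<bar>\<Sum>j\<in>UNIV. D2 y $ i $ j * (expectation (\<lambda>\<omega>. d \<omega> $ i * d \<omega> $ j) - 2 * t * S $ i $ j)\<bar> \<le> 3 * (C2 * ((8 + 2 * C\<rho>) * Q y * e))" for i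
          by (rule abs_sum3_le[OF 1])
        from abs_sum3_le[OF this] show ?thesis by simp
      qed
      have "\<bar>P t \<psi> y - \<psi> y - t * L y (D y) (D2 y)\<bar> \<le> 3 * (l * ((Cr + 1) * (1 + norm y) * e)) + 9 * (C2 * ((8 + 2 * C\<rho>) * Q y * e)) / 2
        + (2 * C3 * (24 * Q y + 9 * (3072 * (Q y)\<^sup>2)) + 4 * C2 * (3 * (C\<rho> * Q y))) * e"
        unfolding eq using s1 s2 ER by linarith
      also have "\<dots> = A y * e" by (simp add: A_def algebra_simps)
      finally show ?thesis .
    qed
    have second: "\<bar>P t \<psi> y - \<psi> y\<bar> \<le> B * Q y * t"
    proof -
      \<comment> \<open>Only the first-order term is subtracted here: the remainder is then
        quadratic in the displacement, and its expectation grows only quadratically in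
        \<open>y\<close>.\<close>
      define R0 where "R0 \<omega> = \<psi> (Y y t \<omega>) - \<psi> y - D y \<bullet> d \<omega>" for \<omega>
      have R0b: "\<bar>R0 \<omega>\<bar> \<le> C2 * (norm (d \<omega>))\<^sup>2" for \<omega>
      proof -
        obtain s where s: "\<psi> (y + d \<omega>) = \<psi> y + D y \<bullet> d \<omega> + d \<omega> \<bullet> (D2 (y + s *\<^sub>R d \<omega>) *v d \<omega>) / 2"
          using C2diff_taylor[OF C2diff] by metis
        have "\<bar>d \<omega> \<bullet> (D2 (y + s *\<^sub>R d \<omega>) *v d \<omega>)\<bar> \<le> C2 * (norm (d \<omega>))\<^sup>2"
          using form_leD[OF C2] by (simp add: power2_eq_square mult.assoc)
        then show ?thesis using s C20 by (simp add: R0_def d_def)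
      qed
      have nd: "(norm (d \<omega>))\<^sup>2 = (d \<omega> $ 1)\<^sup>2 + (d \<omega> $ 2)\<^sup>2 + (d \<omega> $ 3)\<^sup>2" for \<omega> by (rule norm3)
      have iR0: "integrable M R0" unfolding R0_def[abs_def] using i\<psi> iD by simp
      have ind: "integrable M (\<lambda>\<omega>. C2 * (norm (d \<omega>))\<^sup>2)" unfolding nd using id by simp
      have "\<bar>expectation R0\<bar> \<le> expectation (\<lambda>\<omega>. \<bar>R0 \<omega>\<bar>)" by (rule integral_abs_bound)
      also have "\<dots> \<le> expectation (\<lambda>\<omega>. C2 * (norm (d \<omega>))\<^sup>2)"
        by (rule integral_mono) (use iR0 ind R0b in auto)
      also have "\<dots> = C2 * (expectation (\<lambda>\<omega>. (d \<omega> $ 1)\<^sup>2) + expectation (\<lambda>\<omega>. (d \<omega> $ 2)\<^sup>2) + expectation (\<lambda>\<omega>. (d \<omega> $ 3)\<^sup>2))"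
        unfolding nd using id by simp
      also have "\<dots> \<le> C2 * (Cx * Q y * t + Cx * Q y * t + Cx * Q y * t)"
        using D1 C20 by (intro mult_left_mono add_mono) (auto simp: L2le_def)
      finally have r: "\<bar>expectation R0\<bar> \<le> C2 * (3 * Cx) * Q y * t" by (simp add: algebra_simps)
      have m1': "\<bar>expectation (\<lambda>\<omega>. d \<omega> $ c)\<bar> \<le> (km + (Cr + 1)) * (2 * Q y * t)" for c
      proof -
        have "\<bar>drift k1 k2 k3 y $ c\<bar> \<le> km * norm y"
          using component_le_norm_cart[of "drift k1 k2 k3 y" c] drift_norm[of y] by linarith
        also have "\<dots> \<le> km * (2 * Q y)" using nQ[of y] km_pos norm_ge_zero[of y] by (intro mult_left_mono) linarith+
        finally have b: "t * \<bar>drift k1 k2 k3 y $ c\<bar> \<le> t * (km * (2 * Q y))" using t by (intro mult_left_mono) auto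
        have "(Cr + 1) * (1 + norm y) * e \<le> (Cr + 1) * (2 * Q y) * t"
          using nQ[of y] et e0 Cr Q1[of y] by (intro mult_mono) auto
        then have "\<bar>expectation (\<lambda>\<omega>. d \<omega> $ c)\<bar> \<le> t * (km * (2 * Q y)) + (Cr + 1) * (2 * Q y) * t"
          using m1[of c] b t abs_mult[of t "drift k1 k2 k3 y $ c"] by linarith
        then show ?thesis by (simp add: algebra_simps)
      qed
      have s: "\<bar>expectation (\<lambda>\<omega>. D y \<bullet> d \<omega>)\<bar> \<le> 3 * (l * ((km + (Cr + 1)) * (2 * Q y * t)))"
      proof -
        have "\<bar>D y $ i * expectation (\<lambda>\<omega>. d \<omega> $ i)\<bar> \<le> l * ((km + (Cr + 1)) * (2 * Q y * t))" for i
          unfolding abs_mult by (intro mult_mono Dc m1') (use l0 in auto)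
        from abs_sum3_le[OF this] show ?thesis unfolding ED .
      qed
      have "P t \<psi> y - \<psi> y = expectation (\<lambda>\<omega>. D y \<bullet> d \<omega>) + expectation R0"
        unfolding R0_def[abs_def] P_def using i\<psi> iD by (simp add: prob_space)
      then have "\<bar>P t \<psi> y - \<psi> y\<bar> \<le> 3 * (l * ((km + (Cr + 1)) * (2 * Q y * t))) + C2 * (3 * Cx) * Q y * t"
        using s r by linarith
      also have "\<dots> = B * Q y * t" by (simp add: B_def algebra_simps)
      finally show ?thesis .
    qed
    show ?thesis using first second by (simp add: e_def)
  qed
  show thesis by (rule that[OF B0, of A]) (use main in \<open>auto simp: Q_def\<close>)
qed

end

section \<open>Invariance for Lipschitz functions and for the generator\<close>

context stationary
begin

interpretation mu: prob_space \<mu> using inv by (simp add: invariant_probability_def)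

lemma norm_integrable: "integrable \<mu> norm"
proof -
  have "mu.L2le norm (\<integral>y. (norm y)\<^sup>2 \<partial>\<mu>)" using second_moment by (simp add: mu.L2le_def)
  then show ?thesis by (rule mu.L2le_expectation(1))
qed

lemma lip_integrable:
  assumes lip: "\<And>x y. \<bar>\<psi> x - \<psi> y\<bar> \<le> l * norm (x - y)"
  shows "integrable \<mu> \<psi>"
proof (rule Bochner_Integration.integrable_bound)
  show "integrable \<mu> (\<lambda>y. \<bar>\<psi> 0\<bar> + l * norm y)" using norm_integrable by simp
  show "\<psi> \<in> borel_measurable \<mu>" using lip_measurable[OF lip] by simp
  show "AE y in \<mu>. norm (\<psi> y) \<le> norm (\<bar>\<psi> 0\<bar> + l * norm y)"
  proof (rule AE_I2)
    fix y
    have "\<bar>\<psi> y\<bar> \<le> \<bar>\<psi> 0\<bar> + l * norm y" using lip[of y 0] by simp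
    then show "norm (\<psi> y) \<le> norm (\<bar>\<psi> 0\<bar> + l * norm y)" by simp
  qed
qed

text \<open>Clamping \<psi> to the interval from \<open>- n\<close> to \<open>n\<close> preserves
  its Lipschitz constant and makes it bounded, so that invariance applies. Dominated convergence is
  then used over \<omega> as well as under \<mu>.\<close>

lemma lip_invariance:
  assumes t: "0 \<le> t" "t \<le> 1" and lip: "\<And>x y. \<bar>\<psi> x - \<psi> y\<bar> \<le> l * norm (x - y)"
  shows "integrable \<mu> (P t \<psi>)" "(\<integral>y. P t \<psi> y \<partial>\<mu>) = (\<integral>y. \<psi> y \<partial>\<mu>)"
proof -
  have \<psi>m: "\<psi> \<in> borel_measurable borel" by (rule lip_measurable[OF lip])
  have iY: "integrable M (\<lambda>\<omega>. \<psi> (Y y t \<omega>))" for y by (rule lip_Y_integrable[OF t \<psi>m lip])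
  have P_l: "\<bar>P t \<psi> y - P t \<psi> z\<bar> \<le> l * (3 * (Cd + 1)) * norm (y - z)" for y z
    by (rule P_lip[OF t lip iY])
  show iP: "integrable \<mu> (P t \<psi>)" by (rule lip_integrable[OF P_l])
  define g where "g n y = max (- real n) (min (real n) (\<psi> y))" for n y
  have gm: "g n \<in> borel_measurable borel" for n unfolding g_def[abs_def] using \<psi>m by measurable
  have gn: "\<bar>g n y\<bar> \<le> real n" for n y by (auto simp: g_def)
  have gl: "\<bar>g n x - g n y\<bar> \<le> l * norm (x - y)" for n x y using lip[of x y] unfolding g_def by linarith
  have g\<psi>: "\<bar>g n y\<bar> \<le> \<bar>\<psi> y\<bar>" for n y unfolding g_def by linarith
  have glim: "(\<lambda>n. g n y) \<longlonglongrightarrow> \<psi> y" for y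
  proof (rule tendsto_eventually)
    obtain k :: nat where "\<bar>\<psi> y\<bar> \<le> k" using real_arch_simple by blast
    then show "\<forall>\<^sub>F n in sequentially. g n y = \<psi> y"
      by (intro eventually_sequentiallyI[of k]) (auto simp: g_def)
  qed
  have iYa: "integrable M (\<lambda>\<omega>. \<bar>\<psi> (Y y t \<omega>)\<bar>)" for y using iY by (rule integrable_abs)
  have igY: "integrable M (\<lambda>\<omega>. g n (Y y t \<omega>))" for n y by (rule bounded_Y_integrable[OF t(1) gm gn])
  have Plim: "(\<lambda>n. P t (g n) y) \<longlonglongrightarrow> P t \<psi> y" for y
    unfolding P_def
  proof (rule integral_dominated_convergence[OF _ _ iYa])
    show "(\<lambda>\<omega>. \<psi> (Y y t \<omega>)) \<in> borel_measurable M" "(\<lambda>\<omega>. g n (Y y t \<omega>)) \<in> borel_measurable M" for n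
      using iY igY by auto
  qed (use glim g\<psi> in auto)
  have lip_abs: "\<bar>\<bar>\<psi> x\<bar> - \<bar>\<psi> y\<bar>\<bar> \<le> l * norm (x - y)" for x y using lip[of x y] by linarith
  have iPa: "integrable \<mu> (P t (\<lambda>y. \<bar>\<psi> y\<bar>))"
    by (rule lip_integrable[OF P_lip[OF t lip_abs iYa]])
  have "(\<lambda>n. \<integral>y. P t (g n) y \<partial>\<mu>) \<longlonglongrightarrow> (\<integral>y. P t \<psi> y \<partial>\<mu>)"
  proof (rule integral_dominated_convergence[OF _ _ iPa])
    show "P t \<psi> \<in> borel_measurable \<mu>" using iP by auto
    show "P t (g n) \<in> borel_measurable \<mu>" for n
      using lip_integrable[OF P_lip[OF t gl igY]] by auto
    show "AE y in \<mu>. norm (P t (g n) y) \<le> P t (\<lambda>y. \<bar>\<psi> y\<bar>) y" for n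
    proof (rule AE_I2)
      fix y
      have "\<bar>P t (g n) y\<bar> \<le> expectation (\<lambda>\<omega>. \<bar>g n (Y y t \<omega>)\<bar>)" unfolding P_def by (rule integral_abs_bound)
      also have "\<dots> \<le> P t (\<lambda>y. \<bar>\<psi> y\<bar>) y"
        unfolding P_def by (rule integral_mono[OF integrable_abs[OF igY] iYa g\<psi>])
      finally show "norm (P t (g n) y) \<le> P t (\<lambda>y. \<bar>\<psi> y\<bar>) y" by simp
    qed
  qed (use Plim in auto)
  moreover have "(\<integral>y. P t (g n) y \<partial>\<mu>) = (\<integral>y. g n y \<partial>\<mu>)" for n
    by (rule invariance[OF t(1) gm]) (use gn in \<open>auto intro!: boundedI[where B="real n"]\<close>)
  moreover have "(\<lambda>n. \<integral>y. g n y \<partial>\<mu>) \<longlonglongrightarrow> (\<integral>y. \<psi> y \<partial>\<mu>)"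
  proof (rule integral_dominated_convergence)
    show "integrable \<mu> (\<lambda>y. \<bar>\<psi> y\<bar>)" using lip_integrable[OF lip] by (rule integrable_abs)
    show "\<psi> \<in> borel_measurable \<mu>" "g n \<in> borel_measurable \<mu>" for n using \<psi>m gm by auto
  qed (use glim g\<psi> in auto)
  ultimately show "(\<integral>y. P t \<psi> y \<partial>\<mu>) = (\<integral>y. \<psi> y \<partial>\<mu>)"
    using LIMSEQ_unique by simp
qed

text \<open>By invariance the quotients \<open>(P t \<psi> - \<psi>) / t\<close> have integral 0.
  They tend to \<open>L \<psi>\<close> pointwise and are dominated by a multiple of
  \<open>1 + (norm y)\<^sup>2\<close>, which is integrable by \<open>second_moment\<close>.\<close>

theorem stationary_generator:
  assumes C: "C21 \<psi> D D2 C2 C3" and lip: "\<And>x y. \<bar>\<psi> x - \<psi> y\<bar> \<le> l * norm (x - y)"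
  shows "integrable \<mu> (\<lambda>y. L y (D y) (D2 y))" "(\<integral>y. L y (D y) (D2 y) \<partial>\<mu>) = 0"
proof -
  obtain A B where B: "0 \<le> B"
    and A: "\<And>t y. 0 < t \<Longrightarrow> t \<le> 1 \<Longrightarrow> \<bar>P t \<psi> y - \<psi> y - t * L y (D y) (D2 y)\<bar> \<le> A y * (t * sqrt t)"
    and Bt: "\<And>t y. 0 < t \<Longrightarrow> t \<le> 1 \<Longrightarrow> \<bar>P t \<psi> y - \<psi> y\<bar> \<le> B * (1 + (norm y)\<^sup>2) * t"
    using short_time_expansion[OF C lip] by metis
  define t where "t n = 1 / real (Suc n)" for n
  have t: "0 < t n" "t n \<le> 1" for n by (auto simp: t_def)
  have t0: "t \<longlonglongrightarrow> 0" unfolding t_def[abs_def] using LIMSEQ_inverse_real_of_nat by (simp add: inverse_eq_divide)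
  define f where "f n y = (P (t n) \<psi> y - \<psi> y) / t n" for n y
  have i\<psi>: "integrable \<mu> \<psi>" by (rule lip_integrable[OF lip])
  have iP: "integrable \<mu> (P (t n) \<psi>)" for n by (rule lip_invariance(1)[OF _ t(2) lip]) (use t[of n] in simp)
  have fi: "integrable \<mu> (f n)" for n unfolding f_def[abs_def] using i\<psi> iP by simp
  have "(\<integral>y. P (t n) \<psi> y \<partial>\<mu>) = (\<integral>y. \<psi> y \<partial>\<mu>)" for n
    by (rule lip_invariance(2)[OF _ t(2) lip]) (use t[of n] in simp)
  then have f0: "(\<integral>y. f n y \<partial>\<mu>) = 0" for n unfolding f_def using i\<psi> iP by simp
  have flim: "(\<lambda>n. f n y) \<longlonglongrightarrow> L y (D y) (D2 y)" for y
  proof -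
    have "(\<lambda>n. f n y - L y (D y) (D2 y)) \<longlonglongrightarrow> 0"
    proof (rule Lim_null_comparison)
      have "norm (f n y - L y (D y) (D2 y)) \<le> A y * sqrt (t n)" for n
      proof -
        have "f n y - L y (D y) (D2 y) = (P (t n) \<psi> y - \<psi> y - t n * L y (D y) (D2 y)) / t n"
          using t[of n] by (simp add: f_def diff_divide_distrib)
        then have "norm (f n y - L y (D y) (D2 y)) = \<bar>P (t n) \<psi> y - \<psi> y - t n * L y (D y) (D2 y)\<bar> / t n"
          using t(1)[of n] by simp
        also have "\<dots> \<le> A y * (t n * sqrt (t n)) / t n"
          using A[OF t, of n y] t(1)[of n] by (intro divide_right_mono) auto
        finally show ?thesis using t(1)[of n] by simp
      qed
      then show "\<forall>\<^sub>F n in sequentially. norm (f n y - L y (D y) (D2 y)) \<le> A y * sqrt (t n)" by simp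
      have "(\<lambda>n. A y * sqrt (t n)) \<longlonglongrightarrow> A y * sqrt 0" by (intro tendsto_intros t0)
      then show "(\<lambda>n. A y * sqrt (t n)) \<longlonglongrightarrow> 0" by simp
    qed
    then show ?thesis by (simp add: LIM_zero_iff)
  qed
  have w: "integrable \<mu> (\<lambda>y. B * (1 + (norm y)\<^sup>2))" using second_moment by simp
  have fw: "norm (f n y) \<le> B * (1 + (norm y)\<^sup>2)" for n y
  proof -
    have "\<bar>P (t n) \<psi> y - \<psi> y\<bar> / t n \<le> B * (1 + (norm y)\<^sup>2) * t n / t n"
      using Bt[OF t, of n y] t(1)[of n] by (intro divide_right_mono) auto
    then show ?thesis using t(1)[of n] by (simp add: f_def)
  qed
  have Lm: "(\<lambda>y. L y (D y) (D2 y)) \<in> borel_measurable \<mu>"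
    by (rule borel_measurable_LIMSEQ_real[where u=f]) (use flim fi in auto)
  show "integrable \<mu> (\<lambda>y. L y (D y) (D2 y))"
    by (rule integrable_dominated_convergence[where s=f, OF Lm _ w]) (use flim fw fi in auto)
  have "(\<lambda>n. \<integral>y. f n y \<partial>\<mu>) \<longlonglongrightarrow> (\<integral>y. L y (D y) (D2 y) \<partial>\<mu>)"
    by (rule integral_dominated_convergence[where s=f, OF Lm _ w]) (use flim fw fi in auto)
  then show "(\<integral>y. L y (D y) (D2 y) \<partial>\<mu>) = 0" using f0 by (simp add: LIMSEQ_const_iff)
qed

end

section \<open>Mollification\<close>

text \<open>The cube makes the kernel \<open>C\<^sup>2\<close>; it is normalised only in \<open>mollify\<close>.\<close>

definition bump :: "real \<Rightarrow> real^3 \<Rightarrow> real" where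
  "bump \<epsilon> x = (max 0 (\<epsilon>\<^sup>2 - (norm x)\<^sup>2)) ^ 3"

definition bump1 :: "real \<Rightarrow> 3 \<Rightarrow> real^3 \<Rightarrow> real" where
  "bump1 \<epsilon> i x = - 6 * (max 0 (\<epsilon>\<^sup>2 - (norm x)\<^sup>2))\<^sup>2 * x $ i"

definition bump2 :: "real \<Rightarrow> 3 \<Rightarrow> 3 \<Rightarrow> real^3 \<Rightarrow> real" where
  "bump2 \<epsilon> i j x = 24 * max 0 (\<epsilon>\<^sup>2 - (norm x)\<^sup>2) * x $ i * x $ j
     - (if i = j then 6 * (max 0 (\<epsilon>\<^sup>2 - (norm x)\<^sup>2))\<^sup>2 else 0)"

lemma DERIV_max0_power:
  fixes s :: real
  assumes "2 \<le> n"
  shows "((\<lambda>s. (max 0 s) ^ n) has_real_derivative real n * (max 0 s) ^ (n - 1)) (at s)"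
proof -
  consider "s < 0" | "s > 0" | "s = 0" by linarith
  then show ?thesis
  proof cases
    case 1
    have "((\<lambda>s. 0) has_real_derivative 0) (at s)" by simp
    then have "((\<lambda>s. (max 0 s) ^ n) has_real_derivative 0) (at s)"
      by (rule has_field_derivative_transform_within[where d="- s"]) (use 1 assms in \<open>auto simp: dist_real_def\<close>)
    then show ?thesis using 1 assms by (simp add: zero_power)
  next
    case 2
    have "((\<lambda>s. s ^ n) has_real_derivative real n * s ^ (n - 1)) (at s)"
      by (auto intro!: derivative_eq_intros)
    then have "((\<lambda>s. (max 0 s) ^ n) has_real_derivative real n * s ^ (n - 1)) (at s)"
      by (rule has_field_derivative_transform_within[where d=s]) (use 2 in \<open>auto simp: dist_real_def\<close>)
    then show ?thesis using 2 by simp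
  next
    case 3
    have "(\<lambda>h::real. (max 0 (0 + h)) ^ n / h) \<midarrow>0\<rightarrow> 0"
    proof (rule Lim_null_comparison)
      have "norm ((max 0 (0 + h)) ^ n / h) \<le> \<bar>h\<bar> ^ (n - 1)" for h :: real
      proof (cases "h > 0")
        case True
        then show ?thesis using assms by (simp add: power_diff)
      next
        case False
        then show ?thesis using assms by (simp add: max_def zero_power)
      qed
      then show "\<forall>\<^sub>F h in at 0. norm ((max 0 (0 + h)) ^ n / h) \<le> \<bar>h\<bar> ^ (n - 1)" by simp
      have "((\<lambda>h::real. \<bar>h\<bar> ^ (n - 1)) \<longlongrightarrow> \<bar>0\<bar> ^ (n - 1)) (at 0)" by (intro tendsto_intros)
      then show "((\<lambda>h::real. \<bar>h\<bar> ^ (n - 1)) \<longlongrightarrow> 0) (at 0)" using assms by (simp add: power_0_left)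
    qed
    then show ?thesis using 3 assms by (simp add: DERIV_def power_0_left)
  qed
qed

lemma GDERIV_radial:
  assumes "2 \<le> n"
  shows "((\<lambda>x::real^3. (max 0 (\<epsilon>\<^sup>2 - (norm x)\<^sup>2)) ^ n) has_derivative
    (\<lambda>h. - 2 * real n * (max 0 (\<epsilon>\<^sup>2 - (norm x)\<^sup>2)) ^ (n - 1) * (x \<bullet> h))) (at x)"
proof -
  have "((\<lambda>x::real^3. \<epsilon>\<^sup>2 - (norm x)\<^sup>2) has_derivative (\<lambda>h. - 2 * (x \<bullet> h))) (at x)"
    unfolding power2_norm_eq_inner by (auto intro!: derivative_eq_intros simp: inner_commute)
  from DERIV_compose_FDERIV[OF DERIV_max0_power[OF assms] this]
  show ?thesis by (rule has_derivative_eq_rhs) (simp add: fun_eq_iff)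
qed

lemma bump_deriv: "(bump \<epsilon> has_derivative (\<lambda>h. \<Sum>i\<in>UNIV. h $ i * bump1 \<epsilon> i x)) (at x)"
  unfolding bump_def[abs_def]
  by (rule has_derivative_eq_rhs[OF GDERIV_radial]) (auto simp: fun_eq_iff bump1_def inner3 sum_3 algebra_simps)

lemma bump1_deriv: "(bump1 \<epsilon> i has_derivative (\<lambda>h. \<Sum>j\<in>UNIV. h $ j * bump2 \<epsilon> i j x)) (at x)"
proof -
  have "((\<lambda>x. x $ i) has_derivative (\<lambda>h. h $ i)) (at x)"
    by (rule bounded_linear_imp_has_derivative[OF bounded_linear_vec_nth])
  from has_derivative_mult[OF GDERIV_radial[of 2 \<epsilon> x] this]
  have "((\<lambda>x. (- 6) * ((max 0 (\<epsilon>\<^sup>2 - (norm x)\<^sup>2))\<^sup>2 * x $ i)) has_derivative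
    (\<lambda>h. (- 6) * ((max 0 (\<epsilon>\<^sup>2 - (norm x)\<^sup>2))\<^sup>2 * h $ i + (- 2 * real 2 * (max 0 (\<epsilon>\<^sup>2 - (norm x)\<^sup>2)) ^ (2 - 1) * (x \<bullet> h)) * x $ i))) (at x)"
    by (intro has_derivative_mult_right) auto
  moreover have "bump1 \<epsilon> i = (\<lambda>x. (- 6) * ((max 0 (\<epsilon>\<^sup>2 - (norm x)\<^sup>2))\<^sup>2 * x $ i))"
    by (simp add: bump1_def fun_eq_iff)
  moreover have "(\<lambda>h. (- 6) * ((max 0 (\<epsilon>\<^sup>2 - (norm x)\<^sup>2))\<^sup>2 * h $ i + (- 2 * real 2 * (max 0 (\<epsilon>\<^sup>2 - (norm x)\<^sup>2)) ^ (2 - 1) * (x \<bullet> h)) * x $ i))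
     = (\<lambda>h. \<Sum>j\<in>UNIV. h $ j * bump2 \<epsilon> i j x)"
    using exhaust_3[of i] by (auto simp: fun_eq_iff bump2_def inner3 sum_3 algebra_simps)
  ultimately show ?thesis by simp
qed

lemma bump_supp: "\<epsilon> \<le> norm x \<Longrightarrow> 0 \<le> \<epsilon> \<Longrightarrow> bump \<epsilon> x = 0 \<and> bump1 \<epsilon> i x = 0 \<and> bump2 \<epsilon> i j x = 0"
  using power_mono[of \<epsilon> "norm x" 2] by (simp add: bump_def bump1_def bump2_def max_def)

lemma bump_cont: "continuous_on S (bump \<epsilon>)" "continuous_on S (bump1 \<epsilon> i)" "continuous_on S (bump2 \<epsilon> i j)"
proof -
  show "continuous_on S (bump \<epsilon>)" unfolding bump_def[abs_def] by (intro continuous_intros)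
  show "continuous_on S (bump1 \<epsilon> i)" unfolding bump1_def[abs_def] by (intro continuous_intros)
  show "continuous_on S (bump2 \<epsilon> i j)" unfolding bump2_def[abs_def] by (cases "i = j") (auto intro!: continuous_intros)
qed

text \<open>With \<open>y\<close> inside \<open>g\<close>, Lipschitz bounds are immediate;
  \<open>conv_shift\<close> moves it to the kernel for differentiation, and the reflection produces
  the minus sign in the derivative.\<close>

definition conv :: "(real^3 \<Rightarrow> real) \<Rightarrow> (real^3 \<Rightarrow> real) \<Rightarrow> real^3 \<Rightarrow> real" where
  "conv \<kappa> g y = (\<integral>x. g (y + x) * \<kappa> x \<partial>lborel)"

text \<open>Neither sign nor total mass is prescribed, so that \<open>bump1\<close> and
  \<open>bump2\<close>, the derivatives of the bump, qualify too.\<close>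

locale kernel =
  fixes \<epsilon> :: real and \<kappa> :: "real^3 \<Rightarrow> real"
  assumes eps: "0 < \<epsilon>" and \<kappa>_cont: "continuous_on UNIV \<kappa>" and \<kappa>_supp: "\<And>x. \<epsilon> \<le> norm x \<Longrightarrow> \<kappa> x = 0"
begin

lemma supported_integrable:
  fixes f :: "real^3 \<Rightarrow> real"
  assumes "continuous_on UNIV f"
  shows "integrable lborel (\<lambda>x. f x * \<kappa> x)"
proof -
  have c: "continuous_on (cball 0 \<epsilon>) (\<lambda>x. f x * \<kappa> x)"
    by (intro continuous_intros continuous_on_subset[OF assms] continuous_on_subset[OF \<kappa>_cont]) auto
  have "integrable lborel (\<lambda>x. indicator (cball 0 \<epsilon>) x *\<^sub>R (f x * \<kappa> x))"
    using borel_integrable_compact[OF compact_cball c] by simp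
  moreover have "(\<lambda>x. indicator (cball 0 \<epsilon>) x *\<^sub>R (f x * \<kappa> x)) = (\<lambda>x. f x * \<kappa> x)"
    using \<kappa>_supp by (auto simp: indicator_def fun_eq_iff)
  ultimately show ?thesis by simp
qed

lemma conv_integrable:
  assumes "continuous_on UNIV g"
  shows "integrable lborel (\<lambda>x. g (y + x) * \<kappa> x)"
  by (rule supported_integrable) (auto intro!: continuous_on_compose2[OF assms] continuous_intros)

lemma conv_shift:
  assumes g: "continuous_on UNIV g"
  shows "conv \<kappa> g y = (\<integral>z. g z * \<kappa> (z - y) \<partial>lborel)"
proof -
  have "(\<integral>z. g z * \<kappa> (z - y) \<partial>lborel) = (\<integral>z. g z * \<kappa> (z - y) \<partial>(distr lborel borel ((+) y)))"
    by (simp add: lborel_distr_plus)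
  also have "\<dots> = (\<integral>x. g (y + x) * \<kappa> (y + x - y) \<partial>lborel)"
  proof (rule integral_distr)
    show "(\<lambda>z. g z * \<kappa> (z - y)) \<in> borel_measurable borel"
      by (intro borel_measurable_continuous_onI continuous_intros g continuous_on_compose2[OF \<kappa>_cont]) auto
  qed simp
  finally show ?thesis by (simp add: conv_def)
qed

lemma conv_lip:
  assumes g: "\<And>x y. \<bar>g x - g y\<bar> \<le> l * norm (x - y)" and gc: "continuous_on UNIV g"
  shows "\<bar>conv \<kappa> g y - conv \<kappa> g z\<bar> \<le> l * (\<integral>x. \<bar>\<kappa> x\<bar> \<partial>lborel) * norm (y - z)"
proof -
  have i: "integrable lborel (\<lambda>x. g (y + x) * \<kappa> x)" for y by (rule conv_integrable[OF gc])
  have ik: "integrable lborel (\<lambda>x. \<bar>\<kappa> x\<bar>)" using supported_integrable[of "\<lambda>_. 1"] by simp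
  have "\<bar>conv \<kappa> g y - conv \<kappa> g z\<bar> = \<bar>\<integral>x. g (y + x) * \<kappa> x - g (z + x) * \<kappa> x \<partial>lborel\<bar>"
    using i by (simp add: conv_def)
  also have "\<dots> \<le> (\<integral>x. \<bar>g (y + x) * \<kappa> x - g (z + x) * \<kappa> x\<bar> \<partial>lborel)" by (rule integral_abs_bound)
  also have "\<dots> \<le> (\<integral>x. l * norm (y - z) * \<bar>\<kappa> x\<bar> \<partial>lborel)"
  proof (rule integral_mono)
    show "integrable lborel (\<lambda>x. l * norm (y - z) * \<bar>\<kappa> x\<bar>)" using ik by simp
    show "integrable lborel (\<lambda>x. \<bar>g (y + x) * \<kappa> x - g (z + x) * \<kappa> x\<bar>)" using i by simp
    fix x
    have "\<bar>g (y + x) * \<kappa> x - g (z + x) * \<kappa> x\<bar> = \<bar>g (y + x) - g (z + x)\<bar> * \<bar>\<kappa> x\<bar>"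
      by (simp add: abs_mult[symmetric] left_diff_distrib)
    also have "\<dots> \<le> l * norm (y - z) * \<bar>\<kappa> x\<bar>"
      using g[of "y + x" "z + x"] by (intro mult_right_mono) auto
    finally show "\<bar>g (y + x) * \<kappa> x - g (z + x) * \<kappa> x\<bar> \<le> l * norm (y - z) * \<bar>\<kappa> x\<bar>" .
  qed
  finally show ?thesis by (simp add: mult_ac)
qed

end

text \<open>Differentiation under the integral sign. \<open>leibniz_rule\<close> works on a box, so
  the integral over the whole space is first replaced by one over a box that contains all the
  relevant supports.\<close>

lemma conv_has_derivative:
  assumes k: "kernel \<epsilon> \<kappa>" "\<And>i. kernel \<epsilon> (\<kappa>' i)"
    and d: "\<And>x. (\<kappa> has_derivative (\<lambda>h. \<Sum>i\<in>UNIV. h $ i * \<kappa>' i x)) (at x)"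
    and g: "continuous_on UNIV g"
  shows "(conv \<kappa> g has_derivative (\<lambda>h. \<Sum>i\<in>UNIV. h $ i * (- conv (\<kappa>' i) g y))) (at y)"
proof -
  interpret kernel \<epsilon> \<kappa> by (rule k)
  \<comment> \<open>The half-width \<open>\<epsilon> + 1\<close> covers the support of the shifted
    kernel for every centre in the unit ball around \<open>y\<close>.\<close>
  define Q where "Q = cbox (y - (\<chi> i. \<epsilon> + 1)) (y + (\<chi> i. \<epsilon> + 1))"
  have inQ: "z \<in> Q" if "norm (z - y) \<le> \<epsilon> + 1" for z
  proof -
    have "\<bar>z $ i - y $ i\<bar> \<le> \<epsilon> + 1" for i
      using component_le_norm_cart[of "z - y" i] that by simp
    then show ?thesis by (auto simp: Q_def mem_box_cart abs_le_iff algebra_simps)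
  qed
  have local: "conv \<kappa>1 g y' = integral Q (\<lambda>z. g z * \<kappa>1 (z - y'))" if k1: "kernel \<epsilon> \<kappa>1" and y': "y' \<in> ball y 1" for \<kappa>1 y'
  proof -
    interpret k1: kernel \<epsilon> \<kappa>1 by (rule k1)
    have c: "continuous_on UNIV (\<lambda>z. g z * \<kappa>1 (z - y'))"
      by (intro continuous_intros g continuous_on_compose2[OF k1.\<kappa>_cont]) auto
    have "set_integrable lborel Q (\<lambda>z. g z * \<kappa>1 (z - y'))"
      unfolding set_integrable_def Q_def using borel_integrable_compact[OF compact_cbox continuous_on_subset[OF c]] by simp
    then have "(LINT z:Q|lborel. g z * \<kappa>1 (z - y')) = integral Q (\<lambda>z. g z * \<kappa>1 (z - y'))"
      by (rule set_borel_integral_eq_integral(2))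
    moreover have "(LINT z:Q|lborel. g z * \<kappa>1 (z - y')) = (\<integral>z. g z * \<kappa>1 (z - y') \<partial>lborel)"
      unfolding set_lebesgue_integral_def
    proof (rule Bochner_Integration.integral_cong[OF refl])
      fix z
      show "indicator Q z *\<^sub>R (g z * \<kappa>1 (z - y')) = g z * \<kappa>1 (z - y')"
      proof (cases "z \<in> Q")
        case False
        then have "\<epsilon> + 1 < norm (z - y)" using inQ[of z] by fastforce
        moreover have "norm (z - y) \<le> norm (z - y') + norm (y' - y)" by (metis diff_add_cancel norm_triangle_ineq add_diff_eq diff_diff_eq2)
        moreover have "norm (y' - y) < 1" using y' by (simp add: dist_norm norm_minus_commute)
        ultimately have "\<epsilon> \<le> norm (z - y')" by linarith
        then show ?thesis using False k1.\<kappa>_supp by simp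
      qed simp
    qed
    ultimately show ?thesis by (simp add: k1.conv_shift[OF g])
  qed
  define fx where "fx y' z = blinfun_inner_left (\<chi> i. - (g z * \<kappa>' i (z - y')))" for y' z :: "real^3"
  have fx_apply: "blinfun_apply (fx y' z) h = (\<Sum>i\<in>UNIV. h $ i * (- (g z * \<kappa>' i (z - y'))))" for y' z h
    by (simp add: fx_def inner_vec_def)
  have ck: "continuous_on UNIV (\<kappa>' i)" for i using k(2) by (simp add: kernel_def)
  have cont_fx: "continuous_on (ball y 1 \<times> Q) (\<lambda>(y', z). fx y' z)"
    unfolding fx_def split_beta
    by (intro bounded_linear.continuous_on[OF bounded_linear_blinfun_inner_left] continuous_on_vec_lambda continuous_intros
        continuous_on_compose2[OF g] continuous_on_compose2[OF ck]) auto
  have "((\<lambda>y'. integral Q (\<lambda>z. g z * \<kappa> (z - y'))) has_derivative blinfun_apply (integral Q (fx y))) (at y within ball y 1)"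
    unfolding Q_def
  proof (rule leibniz_rule)
    show "((\<lambda>y'. g z * \<kappa> (z - y')) has_derivative blinfun_apply (fx y' z)) (at y' within ball y 1)" for y' z
    proof -
      have "((\<lambda>y'. z - y') has_derivative (\<lambda>h. - h)) (at y' within ball y 1)" by (auto intro!: derivative_eq_intros)
      from has_derivative_compose[OF this d]
      have "((\<lambda>y'. \<kappa> (z - y')) has_derivative (\<lambda>h. \<Sum>i\<in>UNIV. (- h) $ i * \<kappa>' i (z - y'))) (at y' within ball y 1)" .
      from has_derivative_mult_right[OF this, of "g z"]
      show ?thesis
        by (rule has_derivative_eq_rhs) (simp add: fun_eq_iff fx_apply sum_distrib_left sum_negf mult_ac)
    qed
    show "(\<lambda>z. g z * \<kappa> (z - y')) integrable_on cbox (y - (\<chi> i. \<epsilon> + 1)) (y + (\<chi> i. \<epsilon> + 1))" for y'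
      by (intro integrable_continuous continuous_intros continuous_on_subset[OF g] continuous_on_compose2[OF \<kappa>_cont]) auto
    show "continuous_on (ball y 1 \<times> cbox (y - (\<chi> i. \<epsilon> + 1)) (y + (\<chi> i. \<epsilon> + 1))) (\<lambda>(x, t). fx x t)"
      using cont_fx by (simp add: Q_def)
  qed auto
  then have "((\<lambda>y'. integral Q (\<lambda>z. g z * \<kappa> (z - y'))) has_derivative blinfun_apply (integral Q (fx y))) (at y)"
    by (simp add: at_within_open[of y "ball y 1"])
  then have D: "(conv \<kappa> g has_derivative blinfun_apply (integral Q (fx y))) (at y)"
    by (rule has_derivative_transform_within_open[OF _ open_ball[of y 1]]) (use local[OF k(1)] in auto)
  have "blinfun_apply (integral Q (fx y)) h = (\<Sum>i\<in>UNIV. h $ i * (- conv (\<kappa>' i) g y))" for h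
  proof -
    have cz: "continuous_on Q (fx y)"
    proof -
      have "continuous_on Q (\<lambda>z. (\<lambda>(y', z). fx y' z) (y, z))"
        by (rule continuous_on_compose2[OF cont_fx]) (auto intro!: continuous_intros)
      then show ?thesis by simp
    qed
    have "blinfun_apply (integral Q (fx y)) h = integral Q (\<lambda>z. \<Sum>i\<in>UNIV. h $ i * (- (g z * \<kappa>' i (z - y))))"
      using blinfun_apply_integral[of "fx y" Q h] integrable_continuous[of _ _ "fx y"] cz by (simp add: fx_apply Q_def)
    also have "\<dots> = (\<Sum>i\<in>UNIV. integral Q (\<lambda>z. h $ i * (- (g z * \<kappa>' i (z - y)))))"
      unfolding Q_def by (intro integral_sum integrable_continuous continuous_intros continuous_on_subset[OF g] continuous_on_compose2[OF ck]) auto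
    also have "\<dots> = (\<Sum>i\<in>UNIV. h $ i * (- conv (\<kappa>' i) g y))"
      using local[OF k(2), of y] by simp
    finally show ?thesis .
  qed
  then have "blinfun_apply (integral Q (fx y)) = (\<lambda>h. \<Sum>i\<in>UNIV. h $ i * (- conv (\<kappa>' i) g y))" by (simp add: fun_eq_iff)
  then show ?thesis using D by simp
qed

definition mollify :: "real \<Rightarrow> (real^3 \<Rightarrow> real) \<Rightarrow> real^3 \<Rightarrow> real" where
  "mollify \<epsilon> g y = conv (bump \<epsilon>) g y / (\<integral>x. bump \<epsilon> x \<partial>lborel)"

context
  fixes \<epsilon> :: real assumes eps: "0 < \<epsilon>"
begin

lemma kernels: "kernel \<epsilon> (bump \<epsilon>)" "kernel \<epsilon> (bump1 \<epsilon> i)" "kernel \<epsilon> (bump2 \<epsilon> i j)"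
  using eps bump_cont[where S=UNIV] bump_supp[of \<epsilon>] by (auto simp: kernel_def)

interpretation b: kernel \<epsilon> "bump \<epsilon>" by (rule kernels)

lemma bump_nonneg: "0 \<le> bump \<epsilon> x" by (simp add: bump_def)

lemma bump_integral_pos: "0 < (\<integral>x. bump \<epsilon> x \<partial>lborel)"
proof -
  have i: "integrable lborel (bump \<epsilon>)" using b.supported_integrable[of "\<lambda>_. 1"] by simp
  have "(\<integral>x. bump \<epsilon> x \<partial>lborel) \<noteq> 0"
  proof
    assume "(\<integral>x. bump \<epsilon> x \<partial>lborel) = 0"
    then have "AE x in lborel. bump \<epsilon> x = 0"
      using integral_nonneg_eq_0_iff_AE[OF i] bump_nonneg by simp
    then have "AE x in lborel. x \<notin> ball (0::real^3) \<epsilon>"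
    proof eventually_elim
      case (elim x)
      have "0 < bump \<epsilon> x" if "x \<in> ball 0 \<epsilon>"
      proof -
        have "(norm x)\<^sup>2 < \<epsilon>\<^sup>2" using that by (intro power_strict_mono) auto
        then show ?thesis by (simp add: bump_def)
      qed
      then show ?case using elim by auto
    qed
    then have "emeasure lborel (ball (0::real^3) \<epsilon>) = 0"
    proof (subst (asm) AE_iff_measurable[OF _ refl])
      have "{x \<in> space lborel. \<not> x \<notin> ball (0::real^3) \<epsilon>} = ball 0 \<epsilon>" by auto
      then show "emeasure lborel {x \<in> space lborel. \<not> x \<notin> ball (0::real^3) \<epsilon>} = 0 \<Longrightarrow> emeasure lborel (ball (0::real^3) \<epsilon>) = 0"
        by (simp only:)
    qed auto
    then have "measure lborel (ball (0::real^3) \<epsilon>) = 0" by (simp add: measure_def)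
    then show False using content_ball_pos[OF eps, of "0::real^3"] by simp
  qed
  moreover have "0 \<le> (\<integral>x. bump \<epsilon> x \<partial>lborel)" by (rule Bochner_Integration.integral_nonneg) (rule bump_nonneg)
  ultimately show ?thesis by simp
qed

lemma mollify_lip:
  assumes "\<And>x y. \<bar>g x - g y\<bar> \<le> l * norm (x - y)" "continuous_on UNIV g"
  shows "\<bar>mollify \<epsilon> g y - mollify \<epsilon> g z\<bar> \<le> l * norm (y - z)"
proof -
  have "\<bar>mollify \<epsilon> g y - mollify \<epsilon> g z\<bar> = \<bar>conv (bump \<epsilon>) g y - conv (bump \<epsilon>) g z\<bar> / (\<integral>x. bump \<epsilon> x \<partial>lborel)"
    using bump_integral_pos by (simp add: mollify_def diff_divide_distrib[symmetric])
  also have "\<dots> \<le> l * (\<integral>x. \<bar>bump \<epsilon> x\<bar> \<partial>lborel) * norm (y - z) / (\<integral>x. bump \<epsilon> x \<partial>lborel)"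
    using bump_integral_pos by (intro divide_right_mono b.conv_lip assms) auto
  also have "\<dots> = l * norm (y - z)"
    using bump_integral_pos bump_nonneg by simp
  finally show ?thesis .
qed

lemma mollify_close:
  assumes g: "\<And>x y. \<bar>g x - g y\<bar> \<le> l * norm (x - y)" and gc: "continuous_on UNIV g"
  shows "\<bar>mollify \<epsilon> g y - g y\<bar> \<le> l * \<epsilon>"
proof -
  have l0: "0 \<le> l" using g[of "axis 1 1" 0] abs_ge_zero order_trans by fastforce
  define Z where "Z = (\<integral>x. bump \<epsilon> x \<partial>lborel)"
  have Z: "0 < Z" unfolding Z_def by (rule bump_integral_pos)
  have ib: "integrable lborel (bump \<epsilon>)" using b.supported_integrable[of "\<lambda>_. 1"] by simp
  have ig: "integrable lborel (\<lambda>x. g (y + x) * bump \<epsilon> x)" by (rule b.conv_integrable[OF gc])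
  have "conv (bump \<epsilon>) g y - g y * Z = (\<integral>x. g (y + x) * bump \<epsilon> x - g y * bump \<epsilon> x \<partial>lborel)"
    using ig ib by (simp add: conv_def Z_def)
  also have "\<bar>\<dots>\<bar> \<le> (\<integral>x. \<bar>g (y + x) * bump \<epsilon> x - g y * bump \<epsilon> x\<bar> \<partial>lborel)" by (rule integral_abs_bound)
  also have "\<dots> \<le> (\<integral>x. l * \<epsilon> * bump \<epsilon> x \<partial>lborel)"
  proof (rule integral_mono)
    fix x :: "real^3"
    show "\<bar>g (y + x) * bump \<epsilon> x - g y * bump \<epsilon> x\<bar> \<le> l * \<epsilon> * bump \<epsilon> x"
    proof (cases "norm x < \<epsilon>")
      case True
      have "\<bar>g (y + x) - g y\<bar> \<le> l * \<epsilon>"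
        using g[of "y + x" y] True l0 mult_left_mono[of "norm x" \<epsilon> l] by simp
      then have "\<bar>g (y + x) - g y\<bar> * bump \<epsilon> x \<le> l * \<epsilon> * bump \<epsilon> x" by (intro mult_right_mono bump_nonneg)
      then show ?thesis using bump_nonneg[of x] by (simp add: left_diff_distrib[symmetric] abs_mult)
    next
      case False
      then show ?thesis using b.\<kappa>_supp[of x] by simp
    qed
  qed (use ig ib in simp_all)
  also have "\<dots> = l * \<epsilon> * Z" by (simp add: Z_def)
  finally have "\<bar>conv (bump \<epsilon>) g y - g y * Z\<bar> / Z \<le> l * \<epsilon>" using Z by (simp add: divide_le_eq)
  moreover have "mollify \<epsilon> g y - g y = (conv (bump \<epsilon>) g y - g y * Z) / Z"
    using Z by (simp add: mollify_def Z_def field_simps)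
  ultimately show ?thesis using Z by simp
qed

lemma mollify_linear:
  assumes "continuous_on UNIV f" "continuous_on UNIV g"
  shows "mollify \<epsilon> (\<lambda>y. a * f y + c * g y) y = a * mollify \<epsilon> f y + c * mollify \<epsilon> g y"
proof -
  have "conv (bump \<epsilon>) (\<lambda>y. a * f y + c * g y) y = (\<integral>x. a * (f (y + x) * bump \<epsilon> x) + c * (g (y + x) * bump \<epsilon> x) \<partial>lborel)"
    by (simp add: conv_def algebra_simps)
  also have "\<dots> = a * conv (bump \<epsilon>) f y + c * conv (bump \<epsilon>) g y"
    using b.conv_integrable[OF assms(1)] b.conv_integrable[OF assms(2)] by (simp add: conv_def)
  finally show ?thesis by (simp add: mollify_def add_divide_distrib)
qed

text \<open>Since \<open>g\<close> may be unbounded, sizes are not estimated directly: convolution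
  with a kernel inherits the Lipschitz property of \<open>g\<close>. With \<open>bump1\<close> this
  makes the gradient Lipschitz and so bounds the Hessian; with \<open>bump2\<close> it makes the
  Hessian Lipschitz.\<close>

lemma mollify_C21:
  assumes g: "\<And>x y. \<bar>g x - g y\<bar> \<le> l * norm (x - y)" and gc: "continuous_on UNIV g"
  shows "\<exists>D D2 C2 C3. C21 (mollify \<epsilon> g) D D2 C2 C3"
proof -
  define Z where "Z = (\<integral>x. bump \<epsilon> x \<partial>lborel)"
  have Z: "0 < Z" unfolding Z_def by (rule bump_integral_pos)
  define D where "D y = (\<chi> i. - conv (bump1 \<epsilon> i) g y / Z)" for y
  define D2 where "D2 y = (\<chi> i j. conv (bump2 \<epsilon> i j) g y / Z)" for y
  define K1 where "K1 i = (\<integral>x. \<bar>bump1 \<epsilon> i x\<bar> \<partial>lborel)" for i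
  define K2 where "K2 i j = (\<integral>x. \<bar>bump2 \<epsilon> i j x\<bar> \<partial>lborel)" for i j
  have 1: "GDERIV (mollify \<epsilon> g) y :> D y" for y
  proof -
    have "((\<lambda>y. conv (bump \<epsilon>) g y * (1 / Z)) has_derivative (\<lambda>h. (\<Sum>i\<in>UNIV. h $ i * (- conv (bump1 \<epsilon> i) g y)) * (1 / Z))) (at y)"
      by (intro has_derivative_mult_left conv_has_derivative[OF kernels(1) kernels(2) bump_deriv gc])
    moreover have "(\<lambda>y. conv (bump \<epsilon>) g y * (1 / Z)) = mollify \<epsilon> g" by (simp add: mollify_def fun_eq_iff Z_def)
    moreover have "(\<lambda>h. (\<Sum>i\<in>UNIV. h $ i * (- conv (bump1 \<epsilon> i) g y)) * (1 / Z)) = (\<lambda>h. h \<bullet> D y)"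
      by (simp add: fun_eq_iff inner_vec_def sum_divide_distrib D_def)
    ultimately show ?thesis unfolding gderiv_def by simp
  qed
  have Di: "((\<lambda>y. - conv (bump1 \<epsilon> i) g y / Z) has_derivative (\<lambda>h. (D2 y *v h) $ i)) (at y)" for i y
  proof -
    have "((\<lambda>y. conv (bump1 \<epsilon> i) g y * (- 1 / Z)) has_derivative (\<lambda>h. (\<Sum>j\<in>UNIV. h $ j * (- conv (bump2 \<epsilon> i j) g y)) * (- 1 / Z))) (at y)"
      by (intro has_derivative_mult_left conv_has_derivative[OF kernels(2) kernels(3) bump1_deriv gc])
    moreover have "(\<lambda>h. (\<Sum>j\<in>UNIV. h $ j * (- conv (bump2 \<epsilon> i j) g y)) * (- 1 / Z)) = (\<lambda>h. (D2 y *v h) $ i)"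
      by (simp add: fun_eq_iff D2_def matrix_vector_mult_def sum_negf sum_divide_distrib mult.commute)
    ultimately show ?thesis by simp
  qed
  have 2: "(D has_derivative (\<lambda>h. D2 y *v h)) (at y)" for y
    unfolding has_derivative_componentwise_within[of D]
  proof
    fix b :: "real^3" assume "b \<in> Basis"
    then obtain i where b: "b = axis i 1" by (auto simp: Basis_vec_def)
    show "((\<lambda>x. D x \<bullet> b) has_derivative (\<lambda>x. (D2 y *v x) \<bullet> b)) (at y)"
      using Di[of i y] by (simp add: b inner_axis D_def)
  qed
  have e2: "\<bar>(D2 y - D2 z) $ i $ j\<bar> \<le> l * K2 i j / Z * norm (y - z)" for y z i j
  proof -
    interpret k2: kernel \<epsilon> "bump2 \<epsilon> i j" by (rule kernels)
    have "\<bar>(D2 y - D2 z) $ i $ j\<bar> = \<bar>conv (bump2 \<epsilon> i j) g y - conv (bump2 \<epsilon> i j) g z\<bar> / Z"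
      using Z by (simp add: D2_def diff_divide_distrib[symmetric])
    also have "\<dots> \<le> (l * K2 i j * norm (y - z)) / Z"
      unfolding K2_def using Z by (intro divide_right_mono k2.conv_lip g gc) auto
    finally show ?thesis by simp
  qed
  have e1: "\<bar>D2 y $ i $ j\<bar> \<le> l * K1 i / Z" for y i j
  proof -
    interpret k1: kernel \<epsilon> "bump1 \<epsilon> i" by (rule kernels)
    have "\<bar>(- conv (bump1 \<epsilon> i) g u / Z) - (- conv (bump1 \<epsilon> i) g v / Z)\<bar> \<le> (l * K1 i / Z) * norm (u - v)" for u v
    proof -
      have "\<bar>(- conv (bump1 \<epsilon> i) g u / Z) - (- conv (bump1 \<epsilon> i) g v / Z)\<bar> = \<bar>conv (bump1 \<epsilon> i) g u - conv (bump1 \<epsilon> i) g v\<bar> / Z"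
        using Z by (simp add: abs_minus_commute diff_divide_distrib[symmetric])
      also have "\<dots> \<le> (l * K1 i * norm (u - v)) / Z"
        unfolding K1_def using Z by (intro divide_right_mono k1.conv_lip g gc) auto
      finally show ?thesis by simp
    qed
    from has_derivative_lip_bound[OF Di this, of y "axis j 1"]
    show ?thesis by (simp add: matrix_vector_mul_component inner_axis)
  qed
  have "form_le (D2 y) (\<Sum>i\<in>UNIV. \<Sum>j\<in>(UNIV :: 3 set). l * K1 i / Z)" for y
    by (rule form_le_mono[OF form_le_entries]) (intro sum_mono e1)
  moreover have "form_le (D2 y - D2 z) ((\<Sum>i\<in>UNIV. \<Sum>j\<in>UNIV. l * K2 i j / Z) * norm (y - z))" for y z
    unfolding sum_distrib_right by (rule form_le_mono[OF form_le_entries]) (intro sum_mono e2)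
  ultimately have "C21 (mollify \<epsilon> g) D D2 (\<Sum>i\<in>UNIV. \<Sum>j\<in>(UNIV :: 3 set). l * K1 i / Z) (\<Sum>i\<in>UNIV. \<Sum>j\<in>UNIV. l * K2 i j / Z)"
    unfolding C21_def C2diff_def using 1 2 by blast
  then show ?thesis by blast
qed

end

section \<open>Discrete resolvents\<close>

lemma sum_matrix_vector_mult:
  fixes f :: "'a \<Rightarrow> real^3^3"
  shows "(\<Sum>e\<in>I. f e) *v c = (\<Sum>e\<in>I. f e *v c)"
  by (induction I rule: infinite_finite_induct) (auto simp: matrix_vector_mult_add_rdistrib)

lemma am_gm3:
  fixes a b c :: real
  assumes "0 \<le> a" "0 \<le> b" "0 \<le> c"
  shows "a * b * c \<le> (a ^ 3 + b ^ 3 + c ^ 3) / 3"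
proof -
  have "0 \<le> (a + b + c) * ((a - b)\<^sup>2 + (b - c)\<^sup>2 + (c - a)\<^sup>2)" using assms by simp
  also have "\<dots> = 2 * (a ^ 3 + b ^ 3 + c ^ 3) - 6 * (a * b * c)"
    by (simp add: power2_eq_square power3_eq_cube algebra_simps)
  finally show ?thesis by simp
qed

context coeffs
begin

text \<open>\<open>\<kappa> * \<tau>\<close> bounds the square of
  \<open>(norm (A \<tau> e *v d))\<^sup>2 - 1\<close> for unit vectors \<open>d\<close>; \<kappa>
  becomes the possible growth rate of third-order quantities.\<close>

definition \<kappa> :: real where "\<kappa> = (2 * mm + mm\<^sup>2)\<^sup>2"

lemma \<kappa>_nonneg: "0 \<le> \<kappa>" by (simp add: \<kappa>_def)

text \<open>Higher moments need not contract. But \<open>x\<close>, the excess of the squared norm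
  over 1, has nonpositive mean by \<open>avg_A_sq\<close> and size of order
  \<open>sqrt \<tau>\<close>, so \<open>(1 + x)\<^sup>2\<close> averages to at most
  \<open>1 + \<kappa> * \<tau>\<close>.\<close>

lemma avg_A_fourth_unit:
  assumes \<tau>: "small \<tau>" and d: "norm d = 1"
  shows "avg (\<lambda>e. (norm (A \<tau> e *v d)) ^ 4) \<le> 1 + \<kappa> * \<tau>"
proof -
  define x where "x e = (norm (A \<tau> e *v d))\<^sup>2 - 1" for e
  have x: "\<bar>x e\<bar> \<le> sqrt \<tau> * (2 * mm + mm\<^sup>2)" if "e \<in> signs" for e
  proof -
    define v where "v = A \<tau> e *v d - d"
    have v: "norm v \<le> sqrt \<tau> * mm" using A_minus_id[OF \<tau> that, of d] d by (simp add: v_def)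
    have "A \<tau> e *v d = d + v" by (simp add: v_def)
    then have "x e = 2 * (d \<bullet> v) + (norm v)\<^sup>2"
      using d by (simp add: x_def power2_norm_eq_inner inner_add_left inner_add_right inner_commute norm_eq_1)
    moreover have "\<bar>d \<bullet> v\<bar> \<le> norm v" using Cauchy_Schwarz_ineq2[of d v] d by simp
    moreover have "(norm v)\<^sup>2 \<le> sqrt \<tau> * mm\<^sup>2"
    proof -
      have "(norm v)\<^sup>2 \<le> (sqrt \<tau> * mm)\<^sup>2" using v by (intro power_mono) auto
      also have "\<dots> = (sqrt \<tau> * sqrt \<tau>) * mm\<^sup>2" by (simp add: power_mult_distrib power2_eq_square)
      also have "\<dots> \<le> sqrt \<tau> * mm\<^sup>2"
        using sqrt_small[OF \<tau>] by (intro mult_right_mono) auto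
      finally show ?thesis .
    qed
    ultimately have "\<bar>x e\<bar> \<le> 2 * (sqrt \<tau> * mm) + sqrt \<tau> * mm\<^sup>2" using v by (smt (verit) zero_le_power2)
    then show ?thesis by (simp add: algebra_simps)
  qed
  have "avg (\<lambda>e. (norm (A \<tau> e *v d))\<^sup>2) \<le> 1"
    using avg_A_sq[OF \<tau>, of d] power_le_one[of "1 - \<delta> * \<tau>" 2] small_factor[OF \<tau>] d by simp
  then have ax: "avg x \<le> 0" unfolding x_def avg_diff by simp
  have "avg (\<lambda>e. (x e)\<^sup>2) \<le> avg (\<lambda>e. \<kappa> * \<tau>)"
  proof (rule avg_mono)
    fix e assume "e \<in> signs"
    have "(x e)\<^sup>2 \<le> (sqrt \<tau> * (2 * mm + mm\<^sup>2))\<^sup>2"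
      using x[OF \<open>e \<in> signs\<close>] by (rule abs_le_square_iff[THEN iffD1, OF order_trans[OF _ abs_ge_self]])
    also have "\<dots> = \<kappa> * \<tau>" using sqrt_small[OF \<tau>] \<tau> by (simp add: \<kappa>_def power_mult_distrib small_def mult.commute)
    finally show "(x e)\<^sup>2 \<le> \<kappa> * \<tau>" .
  qed
  then have ax2: "avg (\<lambda>e. (x e)\<^sup>2) \<le> \<kappa> * \<tau>" by simp
  have "(norm (A \<tau> e *v d)) ^ 4 = 1 + (2 * x e + (x e)\<^sup>2)" for e
  proof -
    have "(norm (A \<tau> e *v d)) ^ 4 = ((norm (A \<tau> e *v d))\<^sup>2)\<^sup>2" by (simp flip: power_mult)
    also have "\<dots> = (1 + x e)\<^sup>2" by (simp add: x_def)
    finally show ?thesis by (simp add: power2_sum)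
  qed
  then have "avg (\<lambda>e. (norm (A \<tau> e *v d)) ^ 4) = 1 + (2 * avg x + avg (\<lambda>e. (x e)\<^sup>2))"
    by (simp add: avg_add avg_cmult)
  then show ?thesis using ax ax2 by linarith
qed

text \<open>Three factors occur since the Hessian takes two vectors and its Lipschitz bound brings
  in a third. AM-GM reduces the product to cubes, and a cube to the mean of square and fourth
  power.\<close>

lemma avg_A_triple_unit:
  assumes \<tau>: "small \<tau>" and "norm d = 1" "norm c = 1" "norm b = 1"
  shows "avg (\<lambda>e. norm (A \<tau> e *v d) * norm (A \<tau> e *v c) * norm (A \<tau> e *v b)) \<le> 1 + \<kappa> * \<tau>"
proof -
  have t: "0 \<le> \<kappa> * \<tau>" using \<kappa>_nonneg \<tau> by (simp add: small_def)
  have cube: "avg (\<lambda>e. (norm (A \<tau> e *v v)) ^ 3) \<le> 1 + \<kappa> * \<tau>" if v: "norm v = 1" for v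
  proof -
    have "avg (\<lambda>e. (norm (A \<tau> e *v v)) ^ 3) \<le> avg (\<lambda>e. 1 / 2 * (norm (A \<tau> e *v v))\<^sup>2 + 1 / 2 * (norm (A \<tau> e *v v)) ^ 4)"
    proof (rule avg_mono)
      fix e
      define n where "n = norm (A \<tau> e *v v)"
      have "0 \<le> (n * (1 - n))\<^sup>2" by simp
      also have "\<dots> = n\<^sup>2 + n ^ 4 - 2 * n ^ 3"
        by (simp add: power2_eq_square power3_eq_cube power4_eq_xxxx algebra_simps)
      finally show "n ^ 3 \<le> 1 / 2 * n\<^sup>2 + 1 / 2 * n ^ 4" by simp
    qed
    also have "\<dots> = 1 / 2 * avg (\<lambda>e. (norm (A \<tau> e *v v))\<^sup>2) + 1 / 2 * avg (\<lambda>e. (norm (A \<tau> e *v v)) ^ 4)"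
      by (simp only: avg_add avg_cmult)
    also have "\<dots> \<le> 1 / 2 * 1 + 1 / 2 * (1 + \<kappa> * \<tau>)"
      using avg_A_sq[OF \<tau>, of v] power_le_one[of "1 - \<delta> * \<tau>" 2] small_factor[OF \<tau>] v avg_A_fourth_unit[OF \<tau> v]
      by (intro add_mono mult_left_mono) auto
    also have "\<dots> \<le> 1 + \<kappa> * \<tau>" using t by (simp only: distrib_left)
    finally show ?thesis .
  qed
  have "avg (\<lambda>e. norm (A \<tau> e *v d) * norm (A \<tau> e *v c) * norm (A \<tau> e *v b))
    \<le> avg (\<lambda>e. 1 / 3 * (norm (A \<tau> e *v d)) ^ 3 + (1 / 3 * (norm (A \<tau> e *v c)) ^ 3 + 1 / 3 * (norm (A \<tau> e *v b)) ^ 3))"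
    using am_gm3 by (intro avg_mono) (simp add: add_divide_distrib add.assoc)
  also have "\<dots> = 1 / 3 * avg (\<lambda>e. (norm (A \<tau> e *v d)) ^ 3) + (1 / 3 * avg (\<lambda>e. (norm (A \<tau> e *v c)) ^ 3) + 1 / 3 * avg (\<lambda>e. (norm (A \<tau> e *v b)) ^ 3))"
    by (simp only: avg_add avg_cmult)
  also have "\<dots> \<le> 1 + \<kappa> * \<tau>" using cube[OF assms(2)] cube[OF assms(3)] cube[OF assms(4)] by simp
  finally show ?thesis .
qed

lemma avg_A_triple:
  assumes \<tau>: "small \<tau>"
  shows "avg (\<lambda>e. norm (A \<tau> e *v d) * norm (A \<tau> e *v c) * norm (A \<tau> e *v b)) \<le> (1 + \<kappa> * \<tau>) * (norm d * norm c * norm b)"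
proof (cases "d = 0 \<or> c = 0 \<or> b = 0")
  case True
  then show ?thesis by auto
next
  case False
  define n where "n = norm d * norm c * norm b"
  have n: "0 < n" using False by (simp add: n_def)
  have sc: "norm (A \<tau> e *v v) = norm v * norm (A \<tau> e *v sgn v)" if "v \<noteq> 0" for e v
    using that by (simp add: sgn_div_norm matrix_vector_mult_scaleR)
  have "avg (\<lambda>e. norm (A \<tau> e *v d) * norm (A \<tau> e *v c) * norm (A \<tau> e *v b)) =
      avg (\<lambda>e. n * (norm (A \<tau> e *v sgn d) * norm (A \<tau> e *v sgn c) * norm (A \<tau> e *v sgn b)))"
    using False by (simp add: sc[of d] sc[of c] sc[of b] n_def mult_ac)
  also have "\<dots> \<le> n * (1 + \<kappa> * \<tau>)"
    unfolding avg_cmult using n False by (intro mult_left_mono avg_A_triple_unit[OF \<tau>]) (auto simp: norm_sgn)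
  finally show ?thesis by (simp add: n_def mult.commute)
qed

text \<open>As the steps are affine, the Hessian of a composition is a pure pullback, without a term
  from second derivatives of the step. \<open>C2\<close> is preserved because products of two
  factors do not grow on average; \<open>C3\<close> meets three factors and may grow by
  \<open>1 + \<kappa> * \<tau>\<close>.\<close>

lemma K_C21:
  assumes \<tau>: "small \<tau>" and \<psi>: "C21 \<psi> D D2 C2 C3"
  shows "\<exists>D' D2'. C21 (K \<tau> \<psi>) D' D2' C2 ((1 + \<kappa> * \<tau>) * C3)"
proof -
  have C2: "form_le (D2 y) C2" for y using \<psi> by (simp add: C21_def)
  have C3: "form_le (D2 y - D2 z) (C3 * norm (y - z))" for y z using \<psi> by (simp add: C21_def)
  have C20: "0 \<le> C2" using form_le_component[OF C2[of 0], of 1 1] by simp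
  have C30: "0 \<le> C3" using form_le_component[OF C3[of "axis 1 1" 0], of 1 1] by simp
  define D' where "D' y = (1/4) *\<^sub>R (\<Sum>e\<in>signs. transpose (A \<tau> e) *v D (T \<tau> e y))" for y
  define D2' where "D2' y = (1/4) *\<^sub>R (\<Sum>e\<in>signs. transpose (A \<tau> e) ** D2 (T \<tau> e y) ** A \<tau> e)" for y
  have fin: "finite signs" by (simp add: signs_def)
  have "C2diff (\<lambda>y. (1/4) * (\<Sum>e\<in>signs. \<psi> (T \<tau> e y))) D' D2'"
    unfolding D'_def[abs_def] D2'_def[abs_def] estep_def
    by (intro C2diff_cmult C2diff_sum C2diff_affine fin) (use \<psi> in \<open>simp add: C21_def\<close>)
  moreover have "(\<lambda>y. (1/4) * (\<Sum>e\<in>signs. \<psi> (T \<tau> e y))) = K \<tau> \<psi>" by (simp add: fun_eq_iff Kop_def avg_def)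
  ultimately have 1: "C2diff (K \<tau> \<psi>) D' D2'" by simp
  have form: "d \<bullet> (D2' y *v c) = avg (\<lambda>e. (A \<tau> e *v d) \<bullet> (D2 (T \<tau> e y) *v (A \<tau> e *v c)))" for y d c
  proof -
    have "d \<bullet> ((transpose B ** Q ** B) *v c) = (B *v d) \<bullet> (Q *v (B *v c))" for B Q :: "real^3^3"
    proof -
      have "(transpose B ** Q ** B) *v c = transpose B *v (Q *v (B *v c))"
        by (simp only: matrix_vector_mul_assoc matrix_mul_assoc)
      then show ?thesis by (metis dot_lmul_matrix inner_commute transpose_matrix_vector)
    qed
    then show ?thesis
      by (simp add: D2'_def avg_def scaleR_matrix_vector_assoc[symmetric] sum_matrix_vector_mult inner_sum_right)
  qed
  have 2: "form_le (D2' y) C2" for y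
    unfolding form_le_def
  proof (intro allI)
    fix d c
    have "\<bar>d \<bullet> (D2' y *v c)\<bar> \<le> avg (\<lambda>e. \<bar>(A \<tau> e *v d) \<bullet> (D2 (T \<tau> e y) *v (A \<tau> e *v c))\<bar>)"
      unfolding form by (rule abs_avg_le)
    also have "\<dots> \<le> avg (\<lambda>e. C2 * (norm (A \<tau> e *v d) * norm (A \<tau> e *v c)))"
      using form_leD[OF C2] by (intro avg_mono) (simp add: mult.assoc)
    also have "\<dots> \<le> C2 * (norm d * norm c)"
      unfolding avg_cmult using avg_A_product[OF \<tau>] C20 by (intro mult_left_mono)
    finally show "\<bar>d \<bullet> (D2' y *v c)\<bar> \<le> C2 * norm d * norm c" by (simp add: mult.assoc)
  qed
  have 3: "form_le (D2' y - D2' z) ((1 + \<kappa> * \<tau>) * C3 * norm (y - z))" for y z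
    unfolding form_le_def
  proof (intro allI)
    fix d c
    have "d \<bullet> ((D2' y - D2' z) *v c) = avg (\<lambda>e. (A \<tau> e *v d) \<bullet> ((D2 (T \<tau> e y) - D2 (T \<tau> e z)) *v (A \<tau> e *v c)))"
      by (simp add: matrix_vector_mult_diff_rdistrib inner_diff_right form avg_diff)
    then have "\<bar>d \<bullet> ((D2' y - D2' z) *v c)\<bar> \<le> avg (\<lambda>e. \<bar>(A \<tau> e *v d) \<bullet> ((D2 (T \<tau> e y) - D2 (T \<tau> e z)) *v (A \<tau> e *v c))\<bar>)"
      by (simp only: abs_avg_le)
    also have "\<dots> \<le> avg (\<lambda>e. C3 * (norm (A \<tau> e *v d) * norm (A \<tau> e *v c) * norm (A \<tau> e *v (y - z))))"
    proof (rule avg_mono)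
      fix e
      have "\<bar>(A \<tau> e *v d) \<bullet> ((D2 (T \<tau> e y) - D2 (T \<tau> e z)) *v (A \<tau> e *v c))\<bar>
        \<le> C3 * norm (T \<tau> e y - T \<tau> e z) * norm (A \<tau> e *v d) * norm (A \<tau> e *v c)" by (rule form_leD[OF C3])
      then show "\<bar>(A \<tau> e *v d) \<bullet> ((D2 (T \<tau> e y) - D2 (T \<tau> e z)) *v (A \<tau> e *v c))\<bar>
        \<le> C3 * (norm (A \<tau> e *v d) * norm (A \<tau> e *v c) * norm (A \<tau> e *v (y - z)))"
        by (simp add: T_diff mult_ac)
    qed
    also have "\<dots> \<le> C3 * ((1 + \<kappa> * \<tau>) * (norm d * norm c * norm (y - z)))"
      unfolding avg_cmult using avg_A_triple[OF \<tau>] C30 by (intro mult_left_mono)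
    finally show "\<bar>d \<bullet> ((D2' y - D2' z) *v c)\<bar> \<le> (1 + \<kappa> * \<tau>) * C3 * norm (y - z) * norm d * norm c"
      by (simp add: mult_ac)
  qed
  show ?thesis using 1 2 3 unfolding C21_def by blast
qed

lemma Kpow_C21:
  assumes \<tau>: "small \<tau>" and \<psi>: "C21 \<psi> D D2 C2 C3"
  shows "\<exists>D' D2'. C21 ((K \<tau> ^^ n) \<psi>) D' D2' C2 ((1 + \<kappa> * \<tau>) ^ n * C3)"
proof (induction n)
  case 0
  then show ?case using \<psi> by auto
next
  case (Suc n)
  then obtain D' D2' where "C21 ((K \<tau> ^^ n) \<psi>) D' D2' C2 ((1 + \<kappa> * \<tau>) ^ n * C3)" by blast
  from K_C21[OF \<tau> this] show ?case by (simp add: mult.assoc)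
qed

section \<open>The discrete resolvent\<close>

definition \<beta> :: real where "\<beta> = \<kappa> + 1"

lemma \<beta>: "1 \<le> \<beta>" "\<beta> - \<kappa> = 1" using \<kappa>_nonneg by (auto simp: \<beta>_def)

definition \<rho> :: "real \<Rightarrow> real" where "\<rho> \<tau> = 1 / (1 + \<beta> * \<tau>)"

text \<open>The discrete resolvent, an approximate solution of \<open>\<beta> u - L u = g\<close>. The rate \<open>\<beta>\<close> is chosen so large
  that it beats the growth rate \<open>\<kappa>\<close> of the Lipschitz constant of the Hessian of \<open>K\<^sup>n g\<close>.\<close>

definition U :: "real \<Rightarrow> nat \<Rightarrow> (real^3 \<Rightarrow> real) \<Rightarrow> real^3 \<Rightarrow> real" where
  "U \<tau> N g y = (\<Sum>n<N. \<tau> * \<rho> \<tau> ^ Suc n * (K \<tau> ^^ n) g y)"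

lemma \<rho>: "0 < \<tau> \<Longrightarrow> 0 < \<rho> \<tau>" "0 < \<tau> \<Longrightarrow> \<rho> \<tau> < 1" "0 < \<tau> \<Longrightarrow> (1 + \<beta> * \<tau>) * \<rho> \<tau> = 1"
proof -
  assume t: "0 < \<tau>"
  have "0 < \<beta> * \<tau>" using \<beta> t by simp
  then show "0 < \<rho> \<tau>" "\<rho> \<tau> < 1" "(1 + \<beta> * \<tau>) * \<rho> \<tau> = 1" by (auto simp: \<rho>_def)
qed

lemma U_linear: "U \<tau> N (\<lambda>z. a * f z + b * g z) y = a * U \<tau> N f y + b * U \<tau> N g y"
  unfolding U_def Kpow_linear by (simp add: sum.distrib sum_distrib_left algebra_simps)

text \<open>The decay of the Lipschitz constants of \<open>K^n g\<close> adds to the discount: rate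
  \<delta> on top of \<beta>. This strict gain over \<open>1 / \<beta>\<close> is what drives
  uniqueness.\<close>

lemma U_lip:
  assumes \<tau>: "small \<tau>" and g: "\<And>x y. \<bar>g x - g y\<bar> \<le> l * norm (x - y)"
  shows "\<bar>U \<tau> N g x - U \<tau> N g y\<bar> \<le> l / (\<beta> + \<delta>) * norm (x - y)"
proof -
  have t: "0 < \<tau>" using \<tau> by (simp add: small_def)
  have l0: "0 \<le> l" using g[of "axis 1 1" 0] abs_ge_zero order_trans by fastforce
  have geo: "(\<Sum>n<N. \<tau> * \<rho> \<tau> ^ Suc n * (1 - \<delta> * \<tau>) ^ n) \<le> 1 / (\<beta> + \<delta>)"
    using resolvent_geometric_le[of \<tau> \<beta> "- \<delta>" N] t \<beta> delta small_factor[OF \<tau>] by (simp add: \<rho>_def)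
  have "\<bar>U \<tau> N g x - U \<tau> N g y\<bar> = \<bar>\<Sum>n<N. \<tau> * \<rho> \<tau> ^ Suc n * ((K \<tau> ^^ n) g x - (K \<tau> ^^ n) g y)\<bar>"
    by (simp add: U_def sum_subtractf[symmetric] right_diff_distrib)
  also have "\<dots> \<le> (\<Sum>n<N. \<tau> * \<rho> \<tau> ^ Suc n * (l * (1 - \<delta> * \<tau>) ^ n * norm (x - y)))"
  proof (intro order_trans[OF sum_abs] sum_mono)
    fix n
    have c: "0 \<le> \<tau> * \<rho> \<tau> ^ Suc n" using t \<rho>(1)[OF t] by simp
    show "\<bar>\<tau> * \<rho> \<tau> ^ Suc n * ((K \<tau> ^^ n) g x - (K \<tau> ^^ n) g y)\<bar> \<le> \<tau> * \<rho> \<tau> ^ Suc n * (l * (1 - \<delta> * \<tau>) ^ n * norm (x - y))"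
      unfolding abs_mult[of "\<tau> * \<rho> \<tau> ^ Suc n"] abs_of_nonneg[OF c]
      by (intro mult_left_mono Kpow_lip[where f=g, OF \<tau> g] c)
  qed
  also have "\<dots> = (\<Sum>n<N. \<tau> * \<rho> \<tau> ^ Suc n * (1 - \<delta> * \<tau>) ^ n) * (l * norm (x - y))"
    unfolding sum_distrib_right by (rule sum.cong) (auto simp: mult_ac)
  also have "\<dots> \<le> 1 / (\<beta> + \<delta>) * (l * norm (x - y))" using geo l0 by (intro mult_right_mono) auto
  finally show ?thesis by simp
qed

text \<open>The discount outweighs the growth: the weights sum to at most
  \<open>1 / \<beta>\<close>, and with the factors \<open>(1 + \<kappa> * \<tau>) ^ n\<close> to at
  most \<open>1 / (\<beta> - \<kappa>) = 1\<close>. Hence the constants depend neither on \<tau> nor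
  on \<open>N\<close>.\<close>

lemma U_C21:
  assumes \<tau>: "small \<tau>" and g: "C21 g D D2 C2 C3"
  shows "\<exists>D' D2'. C21 (U \<tau> N g) D' D2' C2 C3"
proof -
  have t: "0 < \<tau>" using \<tau> by (simp add: small_def)
  have C20: "0 \<le> C2" using g form_le_component[of "D2 0" C2 1 1] by (auto simp: C21_def)
  have "form_le (D2 (axis 1 1) - D2 0) (C3 * norm (axis 1 1 - 0 :: real^3))" using g unfolding C21_def by blast
  from form_le_component[OF this, of 1 1] have C30: "0 \<le> C3" by simp
  obtain E E2 where E: "\<And>n. C21 ((K \<tau> ^^ n) g) (E n) (E2 n) C2 ((1 + \<kappa> * \<tau>) ^ n * C3)"
    using Kpow_C21[OF \<tau> g] by metis
  define c where "c n = \<tau> * \<rho> \<tau> ^ Suc n" for n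
  have c0: "0 \<le> c n" for n using t \<rho>(1)[OF t] by (simp add: c_def)
  define D' where "D' y = (\<Sum>n<N. c n *\<^sub>R E n y)" for y
  define D2' where "D2' y = (\<Sum>n<N. c n *\<^sub>R E2 n y)" for y
  have "C2diff (\<lambda>y. \<Sum>n<N. c n * (K \<tau> ^^ n) g y) D' D2'"
    unfolding D'_def[abs_def] D2'_def[abs_def]
    by (intro C2diff_sum C2diff_cmult) (use E in \<open>auto simp: C21_def\<close>)
  then have 1: "C2diff (U \<tau> N g) D' D2'" by (simp add: U_def[abs_def] c_def)
  have form: "d \<bullet> (D2' y *v e) = (\<Sum>n<N. c n * (d \<bullet> (E2 n y *v e)))" for y d e
    by (simp add: D2'_def sum_matrix_vector_mult inner_sum_right scaleR_matrix_vector_assoc[symmetric])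
  have s1: "(\<Sum>n<N. c n) \<le> 1"
  proof -
    have "(\<Sum>n<N. c n) \<le> 1 / (\<beta> - 0)"
      using resolvent_geometric_le[of \<tau> \<beta> 0 N] t \<beta> by (simp add: c_def \<rho>_def)
    also have "\<dots> \<le> 1" using \<beta> by simp
    finally show ?thesis .
  qed
  have s2: "(\<Sum>n<N. c n * (1 + \<kappa> * \<tau>) ^ n) \<le> 1"
    using resolvent_geometric_le[of \<tau> \<beta> \<kappa> N] t \<beta> \<kappa>_nonneg by (simp add: c_def \<rho>_def)
  have 2: "form_le (D2' y) C2" for y
    unfolding form_le_def
  proof (intro allI)
    fix d e
    have "\<bar>d \<bullet> (D2' y *v e)\<bar> \<le> (\<Sum>n<N. c n * (C2 * norm d * norm e))"
      unfolding form
    proof (intro order_trans[OF sum_abs] sum_mono)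
      fix n
      have "form_le (E2 n y) C2" using E[of n] by (simp add: C21_def)
      then show "\<bar>c n * (d \<bullet> (E2 n y *v e))\<bar> \<le> c n * (C2 * norm d * norm e)"
        using c0[of n] form_leD[of "E2 n y" C2 d e] by (simp add: abs_mult mult_left_mono)
    qed
    also have "\<dots> = (\<Sum>n<N. c n) * (C2 * norm d * norm e)" by (simp add: sum_distrib_right)
    also have "\<dots> \<le> 1 * (C2 * norm d * norm e)" using s1 C20 by (intro mult_right_mono) auto
    finally show "\<bar>d \<bullet> (D2' y *v e)\<bar> \<le> C2 * norm d * norm e" by simp
  qed
  have 3: "form_le (D2' y - D2' z) (C3 * norm (y - z))" for y z
    unfolding form_le_def
  proof (intro allI)
    fix d e
    have "d \<bullet> ((D2' y - D2' z) *v e) = (\<Sum>n<N. c n * (d \<bullet> ((E2 n y - E2 n z) *v e)))"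
      by (simp add: matrix_vector_mult_diff_rdistrib inner_diff_right form sum_subtractf right_diff_distrib)
    also have "\<bar>\<dots>\<bar> \<le> (\<Sum>n<N. c n * (((1 + \<kappa> * \<tau>) ^ n * C3) * norm (y - z) * norm d * norm e))"
    proof (intro order_trans[OF sum_abs] sum_mono)
      fix n
      have "form_le (E2 n y - E2 n z) ((1 + \<kappa> * \<tau>) ^ n * C3 * norm (y - z))" using E[of n] by (simp add: C21_def)
      then show "\<bar>c n * (d \<bullet> ((E2 n y - E2 n z) *v e))\<bar> \<le> c n * (((1 + \<kappa> * \<tau>) ^ n * C3) * norm (y - z) * norm d * norm e)"
        using c0[of n] form_leD[of "E2 n y - E2 n z" _ d e] by (simp add: abs_mult mult_left_mono)
    qed
    also have "\<dots> = (\<Sum>n<N. c n * (1 + \<kappa> * \<tau>) ^ n) * (C3 * norm (y - z) * norm d * norm e)"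
      unfolding sum_distrib_right by (rule sum.cong) (auto simp: mult_ac)
    also have "\<dots> \<le> 1 * (C3 * norm (y - z) * norm d * norm e)" using s2 C30 by (intro mult_right_mono) auto
    finally show "\<bar>d \<bullet> ((D2' y - D2' z) *v e)\<bar> \<le> C3 * norm (y - z) * norm d * norm e" by simp
  qed
  show ?thesis using 1 2 3 unfolding C21_def by blast
qed

text \<open>Multiplication by \<open>1 + \<beta> * \<tau>\<close> lowers the power of
  \<open>\<rho> \<tau>\<close> by one, and the difference telescopes. The last term is the price of
  cutting the series at \<open>N\<close>.\<close>

lemma U_scheme:
  assumes t: "0 < \<tau>"
  shows "(K \<tau> (U \<tau> N g) y - U \<tau> N g y) / \<tau> = \<beta> * U \<tau> N g y - g y + \<rho> \<tau> ^ N * (K \<tau> ^^ N) g y"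
proof -
  have KU: "K \<tau> (U \<tau> N g) y = (\<Sum>n<N. \<tau> * \<rho> \<tau> ^ Suc n * (K \<tau> ^^ Suc n) g y)"
    unfolding U_def[abs_def] by (subst K_sum) simp
  have bU: "(1 + \<beta> * \<tau>) * U \<tau> N g y = (\<Sum>n<N. \<tau> * \<rho> \<tau> ^ n * (K \<tau> ^^ n) g y)"
    unfolding U_def sum_distrib_left
  proof (rule sum.cong[OF refl])
    fix n
    have "(1 + \<beta> * \<tau>) * (\<tau> * \<rho> \<tau> ^ Suc n * (K \<tau> ^^ n) g y) = ((1 + \<beta> * \<tau>) * \<rho> \<tau>) * (\<tau> * \<rho> \<tau> ^ n * (K \<tau> ^^ n) g y)"
      by (simp add: mult_ac)
    then show "(1 + \<beta> * \<tau>) * (\<tau> * \<rho> \<tau> ^ Suc n * (K \<tau> ^^ n) g y) = \<tau> * \<rho> \<tau> ^ n * (K \<tau> ^^ n) g y"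
      using \<rho>(3)[OF t] by simp
  qed
  have "K \<tau> (U \<tau> N g) y - (1 + \<beta> * \<tau>) * U \<tau> N g y = (\<Sum>n<N. \<tau> * \<rho> \<tau> ^ Suc n * (K \<tau> ^^ Suc n) g y - \<tau> * \<rho> \<tau> ^ n * (K \<tau> ^^ n) g y)"
    unfolding KU bU sum_subtractf ..
  also have "\<dots> = \<tau> * \<rho> \<tau> ^ N * (K \<tau> ^^ N) g y - \<tau> * \<rho> \<tau> ^ 0 * (K \<tau> ^^ 0) g y"
    by (rule sum_lessThan_telescope)
  finally have "K \<tau> (U \<tau> N g) y - U \<tau> N g y = \<tau> * (\<beta> * U \<tau> N g y - g y + \<rho> \<tau> ^ N * (K \<tau> ^^ N) g y)"
    by (simp add: algebra_simps)
  then show ?thesis using t by simp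
qed

text \<open>For unbounded \<open>g\<close> the values \<open>K^n g\<close> at 0 may grow, but only
  linearly in \<open>n\<close>, since each step moves the origin by at most \<open>mm\<close>; the
  discount beats this. The weight \<open>1 + norm y\<close> makes the estimate hold for all
  \<open>y\<close> at once.\<close>

lemma U_tail:
  assumes \<tau>: "small \<tau>" and g: "\<And>x y. \<bar>g x - g y\<bar> \<le> l * norm (x - y)" and e: "0 < e"
  shows "\<exists>N0. \<forall>N\<ge>N0. \<forall>y. \<bar>\<rho> \<tau> ^ N * (K \<tau> ^^ N) g y\<bar> \<le> e * (1 + norm y)"
proof -
  have t: "0 < \<tau>" using \<tau> by (simp add: small_def)
  have l0: "0 \<le> l" using g[of "axis 1 1" 0] abs_ge_zero order_trans by fastforce
  have lipn: "\<bar>(K \<tau> ^^ n) g x - (K \<tau> ^^ n) g y\<bar> \<le> l * norm (x - y)" for n x y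
  proof -
    have "\<bar>(K \<tau> ^^ n) g x - (K \<tau> ^^ n) g y\<bar> \<le> l * (1 - \<delta> * \<tau>) ^ n * norm (x - y)" by (rule Kpow_lip[where f=g, OF \<tau> g])
    also have "\<dots> \<le> l * 1 * norm (x - y)"
      using small_factor[OF \<tau>] l0 by (intro mult_right_mono mult_left_mono power_le_one) auto
    finally show ?thesis by simp
  qed
  have g0: "\<bar>(K \<tau> ^^ n) g 0\<bar> \<le> \<bar>g 0\<bar> + real n * (l * mm)" for n
  proof (induction n)
    case (Suc n)
    have "\<bar>(K \<tau> ^^ Suc n) g 0 - (K \<tau> ^^ n) g 0\<bar> = \<bar>avg (\<lambda>e. (K \<tau> ^^ n) g (T \<tau> e 0) - (K \<tau> ^^ n) g 0)\<bar>"
      by (simp add: Kop_def[of k1 k2 k3 \<tau> "(K \<tau> ^^ n) g" 0] avg_diff)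
    also have "\<dots> \<le> avg (\<lambda>e. l * mm)"
    proof (rule order_trans[OF abs_avg_le avg_mono])
      fix s assume "s \<in> signs"
      have "norm (T \<tau> s 0 - 0) \<le> sqrt \<tau> * mm * (1 + norm (0::real^3))" by (rule step_bound[OF \<tau> \<open>s \<in> signs\<close>])
      also have "\<dots> \<le> 1 * mm * 1" using sqrt_small[OF \<tau>] mm_pos by (intro mult_mono) auto
      finally have "l * norm (T \<tau> s 0 - 0) \<le> l * mm" using l0 by (intro mult_left_mono) auto
      then show "\<bar>(K \<tau> ^^ n) g (T \<tau> s 0) - (K \<tau> ^^ n) g 0\<bar> \<le> l * mm" using lipn[of n "T \<tau> s 0" 0] by simp
    qed
    finally show ?case using Suc by (simp add: algebra_simps)
  qed simp
  define a where "a n = \<rho> \<tau> ^ n * (\<bar>g 0\<bar> + l) + (real n * \<rho> \<tau> ^ n) * (l * mm)" for n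
  have "a \<longlonglongrightarrow> 0 * (\<bar>g 0\<bar> + l) + 0 * (l * mm)"
    unfolding a_def[abs_def]
    using LIMSEQ_power_zero[of "\<rho> \<tau>"] powser_times_n_limit_0[of "\<rho> \<tau>"] \<rho>[OF t]
    by (intro tendsto_intros) (auto simp: mult.commute)
  then have "\<forall>\<^sub>F n in sequentially. a n < e" using e by (auto intro: order_tendstoD)
  then obtain N0 where N0: "\<And>n. n \<ge> N0 \<Longrightarrow> a n < e" by (auto simp: eventually_sequentially)
  have "\<bar>\<rho> \<tau> ^ n * (K \<tau> ^^ n) g y\<bar> \<le> e * (1 + norm y)" if "n \<ge> N0" for n y
  proof -
    have r: "0 \<le> \<rho> \<tau> ^ n" using \<rho>[OF t] by simp
    have "\<bar>(K \<tau> ^^ n) g y\<bar> \<le> (\<bar>g 0\<bar> + real n * (l * mm) + l) * (1 + norm y)"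
    proof -
      have "\<bar>(K \<tau> ^^ n) g y\<bar> \<le> \<bar>g 0\<bar> + real n * (l * mm) + l * norm y" using lipn[of n y 0] g0[of n] by simp
      also have "\<dots> \<le> (\<bar>g 0\<bar> + real n * (l * mm) + l) * (1 + norm y)"
        using l0 mm_pos by (simp add: algebra_simps)
      finally show ?thesis .
    qed
    then have "\<rho> \<tau> ^ n * \<bar>(K \<tau> ^^ n) g y\<bar> \<le> \<rho> \<tau> ^ n * ((\<bar>g 0\<bar> + real n * (l * mm) + l) * (1 + norm y))"
      using r by (rule mult_left_mono)
    also have "\<dots> = a n * (1 + norm y)" by (simp add: a_def algebra_simps)
    also have "\<dots> \<le> e * (1 + norm y)" using N0[OF that] by (intro mult_right_mono) auto
    finally show ?thesis using r by (simp add: abs_mult)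
  qed
  then show ?thesis by blast
qed

end

section \<open>Uniqueness of Lipschitz solutions\<close>

lemma C21_uminus: "C21 g D D2 C2 C3 \<Longrightarrow> C21 (\<lambda>y. - g y) (\<lambda>y. - D y) (\<lambda>y. - D2 y) C2 C3"
proof -
  assume C: "C21 g D D2 C2 C3"
  have n: "(- Q) *v e = - (Q *v e)" for Q :: "real^3^3" and e
    using scaleR_matrix_vector_assoc[of "-1" Q e] by simp
  have f: "form_le (- Q) c" if "form_le Q c" for Q c
    using that unfolding form_le_def n by simp
  have "form_le (- D2 y - - D2 z) (C3 * norm (y - z))" for y z
    using f[of "D2 y - D2 z" "C3 * norm (y - z)"] C by (simp add: C21_def)
  then show ?thesis
    using C C2diff_cmult[of g D D2 "-1"] f unfolding C21_def by simp
qed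

lemma lip_continuous:
  fixes g :: "real^3 \<Rightarrow> real"
  assumes "\<And>x y. \<bar>g x - g y\<bar> \<le> l * norm (x - y)"
  shows "continuous_on S g"
proof -
  have "0 \<le> l" using assms[of "axis 1 1" 0] abs_ge_zero order_trans by fastforce
  then have "l-lipschitz_on S g" using assms by (auto intro!: lipschitz_onI simp: dist_norm)
  then show ?thesis by (rule lipschitz_on_continuous_on)
qed

context coeffs
begin

text \<open>The arguments are the gradient and the Hessian of \<open>\<eta> |y|\<^sup>2\<close>, which serves as a Lyapunov function.\<close>

lemma L_square: "L y ((2 * \<eta>) *\<^sub>R y) ((2 * \<eta>) *\<^sub>R mat 1) \<le> 4 * \<eta>" if "0 \<le> \<eta>"
proof -
  define S where "S = (k1 - 4) * (y $ 1)\<^sup>2 + (k2 - 4) * (y $ 2)\<^sup>2 + k3 * (y $ 3)\<^sup>2"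
  have "0 \<le> S" unfolding S_def using k by (intro add_nonneg_nonneg mult_nonneg_nonneg) auto
  then have "\<eta> * (4 - 2 * S) \<le> \<eta> * 4" using that by (intro mult_left_mono) auto
  moreover have "L y ((2 * \<eta>) *\<^sub>R y) ((2 * \<eta>) *\<^sub>R mat 1) = \<eta> * (4 - 2 * S)"
    by (simp add: Lgen_expand mat_def power2_eq_square algebra_simps S_def)
  ultimately show ?thesis by simp
qed

text \<open>The resolvent plus \<open>\<eta> * (norm y)\<^sup>2\<close> is an admissible test
  function. The penalty confines the maximum of the difference to a ball independent of \<tau> and
  \<open>N\<close>, where consistency is uniform; there the viscosity inequality for
  \<open>w\<close> meets the scheme for \<open>U\<close>, and the zeroth-order term with \<beta>
  yields the bound.\<close>

lemma subsolution_le_resolvent: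
  assumes w: "viscosity_subsolution (cell_operator k1 k2 k3 h l) w"
    and wl: "\<And>x y. \<bar>w x - w y\<bar> \<le> \<Lambda> * norm (x - y)"
    and gC: "C21 g D D2 C2 C3" and gl: "\<And>x y. \<bar>g x - g y\<bar> \<le> lg * norm (x - y)"
    and close: "\<And>z. \<bar>g z - (\<beta> * w z - h z + l)\<bar> \<le> \<epsilon>" and \<eta>: "0 < \<eta>"
  shows "\<exists>t0>0. \<forall>\<tau>. 0 < \<tau> \<and> \<tau> \<le> t0 \<longrightarrow> small \<tau> \<and>
    (\<exists>N0. \<forall>N\<ge>N0. \<forall>y. w y - U \<tau> N g y \<le> \<eta> * (norm y)\<^sup>2 + (\<epsilon> + 6 * \<eta>))"
proof -
  have L0: "0 \<le> \<Lambda>" using wl[of "axis 1 1" 0] abs_ge_zero order_trans by fastforce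
  have lg0: "0 \<le> lg" using gl[of "axis 1 1" 0] abs_ge_zero order_trans by fastforce
  have C20: "0 \<le> C2" using gC form_le_component[of "D2 0" C2 1 1] by (auto simp: C21_def)
  have eps0: "0 \<le> \<epsilon>" using close[of 0] by linarith
  define \<Lambda>' where "\<Lambda>' = \<Lambda> + lg / (\<beta> + \<delta>)"
  have L'0: "0 \<le> \<Lambda>'" using L0 lg0 \<beta> delta by (simp add: \<Lambda>'_def)
  \<comment> \<open>Beyond this radius the quadratic penalty exceeds the linear growth of
    \<open>w - u\<close>, whose rate \<Lambda>' does not depend on \<tau> or \<open>N\<close> by
    \<open>U_lip\<close>.\<close>
  define R where "R = \<Lambda>' / \<eta> + 1"
  have R: "0 < R" "\<Lambda>' \<le> \<eta> * R" using L'0 \<eta> by (auto simp: R_def add_nonneg_pos field_simps)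
  define err where "err \<tau> = ((C3 * (sqrt \<tau> * mm * (1 + R))) * (mm * (1 + R))\<^sup>2 + \<tau> * C2 * (km * R)\<^sup>2) / 2" for \<tau>
  have C30: "0 \<le> C3"
  proof -
    have "form_le (D2 (axis 1 1) - D2 0) (C3 * norm (axis 1 1 - 0 :: real^3))" using gC unfolding C21_def by blast
    from form_le_component[OF this, of 1 1] show ?thesis by simp
  qed
  have "(err \<longlongrightarrow> ((C3 * (sqrt 0 * mm * (1 + R))) * (mm * (1 + R))\<^sup>2 + 0 * C2 * (km * R)\<^sup>2) / 2) (at_right 0)"
    unfolding err_def[abs_def] by (intro tendsto_intros) auto
  then have "\<forall>\<^sub>F \<tau> in at_right 0. err \<tau> < \<eta>" by (rule order_tendstoD) (use \<eta> in simp)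
  then obtain t1 where t1: "t1 > 0" "\<And>\<tau>. 0 < \<tau> \<Longrightarrow> \<tau> < t1 \<Longrightarrow> err \<tau> < \<eta>"
    by (auto simp: eventually_at_right_field)
  obtain t2 where t2: "t2 > 0" "\<And>\<tau>. 0 < \<tau> \<Longrightarrow> \<tau> \<le> t2 \<Longrightarrow> small \<tau>" using small_eventually by blast
  have main: "small \<tau> \<and> (\<exists>N0. \<forall>N\<ge>N0. \<forall>y. w y - U \<tau> N g y \<le> \<eta> * (norm y)\<^sup>2 + (\<epsilon> + 6 * \<eta>))"
    if \<tau>0: "0 < \<tau>" "\<tau> \<le> min (t1 / 2) t2" for \<tau>
  proof -
    have \<tau>: "small \<tau>" using t2 \<tau>0 by simp
    have e\<tau>: "err \<tau> < \<eta>" using t1 \<tau>0 by auto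
    obtain N0 where N0: "\<And>N y. N \<ge> N0 \<Longrightarrow> \<bar>\<rho> \<tau> ^ N * (K \<tau> ^^ N) g y\<bar> \<le> \<eta> / (1 + R) * (1 + norm y)"
      using U_tail[OF \<tau> gl, of "\<eta> / (1 + R)"] \<eta> R by auto
    have "w y - U \<tau> N g y \<le> \<eta> * (norm y)\<^sup>2 + (\<epsilon> + 6 * \<eta>)" if N: "N \<ge> N0" for N y
    proof -
      define u where "u = U \<tau> N g"
      obtain E E2 where E: "C21 u E E2 C2 C3" using U_C21[OF \<tau> gC] unfolding u_def by blast
      have ul: "\<bar>u x - u y\<bar> \<le> lg / (\<beta> + \<delta>) * norm (x - y)" for x y
        unfolding u_def by (rule U_lip[where g=g, OF \<tau> gl])
      define \<Phi> where "\<Phi> z = w z - u z - \<eta> * (norm z)\<^sup>2" for z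
      have \<Phi>c: "continuous_on (cball 0 R) \<Phi>"
        unfolding \<Phi>_def[abs_def] by (intro continuous_intros lip_continuous[OF wl] lip_continuous[OF ul])
      obtain y1 where y1: "y1 \<in> cball 0 R" "\<And>z. z \<in> cball 0 R \<Longrightarrow> \<Phi> z \<le> \<Phi> y1"
        using continuous_attains_sup[OF compact_cball _ \<Phi>c] R by force
      have n1: "norm y1 \<le> R" using y1(1) by simp
      have max: "\<Phi> z \<le> \<Phi> y1" for z
      proof (cases "z \<in> cball 0 R")
        case False
        then have z: "R < norm z" by simp
        have "\<bar>w z - w 0\<bar> \<le> \<Lambda> * norm z" "\<bar>u z - u 0\<bar> \<le> lg / (\<beta> + \<delta>) * norm z" using wl[of z 0] ul[of z 0] by simp_all
        then have "(w z - u z) - (w 0 - u 0) \<le> \<Lambda>' * norm z" unfolding \<Lambda>'_def distrib_right by linarith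
        also have "\<dots> \<le> \<eta> * R * norm z" using R by (intro mult_right_mono) auto
        also have "\<dots> \<le> \<eta> * norm z * norm z" using z \<eta> by (intro mult_right_mono mult_left_mono) auto
        finally have "\<Phi> z \<le> \<Phi> 0" by (simp add: \<Phi>_def power2_eq_square)
        also have "\<dots> \<le> \<Phi> y1" using y1(2)[of 0] R by simp
        finally show ?thesis .
      qed (rule y1(2))
      have C2f: "C2_function (\<lambda>z. u z + \<eta> * (norm (z - 0))\<^sup>2) (\<lambda>z. E z + (2 * \<eta>) *\<^sub>R (z - 0)) (\<lambda>z. E2 z + (2 * \<eta>) *\<^sub>R mat 1)"
        using C2diff_add[OF _ C2diff_square[of \<eta> 0], of u E E2] E C21_continuous[OF E]
        by (auto simp: C2_function_def C21_def C2diff_def intro!: continuous_intros)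
      have "cell_operator k1 k2 k3 h l y1 (w y1) (E y1 + (2 * \<eta>) *\<^sub>R (y1 - 0)) (E2 y1 + (2 * \<eta>) *\<^sub>R mat 1) \<le> 0"
      proof (rule w[unfolded viscosity_subsolution_def, rule_format, OF conjI[OF C2f]])
        show "\<forall>\<^sub>F z in nhds y1. w z - (u z + \<eta> * (norm (z - 0))\<^sup>2) \<le> w y1 - (u y1 + \<eta> * (norm (y1 - 0))\<^sup>2)"
        proof (intro always_eventually allI)
          fix z
          show "w z - (u z + \<eta> * (norm (z - 0))\<^sup>2) \<le> w y1 - (u y1 + \<eta> * (norm (y1 - 0))\<^sup>2)"
            using max[of z] by (simp add: \<Phi>_def)
        qed
      qed
      then have visc: "h y1 - l \<le> L y1 (E y1) (E2 y1) + 4 * \<eta>"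
        using L_square[of \<eta> y1] \<eta> by (simp add: cell_operator_Lgen Lgen_add)
      have "\<bar>(K \<tau> u y1 - u y1) / \<tau> - L y1 (E y1) (E2 y1)\<bar>
          \<le> ((C3 * (sqrt \<tau> * mm * (1 + norm y1))) * (mm * (1 + norm y1))\<^sup>2 + \<tau> * C2 * (km * norm y1)\<^sup>2) / 2"
      proof (rule K_consistent[OF _ \<tau>])
        show "C2diff u E E2" "form_le (E2 y1) C2" using E by (auto simp: C21_def)
        fix z assume z: "norm (z - y1) \<le> sqrt \<tau> * mm * (1 + norm y1)"
        have "form_le (E2 z - E2 y1) (C3 * norm (z - y1))" using E by (simp add: C21_def)
        then show "form_le (E2 z - E2 y1) (C3 * (sqrt \<tau> * mm * (1 + norm y1)))"
          by (rule form_le_mono) (use z C30 in \<open>simp add: mult_left_mono\<close>)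
      qed
      also have "\<dots> \<le> err \<tau>"
        unfolding err_def using n1 C20 C30 mm_pos km_pos R \<tau>0 sqrt_small[OF \<tau>]
        by (intro divide_right_mono add_mono mult_mono power_mono) auto
      finally have cons: "L y1 (E y1) (E2 y1) \<le> (K \<tau> u y1 - u y1) / \<tau> + \<eta>" using e\<tau> by linarith
      have "\<bar>\<rho> \<tau> ^ N * (K \<tau> ^^ N) g y1\<bar> \<le> \<eta> / (1 + R) * (1 + R)"
        by (rule order_trans[OF N0[OF N]]) (use n1 \<eta> R in \<open>intro mult_left_mono, auto\<close>)
      then have tail: "\<rho> \<tau> ^ N * (K \<tau> ^^ N) g y1 \<le> \<eta>" using R by simp
      have scheme: "(K \<tau> u y1 - u y1) / \<tau> \<le> \<beta> * u y1 - g y1 + \<eta>"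
        unfolding u_def U_scheme[OF \<tau>0(1)] using tail by simp
      \<comment> \<open>The 6 is made up of 4 from the generator of the penalty, 1 from consistency
        and 1 from the tail; \<epsilon> is the distance of \<open>g\<close> from the exact
        data.\<close>
      have "\<beta> * (w y1 - u y1) \<le> \<epsilon> + 6 * \<eta>"
        using visc cons scheme close[of y1] by (simp add: right_diff_distrib)
      moreover have "w y1 - u y1 \<le> \<beta> * (w y1 - u y1)" if "0 \<le> w y1 - u y1"
        using \<beta>(1) that mult_right_mono[of 1 \<beta> "w y1 - u y1"] by simp
      ultimately have "w y1 - u y1 \<le> \<epsilon> + 6 * \<eta>" using eps0 \<eta> by (cases "0 \<le> w y1 - u y1") auto
      moreover have "\<Phi> y1 \<le> w y1 - u y1" using \<eta> by (simp add: \<Phi>_def)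
      ultimately show ?thesis using max[of y] by (simp add: \<Phi>_def u_def)
    qed
    then show ?thesis using \<tau> by blast
  qed
  show ?thesis
    by (rule exI[of _ "min (t1 / 2) t2"]) (use t1 t2 main in auto)
qed

text \<open>The one-sided estimate applied to \<open>w\<close> and, as the resolvent is linear, to
  \<open>- w\<close> with negated data.\<close>

lemma solution_near_resolvent:
  assumes w: "viscosity_solution (cell_operator k1 k2 k3 h l) w"
    and wl: "\<And>x y. \<bar>w x - w y\<bar> \<le> \<Lambda> * norm (x - y)"
    and gC: "C21 g D D2 C2 C3" and gl: "\<And>x y. \<bar>g x - g y\<bar> \<le> lg * norm (x - y)"
    and close: "\<And>z. \<bar>g z - (\<beta> * w z - h z + l)\<bar> \<le> \<epsilon>" and \<eta>: "0 < \<eta>"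
  shows "\<exists>t0>0. \<forall>\<tau>. 0 < \<tau> \<and> \<tau> \<le> t0 \<longrightarrow> small \<tau> \<and>
    (\<exists>N0. \<forall>N\<ge>N0. \<forall>y. \<bar>w y - U \<tau> N g y\<bar> \<le> \<eta> * (norm y)\<^sup>2 + (\<epsilon> + 6 * \<eta>))"
proof -
  have sub: "viscosity_subsolution (cell_operator k1 k2 k3 h l) w"
    and sub': "viscosity_subsolution (cell_operator k1 k2 k3 (\<lambda>y. - h y) (- l)) (\<lambda>y. - w y)"
    using w subsolution_uminus by (auto simp: viscosity_solution_def)
  obtain t1 where t1: "t1 > 0" "\<And>\<tau>. 0 < \<tau> \<Longrightarrow> \<tau> \<le> t1 \<Longrightarrow> small \<tau> \<and>
      (\<exists>N0. \<forall>N\<ge>N0. \<forall>y. w y - U \<tau> N g y \<le> \<eta> * (norm y)\<^sup>2 + (\<epsilon> + 6 * \<eta>))"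
    using subsolution_le_resolvent[where w=w and g=g, OF sub wl gC gl close \<eta>] by blast
  have wl': "\<bar>- w x - - w y\<bar> \<le> \<Lambda> * norm (x - y)" for x y using wl[of y x] by (simp add: norm_minus_commute)
  have gl': "\<bar>- g x - - g y\<bar> \<le> lg * norm (x - y)" for x y using gl[of y x] by (simp add: norm_minus_commute)
  have close': "\<bar>- g z - (\<beta> * - w z - - h z + - l)\<bar> \<le> \<epsilon>" for z
    using close[of z] by (simp add: abs_le_iff)
  obtain t2 where t2: "t2 > 0" "\<And>\<tau>. 0 < \<tau> \<Longrightarrow> \<tau> \<le> t2 \<Longrightarrow> small \<tau> \<and>
      (\<exists>N0. \<forall>N\<ge>N0. \<forall>y. - w y - U \<tau> N (\<lambda>y. - g y) y \<le> \<eta> * (norm y)\<^sup>2 + (\<epsilon> + 6 * \<eta>))"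
    using subsolution_le_resolvent[where w="\<lambda>y. - w y" and g="\<lambda>y. - g y" and h="\<lambda>y. - h y", OF sub' wl' C21_uminus[OF gC] gl' close' \<eta>] by blast
  have neg: "U \<tau> N (\<lambda>y. - g y) y = - U \<tau> N g y" for \<tau> N y
    using U_linear[of \<tau> N "-1" g 0 g y] by simp
  show ?thesis
  proof (intro exI[of _ "min t1 t2"] conjI allI impI)
    show "0 < min t1 t2" using t1 t2 by simp
    fix \<tau> assume "0 < \<tau> \<and> \<tau> \<le> min t1 t2"
    then have \<tau>: "0 < \<tau>" "\<tau> \<le> t1" "\<tau> \<le> t2" by auto
    then show "small \<tau>" using t1 by simp
    obtain N1 where N1: "\<And>N y. N \<ge> N1 \<Longrightarrow> w y - U \<tau> N g y \<le> \<eta> * (norm y)\<^sup>2 + (\<epsilon> + 6 * \<eta>)"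
      using t1(2)[OF \<tau>(1,2)] by blast
    obtain N2 where N2: "\<And>N y. N \<ge> N2 \<Longrightarrow> - w y - U \<tau> N (\<lambda>y. - g y) y \<le> \<eta> * (norm y)\<^sup>2 + (\<epsilon> + 6 * \<eta>)"
      using t2(2)[OF \<tau>(1,3)] by blast
    show "\<exists>N0. \<forall>N\<ge>N0. \<forall>y. \<bar>w y - U \<tau> N g y\<bar> \<le> \<eta> * (norm y)\<^sup>2 + (\<epsilon> + 6 * \<eta>)"
    proof (intro exI[of _ "max N1 N2"] allI impI)
      fix N y assume "max N1 N2 \<le> N"
      then show "\<bar>w y - U \<tau> N g y\<bar> \<le> \<eta> * (norm y)\<^sup>2 + (\<epsilon> + 6 * \<eta>)"
        using N1[of N y] N2[of N y] unfolding neg by (simp add: abs_le_iff)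
    qed
  qed
qed

lemma data_lip:
  assumes wl: "\<And>x y. \<bar>w x - w y\<bar> \<le> \<Lambda> * norm (x - y)" and hl: "\<And>x y. \<bar>h x - h y\<bar> \<le> lh * norm (x - y)"
  shows "\<bar>(\<beta> * w x - h x + l) - (\<beta> * w y - h y + l)\<bar> \<le> (\<beta> * \<Lambda> + lh) * norm (x - y)"
proof -
  have "\<beta> * \<bar>w x - w y\<bar> \<le> \<beta> * (\<Lambda> * norm (x - y))" using wl \<beta> by (intro mult_left_mono) auto
  moreover have "\<bar>\<beta> * (w x - w y)\<bar> = \<beta> * \<bar>w x - w y\<bar>" using \<beta> by (simp add: abs_mult)
  moreover have "(\<beta> * w x - h x + l) - (\<beta> * w y - h y + l) = \<beta> * (w x - w y) - (h x - h y)" by (simp add: algebra_simps)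
  ultimately show ?thesis using hl[of x y] by (simp add: distrib_right mult.assoc)
qed

text \<open>Both solutions are limits of resolvents of their own data, and the resolvent contracts Lipschitz
  constants by the factor \<open>1 / (\<beta> + \<delta>)\<close>.\<close>

lemma difference_lip_improves:
  assumes v: "viscosity_solution (cell_operator k1 k2 k3 h l1) v" and vl: "\<And>x y. \<bar>v x - v y\<bar> \<le> \<Lambda>1 * norm (x - y)"
    and w: "viscosity_solution (cell_operator k1 k2 k3 h l2) w" and wl: "\<And>x y. \<bar>w x - w y\<bar> \<le> \<Lambda>2 * norm (x - y)"
    and hl: "\<And>x y. \<bar>h x - h y\<bar> \<le> lh * norm (x - y)"
    and dl: "\<And>x y. \<bar>(v x - w x) - (v y - w y)\<bar> \<le> \<Lambda> * norm (x - y)"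
  shows "\<bar>(v x - w x) - (v y - w y)\<bar> \<le> \<beta> / (\<beta> + \<delta>) * \<Lambda> * norm (x - y)"
proof (rule field_le_epsilon)
  fix e :: real assume e: "0 < e"
  define G1 where "G1 z = \<beta> * v z - h z + l1" for z
  define G2 where "G2 z = \<beta> * w z - h z + l2" for z
  define a1 where "a1 = \<beta> * \<Lambda>1 + lh"
  define a2 where "a2 = \<beta> * \<Lambda>2 + lh"
  have G1: "\<bar>G1 x - G1 y\<bar> \<le> a1 * norm (x - y)" for x y unfolding G1_def a1_def by (rule data_lip[OF vl hl])
  have G2: "\<bar>G2 x - G2 y\<bar> \<le> a2 * norm (x - y)" for x y unfolding G2_def a2_def by (rule data_lip[OF wl hl])
  have c: "continuous_on UNIV G1" "continuous_on UNIV G2" using lip_continuous[OF G1] lip_continuous[OF G2] by auto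
  have a0: "0 \<le> a1" "0 \<le> a2" using G1[of "axis 1 1" 0] G2[of "axis 1 1" 0] abs_ge_zero order_trans by fastforce+
  \<comment> \<open>Four resolvent approximations enter, two solutions at two points, each with
    error \<open>2 * \<epsilon>\<close>.\<close>
  define \<epsilon> where "\<epsilon> = e / 8"
  define s where "s = \<epsilon> / (a1 + a2 + 1)"
  have \<epsilon>: "0 < \<epsilon>" using e by (simp add: \<epsilon>_def)
  have s: "0 < s" "a1 * s \<le> \<epsilon>" "a2 * s \<le> \<epsilon>"
    using \<epsilon> a0 by (auto simp: s_def field_simps)
  \<comment> \<open>Chosen for the two given points: the penalty there, together with
    \<open>6 * \<eta>\<close>, is at most \<epsilon>.\<close>
  define \<eta> where "\<eta> = \<epsilon> / ((norm x)\<^sup>2 + (norm y)\<^sup>2 + 6)"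
  have den: "0 < (norm x)\<^sup>2 + (norm y)\<^sup>2 + 6" by (rule add_nonneg_pos) auto
  have \<eta>: "0 < \<eta>" using \<epsilon> den by (simp add: \<eta>_def)
  have \<eta>b: "\<eta> * (norm z)\<^sup>2 + 6 * \<eta> \<le> \<epsilon>" if "z = x \<or> z = y" for z
  proof -
    have "\<eta> * ((norm z)\<^sup>2 + 6) \<le> \<eta> * ((norm x)\<^sup>2 + (norm y)\<^sup>2 + 6)" using \<eta> that by (intro mult_left_mono) auto
    also have "\<dots> = \<epsilon>" using den by (simp add: \<eta>_def)
    finally show ?thesis by (simp add: algebra_simps)
  qed
  define g1 where "g1 = mollify s G1"
  define g2 where "g2 = mollify s G2"
  obtain D1 D12 C12 C13 where C1: "C21 g1 D1 D12 C12 C13" using mollify_C21[OF s(1) G1 c(1)] unfolding g1_def by blast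
  obtain E1 E12 E2' E3' where C2: "C21 g2 E1 E12 E2' E3'" using mollify_C21[OF s(1) G2 c(2)] unfolding g2_def by blast
  have l1: "\<bar>g1 p - g1 q\<bar> \<le> a1 * norm (p - q)" for p q unfolding g1_def by (rule mollify_lip[OF s(1) G1 c(1)])
  have l2: "\<bar>g2 p - g2 q\<bar> \<le> a2 * norm (p - q)" for p q unfolding g2_def by (rule mollify_lip[OF s(1) G2 c(2)])
  have cl1: "\<bar>g1 z - (\<beta> * v z - h z + l1)\<bar> \<le> \<epsilon>" for z
    using mollify_close[OF s(1) G1 c(1), of z] s(2) by (simp add: g1_def G1_def)
  have cl2: "\<bar>g2 z - (\<beta> * w z - h z + l2)\<bar> \<le> \<epsilon>" for z
    using mollify_close[OF s(1) G2 c(2), of z] s(3) by (simp add: g2_def G2_def)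
  obtain t1 where t1: "t1 > 0" "\<And>\<tau>. 0 < \<tau> \<Longrightarrow> \<tau> \<le> t1 \<Longrightarrow> small \<tau> \<and> (\<exists>N0. \<forall>N\<ge>N0. \<forall>y. \<bar>v y - U \<tau> N g1 y\<bar> \<le> \<eta> * (norm y)\<^sup>2 + (\<epsilon> + 6 * \<eta>))"
    using solution_near_resolvent[where w=v and g=g1, OF v vl C1 l1 cl1 \<eta>] by blast
  obtain t2 where t2: "t2 > 0" "\<And>\<tau>. 0 < \<tau> \<Longrightarrow> \<tau> \<le> t2 \<Longrightarrow> small \<tau> \<and> (\<exists>N0. \<forall>N\<ge>N0. \<forall>y. \<bar>w y - U \<tau> N g2 y\<bar> \<le> \<eta> * (norm y)\<^sup>2 + (\<epsilon> + 6 * \<eta>))"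
    using solution_near_resolvent[where w=w and g=g2, OF w wl C2 l2 cl2 \<eta>] by blast
  define \<tau> where "\<tau> = min t1 t2"
  have \<tau>: "0 < \<tau>" "\<tau> \<le> t1" "\<tau> \<le> t2" using t1 t2 by (auto simp: \<tau>_def)
  have sm: "small \<tau>" using t1 \<tau> by simp
  obtain N1 where N1: "\<And>N y. N \<ge> N1 \<Longrightarrow> \<bar>v y - U \<tau> N g1 y\<bar> \<le> \<eta> * (norm y)\<^sup>2 + (\<epsilon> + 6 * \<eta>)" using t1(2)[OF \<tau>(1,2)] by blast
  obtain N2 where N2: "\<And>N y. N \<ge> N2 \<Longrightarrow> \<bar>w y - U \<tau> N g2 y\<bar> \<le> \<eta> * (norm y)\<^sup>2 + (\<epsilon> + 6 * \<eta>)" using t2(2)[OF \<tau>(1,3)] by blast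
  define N where "N = max N1 N2"
  have vb: "\<bar>v z - U \<tau> N g1 z\<bar> \<le> 2 * \<epsilon>" and wb: "\<bar>w z - U \<tau> N g2 z\<bar> \<le> 2 * \<epsilon>" if "z = x \<or> z = y" for z
    using N1[of N z] N2[of N z] \<eta>b[OF that] by (simp_all add: N_def)
  have gd: "1 * g1 z + (-1) * g2 z = mollify s (\<lambda>y. 1 * G1 y + (-1) * G2 y) z" for z
    unfolding g1_def g2_def by (rule mollify_linear[OF s(1) c, symmetric])
  \<comment> \<open>In the difference of the data \<open>h\<close> cancels and
    \<open>l1 - l2\<close> is constant, so that only \<open>\<beta> * \<Lambda>\<close> remains as
    Lipschitz constant; mollification being linear, it passes to \<open>g1 - g2\<close>.\<close>
  have Gd: "\<bar>(1 * G1 p + (-1) * G2 p) - (1 * G1 q + (-1) * G2 q)\<bar> \<le> (\<beta> * \<Lambda>) * norm (p - q)" for p q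
  proof -
    have "(1 * G1 p + (-1) * G2 p) - (1 * G1 q + (-1) * G2 q) = \<beta> * ((v p - w p) - (v q - w q))"
      by (simp add: G1_def G2_def algebra_simps)
    then show ?thesis using dl[of p q] \<beta> by (simp add: abs_mult mult.assoc mult_left_mono)
  qed
  have Gc: "continuous_on UNIV (\<lambda>y. 1 * G1 y + (-1) * G2 y)" by (intro continuous_intros c)
  have gl: "\<bar>(1 * g1 p + (-1) * g2 p) - (1 * g1 q + (-1) * g2 q)\<bar> \<le> (\<beta> * \<Lambda>) * norm (p - q)" for p q
    unfolding gd by (rule mollify_lip[OF s(1) Gd Gc])
  have "\<bar>U \<tau> N (\<lambda>z. 1 * g1 z + (-1) * g2 z) x - U \<tau> N (\<lambda>z. 1 * g1 z + (-1) * g2 z) y\<bar> \<le> (\<beta> * \<Lambda>) / (\<beta> + \<delta>) * norm (x - y)"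
    by (rule U_lip[where g="\<lambda>z. 1 * g1 z + (-1) * g2 z", OF sm gl])
  then have ub: "\<bar>(U \<tau> N g1 x - U \<tau> N g2 x) - (U \<tau> N g1 y - U \<tau> N g2 y)\<bar> \<le> \<beta> / (\<beta> + \<delta>) * \<Lambda> * norm (x - y)"
    unfolding U_linear by simp
  have "\<bar>(v x - w x) - (v y - w y)\<bar> \<le> \<beta> / (\<beta> + \<delta>) * \<Lambda> * norm (x - y) + 8 * \<epsilon>"
  proof -
    have "\<bar>v x - U \<tau> N g1 x\<bar> \<le> 2 * \<epsilon>" "\<bar>v y - U \<tau> N g1 y\<bar> \<le> 2 * \<epsilon>"
      "\<bar>w x - U \<tau> N g2 x\<bar> \<le> 2 * \<epsilon>" "\<bar>w y - U \<tau> N g2 y\<bar> \<le> 2 * \<epsilon>"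
      using vb[of x] vb[of y] wb[of x] wb[of y] by simp_all
    with ub show ?thesis by linarith
  qed
  then show "\<bar>(v x - w x) - (v y - w y)\<bar> \<le> \<beta> / (\<beta> + \<delta>) * \<Lambda> * norm (x - y) + e" by (simp add: \<epsilon>_def)
qed

text \<open>The improvement is iterated from the crude constant
  \<open>\<Lambda>1 + \<Lambda>2\<close>; this finite start is where the Lipschitz property of both
  solutions enters.\<close>

theorem lipschitz_solutions_differ_by_constant:
  assumes v: "viscosity_solution (cell_operator k1 k2 k3 h l1) v" and vl: "\<And>x y. \<bar>v x - v y\<bar> \<le> \<Lambda>1 * norm (x - y)"
    and w: "viscosity_solution (cell_operator k1 k2 k3 h l2) w" and wl: "\<And>x y. \<bar>w x - w y\<bar> \<le> \<Lambda>2 * norm (x - y)"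
    and hl: "\<And>x y. \<bar>h x - h y\<bar> \<le> lh * norm (x - y)"
  shows "v x - w x = v y - w y"
proof -
  define q where "q = \<beta> / (\<beta> + \<delta>)"
  have q: "0 \<le> q" "q < 1" using \<beta> delta(1) by (auto simp: q_def)
  have "\<bar>(v x - w x) - (v y - w y)\<bar> \<le> (q ^ n * (\<Lambda>1 + \<Lambda>2)) * norm (x - y)" for n x y
  proof (induction n arbitrary: x y)
    case 0
    show ?case using vl[of x y] wl[of x y] by (simp add: distrib_right)
  next
    case (Suc n)
    have "\<bar>(v x - w x) - (v y - w y)\<bar> \<le> \<beta> / (\<beta> + \<delta>) * (q ^ n * (\<Lambda>1 + \<Lambda>2)) * norm (x - y)"
      by (rule difference_lip_improves[where h=h and v=v and w=w, OF v vl w wl hl Suc])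
    then show ?case by (simp add: q_def mult.assoc)
  qed
  moreover have "(\<lambda>n. (q ^ n * (\<Lambda>1 + \<Lambda>2)) * norm (x - y)) \<longlonglongrightarrow> (0 * (\<Lambda>1 + \<Lambda>2)) * norm (x - y)"
    using q by (intro tendsto_intros LIMSEQ_power_zero) auto
  ultimately have "\<bar>(v x - w x) - (v y - w y)\<bar> \<le> 0"
    by (intro LIMSEQ_le_const[of "\<lambda>n. (q ^ n * (\<Lambda>1 + \<Lambda>2)) * norm (x - y)"]) auto
  then show ?thesis by simp
qed

end

section \<open>The ergodic constant\<close>

context stationary
begin

interpretation mu: prob_space \<mu> using inv by (simp add: invariant_probability_def)

text \<open>Supplies a dominating function common to all resolvents, within reach of the second
  moment of \<mu>.\<close>

lemma L_growth:
  assumes q: "norm q \<le> l" and Q: "form_le Q C"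
  shows "\<bar>L y q Q\<bar> \<le> (6 * (l * km) + 36 * C) * (1 + (norm y)\<^sup>2)"
proof -
  define n where "n = 1 + (norm y)\<^sup>2"
  have l0: "0 \<le> l" using q norm_ge_zero order_trans by blast
  have C0: "0 \<le> C" using form_le_component[OF Q, of 1 1] by simp
  have ny: "norm y \<le> 2 * n"
  proof -
    have "2 * norm y \<le> 1 + (norm y)\<^sup>2" using zero_le_power2[of "1 - norm y"] unfolding power2_diff by simp
    then show ?thesis using norm_ge_zero[of y] unfolding n_def by argo
  qed
  have 1: "\<bar>q $ i * drift k1 k2 k3 y $ i\<bar> \<le> 2 * (l * km) * n" for i
  proof -
    have "\<bar>q $ i\<bar> \<le> l" using component_le_norm_cart[of q i] q by linarith
    moreover have "\<bar>drift k1 k2 k3 y $ i\<bar> \<le> km * (2 * n)"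
    proof -
      have "\<bar>drift k1 k2 k3 y $ i\<bar> \<le> km * norm y"
        using component_le_norm_cart[of "drift k1 k2 k3 y" i] drift_norm[of y] by linarith
      also have "\<dots> \<le> km * (2 * n)" using ny km_pos by (intro mult_left_mono) auto
      finally show ?thesis .
    qed
    ultimately have "\<bar>q $ i\<bar> * \<bar>drift k1 k2 k3 y $ i\<bar> \<le> l * (km * (2 * n))" using l0 by (intro mult_mono) auto
    then show ?thesis by (simp add: abs_mult mult_ac)
  qed
  have S: "\<bar>(sig y ** transpose (sig y)) $ i $ j\<bar> \<le> 4 * n" for i j
  proof -
    have "2 * \<bar>a * b\<bar> \<le> a\<^sup>2 + b\<^sup>2" for a b :: real
      using zero_le_power2[of "\<bar>a\<bar> - \<bar>b\<bar>"] by (simp add: power2_diff abs_mult)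
    note ab = this
    have "(sig y ** transpose (sig y)) $ i $ j = sig y $ i $ 1 * sig y $ j $ 1 + sig y $ i $ 2 * sig y $ j $ 2"
      by (simp add: matrix_matrix_mult_def transpose_def sum_2)
    then have "2 * \<bar>(sig y ** transpose (sig y)) $ i $ j\<bar> \<le> ((sig y $ i $ 1)\<^sup>2 + (sig y $ j $ 1)\<^sup>2) + ((sig y $ i $ 2)\<^sup>2 + (sig y $ j $ 2)\<^sup>2)"
      using ab[of "sig y $ i $ 1" "sig y $ j $ 1"] ab[of "sig y $ i $ 2" "sig y $ j $ 2"] by linarith
    then show ?thesis using sig_bound[of y i] sig_bound[of y j] unfolding n_def by linarith
  qed
  have 2: "\<bar>Q $ i $ j * (sig y ** transpose (sig y)) $ i $ j\<bar> \<le> C * (4 * n)" for i j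
    unfolding abs_mult by (intro mult_mono form_le_component[OF Q] S) (use C0 in auto)
  have "\<bar>L y q Q\<bar> \<le> 3 * (2 * (l * km) * n) + 3 * (3 * (C * (4 * n)))"
    unfolding L_as_sum by (rule order_trans[OF abs_triangle_ineq]) (intro add_mono abs_sum3_le 1 2)
  also have "\<dots> = (6 * (l * km) + 36 * C) * n" by (simp add: algebra_simps)
  finally show ?thesis by (simp add: n_def)
qed

text \<open>The stationary measure annihilates \<open>L u\<close> for the smooth resolvents \<open>u\<close>, and \<open>L u\<close> tends to
  \<open>h - l\<close> up to the mollification error.\<close>

theorem ergodic_constant:
  assumes w: "viscosity_solution (cell_operator k1 k2 k3 h l) w" and wl: "\<And>x y. \<bar>w x - w y\<bar> \<le> \<Lambda> * norm (x - y)"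
    and hl: "\<And>x y. \<bar>h x - h y\<bar> \<le> lh * norm (x - y)"
  shows "l = (\<integral>y. h y \<partial>\<mu>)"
proof -
  have ih: "integrable \<mu> h" by (rule lip_integrable[OF hl])
  have key: "\<bar>(\<integral>y. h y \<partial>\<mu>) - l\<bar> \<le> (\<beta> + 1) * \<epsilon>" if \<epsilon>: "0 < \<epsilon>" for \<epsilon>
  proof -
    have \<beta>0: "0 \<le> \<beta>" using \<beta> by linarith
    define G where "G z = \<beta> * w z - h z + l" for z
    define a where "a = \<beta> * \<Lambda> + lh"
    have Gl: "\<bar>G x - G y\<bar> \<le> a * norm (x - y)" for x y unfolding G_def a_def by (rule data_lip[OF wl hl])
    have Gc: "continuous_on UNIV G" by (rule lip_continuous[OF Gl])
    have a0: "0 \<le> a" using Gl[of "axis 1 1" 0] abs_ge_zero order_trans by fastforce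
    define s where "s = \<epsilon> / (a + 1)"
    have s: "0 < s" "a * s \<le> \<epsilon>" using \<epsilon> a0 by (auto simp: s_def field_simps)
    define g where "g = mollify s G"
    obtain D D2 C2 C3 where gC: "C21 g D D2 C2 C3" using mollify_C21[OF s(1) Gl Gc] unfolding g_def by blast
    have gl: "\<bar>g x - g y\<bar> \<le> a * norm (x - y)" for x y unfolding g_def by (rule mollify_lip[OF s(1) Gl Gc])
    have gG: "\<bar>g z - (\<beta> * w z - h z + l)\<bar> \<le> \<epsilon>" for z
      using mollify_close[OF s(1) Gl Gc, of z] s(2) by (simp add: g_def G_def)
    define \<eta> where "\<eta> j = 1 / real (Suc j)" for j
    have \<eta>: "0 < \<eta> j" for j by (simp add: \<eta>_def)
    have \<eta>0: "\<eta> \<longlonglongrightarrow> 0" unfolding \<eta>_def[abs_def] using LIMSEQ_inverse_real_of_nat by (simp add: inverse_eq_divide)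
    have "\<exists>\<tau> N. small \<tau> \<and> \<tau> \<le> \<eta> j \<and> (\<forall>y. \<bar>w y - U \<tau> N g y\<bar> \<le> \<eta> j * (norm y)\<^sup>2 + (\<epsilon> + 6 * \<eta> j))
        \<and> (\<forall>y. \<bar>\<rho> \<tau> ^ N * (K \<tau> ^^ N) g y\<bar> \<le> \<eta> j * (1 + norm y))" for j
    proof -
      obtain t0 where t0: "t0 > 0" "\<And>\<tau>. 0 < \<tau> \<Longrightarrow> \<tau> \<le> t0 \<Longrightarrow> small \<tau> \<and> (\<exists>N0. \<forall>N\<ge>N0. \<forall>y. \<bar>w y - U \<tau> N g y\<bar> \<le> \<eta> j * (norm y)\<^sup>2 + (\<epsilon> + 6 * \<eta> j))"
        using solution_near_resolvent[where w=w and g=g, OF w wl gC gl gG \<eta>[of j]] by blast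
      define \<tau> where "\<tau> = min t0 (\<eta> j)"
      have \<tau>: "0 < \<tau>" "\<tau> \<le> t0" "\<tau> \<le> \<eta> j" using t0 \<eta>[of j] by (auto simp: \<tau>_def)
      have sm: "small \<tau>" using t0(2)[OF \<tau>(1,2)] by blast
      obtain N1 where N1: "\<And>N y. N \<ge> N1 \<Longrightarrow> \<bar>w y - U \<tau> N g y\<bar> \<le> \<eta> j * (norm y)\<^sup>2 + (\<epsilon> + 6 * \<eta> j)"
        using t0(2)[OF \<tau>(1,2)] by blast
      obtain N2 where N2: "\<And>N y. N \<ge> N2 \<Longrightarrow> \<bar>\<rho> \<tau> ^ N * (K \<tau> ^^ N) g y\<bar> \<le> \<eta> j * (1 + norm y)"
        using U_tail[where g=g, OF sm gl \<eta>[of j]] by blast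
      show ?thesis
        using sm \<tau>(3) N1[of "max N1 N2"] N2[of "max N1 N2"] by (intro exI[of _ \<tau>] exI[of _ "max N1 N2"]) auto
    qed
    then obtain \<tau> N where \<tau>: "\<And>j. small (\<tau> j)" "\<And>j. \<tau> j \<le> \<eta> j"
      and near: "\<And>j y. \<bar>w y - U (\<tau> j) (N j) g y\<bar> \<le> \<eta> j * (norm y)\<^sup>2 + (\<epsilon> + 6 * \<eta> j)"
      and tail: "\<And>j y. \<bar>\<rho> (\<tau> j) ^ N j * (K (\<tau> j) ^^ N j) g y\<bar> \<le> \<eta> j * (1 + norm y)"
      by metis
    define u where "u j = U (\<tau> j) (N j) g" for j
    have "\<exists>E E2. C21 (u j) E E2 C2 C3" for j unfolding u_def by (rule U_C21[OF \<tau>(1) gC])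
    then obtain E E2 where E: "\<And>j. C21 (u j) (E j) (E2 j) C2 C3" by metis
    define lu where "lu = a / (\<beta> + \<delta>)"
    have ul: "\<bar>u j x - u j y\<bar> \<le> lu * norm (x - y)" for j x y
      unfolding u_def lu_def by (rule U_lip[where g=g, OF \<tau>(1) gl])
    have C2: "form_le (E2 j y) C2" for j y using E[of j] by (simp add: C21_def)
    have C30: "0 \<le> C3"
    proof -
      have "form_le (D2 (axis 1 1) - D2 0) (C3 * norm (axis 1 1 - 0 :: real^3))" using gC unfolding C21_def by blast
      from form_le_component[OF this, of 1 1] show ?thesis by simp
    qed
    define f where "f j y = L y (E j y) (E2 j y)" for j y
    have fi: "integrable \<mu> (f j)" "(\<integral>y. f j y \<partial>\<mu>) = 0" for j
      unfolding f_def[abs_def] by (rule stationary_generator[OF E ul])+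
    define B where "B = 6 * (lu * km) + 36 * C2"
    have fB: "\<bar>f j y\<bar> \<le> B * (1 + (norm y)\<^sup>2)" for j y
      unfolding f_def B_def by (rule L_growth[OF lipschitz_gradient_le[OF E ul] C2])
    define er where "er j y = (C3 * (sqrt (\<tau> j) * mm * (1 + norm y)) * (mm * (1 + norm y))\<^sup>2 + \<tau> j * C2 * (km * norm y)\<^sup>2) / 2" for j and y :: "real^3"
    have cons: "\<bar>(K (\<tau> j) (u j) y - u j y) / \<tau> j - f j y\<bar> \<le> er j y" for j y
      unfolding f_def er_def
    proof (rule K_consistent[OF _ \<tau>(1) C2])
      show "C2diff (u j) (E j) (E2 j)" using E[of j] by (simp add: C21_def)
      fix z assume z: "norm (z - y) \<le> sqrt (\<tau> j) * mm * (1 + norm y)"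
      have "form_le (E2 j z - E2 j y) (C3 * norm (z - y))" using E[of j] by (simp add: C21_def)
      then show "form_le (E2 j z - E2 j y) (C3 * (sqrt (\<tau> j) * mm * (1 + norm y)))"
        by (rule form_le_mono) (use z C30 in \<open>simp add: mult_left_mono\<close>)
    qed
    define b where "b j y = \<beta> * (\<eta> j * (norm y)\<^sup>2 + 6 * \<eta> j) + \<eta> j * (1 + norm y) + er j y" for j and y :: "real^3"
    have close: "\<bar>f j y - (h y - l)\<bar> \<le> (\<beta> + 1) * \<epsilon> + b j y" for j y
    proof -
      have t: "0 < \<tau> j" using \<tau>(1)[of j] by (simp add: small_def)
      have sch: "(K (\<tau> j) (u j) y - u j y) / \<tau> j = \<beta> * u j y - g y + \<rho> (\<tau> j) ^ N j * (K (\<tau> j) ^^ N j) g y"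
        unfolding u_def by (rule U_scheme[OF t])
      have "\<beta> * \<bar>w y - u j y\<bar> \<le> \<beta> * (\<eta> j * (norm y)\<^sup>2 + (\<epsilon> + 6 * \<eta> j))"
        using near[of y j] \<beta> unfolding u_def by (intro mult_left_mono) auto
      then have "\<bar>\<beta> * (w y - u j y)\<bar> \<le> \<beta> * (\<eta> j * (norm y)\<^sup>2 + 6 * \<eta> j) + \<beta> * \<epsilon>"
        unfolding abs_mult abs_of_nonneg[OF \<beta>0] by (simp only: distrib_left add_ac)
      moreover have "f j y - (h y - l) = - ((K (\<tau> j) (u j) y - u j y) / \<tau> j - f j y) - \<beta> * (w y - u j y)
          - (g y - (\<beta> * w y - h y + l)) + \<rho> (\<tau> j) ^ N j * (K (\<tau> j) ^^ N j) g y"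
        unfolding sch by (simp add: algebra_simps)
      ultimately show ?thesis using cons[of j y] gG[of y] tail[of j y] unfolding b_def distrib_right by linarith
    qed
    have b0: "(\<lambda>j. b j y) \<longlonglongrightarrow> 0" for y
    proof -
      have "\<tau> \<longlonglongrightarrow> 0"
        by (rule tendsto_sandwich[OF _ _ tendsto_const \<eta>0]) (use \<tau> in \<open>auto simp: small_def intro!: always_eventually less_imp_le\<close>)
      then have "(\<lambda>j. b j y) \<longlonglongrightarrow> \<beta> * (0 * (norm y)\<^sup>2 + 6 * 0) + 0 * (1 + norm y)
         + (C3 * (sqrt 0 * mm * (1 + norm y)) * (mm * (1 + norm y))\<^sup>2 + 0 * C2 * (km * norm y)\<^sup>2) / 2"
        unfolding b_def er_def by (intro tendsto_intros \<eta>0) auto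
      then show ?thesis by simp
    qed
    \<comment> \<open>The error \<open>b j y\<close> contains cubes of \<open>norm y\<close>, beyond
      the moments known for \<mu>. It therefore only serves pointwise convergence of this excess,
      while domination comes from the quadratic bound \<open>fB\<close>.\<close>
    define e where "e j y = max 0 (\<bar>f j y - (h y - l)\<bar> - (\<beta> + 1) * \<epsilon>)" for j y
    have \<beta>\<epsilon>: "0 \<le> (\<beta> + 1) * \<epsilon>" using \<beta> \<epsilon> by simp
    have id: "integrable \<mu> (\<lambda>y. \<bar>f j y - (h y - l)\<bar>)" for j using fi(1) ih by simp
    have em: "e j \<in> borel_measurable \<mu>" for j
      unfolding e_def[abs_def] using id[of j] by (intro borel_measurable_max borel_measurable_diff) auto
    have elim: "(\<lambda>j. e j y) \<longlonglongrightarrow> 0" for y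
    proof (rule Lim_null_comparison)
      have "norm (e j y) \<le> \<bar>b j y\<bar>" for j using close[of j y] by (auto simp: e_def)
      then show "\<forall>\<^sub>F j in sequentially. norm (e j y) \<le> \<bar>b j y\<bar>" by simp
      show "(\<lambda>j. \<bar>b j y\<bar>) \<longlonglongrightarrow> 0" using tendsto_rabs[OF b0[of y]] by simp
    qed
    have iw: "integrable \<mu> (\<lambda>y. B * (1 + (norm y)\<^sup>2) + \<bar>h y - l\<bar>)" using second_moment ih by simp
    have ew: "norm (e j y) \<le> B * (1 + (norm y)\<^sup>2) + \<bar>h y - l\<bar>" for j y
    proof -
      have "\<bar>f j y - (h y - l)\<bar> \<le> B * (1 + (norm y)\<^sup>2) + \<bar>h y - l\<bar>" using fB[of j y] by linarith
      then show ?thesis using \<beta>\<epsilon> fB[of j y] unfolding e_def by simp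
    qed
    have lim: "(\<lambda>j. (\<integral>y. e j y \<partial>\<mu>)) \<longlonglongrightarrow> (\<integral>y. 0 \<partial>\<mu>)"
      by (rule integral_dominated_convergence[where w="\<lambda>y. B * (1 + (norm y)\<^sup>2) + \<bar>h y - l\<bar>"])
        (use em elim iw ew in auto)
    have ie: "integrable \<mu> (e j)" for j
      by (rule Bochner_Integration.integrable_bound[OF iw em]) (rule AE_I2, metis ew real_norm_def abs_ge_self order_trans)
    have bound: "\<bar>(\<integral>y. h y \<partial>\<mu>) - l\<bar> \<le> (\<beta> + 1) * \<epsilon> + (\<integral>y. e j y \<partial>\<mu>)" for j
    proof -
      have "(\<integral>y. f j y - (h y - l) \<partial>\<mu>) = - ((\<integral>y. h y \<partial>\<mu>) - l)"
        using fi[of j] ih by (simp add: mu.prob_space)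
      then have "\<bar>(\<integral>y. h y \<partial>\<mu>) - l\<bar> = \<bar>\<integral>y. f j y - (h y - l) \<partial>\<mu>\<bar>" by simp
      also have "\<dots> \<le> (\<integral>y. \<bar>f j y - (h y - l)\<bar> \<partial>\<mu>)" by (rule integral_abs_bound)
      also have "\<dots> \<le> (\<integral>y. (\<beta> + 1) * \<epsilon> + e j y \<partial>\<mu>)"
      proof (rule integral_mono[OF id])
        show "integrable \<mu> (\<lambda>y. (\<beta> + 1) * \<epsilon> + e j y)" using ie[of j] by simp
        show "\<bar>f j y - (h y - l)\<bar> \<le> (\<beta> + 1) * \<epsilon> + e j y" for y by (simp add: e_def)
      qed
      also have "\<dots> = (\<beta> + 1) * \<epsilon> + (\<integral>y. e j y \<partial>\<mu>)" using ie by (simp add: mu.prob_space)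
      finally show ?thesis .
    qed
    have "(\<lambda>j. (\<beta> + 1) * \<epsilon> + (\<integral>y. e j y \<partial>\<mu>)) \<longlonglongrightarrow> (\<beta> + 1) * \<epsilon> + 0"
      using tendsto_add[OF tendsto_const lim] by simp
    from LIMSEQ_le_const[OF this] bound show ?thesis by auto
  qed
  have "\<bar>(\<integral>y. h y \<partial>\<mu>) - l\<bar> \<le> 0"
  proof (rule field_le_epsilon)
    fix e :: real assume "0 < e"
    then show "\<bar>(\<integral>y. h y \<partial>\<mu>) - l\<bar> \<le> 0 + e" using key[of "e / (\<beta> + 1)"] \<beta> by simp
  qed
  then show ?thesis by simp
qed

end

text \<open>Since \<open>r \<le> r\<^sup>2 + 1\<close>, the squared Euclidean norm is at most
  \<open>M\<close>, hence \<open>1 + norm y \<le> 2 * M \<le> exp 1 * M\<close>. The logarithm of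
  \<open>exp 1\<close> is the additive 1 that doubling the constant absorbs.\<close>

lemma log_growthI:
  assumes b: "\<And>y. \<bar>w y\<bar> \<le> C * (1 + ln (1 + norm y))" and w0: "w 0 = 0" and C: "0 \<le> C"
  shows "log_growth w"
  unfolding log_growth_def
proof (intro exI[of _ "C * 2"] allI)
  fix y :: "real^3"
  define r where "r = (y$1)\<^sup>2 + (y$2)\<^sup>2"
  define M where "M = r\<^sup>2 + (y$3)\<^sup>2 + 1"
  have r0: "0 \<le> r" by (simp add: r_def)
  have M1: "1 \<le> M" by (simp add: M_def)
  have n: "(norm y)\<^sup>2 \<le> M"
  proof -
    have "0 \<le> (r - 1)\<^sup>2 + 1 + r\<^sup>2" by simp
    then have "r \<le> r\<^sup>2 + 1" by (simp add: power2_eq_square algebra_simps)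
    then show ?thesis unfolding norm3 M_def r_def by simp
  qed
  have "1 + norm y \<le> exp 1 * M"
  proof -
    have "2 * norm y \<le> 1 + (norm y)\<^sup>2" using zero_le_power2[of "1 - norm y"] unfolding power2_diff by simp
    then have "1 + norm y \<le> 2 * M" using n M1 by linarith
    also have "\<dots> \<le> exp 1 * M" using exp_ge_add_one_self[of 1] M1 by (intro mult_right_mono) auto
    finally show ?thesis .
  qed
  then have "ln (1 + norm y) \<le> ln (exp 1 * M)" using M1 by (intro ln_mono) (auto simp: add_pos_nonneg)
  also have "\<dots> = 1 + ln M" using M1 by (simp add: ln_mult)
  finally have "1 + ln (1 + norm y) \<le> 2 * (1 + ln M)" using ln_ge_zero[OF M1] by argo
  then have "C * (1 + ln (1 + norm y)) \<le> C * (2 * (1 + ln M))" using C by (rule mult_left_mono)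
  then show "\<bar>w y - w 0\<bar> \<le> C * 2 * (1 + ln (((y$1)\<^sup>2 + (y$2)\<^sup>2)\<^sup>2 + (y$3)\<^sup>2 + 1))"
    using b[of y] unfolding w0 M_def r_def by (simp add: mult.assoc)
qed

lemma lipschitz_onD_real:
  fixes g :: "'a::real_normed_vector \<Rightarrow> real"
  shows "l-lipschitz_on UNIV g \<Longrightarrow> \<bar>g x - g y\<bar> \<le> l * norm (x - y)"
  using lipschitz_onD[of l UNIV g x y] by (simp add: dist_norm)

theorem theorem3p3:
  fixes U :: "'u::metric_space set"
    and \<phi> :: "real^'n \<Rightarrow> real^3 \<Rightarrow> 'u \<Rightarrow> real^'n"
    and \<sigma> :: "real^'n \<Rightarrow> real^3 \<Rightarrow> 'u \<Rightarrow> real^2^'n"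
    and f :: "real^'n \<Rightarrow> real^3 \<Rightarrow> 'u \<Rightarrow> real"
    and g :: "real^'n \<Rightarrow> real^3 \<Rightarrow> real"
    and k1 k2 k3 :: real
    and M :: "'w measure" and F :: "real \<Rightarrow> 'w measure" and W :: "real \<Rightarrow> 'w \<Rightarrow> real^2"
    and Y :: "real^3 \<Rightarrow> real \<Rightarrow> 'w \<Rightarrow> real^3"
    and \<mu> :: "(real^3) measure"
  defines "H \<equiv> hamiltonian U \<phi> \<sigma> f"
  assumes U_compact: "compact U"
    and min_attained: "\<And>x y p X Z. transpose X = X \<Longrightarrow>
      \<exists>u\<in>U. \<forall>v\<in>U. pre_hamiltonian \<phi> \<sigma> f x y p X Z u \<le> pre_hamiltonian \<phi> \<sigma> f x y p X Z v"
    and A2: "k1 > 4" "k2 > 4" "k3 > 0"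
    and A3_lipschitz: "uniformly_lipschitz_in_xy U f"
    and A3_growth: "\<exists>C>0. \<forall>x y. \<forall>u\<in>U. \<bar>f x y u\<bar> \<le> C * (1 + norm x)"
    and A4_continuous: "continuous_on UNIV (\<lambda>(x, y). g x y)"
    and A4_growth: "\<exists>C. \<forall>x y. \<bar>g x y\<bar> \<le> C * (1 + norm x)"
    and A5_lipschitz: "uniformly_lipschitz_in_xy U \<phi>" "uniformly_lipschitz_in_xy U \<sigma>"
    and A5_bounded: "\<exists>C. \<forall>x y. \<forall>u\<in>U. norm (\<phi> x y u) \<le> C"
                    "\<exists>C. \<forall>x y. \<forall>u\<in>U. norm (\<sigma> x y u) \<le> C"
    and A6: "\<And>x p X. transpose X = X \<Longrightarrow>
      \<exists>G' G''. has_partial_y3 (\<lambda>y. - H x y p X 0) G' \<and> has_partial_y3 G' G'' \<and>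
        bounded_lipschitz (\<lambda>y. - H x y p X 0) \<and> bounded_lipschitz G' \<and> bounded_lipschitz G''"
    and diffusion: "is_diffusion k1 k2 k3 M F W Y"
    and invariant: "invariant_probability M Y \<mu>"
  shows "\<forall>x p X. transpose X = X \<longrightarrow>
    (let h = (\<lambda>y. H x y p X 0); c = (\<integral>y. h y \<partial>\<mu>) in
       (\<forall>l. (\<exists>w. cell_solution k1 k2 k3 h l w) \<longleftrightarrow> l = c) \<and>
       (\<forall>v w. cell_solution k1 k2 k3 h c v \<and> cell_solution k1 k2 k3 h c w \<longrightarrow>
          (\<exists>a. \<forall>y. v y = w y + a)))"
proof (intro allI impI)
  fix x p :: "real^'n" and X :: "real^'n^'n" assume X: "transpose X = X"
  interpret stationary k1 k2 k3 M F W Y \<mu>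
    using A2 diffusion invariant by unfold_locales (auto simp: is_diffusion_def)
  define h where "h = (\<lambda>y. H x y p X 0)"
  define c where "c = (\<integral>y. h y \<partial>\<mu>)"
  have bl: "bounded_lipschitz (\<lambda>y. - h y)" using A6[OF X, of x p] unfolding h_def by blast
  obtain lh where "lh-lipschitz_on UNIV (\<lambda>y. - h y)" using bl by (auto simp: bounded_lipschitz_def)
  then have hl: "\<bar>h y - h z\<bar> \<le> lh * norm (y - z)" for y z
    using lipschitz_onD_real[of lh "\<lambda>y. - h y" z y] by (simp add: norm_minus_commute)
  obtain B where B: "\<bar>h y\<bar> \<le> B" for y
    using bl by (auto simp: bounded_lipschitz_def bounded_iff)
  have lh0: "0 \<le> lh" using hl[of "axis 1 1" 0] abs_ge_zero order_trans by fastforce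
  have B0: "0 \<le> B" using B[of 0] by simp
  have sol: "viscosity_solution (cell_operator k1 k2 k3 h l) w \<and> (\<exists>\<Lambda>. \<forall>y z. \<bar>w y - w z\<bar> \<le> \<Lambda> * norm (y - z))"
    if "cell_solution k1 k2 k3 h l w" for l w
    using that lipschitz_onD_real unfolding cell_solution_def by blast
  have const: "l = c" if "cell_solution k1 k2 k3 h l w" for l w
    using sol[OF that] ergodic_constant[where h=h and w=w and l=l, OF _ _ hl] unfolding c_def by blast
  obtain l w where w: "viscosity_solution (cell_operator k1 k2 k3 h l) w"
      "\<And>y z. \<bar>w y - w z\<bar> \<le> lh / \<delta> * norm (y - z)" "w 0 = 0"
      "\<And>y. \<bar>w y\<bar> \<le> (2 * B / \<delta> + 2 * B + lh / \<delta>) * (1 + ln (1 + norm y))"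
    using cell_solution_exists[where h=h, OF hl B] by blast
  have "(lh / \<delta>)-lipschitz_on UNIV w"
    using w(2) lh0 delta(1) by (auto intro!: lipschitz_onI simp: dist_norm)
  moreover have "log_growth w"
    by (rule log_growthI[OF w(4,3)]) (use lh0 B0 delta(1) in simp)
  ultimately have cw: "cell_solution k1 k2 k3 h l w" using w(1) by (auto simp: cell_solution_def)
  \<comment> \<open>The construction delivers a solution for some \<open>l\<close> obtained by
    compactness; \<open>const\<close> identifies this \<open>l\<close> as \<open>c\<close>.\<close>
  have ex: "(\<exists>w. cell_solution k1 k2 k3 h l w) \<longleftrightarrow> l = c" for l
    using const[OF cw] cw const by blast
  have uniq: "\<exists>a. \<forall>y. v y = w y + a" if v: "cell_solution k1 k2 k3 h c v" and w: "cell_solution k1 k2 k3 h c w" for v w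
  proof -
    obtain \<Lambda>1 \<Lambda>2 where L: "\<And>y z. \<bar>v y - v z\<bar> \<le> \<Lambda>1 * norm (y - z)" "\<And>y z. \<bar>w y - w z\<bar> \<le> \<Lambda>2 * norm (y - z)"
      using sol[OF v] sol[OF w] by blast
    have "v y - w y = v 0 - w 0" for y
      by (rule lipschitz_solutions_differ_by_constant[where h=h and v=v and w=w, OF _ L(1) _ L(2) hl]) (use sol[OF v] sol[OF w] in auto)
    then have "v y = w y + (v 0 - w 0)" for y by (simp add: algebra_simps)
    then show ?thesis by blast
  qed
  show "let h = (\<lambda>y. H x y p X 0); c = (\<integral>y. h y \<partial>\<mu>) in
       (\<forall>l. (\<exists>w. cell_solution k1 k2 k3 h l w) \<longleftrightarrow> l = c) \<and>
       (\<forall>v w. cell_solution k1 k2 k3 h c v \<and> cell_solution k1 k2 k3 h c w \<longrightarrow>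
          (\<exists>a. \<forall>y. v y = w y + a))"
    using ex uniq unfolding Let_def h_def[symmetric] c_def[symmetric] by blast
qed

end
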